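(* Assume the Unique Games Conjecture and P $\neq$ NP. Let $A$ be a polynomial-time learning-augmented approximation algorithm for Minimum Vertex Cover which, for every input graph and every prediction $\widehat{X}\subseteq V$, outputs a vertex cover of size at most $\big(1+f\big(\tfrac{\eta^+}{\mathrm{OPT}},\tfrac{\eta^-}{\mathrm{OPT}}\big)\big)\cdot\mathrm{OPT}$, where $\mathrm{OPT}$ is the minimum vertex cover size, $(\eta^+,\eta^-)=(|\widehat{X}\setminus X^*|, |X^*\setminus\widehat{X}|)$ for any minimum vertex cover $X^*$, and $f:\mathbb{R}_{\geqslant0}^2\to\mathbb{R}_{\geqslant 0}$ is non-decreasing (in each coordinate). Then $f(x,y)\geqslant x+y$ for all $x,y\geqslant 0$ with $x+y\leqslant 1$.
   Context: A vertex cover of an undirected graph $G=(V,E)$ is a set $X\subseteq V$ containing at least one endpoint of every edge; Minimum Vertex Cover asks for one of minimum cardinality. A learning-augmented algorithm receives, besides the graph, a predicted set $\widehat{X}\subseteq V$ (not necessarily a vertex cover). *)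

theory Defs
  imports Complex_Main "HOL-Library.FuncSet" "HOL-Computational_Algebra.Polynomial"
begin

section \<open>Deterministic multi-tape Turing machines\<close>

text \<open>
  States are \<open>0, \<dots>, nstates\<close>; \<open>0\<close> is the initial and \<open>nstates\<close> the only halting state.
  Tape symbols are \<open>0, \<dots>, nsyms - 1\<close>, where \<open>0\<close> is the blank and \<open>1\<close>, \<open>2\<close> are the bits.
  Tapes are infinite in both directions.
\<close>

datatype move = MoveL | Stay | MoveR

record tm =
  ntapes :: nat
  nstates :: nat
  nsyms :: nat
  delta :: "nat \<Rightarrow> nat list \<Rightarrow> nat \<times> nat list \<times> move list"

definition wf_tm :: "tm \<Rightarrow> bool" where
  "wf_tm M \<longleftrightarrow> 1 \<le> ntapes M \<and> 1 \<le> nstates M \<and> 3 \<le> nsyms M \<and>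
     (\<forall>q ss. q < nstates M \<and> length ss = ntapes M \<and> (\<forall>s\<in>set ss. s < nsyms M) \<longrightarrow>
        (case delta M q ss of (q', ws, ms) \<Rightarrow>
           q' \<le> nstates M \<and> length ws = ntapes M \<and> (\<forall>s\<in>set ws. s < nsyms M) \<and>
           length ms = ntapes M))"

text \<open>A tape is its contents together with the position of the head.\<close>

type_synonym tape = "(int \<Rightarrow> nat) \<times> int"

type_synonym config = "nat \<times> tape list"

fun tape_read :: "tape \<Rightarrow> nat" where
  "tape_read (c, h) = c h"

fun tape_act :: "nat \<Rightarrow> move \<Rightarrow> tape \<Rightarrow> tape" where
  "tape_act w m (c, h) =
     (c(h := w), case m of MoveL \<Rightarrow> h - 1 | Stay \<Rightarrow> h | MoveR \<Rightarrow> h + 1)"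

fun tm_step :: "tm \<Rightarrow> config \<Rightarrow> config" where
  "tm_step M (q, ts) =
     (if q < nstates M then
        (case delta M q (map tape_read ts) of (q', ws, ms) \<Rightarrow>
           (q', map (\<lambda>(t, w, m). tape_act w m t) (zip ts (zip ws ms))))
      else (q, ts))"

fun bit_sym :: "bool \<Rightarrow> nat" where
  "bit_sym False = 1"
| "bit_sym True = 2"

definition input_tape :: "bool list \<Rightarrow> tape" where
  "input_tape x =
     (\<lambda>i. if 0 \<le> i \<and> i < int (length x) then bit_sym (x ! nat i) else 0, 0)"

definition init_config :: "tm \<Rightarrow> bool list \<Rightarrow> config" where
  "init_config M x = (0, input_tape x # replicate (ntapes M - 1) (input_tape []))"

text \<open>The output is read off the last tape, from cell \<open>0\<close> up to the first blank.\<close>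

definition tape_shows :: "tape \<Rightarrow> bool list \<Rightarrow> bool" where
  "tape_shows t y \<longleftrightarrow>
     (\<forall>i<length y. fst t (int i) = bit_sym (y ! i)) \<and> fst t (int (length y)) = 0"

text \<open>
  Halting configurations are fixed points of \<open>tm_step\<close>, so this says that the machine halts
  within \<open>n\<close> steps.
\<close>

definition tm_computes_within :: "tm \<Rightarrow> bool list \<Rightarrow> bool list \<Rightarrow> nat \<Rightarrow> bool" where
  "tm_computes_within M x y n \<longleftrightarrow>
     (case (tm_step M ^^ n) (init_config M x) of (q, ts) \<Rightarrow>
        q = nstates M \<and> tape_shows (last ts) y)"

section \<open>Polynomial time, P and NP\<close>

text \<open>
  On every instance \<open>x\<close> in \<open>D\<close>, presented as the bit string \<open>enc x\<close>, the bit string \<open>out x\<close>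
  is computed in time polynomial in the length of \<open>enc x\<close>.
\<close>

definition polytime_on :: "'a set \<Rightarrow> ('a \<Rightarrow> bool list) \<Rightarrow> ('a \<Rightarrow> bool list) \<Rightarrow> bool" where
  "polytime_on D enc out \<longleftrightarrow>
     (\<exists>M (p :: nat poly). wf_tm M \<and>
        (\<forall>x\<in>D. tm_computes_within M (enc x) (out x) (poly p (length (enc x)))))"

definition class_P :: "bool list set set" where
  "class_P = {L. polytime_on UNIV (\<lambda>x. x) (\<lambda>x. [x \<in> L])}"

definition enc_pair :: "bool list \<times> bool list \<Rightarrow> bool list" where
  "enc_pair = (\<lambda>(x, w). concat (map (\<lambda>b. [True, b]) x) @ [False] @ w)"

definition class_NP :: "bool list set set" where
  "class_NP = {L. \<exists>R (p :: nat poly).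
     polytime_on UNIV enc_pair (\<lambda>(x, w). [R x w]) \<and>
     (\<forall>x. x \<in> L \<longleftrightarrow> (\<exists>w. length w \<le> poly p (length x) \<and> R x w))}"

section \<open>The Unique Games Conjecture\<close>

text \<open>
  An instance with label set \<open>{0, \<dots>, k - 1}\<close> consists of the number of variables and the list of
  constraints (parallel constraints are allowed). A constraint \<open>(u, v, \<pi>)\<close> on the variables \<open>u\<close>
  and \<open>v\<close> carries a permutation of the labels, given by the list \<open>\<pi>\<close> of its values.
\<close>

type_synonym unique_game = "nat \<times> (nat \<times> nat \<times> nat list) list"

definition wf_unique_game :: "nat \<Rightarrow> unique_game \<Rightarrow> bool" where
  "wf_unique_game k = (\<lambda>(n, C). C \<noteq> [] \<and>
     (\<forall>(u, v, \<pi>) \<in> set C. u < n \<and> v < n \<and> u \<noteq> v \<and> distinct \<pi> \<and> set \<pi> = {..<k}))"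

definition sat_fraction :: "(nat \<times> nat \<times> nat list) list \<Rightarrow> (nat \<Rightarrow> nat) \<Rightarrow> real" where
  "sat_fraction C l =
     real (length (filter (\<lambda>(u, v, \<pi>). \<pi> ! l u = l v) C)) / real (length C)"

definition ug_value :: "nat \<Rightarrow> unique_game \<Rightarrow> real" where
  "ug_value k = (\<lambda>(n, C). Max (sat_fraction C ` ({..<n} \<rightarrow>\<^sub>E {..<k})))"

definition enc_nats :: "nat list \<Rightarrow> bool list" where
  "enc_nats ms = concat (map (\<lambda>m. replicate m True @ [False]) ms)"

definition enc_unique_game :: "unique_game \<Rightarrow> bool list" where
  "enc_unique_game = (\<lambda>(n, C). enc_nats (n # concat (map (\<lambda>(u, v, \<pi>). u # v # \<pi>) C)))"

text \<open>
  NP-hardness of the gap problem: every NP language has a polynomial-time many-one reduction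
  sending members to instances of value at least \<open>1 - \<epsilon>\<close> and non-members to instances of value
  at most \<open>\<delta>\<close>.
\<close>

definition gap_unique_games_NP_hard :: "nat \<Rightarrow> real \<Rightarrow> real \<Rightarrow> bool" where
  "gap_unique_games_NP_hard k \<epsilon> \<delta> \<longleftrightarrow>
     (\<forall>L\<in>class_NP. \<exists>r :: bool list \<Rightarrow> unique_game.
        polytime_on UNIV (\<lambda>x. x) (\<lambda>x. enc_unique_game (r x)) \<and>
        (\<forall>x. wf_unique_game k (r x) \<and>
             (x \<in> L \<longrightarrow> ug_value k (r x) \<ge> 1 - \<epsilon>) \<and>
             (x \<notin> L \<longrightarrow> ug_value k (r x) \<le> \<delta>)))"

definition unique_games_conjecture :: bool where
  "unique_games_conjecture \<longleftrightarrow>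
     (\<forall>\<epsilon>>0. \<forall>\<delta>>0. \<exists>k\<ge>1. gap_unique_games_NP_hard k \<epsilon> \<delta>)"

section \<open>Vertex cover with predictions\<close>

definition simple_graph :: "'a set \<Rightarrow> 'a set set \<Rightarrow> bool" where
  "simple_graph V E \<longleftrightarrow> finite V \<and> (\<forall>e\<in>E. e \<subseteq> V \<and> card e = 2)"

definition vertex_cover :: "'a set \<Rightarrow> 'a set set \<Rightarrow> 'a set \<Rightarrow> bool" where
  "vertex_cover V E X \<longleftrightarrow> X \<subseteq> V \<and> (\<forall>e\<in>E. e \<inter> X \<noteq> {})"

definition opt_vc :: "'a set \<Rightarrow> 'a set set \<Rightarrow> nat" where
  "opt_vc V E = Min (card ` {X. vertex_cover V E X})"

definition min_vertex_cover :: "'a set \<Rightarrow> 'a set set \<Rightarrow> 'a set \<Rightarrow> bool" where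
  "min_vertex_cover V E X \<longleftrightarrow> vertex_cover V E X \<and> card X = opt_vc V E"

text \<open>
  Algorithms receive graphs with vertex set \<open>{0, \<dots>, n - 1}\<close>, presented by \<open>n\<close> in unary and
  the adjacency matrix; vertex sets are presented by their characteristic vectors.
\<close>

definition vc_inputs :: "(nat \<times> nat set set \<times> nat set) set" where
  "vc_inputs = {(n, E, X). simple_graph {..<n} E \<and> X \<subseteq> {..<n}}"

definition enc_vertex_set :: "nat \<Rightarrow> nat set \<Rightarrow> bool list" where
  "enc_vertex_set n X = map (\<lambda>i. i \<in> X) [0..<n]"

definition enc_graph :: "nat \<Rightarrow> nat set set \<Rightarrow> bool list" where
  "enc_graph n E =
     replicate n True @ [False] @ concat (map (\<lambda>i. map (\<lambda>j. {i, j} \<in> E) [0..<n]) [0..<n])"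

definition polytime_vc_algorithm :: "(nat \<Rightarrow> nat set set \<Rightarrow> nat set \<Rightarrow> nat set) \<Rightarrow> bool" where
  "polytime_vc_algorithm A \<longleftrightarrow>
     polytime_on vc_inputs
       (\<lambda>(n, E, X). enc_graph n E @ enc_vertex_set n X)
       (\<lambda>(n, E, X). enc_vertex_set n (A n E X))"

end

theory Submission imports Defs begin

text \<open>For every \<open>\<epsilon> > 0\<close>, the Unique Games Conjecture makes it NP-hard to tell graphs \<open>G\<close> on \<open>N\<close> vertices
  with a vertex cover of size \<open>(1/2 + \<epsilon>) N\<close> from those whose covers all have size at least \<open>(1 - \<epsilon>) N\<close>,
  and a cover never has less than \<open>N / 2\<close> vertices. Take \<open>c\<^sub>1 \<approx> x c\<close> copies of \<open>G\<close> on which everything is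
  predicted, \<open>c\<^sub>2 \<approx> y c\<close> copies on which nothing is, and perfect matchings with a correct prediction
  for the remaining \<open>c - c\<^sub>1 - c\<^sub>2\<close> copies. In the first case the relative errors are at most \<open>x\<close> and
  \<open>y\<close>, so the algorithm finds a cover of size about \<open>(1 + f x y) c N / 2\<close>; in the second case every
  cover has size about \<open>(1 + x + y) c N / 2\<close>. If \<open>f x y < x + y\<close>, the size of the output decides an
  NP-complete problem.

  The gap is obtained as by Khot and Regev from the biased long code: vertices are sets of labels
  at a variable, drawn with bias below \<open>1/2\<close>, and two of them conflict if they contain no pair
  of labels agreeing at a common neighbour. An independent set of positive density has an upward closure
  whose measure, by Russo's formula, has small derivative at some bias; Fourier analysis and
  hypercontractivity (Bonami's lemma) then yield a bounded set of coordinates on which the family essentially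
  depends, and these lists of labels give a labelling of the unique game. The reduction
  runs in polynomial time because every bit of its output is the value of an arithmetic expression
  with bounded sums, and such expressions are evaluated by Turing machines in polynomial time.\<close>

section \<open>Programs for Turing machines\<close>

text \<open>The conjecture bounds only the fraction of violated constraints: a good labelling may
  violate a constraint at every variable, and degrees are arbitrary. A vertex therefore cannot be
  compared with all neighbours of its variable. It carries \<open>l\<close> sampled half-edges
  instead, and conflicts are tested at common sampled neighbours only; a sample is entirely
  satisfied except with probability at most \<open>2 * l * \<zeta>\<close>, and \<zeta> is chosen
  after \<open>l\<close>. For soundness \<open>l = Suc r\<close>, where \<open>r\<close> bounds the
  lists: every sampled neighbour shares a label with the list found at the variable, so by
  pigeonhole two neighbours agree on one label, which is what the random labelling needs. The
  constants \<open>s\<close>, \<open>D\<close>, \<open>r\<close>, \<open>l\<close>, \<zeta>,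
  \<gamma> depend on \<epsilon> alone, because the conjecture yields \<open>k\<close> only in answer
  to \<zeta> and \<gamma>. Hence the bounds on cores must not depend on the ground set. Once chosen,
  \<open>k\<close> and \<open>l\<close> are constants, so all numbers in the reduction are
  polynomial in the input and unary counters suffice.\<close>

datatype com =
    Act "nat list \<Rightarrow> nat list \<times> move list"
  | Seq com com
  | Cond "nat list \<Rightarrow> bool" com com
  | While "nat list \<Rightarrow> bool" com

fun apply_act :: "nat list \<times> move list \<Rightarrow> tape list \<Rightarrow> tape list" where
  "apply_act (ws, ms) ts = map (\<lambda>(t, w, m). tape_act w m t) (zip ts (zip ws ms))"

text \<open>The step counts are those of the compiled machine: an action or a test costs one step,
  and sequencing is free because \<open>flow\<close> links exit and entry states directly.\<close>

inductive exec :: "com \<Rightarrow> tape list \<Rightarrow> nat \<Rightarrow> tape list \<Rightarrow> bool" where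
  exec_Act: "exec (Act a) ts (Suc 0) (apply_act (a (map tape_read ts)) ts)"
| exec_Seq: "exec c ts n ts1 \<Longrightarrow> exec d ts1 n' ts2 \<Longrightarrow> exec (Seq c d) ts (n + n') ts2"
| exec_CondT: "b (map tape_read ts) \<Longrightarrow> exec c ts n ts' \<Longrightarrow> exec (Cond b c d) ts (Suc n) ts'"
| exec_CondF: "\<not> b (map tape_read ts) \<Longrightarrow> exec d ts n ts' \<Longrightarrow> exec (Cond b c d) ts (Suc n) ts'"
| exec_WhileF: "\<not> b (map tape_read ts) \<Longrightarrow> exec (While b c) ts (Suc 0) ts"
| exec_WhileT: "b (map tape_read ts) \<Longrightarrow> exec c ts n ts1 \<Longrightarrow> exec (While b c) ts1 n' ts2 \<Longrightarrow>
    exec (While b c) ts (Suc (n + n')) ts2"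

fun csize :: "com \<Rightarrow> nat" where
  "csize (Act a) = 1"
| "csize (Seq c d) = csize c + csize d"
| "csize (Cond b c d) = 1 + csize c + csize d"
| "csize (While b c) = 1 + csize c"

lemma csize_pos: "0 < csize c"
  by (induction c) auto

text \<open>\<open>flow c s e\<close> is the transition function of \<open>c\<close> placed in the states \<open>s, \<dots>, s + csize c - 1\<close>
  and leaving to the state \<open>e\<close>.\<close>

fun flow :: "com \<Rightarrow> nat \<Rightarrow> nat \<Rightarrow> nat \<Rightarrow> nat list \<Rightarrow> nat \<times> nat list \<times> move list" where
  "flow (Act a) s e q ss = (e, a ss)"
| "flow (Seq c d) s e q ss =
     (if q < s + csize c then flow c s (s + csize c) q ss else flow d (s + csize c) e q ss)"
| "flow (Cond b c d) s e q ss =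
     (if q = s then (if b ss then Suc s else Suc s + csize c, ss, replicate (length ss) Stay)
      else if q < Suc s + csize c then flow c (Suc s) e q ss else flow d (Suc s + csize c) e q ss)"
| "flow (While b c) s e q ss =
     (if q = s then (if b ss then Suc s else e, ss, replicate (length ss) Stay)
      else flow c (Suc s) s q ss)"

definition valid_syms :: "nat \<Rightarrow> nat \<Rightarrow> nat list \<Rightarrow> bool" where
  "valid_syms K G ss \<longleftrightarrow> length ss = K \<and> (\<forall>s\<in>set ss. s < G)"

fun wf_com :: "nat \<Rightarrow> nat \<Rightarrow> com \<Rightarrow> bool" where
  "wf_com K G (Act a) \<longleftrightarrow> (\<forall>ss. valid_syms K G ss \<longrightarrow>
     valid_syms K G (fst (a ss)) \<and> length (snd (a ss)) = K)"
| "wf_com K G (Seq c d) \<longleftrightarrow> wf_com K G c \<and> wf_com K G d"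
| "wf_com K G (Cond b c d) \<longleftrightarrow> wf_com K G c \<and> wf_com K G d"
| "wf_com K G (While b c) \<longleftrightarrow> wf_com K G c"

definition tm_of :: "nat \<Rightarrow> nat \<Rightarrow> com \<Rightarrow> tm" where
  "tm_of K G c = \<lparr>ntapes = K, nstates = csize c, nsyms = G, delta = flow c 0 (csize c)\<rparr>"

section \<open>Correctness of the compiled machines\<close>

lemma flow_valid:
  assumes "wf_com K G c" "valid_syms K G ss" "s \<le> q" "q < s + csize c" "s + csize c \<le> n" "e \<le> n"
  shows "fst (flow c s e q ss) \<le> n \<and> valid_syms K G (fst (snd (flow c s e q ss))) \<and>
    length (snd (snd (flow c s e q ss))) = K"
  using assms
proof (induction c arbitrary: s e)
  case (Seq c d)
  then show ?case
    using Seq.IH(1)[of s "s + csize c"] Seq.IH(2)[of "s + csize c" e] by simp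
next
  case (Cond b c d)
  consider "q = s" | "q \<noteq> s" "q < Suc s + csize c" | "q \<noteq> s" "\<not> q < Suc s + csize c" by blast
  then show ?case
  proof cases
    case 1
    then show ?thesis using Cond.prems csize_pos[of d] by (auto simp: valid_syms_def)
  next
    case 2
    then have "flow (Cond b c d) s e q ss = flow c (Suc s) e q ss" by simp
    moreover have "fst (flow c (Suc s) e q ss) \<le> n \<and> valid_syms K G (fst (snd (flow c (Suc s) e q ss))) \<and>
        length (snd (snd (flow c (Suc s) e q ss))) = K"
      by (rule Cond.IH(1)) (use Cond.prems 2 in auto)
    ultimately show ?thesis by simp
  next
    case 3
    then have "flow (Cond b c d) s e q ss = flow d (Suc s + csize c) e q ss" by simp
    moreover have "fst (flow d (Suc s + csize c) e q ss) \<le> n \<and>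
        valid_syms K G (fst (snd (flow d (Suc s + csize c) e q ss))) \<and>
        length (snd (snd (flow d (Suc s + csize c) e q ss))) = K"
      by (rule Cond.IH(2)) (use Cond.prems 3 in auto)
    ultimately show ?thesis by simp
  qed
next
  case (While b c)
  show ?case
  proof (cases "q = s")
    case True
    then show ?thesis using While.prems by (auto simp: valid_syms_def)
  next
    case False
    then have "flow (While b c) s e q ss = flow c (Suc s) s q ss" by simp
    moreover have "fst (flow c (Suc s) s q ss) \<le> n \<and> valid_syms K G (fst (snd (flow c (Suc s) s q ss))) \<and>
        length (snd (snd (flow c (Suc s) s q ss))) = K"
      by (rule While.IH) (use While.prems False in auto)
    ultimately show ?thesis by simp
  qed
qed simp

lemma wf_tm_of:
  assumes "wf_com K G c" "1 \<le> K" "3 \<le> G"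
  shows "wf_tm (tm_of K G c)"
proof -
  have "1 \<le> csize c" using csize_pos[of c] by simp
  moreover have "case flow c 0 (csize c) q ss of (q', ws, ms) \<Rightarrow>
      q' \<le> csize c \<and> length ws = K \<and> (\<forall>s\<in>set ws. s < G) \<and> length ms = K"
    if "q < csize c" "length ss = K" "\<forall>s\<in>set ss. s < G" for q ss
    using flow_valid[of K G c ss 0 q "csize c" "csize c"] assms(1) that
    by (auto simp: valid_syms_def split: prod.splits)
  ultimately show ?thesis
    using assms(2,3) by (auto simp: wf_tm_def tm_of_def)
qed

lemma tape_act_read [simp]: "tape_act (tape_read t) Stay t = t"
  by (cases t) auto

lemma apply_act_Stay [simp]:
  "apply_act (map tape_read ts, replicate (length ts) Stay) ts = ts"
  by (auto intro!: nth_equalityI)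

declare tm_step.simps [simp del]

text \<open>The transition function of \<open>M\<close> has to agree with \<open>flow\<close> only
  on the states of \<open>c\<close>; this lets the induction descend to a subprogram placed at a
  shifted start state with an inner exit.\<close>

lemma exec_tm:
  assumes "exec c ts n ts'"
    and "\<And>q ss. s \<le> q \<Longrightarrow> q < s + csize c \<Longrightarrow> delta M q ss = flow c s e q ss"
    and "s + csize c \<le> nstates M"
  shows "(tm_step M ^^ n) (s, ts) = (e, ts')"
  using assms
proof (induction arbitrary: s e rule: exec.induct)
  case (exec_Act a ts)
  have "delta M s (map tape_read ts) = (e, a (map tape_read ts))"
    using exec_Act.prems(1)[of s] by simp
  then show ?case using exec_Act.prems(2) by (auto simp: tm_step.simps split: prod.splits)
next
  case (exec_Seq c ts n ts1 d n' ts2)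
  have 1: "(tm_step M ^^ n) (s, ts) = (s + csize c, ts1)"
    by (rule exec_Seq.IH(1)) (use exec_Seq.prems in auto)
  have 2: "(tm_step M ^^ n') (s + csize c, ts1) = (e, ts2)"
    by (rule exec_Seq.IH(2)) (use exec_Seq.prems in auto)
  have "(tm_step M ^^ (n' + n)) (s, ts) = (e, ts2)"
    unfolding funpow_add by (simp add: 1 2)
  then show ?case by (simp add: add.commute)
next
  case (exec_CondT b ts c n ts' d)
  have 1: "(tm_step M ^^ n) (Suc s, ts) = (e, ts')"
    by (rule exec_CondT.IH) (use exec_CondT.prems in auto)
  have "tm_step M (s, ts) = (Suc s, ts)"
    using exec_CondT.prems(1)[of s] exec_CondT.prems(2) exec_CondT.hyps(1) apply_act_Stay[of ts]
    by (simp add: tm_step.simps del: apply_act_Stay)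
  then show ?case using 1 by (simp add: funpow_Suc_right del: funpow.simps)
next
  case (exec_CondF b ts d n ts' c)
  have 1: "(tm_step M ^^ n) (Suc s + csize c, ts) = (e, ts')"
    by (rule exec_CondF.IH) (use exec_CondF.prems in auto)
  have "tm_step M (s, ts) = (Suc s + csize c, ts)"
    using exec_CondF.prems(1)[of s] exec_CondF.prems(2) exec_CondF.hyps(1) apply_act_Stay[of ts]
    by (simp add: tm_step.simps del: apply_act_Stay)
  then show ?case using 1 by (simp add: funpow_Suc_right del: funpow.simps)
next
  case (exec_WhileF b ts c)
  show ?case
    using exec_WhileF.prems(1)[of s] exec_WhileF.prems(2) exec_WhileF.hyps(1) apply_act_Stay[of ts]
    by (simp add: tm_step.simps del: apply_act_Stay)
next
  case (exec_WhileT b ts c n ts1 n' ts2)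
  have 0: "tm_step M (s, ts) = (Suc s, ts)"
    using exec_WhileT.prems(1)[of s] exec_WhileT.prems(2) exec_WhileT.hyps(1) apply_act_Stay[of ts]
    by (simp add: tm_step.simps del: apply_act_Stay)
  have 1: "(tm_step M ^^ n) (Suc s, ts) = (s, ts1)"
    by (rule exec_WhileT.IH(1)) (use exec_WhileT.prems in auto)
  have 2: "(tm_step M ^^ n') (s, ts1) = (e, ts2)"
    by (rule exec_WhileT.IH(2)) (use exec_WhileT.prems in auto)
  have "(tm_step M ^^ (n' + (n + 1))) (s, ts) = (e, ts2)"
    unfolding funpow_add by (simp add: 0 1 2)
  then show ?case by (simp add: add.commute add.left_commute)
qed

text \<open>Only an upper bound on the time is recorded. A halted machine idles, so this suffices
  for \<open>tm_computes_within\<close>, and bounds can be rounded up freely to polynomials.\<close>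

definition runs :: "com \<Rightarrow> tape list \<Rightarrow> tape list \<Rightarrow> nat \<Rightarrow> bool" where
  "runs c ts ts' n \<longleftrightarrow> (\<exists>i\<le>n. exec c ts i ts')"

lemma tm_step_halted: "(tm_step M ^^ n) (nstates M, ts) = (nstates M, ts)"
  by (induction n) (auto simp: tm_step.simps)

lemma polytime_by_com:
  assumes "wf_com K G c" "1 \<le> K" "3 \<le> G"
    and "\<And>x. x \<in> D \<Longrightarrow> \<exists>ts. tape_shows (last ts) (out x) \<and>
      runs c (input_tape (enc x) # replicate (K - 1) (input_tape [])) ts (poly p (length (enc x)))"
  shows "polytime_on D enc out"
  unfolding polytime_on_def
proof (intro exI conjI ballI)
  show "wf_tm (tm_of K G c)" using assms(1-3) by (rule wf_tm_of)
  fix x assume "x \<in> D"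
  then obtain ts i where ts: "tape_shows (last ts) (out x)" and i: "i \<le> poly p (length (enc x))"
    "exec c (input_tape (enc x) # replicate (K - 1) (input_tape [])) i ts"
    using assms(4) unfolding runs_def by blast
  let ?M = "tm_of K G c"
  have "(tm_step ?M ^^ i) (init_config ?M (enc x)) = (nstates ?M, ts)"
    using exec_tm[OF i(2), of 0 ?M "csize c"] by (simp add: init_config_def tm_of_def)
  then have "(tm_step ?M ^^ (poly p (length (enc x)) - i + i)) (init_config ?M (enc x)) = (nstates ?M, ts)"
    unfolding funpow_add by (simp add: tm_step_halted)
  then show "tm_computes_within ?M (enc x) (out x) (poly p (length (enc x)))"
    using i(1) ts by (simp add: tm_computes_within_def)
qed

lemma runs_mono: "runs c ts ts' n \<Longrightarrow> n \<le> n' \<Longrightarrow> runs c ts ts' n'"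
  unfolding runs_def by (meson order_trans)

lemma runs_Act: "ts' = apply_act (a (map tape_read ts)) ts \<Longrightarrow> runs (Act a) ts ts' 1"
  unfolding runs_def using exec_Act[of a ts] by (intro exI[of _ "Suc 0"]) simp

lemma runs_Seq: "runs c ts ts1 n \<Longrightarrow> runs d ts1 ts2 n' \<Longrightarrow> runs (Seq c d) ts ts2 (n + n')"
  unfolding runs_def by (meson add_mono exec_Seq)

lemma runs_CondT: "b (map tape_read ts) \<Longrightarrow> runs c ts ts' n \<Longrightarrow> runs (Cond b c d) ts ts' (Suc n)"
  unfolding runs_def by (meson Suc_le_mono exec_CondT)

lemma runs_CondF: "\<not> b (map tape_read ts) \<Longrightarrow> runs d ts ts' n \<Longrightarrow> runs (Cond b c d) ts ts' (Suc n)"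
  unfolding runs_def by (meson Suc_le_mono exec_CondF)

lemma runs_While:
  assumes "\<And>i. i < n \<Longrightarrow> b (map tape_read (S i))"
    and "\<And>i. i < n \<Longrightarrow> runs c (S i) (S (Suc i)) T"
    and "\<not> b (map tape_read (S n))"
  shows "runs (While b c) (S 0) (S n) (n * Suc T + 1)"
  using assms
proof (induction n arbitrary: S)
  case 0
  then show ?case unfolding runs_def
    using exec_WhileF[of b "S 0" c] by (intro exI[of _ "Suc 0"]) simp
next
  case (Suc n)
  have "runs (While b c) (S (Suc 0)) (S (Suc n)) (n * Suc T + 1)"
    using Suc.IH[of "\<lambda>i. S (Suc i)"] Suc.prems by simp
  then obtain j where j: "j \<le> n * Suc T + 1" "exec (While b c) (S (Suc 0)) j (S (Suc n))"
    unfolding runs_def by blast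
  obtain i where i: "i \<le> T" "exec c (S 0) i (S (Suc 0))"
    using Suc.prems(2)[of 0] unfolding runs_def by blast
  have "exec (While b c) (S 0) (Suc (i + j)) (S (Suc n))"
    using exec_WhileT[of b "S 0" c i "S (Suc 0)" j] i j Suc.prems(1)[of 0] by simp
  moreover have "Suc (i + j) \<le> Suc n * Suc T + 1" using i j by simp
  ultimately show ?case unfolding runs_def by blast
qed

section \<open>Counter programs\<close>

text \<open>The number is the position of the head, and the only nonblank cell is the marker
  \<open>1\<close> at the origin. Incrementing and decrementing are single moves, and the test for
  zero reads the marker.\<close>

definition ctr :: "nat \<Rightarrow> tape" where
  "ctr n = ((\<lambda>_. 0)(0 := 1), int n)"

definition in_tape :: "bool list \<Rightarrow> nat \<Rightarrow> tape" where
  "in_tape x h = (fst (input_tape x), int h)"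

definition mk :: "nat \<Rightarrow> bool list \<Rightarrow> nat \<Rightarrow> (nat \<Rightarrow> nat) \<Rightarrow> bool list \<Rightarrow> tape list" where
  "mk m x h \<sigma> y = map (\<lambda>r. if r = 0 then in_tape x h else if r \<le> m then ctr (\<sigma> r)
     else in_tape y (length y)) [0..<m + 2]"

definition on_tape :: "nat \<Rightarrow> (nat \<Rightarrow> nat \<times> move) \<Rightarrow> com" where
  "on_tape r g = Act (\<lambda>ss. (ss[r := fst (g (ss ! r))], (replicate (length ss) Stay)[r := snd (g (ss ! r))]))"

lemma length_mk [simp]: "length (mk m x h \<sigma> y) = m + 2"
  by (simp add: mk_def)

lemma nth_mk: "r < m + 2 \<Longrightarrow> mk m x h \<sigma> y ! r =
    (if r = 0 then in_tape x h else if r \<le> m then ctr (\<sigma> r) else in_tape y (length y))"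
  by (simp add: mk_def del: upt_Suc)

lemma runs_on_tape:
  assumes "r < length ts"
    and "ts' = ts[r := tape_act (fst (g (tape_read (ts ! r)))) (snd (g (tape_read (ts ! r)))) (ts ! r)]"
  shows "runs (on_tape r g) ts ts' 1"
  unfolding on_tape_def
proof (rule runs_Act)
  show "ts' = apply_act ((\<lambda>ss. (ss[r := fst (g (ss ! r))], (replicate (length ss) Stay)[r := snd (g (ss ! r))])) (map tape_read ts)) ts"
    using assms by (auto intro!: nth_equalityI simp: nth_list_update)
qed

lemma wf_on_tape: "(\<And>s. s < G \<Longrightarrow> fst (g s) < G) \<Longrightarrow> wf_com K G (on_tape r g)"
proof -
  assume *: "\<And>s. s < G \<Longrightarrow> fst (g s) < G"
  have "s < G" if "valid_syms K G ss" "s \<in> set (ss[r := fst (g (ss ! r))])" for ss s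
  proof (cases "r < length ss")
    case True
    then have "ss ! r < G" using that(1) by (auto simp: valid_syms_def)
    then show ?thesis using that * set_update_subset_insert[of ss r "fst (g (ss ! r))"]
      by (auto simp: valid_syms_def)
  next
    case False
    then have "ss[r := fst (g (ss ! r))] = ss" by (simp add: list_update_beyond)
    then show ?thesis using that by (auto simp: valid_syms_def)
  qed
  then show ?thesis by (auto simp: on_tape_def valid_syms_def)
qed

definition inc :: "nat \<Rightarrow> com" where "inc r = on_tape r (\<lambda>s. (s, MoveR))"
definition dec :: "nat \<Rightarrow> com" where "dec r = on_tape r (\<lambda>s. (s, MoveL))"
definition nz :: "nat \<Rightarrow> nat list \<Rightarrow> bool" where "nz r ss \<longleftrightarrow> ss ! r \<noteq> 1"
definition drain :: "nat \<Rightarrow> com \<Rightarrow> com" where "drain r c = While (nz r) (Seq (dec r) c)"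

lemma wf_inc [simp]: "wf_com K G (inc r)" and wf_dec [simp]: "wf_com K G (dec r)"
  unfolding inc_def dec_def by (auto intro!: wf_on_tape)

lemma wf_drain [simp]: "wf_com K G (drain r c) \<longleftrightarrow> wf_com K G c"
  by (simp add: drain_def)

lemma runs_inc:
  assumes "1 \<le> r" "r \<le> m"
  shows "runs (inc r) (mk m x h \<sigma> y) (mk m x h (\<sigma>(r := Suc (\<sigma> r))) y) 1"
  unfolding inc_def
proof (rule runs_on_tape)
  show "mk m x h (\<sigma>(r := Suc (\<sigma> r))) y = (mk m x h \<sigma> y)[r := tape_act
    (fst (tape_read (mk m x h \<sigma> y ! r), MoveR)) (snd (tape_read (mk m x h \<sigma> y ! r), MoveR)) (mk m x h \<sigma> y ! r)]"
    using assms by (intro nth_equalityI) (auto simp: nth_mk nth_list_update ctr_def)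
qed (use assms in simp)

lemma runs_dec:
  assumes "1 \<le> r" "r \<le> m" "\<sigma> r = Suc v"
  shows "runs (dec r) (mk m x h \<sigma> y) (mk m x h (\<sigma>(r := v)) y) 1"
  unfolding dec_def
proof (rule runs_on_tape)
  show "mk m x h (\<sigma>(r := v)) y = (mk m x h \<sigma> y)[r := tape_act
    (fst (tape_read (mk m x h \<sigma> y ! r), MoveL)) (snd (tape_read (mk m x h \<sigma> y ! r), MoveL)) (mk m x h \<sigma> y ! r)]"
    using assms by (intro nth_equalityI) (auto simp: nth_mk nth_list_update ctr_def)
qed (use assms in simp)

lemma runs_in_right: "runs (inc 0) (mk m x h \<sigma> y) (mk m x (Suc h) \<sigma> y) 1"
  unfolding inc_def
proof (rule runs_on_tape)
  show "mk m x (Suc h) \<sigma> y = (mk m x h \<sigma> y)[0 := tape_act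
    (fst (tape_read (mk m x h \<sigma> y ! 0), MoveR)) (snd (tape_read (mk m x h \<sigma> y ! 0), MoveR)) (mk m x h \<sigma> y ! 0)]"
    by (intro nth_equalityI) (auto simp: nth_mk nth_list_update in_tape_def)
qed simp

lemma runs_in_left: "runs (dec 0) (mk m x (Suc h) \<sigma> y) (mk m x h \<sigma> y) 1"
  unfolding dec_def
proof (rule runs_on_tape)
  show "mk m x h \<sigma> y = (mk m x (Suc h) \<sigma> y)[0 := tape_act
    (fst (tape_read (mk m x (Suc h) \<sigma> y ! 0), MoveL)) (snd (tape_read (mk m x (Suc h) \<sigma> y ! 0), MoveL)) (mk m x (Suc h) \<sigma> y ! 0)]"
    by (intro nth_equalityI) (auto simp: nth_mk nth_list_update in_tape_def)
qed simp

lemma nz_mk: "1 \<le> r \<Longrightarrow> r \<le> m \<Longrightarrow> nz r (map tape_read (mk m x h \<sigma> y)) \<longleftrightarrow> \<sigma> r \<noteq> 0"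
  by (simp add: nz_def nth_mk ctr_def)

definition sym_at :: "bool list \<Rightarrow> nat \<Rightarrow> nat" where
  "sym_at x i = (if i < length x then bit_sym (x ! i) else 0)"

lemma read_input_mk: "map tape_read (mk m x h \<sigma> y) ! 0 = sym_at x h"
  by (simp add: nth_mk in_tape_def input_tape_def sym_at_def)

text \<open>The register is decremented before each run of the body, hence the value
  \<open>n - Suc i\<close> at its start. Input position and output may vary with \<open>i\<close>,
  as needed by loops that read or write.\<close>

lemma runs_drain:
  assumes "1 \<le> r" "r \<le> m" "\<And>i. i \<le> n \<Longrightarrow> \<tau> i r = n - i"
    and "\<And>i. i < n \<Longrightarrow> runs c (mk m x (h i) ((\<tau> i)(r := n - Suc i)) (y i)) (mk m x (h (Suc i)) (\<tau> (Suc i)) (y (Suc i))) T"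
  shows "runs (drain r c) (mk m x (h 0) (\<tau> 0) (y 0)) (mk m x (h n) (\<tau> n) (y n)) (n * (T + 2) + 1)"
proof -
  have "runs (drain r c) (mk m x (h 0) (\<tau> 0) (y 0)) (mk m x (h n) (\<tau> n) (y n)) (n * Suc (1 + T) + 1)"
    unfolding drain_def
  proof (rule runs_While[where S = "\<lambda>i. mk m x (h i) (\<tau> i) (y i)"])
    fix i assume i: "i < n"
    show "nz r (map tape_read (mk m x (h i) (\<tau> i) (y i)))"
      using assms(1,2) assms(3)[of i] i by (simp add: nz_mk)
    show "runs (Seq (dec r) c) (mk m x (h i) (\<tau> i) (y i)) (mk m x (h (Suc i)) (\<tau> (Suc i)) (y (Suc i))) (1 + T)"
      by (rule runs_Seq[OF runs_dec assms(4)[OF i]]) (use assms(1,2) assms(3)[of i] i in auto)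
  next
    show "\<not> nz r (map tape_read (mk m x (h n) (\<tau> n) (y n)))"
      using assms(1,2) assms(3)[of n] by (simp add: nz_mk)
  qed
  then show ?thesis by simp
qed

section \<open>Expressions with bounded sums\<close>

text \<open>Variables are numbered from the outside: the body of \<open>Sum g e\<close> sees its index as the last
  entry of the environment.\<close>

datatype exp = Var nat | Const nat | Len | Sym exp | Add exp exp | Sub exp exp | Sum exp exp
  | App exp "exp list"

fun eval :: "bool list \<Rightarrow> nat list \<Rightarrow> exp \<Rightarrow> nat" where
  "eval x \<rho> (Var i) = (if i < length \<rho> then \<rho> ! i else 0)"
| "eval x \<rho> (Const n) = n"
| "eval x \<rho> Len = length x"
| "eval x \<rho> (Sym e) = sym_at x (eval x \<rho> e)"
| "eval x \<rho> (Add e e') = eval x \<rho> e + eval x \<rho> e'"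
| "eval x \<rho> (Sub e e') = eval x \<rho> e - eval x \<rho> e'"
| "eval x \<rho> (Sum g e) = (\<Sum>i<eval x \<rho> g. eval x (\<rho> @ [i]) e)"
| "eval x \<rho> (App e es) = eval x (map (\<lambda>a. eval x \<rho> a) es) e"

definition clear :: "nat \<Rightarrow> com" where "clear r = While (nz r) (dec r)"
text \<open>A counter can be read only by emptying it, so \<open>t\<close> receives a second copy
  from which \<open>r\<close> is restored.\<close>

definition copy :: "nat \<Rightarrow> nat \<Rightarrow> nat \<Rightarrow> com" where
  "copy r d t = Seq (drain r (Seq (inc d) (inc t))) (drain t (inc r))"

lemma wf_clear [simp]: "wf_com K G (clear r)" and wf_copy [simp]: "wf_com K G (copy r d t)"
  by (simp_all add: clear_def copy_def)

lemma runs_clear: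
  assumes "1 \<le> r" "r \<le> m"
  shows "runs (clear r) (mk m x h \<sigma> y) (mk m x h (\<sigma>(r := 0)) y) (\<sigma> r * 2 + 1)"
proof -
  define S where "S i = mk m x h (\<sigma>(r := \<sigma> r - i)) y" for i
  have "runs (clear r) (S 0) (S (\<sigma> r)) (\<sigma> r * Suc 1 + 1)"
    unfolding clear_def
  proof (rule runs_While)
    fix i assume i: "i < \<sigma> r"
    show "nz r (map tape_read (S i))" unfolding S_def using assms i by (simp add: nz_mk)
    have "runs (dec r) (S i) (mk m x h ((\<sigma>(r := \<sigma> r - i))(r := \<sigma> r - Suc i)) y) 1"
      unfolding S_def by (rule runs_dec) (use assms i in auto)
    then show "runs (dec r) (S i) (S (Suc i)) 1" by (simp add: S_def)
  qed (use assms in \<open>simp add: S_def nz_mk\<close>)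
  then show ?thesis by (simp add: S_def numeral_eq_Suc)
qed

lemma runs_skip:
  assumes "1 \<le> r" "r \<le> m" "\<sigma> r = 0"
  shows "runs (clear r) (mk m x h \<sigma> y) (mk m x h \<sigma> y) 1"
proof -
  have "\<sigma>(r := 0) = \<sigma>" using assms(3) by auto
  then show ?thesis using runs_clear[OF assms(1,2), of x h \<sigma> y] assms(3) by simp
qed

lemma runs_transfer:
  assumes "1 \<le> r" "r \<le> m" "1 \<le> d" "d \<le> m" "r \<noteq> d"
  shows "runs (drain r (inc d)) (mk m x h \<sigma> y) (mk m x h (\<sigma>(d := \<sigma> d + \<sigma> r, r := 0)) y) (\<sigma> r * 3 + 1)"
proof -
  define \<tau> where "\<tau> i = \<sigma>(d := \<sigma> d + i, r := \<sigma> r - i)" for i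
  have "runs (drain r (inc d)) (mk m x h (\<tau> 0) y) (mk m x h (\<tau> (\<sigma> r)) y) (\<sigma> r * (1 + 2) + 1)"
  proof (rule runs_drain[where h = "\<lambda>_. h" and y = "\<lambda>_. y"])
    fix i assume "i < \<sigma> r"
    have "\<tau> (Suc i) = ((\<tau> i)(r := \<sigma> r - Suc i))(d := Suc (((\<tau> i)(r := \<sigma> r - Suc i)) d))"
      using assms by (auto simp: \<tau>_def)
    then show "runs (inc d) (mk m x h ((\<tau> i)(r := \<sigma> r - Suc i)) y) (mk m x h (\<tau> (Suc i)) y) 1"
      using runs_inc[OF assms(3,4)] by metis
  qed (use assms in \<open>auto simp: \<tau>_def\<close>)
  moreover have "\<tau> 0 = \<sigma>" by (auto simp: \<tau>_def)
  ultimately show ?thesis by (simp add: \<tau>_def numeral_eq_Suc)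
qed

lemma runs_transfer2:
  assumes "1 \<le> r" "r \<le> m" "1 \<le> d" "d \<le> m" "r \<noteq> d" "1 \<le> t" "t \<le> m" "t \<noteq> d" "t \<noteq> r"
  shows "runs (drain r (Seq (inc d) (inc t))) (mk m x h \<sigma> y)
    (mk m x h (\<sigma>(d := \<sigma> d + \<sigma> r, t := \<sigma> t + \<sigma> r, r := 0)) y) (\<sigma> r * 4 + 1)"
proof -
  define \<tau> where "\<tau> i = \<sigma>(d := \<sigma> d + i, t := \<sigma> t + i, r := \<sigma> r - i)" for i
  have "runs (drain r (Seq (inc d) (inc t))) (mk m x h (\<tau> 0) y) (mk m x h (\<tau> (\<sigma> r)) y) (\<sigma> r * (1 + 1 + 2) + 1)"
  proof (rule runs_drain[where h = "\<lambda>_. h" and y = "\<lambda>_. y"])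
    fix i assume "i < \<sigma> r"
    let ?a = "(\<tau> i)(r := \<sigma> r - Suc i)"
    let ?b = "?a(d := Suc (?a d))"
    have "\<tau> (Suc i) = ?b(t := Suc (?b t))"
      using assms by (auto simp: \<tau>_def)
    then show "runs (Seq (inc d) (inc t)) (mk m x h ?a y) (mk m x h (\<tau> (Suc i)) y) (1 + 1)"
      using runs_Seq[OF runs_inc[OF assms(3,4)] runs_inc[OF assms(6,7)]] by metis
  qed (use assms in \<open>auto simp: \<tau>_def\<close>)
  moreover have "\<tau> 0 = \<sigma>" by (auto simp: \<tau>_def)
  ultimately show ?thesis by (simp add: \<tau>_def numeral_eq_Suc)
qed

lemma runs_copy:
  assumes "1 \<le> r" "r \<le> m" "1 \<le> d" "d \<le> m" "r \<noteq> d" "1 \<le> t" "t \<le> m" "t \<noteq> d" "t \<noteq> r" "\<sigma> t = 0"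
  shows "runs (copy r d t) (mk m x h \<sigma> y) (mk m x h (\<sigma>(d := \<sigma> d + \<sigma> r)) y) (\<sigma> r * 7 + 2)"
proof -
  let ?a = "\<sigma>(d := \<sigma> d + \<sigma> r, t := \<sigma> t + \<sigma> r, r := 0)"
  have "runs (copy r d t) (mk m x h \<sigma> y) (mk m x h (?a(r := ?a r + ?a t, t := 0)) y)
      ((\<sigma> r * 4 + 1) + (?a t * 3 + 1))"
    unfolding copy_def by (rule runs_Seq[OF runs_transfer2 runs_transfer]) (use assms in auto)
  moreover have "?a(r := ?a r + ?a t, t := 0) = \<sigma>(d := \<sigma> d + \<sigma> r)"
    using assms by auto
  moreover have "(\<sigma> r * 4 + 1) + (?a t * 3 + 1) = \<sigma> r * 7 + 2" using assms by simp
  ultimately show ?thesis by (simp only:)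
qed

text \<open>One polynomial bounds the value as well as the time: the value bound keeps the argument
  \<open>N\<close> polynomial when the result becomes the content of a register for another
  expression. The result is added to \<open>d\<close> rather than stored, so that \<open>Add\<close>
  and \<open>Sum\<close> accumulate in place.\<close>

definition computes :: "exp \<Rightarrow> nat \<Rightarrow> nat poly \<Rightarrow> nat list \<Rightarrow> nat \<Rightarrow> nat \<Rightarrow> com \<Rightarrow> bool" where
  "computes e w p rs d f c \<longleftrightarrow> (\<forall>K. wf_com K 3 c) \<and>
     (\<forall>m x \<sigma> y N. f + w \<le> Suc m \<longrightarrow> (\<forall>r\<ge>f. \<sigma> r = 0) \<longrightarrow> length x + sum_list (map \<sigma> rs) \<le> N \<longrightarrow>
        eval x (map \<sigma> rs) e \<le> poly p N \<and>
        runs c (mk m x 0 \<sigma> y) (mk m x 0 (\<sigma>(d := \<sigma> d + eval x (map \<sigma> rs) e)) y) (poly p N))"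

text \<open>The expression can be added to register \<open>d\<close> in polynomial time, using as scratch space only
  \<open>w\<close> registers from \<open>f\<close> on, which are \<open>0\<close> before and after.\<close>

definition computable :: "exp \<Rightarrow> bool" where
  "computable e \<longleftrightarrow> (\<exists>w p. \<forall>rs d f. set rs \<subseteq> {1..<f} \<longrightarrow> 1 \<le> d \<longrightarrow> d < f \<longrightarrow> d \<notin> set rs \<longrightarrow>
     (\<exists>c. computes e w p rs d f c))"

lemma computesD:
  assumes "computes e w p rs d f c" "f + w \<le> Suc m" "\<forall>r\<ge>f. \<sigma> r = 0" "length x + sum_list (map \<sigma> rs) \<le> N"
  shows "eval x (map \<sigma> rs) e \<le> poly p N"
    "runs c (mk m x 0 \<sigma> y) (mk m x 0 (\<sigma>(d := \<sigma> d + eval x (map \<sigma> rs) e)) y) (poly p N)"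
  using assms unfolding computes_def by blast+

lemma computes_wf: "computes e w p rs d f c \<Longrightarrow> wf_com K 3 c"
  unfolding computes_def by blast

lemma map_upd_notin: "d \<notin> set rs \<Longrightarrow> map (\<sigma>(d := v)) rs = map \<sigma> rs"
  by auto

section \<open>Polynomial-time evaluation, constructor by constructor\<close>

lemma computable_V: "computable (Var i)"
  unfolding computable_def
proof (rule exI[of _ 1], rule exI[of _ "[:2, 7:]"], intro allI impI)
  fix rs :: "nat list" and d f
  assume as: "set rs \<subseteq> {1..<f}" "1 \<le> d" "d < f" "d \<notin> set rs"
  show "\<exists>c. computes (Var i) 1 [:2, 7:] rs d f c"
  proof (cases "i < length rs")
    case True
    then have mem: "rs ! i \<in> set rs" by simp
    have "computes (Var i) 1 [:2, 7:] rs d f (copy (rs ! i) d f)"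
      unfolding computes_def
    proof (intro conjI allI impI)
      fix m and x :: "bool list" and \<sigma> :: "nat \<Rightarrow> nat" and y N
      assume h: "f + 1 \<le> Suc m" "\<forall>r\<ge>f. \<sigma> r = 0" "length x + sum_list (map \<sigma> rs) \<le> N"
      have "\<sigma> (rs ! i) \<le> sum_list (map \<sigma> rs)" using mem by (intro member_le_sum_list) auto
      then have le: "\<sigma> (rs ! i) \<le> N" using h by simp
      have "runs (copy (rs ! i) d f) (mk m x 0 \<sigma> y) (mk m x 0 (\<sigma>(d := \<sigma> d + \<sigma> (rs ! i))) y) (\<sigma> (rs ! i) * 7 + 2)"
        by (rule runs_copy) (use as h mem in auto)
      from runs_mono[OF this, of "poly [:2, 7:] N"] le True
      show "eval x (map \<sigma> rs) (Var i) \<le> poly [:2, 7:] N"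
        "runs (copy (rs ! i) d f) (mk m x 0 \<sigma> y) (mk m x 0 (\<sigma>(d := \<sigma> d + eval x (map \<sigma> rs) (Var i))) y) (poly [:2, 7:] N)"
        by auto
    qed simp
    then show ?thesis by blast
  next
    case False
    \<comment> \<open>An out-of-range variable has the value 0. As there is no empty program,
      clearing the register \<open>f\<close>, which is already 0, stands for doing nothing.\<close>
    have "computes (Var i) 1 [:2, 7:] rs d f (clear f)"
      unfolding computes_def
    proof (intro conjI allI impI)
      fix m and x :: "bool list" and \<sigma> :: "nat \<Rightarrow> nat" and y N
      assume h: "f + 1 \<le> Suc m" "\<forall>r\<ge>f. \<sigma> r = 0" "length x + sum_list (map \<sigma> rs) \<le> N"
      have "runs (clear f) (mk m x 0 \<sigma> y) (mk m x 0 \<sigma> y) 1"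
        by (rule runs_skip) (use as h in auto)
      from runs_mono[OF this, of "poly [:2, 7:] N"] False
      show "eval x (map \<sigma> rs) (Var i) \<le> poly [:2, 7:] N"
        "runs (clear f) (mk m x 0 \<sigma> y) (mk m x 0 (\<sigma>(d := \<sigma> d + eval x (map \<sigma> rs) (Var i))) y) (poly [:2, 7:] N)"
        by auto
    qed simp
    then show ?thesis by blast
  qed
qed

lemma computable_C: "computable (Const n)"
  unfolding computable_def
proof (rule exI[of _ 1], rule exI[of _ "[:n + 1:]"], intro allI impI)
  fix rs :: "nat list" and d f
  assume as: "set rs \<subseteq> {1..<f}" "1 \<le> d" "d < f" "d \<notin> set rs"
  show "\<exists>c. computes (Const n) 1 [:n + 1:] rs d f c"
  proof (induction n)
    case 0
    have "computes (Const 0) 1 [:0 + 1:] rs d f (clear f)"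
      unfolding computes_def using as runs_skip by auto
    then show ?case by blast
  next
    case (Suc n)
    then obtain c where c: "computes (Const n) 1 [:n + 1:] rs d f c" by blast
    have "computes (Const (Suc n)) 1 [:Suc n + 1:] rs d f (Seq c (inc d))"
      unfolding computes_def
    proof (intro conjI allI impI)
      fix m and x :: "bool list" and \<sigma> :: "nat \<Rightarrow> nat" and y N
      assume h: "f + 1 \<le> Suc m" "\<forall>r\<ge>f. \<sigma> r = 0" "length x + sum_list (map \<sigma> rs) \<le> N"
      have "runs (Seq c (inc d)) (mk m x 0 \<sigma> y) (mk m x 0 ((\<sigma>(d := \<sigma> d + n))(d := Suc ((\<sigma>(d := \<sigma> d + n)) d))) y) (n + 1 + 1)"
        by (rule runs_Seq[OF _ runs_inc]) (use computesD(2)[OF c h(1-3)] as h in auto)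
      then show "runs (Seq c (inc d)) (mk m x 0 \<sigma> y) (mk m x 0 (\<sigma>(d := \<sigma> d + eval x (map \<sigma> rs) (Const (Suc n)))) y) (poly [:Suc n + 1:] N)"
        by simp
    qed (use computes_wf[OF c] in auto)
    then show ?case by blast
  qed
qed

lemma computable_Add:
  assumes "computable a" "computable b"
  shows "computable (Add a b)"
proof -
  obtain w p where a: "\<And>rs d f. set rs \<subseteq> {1..<f} \<Longrightarrow> 1 \<le> d \<Longrightarrow> d < f \<Longrightarrow> d \<notin> set rs \<Longrightarrow> \<exists>c. computes a w p rs d f c"
    using assms(1) unfolding computable_def by blast
  obtain w' p' where b: "\<And>rs d f. set rs \<subseteq> {1..<f} \<Longrightarrow> 1 \<le> d \<Longrightarrow> d < f \<Longrightarrow> d \<notin> set rs \<Longrightarrow> \<exists>c. computes b w' p' rs d f c"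
    using assms(2) unfolding computable_def by blast
  have "\<exists>c. computes (Add a b) (w + w') (p + p') rs d f c"
    if as: "set rs \<subseteq> {1..<f}" "1 \<le> d" "d < f" "d \<notin> set rs" for rs d f
  proof -
    obtain c where c: "computes a w p rs d f c" using a as by blast
    obtain c' where c': "computes b w' p' rs d f c'" using b as by blast
    have "computes (Add a b) (w + w') (p + p') rs d f (Seq c c')"
      unfolding computes_def
    proof (intro conjI allI impI)
      fix m and x :: "bool list" and \<sigma> :: "nat \<Rightarrow> nat" and y N
      assume h: "f + (w + w') \<le> Suc m" "\<forall>r\<ge>f. \<sigma> r = 0" "length x + sum_list (map \<sigma> rs) \<le> N"
      define \<sigma>' where "\<sigma>' = \<sigma>(d := \<sigma> d + eval x (map \<sigma> rs) a)"
      have eq: "map \<sigma>' rs = map \<sigma> rs" unfolding \<sigma>'_def using as(4) by (rule map_upd_notin)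
      have 1: "eval x (map \<sigma> rs) a \<le> poly p N" "runs c (mk m x 0 \<sigma> y) (mk m x 0 \<sigma>' y) (poly p N)"
        using computesD[OF c _ h(2,3), of m] h(1) unfolding \<sigma>'_def by auto
      have 2: "eval x (map \<sigma>' rs) b \<le> poly p' N"
          "runs c' (mk m x 0 \<sigma>' y) (mk m x 0 (\<sigma>'(d := \<sigma>' d + eval x (map \<sigma>' rs) b)) y) (poly p' N)"
        using computesD[OF c', of m \<sigma>' x N] h as eq by (auto simp: \<sigma>'_def)
      show "eval x (map \<sigma> rs) (Add a b) \<le> poly (p + p') N" using 1 2 eq by simp
      have "\<sigma>'(d := \<sigma>' d + eval x (map \<sigma>' rs) b) = \<sigma>(d := \<sigma> d + eval x (map \<sigma> rs) (Add a b))"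
        unfolding eq by (auto simp: \<sigma>'_def)
      then show "runs (Seq c c') (mk m x 0 \<sigma> y) (mk m x 0 (\<sigma>(d := \<sigma> d + eval x (map \<sigma> rs) (Add a b))) y) (poly (p + p') N)"
        using runs_Seq[OF 1(2) 2(2)] by simp
    qed (use computes_wf[OF c] computes_wf[OF c'] in auto)
    then show ?thesis by blast
  qed
  then show ?thesis unfolding computable_def by blast
qed

lemma computable_Sub:
  assumes "computable a" "computable b"
  shows "computable (Sub a b)"
proof -
  obtain w p where a: "\<And>rs d f. set rs \<subseteq> {1..<f} \<Longrightarrow> 1 \<le> d \<Longrightarrow> d < f \<Longrightarrow> d \<notin> set rs \<Longrightarrow> \<exists>c. computes a w p rs d f c"
    using assms(1) unfolding computable_def by blast
  obtain w' p' where b: "\<And>rs d f. set rs \<subseteq> {1..<f} \<Longrightarrow> 1 \<le> d \<Longrightarrow> d < f \<Longrightarrow> d \<notin> set rs \<Longrightarrow> \<exists>c. computes b w' p' rs d f c"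
    using assms(2) unfolding computable_def by blast
  let ?P = "[:4:] * p + [:6:] * p' + [:2:]"
  have "\<exists>c. computes (Sub a b) (w + w' + 2) ?P rs d f c"
    if as: "set rs \<subseteq> {1..<f}" "1 \<le> d" "d < f" "d \<notin> set rs" for rs d f
  proof -
    have rs: "set rs \<subseteq> {1..<Suc f}" "set rs \<subseteq> {1..<Suc (Suc f)}" using as(1) by auto
    have nf: "f \<notin> set rs" "Suc f \<notin> set rs" using as(1) by auto
    obtain c where c: "computes a w p rs f (Suc f) c" using a[OF rs(1), of f] as nf by auto
    obtain c' where c': "computes b w' p' rs (Suc f) (Suc (Suc f)) c'" using b[OF rs(2), of "Suc f"] as nf by auto
    \<comment> \<open>Truncated subtraction: each unit of the subtrahend removes a unit from
      \<open>f\<close>, as long as one is left.\<close>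
    let ?D = "drain (Suc f) (Cond (nz f) (dec f) (clear f))"
    let ?c = "Seq c (Seq c' (Seq ?D (drain f (inc d))))"
    have "computes (Sub a b) (w + w' + 2) ?P rs d f ?c"
      unfolding computes_def
    proof (intro conjI allI impI)
      fix m and x :: "bool list" and \<sigma> :: "nat \<Rightarrow> nat" and y N
      assume h: "f + (w + w' + 2) \<le> Suc m" "\<forall>r\<ge>f. \<sigma> r = 0" "length x + sum_list (map \<sigma> rs) \<le> N"
      define u where "u = eval x (map \<sigma> rs) a"
      define v where "v = eval x (map \<sigma> rs) b"
      let ?\<sigma>1 = "\<sigma>(f := u)"
      let ?\<sigma>2 = "\<sigma>(f := u, Suc f := v)"
      let ?\<sigma>3 = "\<sigma>(f := u - v)"
      have eq: "map ?\<sigma>1 rs = map \<sigma> rs" using nf(1) by (rule map_upd_notin)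
      have 1: "u \<le> poly p N" "runs c (mk m x 0 \<sigma> y) (mk m x 0 ?\<sigma>1 y) (poly p N)"
        using computesD[OF c _ _ h(3), of m] h(1,2) unfolding u_def by auto
      have 2: "v \<le> poly p' N" "runs c' (mk m x 0 ?\<sigma>1 y) (mk m x 0 ?\<sigma>2 y) (poly p' N)"
        using computesD[OF c', of m ?\<sigma>1 x N] h eq unfolding v_def by auto
      have 3: "runs ?D (mk m x 0 ?\<sigma>2 y) (mk m x 0 ?\<sigma>3 y) (v * (2 + 2) + 1)"
      proof -
        let ?\<tau> = "\<lambda>i. \<sigma>(f := u - i, Suc f := v - i)"
        have "runs ?D (mk m x 0 (?\<tau> 0) y) (mk m x 0 (?\<tau> v) y) (v * (2 + 2) + 1)"
        proof (rule runs_drain[where h = "\<lambda>_. 0" and y = "\<lambda>_. y"])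
          fix i assume i: "i < v"
          let ?s = "(?\<tau> i)(Suc f := v - Suc i)"
          show "runs (Cond (nz f) (dec f) (clear f)) (mk m x 0 ?s y) (mk m x 0 (?\<tau> (Suc i)) y) 2"
          proof (cases "i < u")
            case True
            have "runs (dec f) (mk m x 0 ?s y) (mk m x 0 (?s(f := u - Suc i)) y) 1"
              by (rule runs_dec) (use True as h in auto)
            moreover have "?s(f := u - Suc i) = ?\<tau> (Suc i)" by auto
            ultimately have "runs (dec f) (mk m x 0 ?s y) (mk m x 0 (?\<tau> (Suc i)) y) 1" by simp
            moreover have "nz f (map tape_read (mk m x 0 ?s y))"
              using as h True by (subst nz_mk) auto
            ultimately show ?thesis using runs_CondT by (metis Suc_1)
          next
            case False
            have "runs (clear f) (mk m x 0 ?s y) (mk m x 0 ?s y) 1"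
              by (rule runs_skip) (use False as h in auto)
            moreover have "?s = ?\<tau> (Suc i)" using False by auto
            ultimately have "runs (clear f) (mk m x 0 ?s y) (mk m x 0 (?\<tau> (Suc i)) y) 1" by simp
            moreover have "\<not> nz f (map tape_read (mk m x 0 ?s y))"
              using as h False by (subst nz_mk) auto
            ultimately show ?thesis using runs_CondF by (metis Suc_1)
          qed
        qed (use as h in auto)
        moreover have "?\<tau> v = ?\<sigma>3" using h(2) by auto
        ultimately show ?thesis by simp
      qed
      have 4: "runs (drain f (inc d)) (mk m x 0 ?\<sigma>3 y) (mk m x 0 (?\<sigma>3(d := ?\<sigma>3 d + ?\<sigma>3 f, f := 0)) y) (?\<sigma>3 f * 3 + 1)"
        by (rule runs_transfer) (use as h in auto)
      have 5: "?\<sigma>3(d := ?\<sigma>3 d + ?\<sigma>3 f, f := 0) = \<sigma>(d := \<sigma> d + eval x (map \<sigma> rs) (Sub a b))"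
        using as h(2) by (auto simp: u_def v_def)
      have "runs ?c (mk m x 0 \<sigma> y) (mk m x 0 (\<sigma>(d := \<sigma> d + eval x (map \<sigma> rs) (Sub a b))) y)
        (poly p N + (poly p' N + ((v * (2 + 2) + 1) + (?\<sigma>3 f * 3 + 1))))"
        using runs_Seq[OF 1(2) runs_Seq[OF 2(2) runs_Seq[OF 3 4]]] unfolding 5 .
      moreover have "poly p N + (poly p' N + ((v * (2 + 2) + 1) + (?\<sigma>3 f * 3 + 1))) \<le> poly ?P N"
        using 1(1) 2(1) by simp
      ultimately show "runs ?c (mk m x 0 \<sigma> y) (mk m x 0 (\<sigma>(d := \<sigma> d + eval x (map \<sigma> rs) (Sub a b))) y) (poly ?P N)"
        by (rule runs_mono)
      show "eval x (map \<sigma> rs) (Sub a b) \<le> poly ?P N" using 1(1) by (simp add: u_def)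
    qed (use computes_wf[OF c] computes_wf[OF c'] in auto)
    then show ?thesis by blast
  qed
  then show ?thesis unfolding computable_def by blast
qed

lemma computable_Sum:
  assumes "computable g" "computable e"
  shows "computable (Sum g e)"
proof -
  obtain w p where a: "\<And>rs d f. set rs \<subseteq> {1..<f} \<Longrightarrow> 1 \<le> d \<Longrightarrow> d < f \<Longrightarrow> d \<notin> set rs \<Longrightarrow> \<exists>c. computes g w p rs d f c"
    using assms(1) unfolding computable_def by blast
  obtain w' p' where b: "\<And>rs d f. set rs \<subseteq> {1..<f} \<Longrightarrow> 1 \<le> d \<Longrightarrow> d < f \<Longrightarrow> d \<notin> set rs \<Longrightarrow> \<exists>c. computes e w' p' rs d f c"
    using assms(2) unfolding computable_def by blast
  \<comment> \<open>Inside the sum the index is a further register with content below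
    \<open>poly p N\<close>, so the bound for the body is taken at
    \<open>N + poly p N\<close>.\<close>
  define q where "q = p' \<circ>\<^sub>p ([:0, 1:] + p)"
  let ?P = "p + p * (q + [:5:]) + [:2:]"
  have q: "poly q N = poly p' (N + poly p N)" for N by (simp add: q_def poly_pcompose)
  have "\<exists>c. computes (Sum g e) (w + w' + 2) ?P rs d f c"
    if as: "set rs \<subseteq> {1..<f}" "1 \<le> d" "d < f" "d \<notin> set rs" for rs d f
  proof -
    have rs: "set rs \<subseteq> {1..<Suc f}" "set (rs @ [Suc f]) \<subseteq> {1..<Suc (Suc f)}" using as(1) by auto
    have nf: "f \<notin> set rs" "Suc f \<notin> set rs" using as(1) by auto
    obtain c where c: "computes g w p rs f (Suc f) c" using a[OF rs(1), of f] as nf by auto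
    obtain c' where c': "computes e w' p' (rs @ [Suc f]) d (Suc (Suc f)) c'" using b[OF rs(2), of d] as nf by auto
    let ?B = "Seq c' (inc (Suc f))"
    let ?c = "Seq c (Seq (drain f ?B) (clear (Suc f)))"
    have "computes (Sum g e) (w + w' + 2) ?P rs d f ?c"
      unfolding computes_def
    proof (intro conjI allI impI)
      fix m and x :: "bool list" and \<sigma> :: "nat \<Rightarrow> nat" and y N
      assume h: "f + (w + w' + 2) \<le> Suc m" "\<forall>r\<ge>f. \<sigma> r = 0" "length x + sum_list (map \<sigma> rs) \<le> N"
      define n where "n = eval x (map \<sigma> rs) g"
      define s where "s i = (\<Sum>j<i. eval x (map \<sigma> rs @ [j]) e)" for i
      \<comment> \<open>\<open>f\<close> holds the number of iterations still to come, while
        \<open>Suc f\<close> counts upwards because the body reads it as the summation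
        index.\<close>
      define \<tau> where "\<tau> i = \<sigma>(f := n - i, Suc f := i, d := \<sigma> d + s i)" for i
      have 1: "n \<le> poly p N" "runs c (mk m x 0 \<sigma> y) (mk m x 0 (\<sigma>(f := n)) y) (poly p N)"
        using computesD[OF c _ _ h(3), of m] h(1,2) unfolding n_def by auto
      have t0: "\<sigma>(f := n) = \<tau> 0" using h(2) as by (auto simp: \<tau>_def s_def)
      have body: "eval x (map \<sigma> rs @ [i]) e \<le> poly q N \<and>
          runs ?B (mk m x 0 ((\<tau> i)(f := n - Suc i)) y) (mk m x 0 (\<tau> (Suc i)) y) (poly q N + 1)" if i: "i < n" for i
      proof -
        let ?t = "(\<tau> i)(f := n - Suc i)"
        have eq: "map ?t (rs @ [Suc f]) = map \<sigma> rs @ [i]" using nf as by (auto simp: \<tau>_def)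
        have 1: "length x + sum_list (map ?t (rs @ [Suc f])) \<le> N + poly p N"
          unfolding eq using h(3) 1(1) i by simp
        have z: "\<forall>r\<ge>Suc (Suc f). ?t r = 0" using h(2) as by (auto simp: \<tau>_def)
        note D = computesD[OF c' _ z 1, of m, unfolded eq]
        have D1: "eval x (map \<sigma> rs @ [i]) e \<le> poly q N" using D(1) h(1) by (simp add: q)
        let ?t2 = "?t(d := ?t d + eval x (map \<sigma> rs @ [i]) e)"
        have D2: "runs c' (mk m x 0 ?t y) (mk m x 0 ?t2 y) (poly q N)" using D(2) h(1) by (simp add: q)
        have D3: "runs (inc (Suc f)) (mk m x 0 ?t2 y) (mk m x 0 (?t2(Suc f := Suc (?t2 (Suc f)))) y) 1"
          by (rule runs_inc) (use h in auto)
        have "?t2(Suc f := Suc (?t2 (Suc f))) = \<tau> (Suc i)" using as by (auto simp: \<tau>_def s_def)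
        then show ?thesis using D1 runs_Seq[OF D2 D3] by simp
      qed
      have 2: "runs (drain f ?B) (mk m x 0 (\<tau> 0) y) (mk m x 0 (\<tau> n) y) (n * (poly q N + 1 + 2) + 1)"
      proof (rule runs_drain[where h = "\<lambda>_. 0" and y = "\<lambda>_. y"])
        show "\<tau> i f = n - i" for i using as by (simp add: \<tau>_def)
      qed (use as h body in auto)
      have 3: "runs (clear (Suc f)) (mk m x 0 (\<tau> n) y) (mk m x 0 ((\<tau> n)(Suc f := 0)) y) ((\<tau> n) (Suc f) * 2 + 1)"
        by (rule runs_clear) (use h in auto)
      have 4: "(\<tau> n)(Suc f := 0) = \<sigma>(d := \<sigma> d + eval x (map \<sigma> rs) (Sum g e))"
        using h(2) as by (auto simp: \<tau>_def s_def n_def)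
      have 5: "(\<tau> n) (Suc f) = n" using as by (simp add: \<tau>_def)
      have "runs ?c (mk m x 0 \<sigma> y) (mk m x 0 (\<sigma>(d := \<sigma> d + eval x (map \<sigma> rs) (Sum g e))) y)
        (poly p N + ((n * (poly q N + 1 + 2) + 1) + (n * 2 + 1)))"
        using runs_Seq[OF 1(2)[unfolded t0] runs_Seq[OF 2 3]] unfolding 4 5 .
      moreover have "n * (poly q N + 5) \<le> poly p N * (poly q N + 5)" using 1(1) by (rule mult_le_mono1)
      then have "poly p N + ((n * (poly q N + 1 + 2) + 1) + (n * 2 + 1)) \<le> poly ?P N"
        by (simp add: algebra_simps)
      ultimately show "runs ?c (mk m x 0 \<sigma> y) (mk m x 0 (\<sigma>(d := \<sigma> d + eval x (map \<sigma> rs) (Sum g e))) y) (poly ?P N)"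
        by (rule runs_mono)
      have "eval x (map \<sigma> rs) (Sum g e) \<le> (\<Sum>i<n. poly q N)"
        unfolding eval.simps n_def[symmetric] by (rule sum_mono) (use body in auto)
      also have "\<dots> \<le> poly p N * poly q N" using 1(1) by simp
      also have "\<dots> \<le> poly ?P N" by (simp add: algebra_simps)
      finally show "eval x (map \<sigma> rs) (Sum g e) \<le> poly ?P N" .
    qed (use computes_wf[OF c] computes_wf[OF c'] in auto)
    then show ?thesis by blast
  qed
  then show ?thesis unfolding computable_def by blast
qed

lemma computable_Len: "computable Len"
proof -
  have "\<exists>c. computes Len 1 [:2, 7:] rs d f c"
    if as: "set rs \<subseteq> {1..<f}" "1 \<le> d" "d < f" "d \<notin> set rs" for rs d f
  proof -
    \<comment> \<open>The input head runs to the first blank behind the input; \<open>f\<close>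
      counts the moves so that the head can be brought back to cell 0.\<close>
    let ?B = "Seq (inc d) (Seq (inc f) (inc 0))"
    let ?c = "Seq (While (\<lambda>ss. ss ! 0 \<noteq> 0) ?B) (drain f (dec 0))"
    have "computes Len 1 [:2, 7:] rs d f ?c"
      unfolding computes_def
    proof (intro conjI allI impI)
      fix m and x :: "bool list" and \<sigma> :: "nat \<Rightarrow> nat" and y N
      assume h: "f + 1 \<le> Suc m" "\<forall>r\<ge>f. \<sigma> r = 0" "length x + sum_list (map \<sigma> rs) \<le> N"
      let ?n = "length x"
      define S where "S i = mk m x i (\<sigma>(d := \<sigma> d + i, f := i)) y" for i
      have 1: "runs (While (\<lambda>ss. ss ! 0 \<noteq> 0) ?B) (S 0) (S ?n) (?n * Suc (1 + (1 + 1)) + 1)"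
      proof (rule runs_While)
        fix i assume i: "i < ?n"
        show "map tape_read (S i) ! 0 \<noteq> 0"
          unfolding S_def using i by (subst read_input_mk) (cases "x ! i"; simp add: sym_at_def)
        let ?a = "\<sigma>(d := \<sigma> d + i, f := i)"
        let ?b = "?a(d := Suc (?a d))"
        have "?b(f := Suc (?b f)) = \<sigma>(d := \<sigma> d + Suc i, f := Suc i)" using as by auto
        moreover have "runs ?B (S i) (mk m x (Suc i) (?b(f := Suc (?b f))) y) (1 + (1 + 1))"
          unfolding S_def by (rule runs_Seq[OF runs_inc runs_Seq[OF runs_inc runs_in_right]]) (use as h in auto)
        ultimately show "runs ?B (S i) (S (Suc i)) (1 + (1 + 1))" by (simp add: S_def)
      next
        show "\<not> map tape_read (S ?n) ! 0 \<noteq> 0"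
          unfolding S_def by (subst read_input_mk) (simp add: sym_at_def)
      qed
      let ?\<tau> = "\<lambda>i. \<sigma>(d := \<sigma> d + ?n, f := ?n - i)"
      have 2: "runs (drain f (dec 0)) (mk m x (?n - 0) (?\<tau> 0) y) (mk m x (?n - ?n) (?\<tau> ?n) y) (?n * (1 + 2) + 1)"
      proof (rule runs_drain[where h = "\<lambda>i. ?n - i" and y = "\<lambda>_. y"])
        fix i assume i: "i < ?n"
        have "(?\<tau> i)(f := ?n - Suc i) = ?\<tau> (Suc i)" by auto
        moreover have "?n - i = Suc (?n - Suc i)" using i by simp
        ultimately show "runs (dec 0) (mk m x (?n - i) ((?\<tau> i)(f := ?n - Suc i)) y) (mk m x (?n - Suc i) (?\<tau> (Suc i)) y) 1"
          using runs_in_left by metis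
      qed (use as h in auto)
      have "?\<tau> ?n = \<sigma>(d := \<sigma> d + eval x (map \<sigma> rs) Len)" using h(2) as by auto
      then have 3: "mk m x (?n - ?n) (?\<tau> ?n) y = mk m x 0 (\<sigma>(d := \<sigma> d + eval x (map \<sigma> rs) Len)) y" by simp
      have 4: "S 0 = mk m x 0 \<sigma> y" unfolding S_def using h(2) by (intro arg_cong[where f = "\<lambda>s. mk m x 0 s y"]) auto
      have 5: "S ?n = mk m x (?n - 0) (?\<tau> 0) y" by (simp add: S_def)
      have "runs ?c (mk m x 0 \<sigma> y) (mk m x 0 (\<sigma>(d := \<sigma> d + eval x (map \<sigma> rs) Len)) y)
          ((?n * Suc (1 + (1 + 1)) + 1) + (?n * (1 + 2) + 1))"
        using runs_Seq[OF 1[unfolded 4 5] 2] unfolding 3 .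
      moreover have "(?n * Suc (1 + (1 + 1)) + 1) + (?n * (1 + 2) + 1) \<le> poly [:2, 7:] N" using h(3) by simp
      ultimately show "runs ?c (mk m x 0 \<sigma> y) (mk m x 0 (\<sigma>(d := \<sigma> d + eval x (map \<sigma> rs) Len)) y) (poly [:2, 7:] N)"
        by (rule runs_mono)
      show "eval x (map \<sigma> rs) Len \<le> poly [:2, 7:] N" using h(3) by simp
    qed auto
    then show ?thesis by blast
  qed
  then show ?thesis unfolding computable_def by blast
qed

lemma computable_Sym:
  assumes "computable a"
  shows "computable (Sym a)"
proof -
  obtain w p where a: "\<And>rs d f. set rs \<subseteq> {1..<f} \<Longrightarrow> 1 \<le> d \<Longrightarrow> d < f \<Longrightarrow> d \<notin> set rs \<Longrightarrow> \<exists>c. computes a w p rs d f c"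
    using assms(1) unfolding computable_def by blast
  let ?P = "[:8:] * p + [:8:]"
  have "\<exists>c. computes (Sym a) (w + 2) ?P rs d f c"
    if as: "set rs \<subseteq> {1..<f}" "1 \<le> d" "d < f" "d \<notin> set rs" for rs d f
  proof -
    have rs: "set rs \<subseteq> {1..<Suc f}" using as(1) by auto
    have nf: "f \<notin> set rs" "Suc f \<notin> set rs" using as(1) by auto
    obtain c where c: "computes a w p rs f (Suc f) c" using a[OF rs(1), of f] as nf by auto
    \<comment> \<open>The head moves to the cell in question while \<open>Suc f\<close> records the
      way back. The symbol found there is 0, 1 or 2 and is added to \<open>d\<close> by
      cases.\<close>
    let ?B = "Seq (inc (Suc f)) (inc 0)"
    let ?R = "Cond (\<lambda>ss. ss ! 0 = 0) (clear f) (Cond (\<lambda>ss. ss ! 0 = 1) (inc d) (Seq (inc d) (inc d)))"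
    let ?c = "Seq c (Seq (drain f ?B) (Seq ?R (drain (Suc f) (dec 0))))"
    have "computes (Sym a) (w + 2) ?P rs d f ?c"
      unfolding computes_def
    proof (intro conjI allI impI)
      fix m and x :: "bool list" and \<sigma> :: "nat \<Rightarrow> nat" and y N
      assume h: "f + (w + 2) \<le> Suc m" "\<forall>r\<ge>f. \<sigma> r = 0" "length x + sum_list (map \<sigma> rs) \<le> N"
      define v where "v = eval x (map \<sigma> rs) a"
      define k where "k = sym_at x v"
      have k2: "k = 0 \<or> k = 1 \<or> k = 2" unfolding k_def sym_at_def by (cases "x ! v") auto
      let ?\<tau> = "\<lambda>i. \<sigma>(f := v - i, Suc f := i)"
      have 1: "v \<le> poly p N" "runs c (mk m x 0 \<sigma> y) (mk m x 0 (\<sigma>(f := v)) y) (poly p N)"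
        using computesD[OF c _ _ h(3), of m] h(1,2) unfolding v_def by auto
      have t0: "\<sigma>(f := v) = ?\<tau> 0" using h(2) by auto
      have 2: "runs (drain f ?B) (mk m x 0 (?\<tau> 0) y) (mk m x v (?\<tau> v) y) (v * (1 + 1 + 2) + 1)"
      proof (rule runs_drain[where h = "\<lambda>i. i" and y = "\<lambda>_. y"])
        fix i assume i: "i < v"
        let ?s = "(?\<tau> i)(f := v - Suc i)"
        have "runs ?B (mk m x i ?s y) (mk m x (Suc i) (?s(Suc f := Suc (?s (Suc f)))) y) (1 + 1)"
          by (rule runs_Seq[OF runs_inc runs_in_right]) (use as h in auto)
        moreover have "?s(Suc f := Suc (?s (Suc f))) = ?\<tau> (Suc i)" by auto
        ultimately show "runs ?B (mk m x i ?s y) (mk m x (Suc i) (?\<tau> (Suc i)) y) (1 + 1)" by simp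
      qed (use as h in auto)
      let ?\<tau>' = "\<lambda>i. \<sigma>(d := \<sigma> d + k, Suc f := v - i)"
      have r: "map tape_read (mk m x v s y) ! 0 = k" for s unfolding read_input_mk k_def ..
      have 3: "runs ?R (mk m x v (?\<tau> v) y) (mk m x v (?\<tau>' 0) y) 4"
      proof -
        consider "k = 0" | "k = 1" | "k = 2" using k2 by blast
        then show ?thesis
        proof cases
          case 1
          have "runs (clear f) (mk m x v (?\<tau> v) y) (mk m x v (?\<tau> v) y) 1"
            by (rule runs_skip) (use as h in auto)
          moreover have "?\<tau> v = ?\<tau>' 0" using 1 as h(2) by auto
          ultimately have "runs (clear f) (mk m x v (?\<tau> v) y) (mk m x v (?\<tau>' 0) y) 1" by simp
          then have "runs ?R (mk m x v (?\<tau> v) y) (mk m x v (?\<tau>' 0) y) (Suc 1)"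
            by (intro runs_CondT) (simp_all only: r 1)
          then show ?thesis by (rule runs_mono) simp
        next
          case 2
          have "runs (inc d) (mk m x v (?\<tau> v) y) (mk m x v ((?\<tau> v)(d := Suc ((?\<tau> v) d))) y) 1"
            by (rule runs_inc) (use as h in auto)
          moreover have "(?\<tau> v)(d := Suc ((?\<tau> v) d)) = ?\<tau>' 0" using 2 as h(2) by auto
          ultimately have "runs (inc d) (mk m x v (?\<tau> v) y) (mk m x v (?\<tau>' 0) y) 1" by simp
          then have "runs ?R (mk m x v (?\<tau> v) y) (mk m x v (?\<tau>' 0) y) (Suc (Suc 1))"
            using r 2 by (intro runs_CondF[OF _ runs_CondT]) (simp_all del: nth_map)
          then show ?thesis by (rule runs_mono) simp
        next
          case 3
          let ?s = "(?\<tau> v)(d := Suc ((?\<tau> v) d))"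
          have "runs (Seq (inc d) (inc d)) (mk m x v (?\<tau> v) y) (mk m x v (?s(d := Suc (?s d))) y) (1 + 1)"
            by (rule runs_Seq[OF runs_inc runs_inc]) (use as h in auto)
          moreover have "?s(d := Suc (?s d)) = ?\<tau>' 0" using 3 as h(2) by auto
          ultimately have "runs (Seq (inc d) (inc d)) (mk m x v (?\<tau> v) y) (mk m x v (?\<tau>' 0) y) (1 + 1)" by simp
          then have "runs ?R (mk m x v (?\<tau> v) y) (mk m x v (?\<tau>' 0) y) (Suc (Suc (1 + 1)))"
            using r 3 by (intro runs_CondF) (simp_all del: nth_map)
          then show ?thesis by (rule runs_mono) simp
        qed
      qed
      have 4: "runs (drain (Suc f) (dec 0)) (mk m x (v - 0) (?\<tau>' 0) y) (mk m x (v - v) (?\<tau>' v) y) (v * (1 + 2) + 1)"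
      proof (rule runs_drain[where h = "\<lambda>i. v - i" and y = "\<lambda>_. y"])
        fix i assume i: "i < v"
        have "(?\<tau>' i)(Suc f := v - Suc i) = ?\<tau>' (Suc i)" by auto
        moreover have "v - i = Suc (v - Suc i)" using i by simp
        ultimately show "runs (dec 0) (mk m x (v - i) ((?\<tau>' i)(Suc f := v - Suc i)) y) (mk m x (v - Suc i) (?\<tau>' (Suc i)) y) 1"
          using runs_in_left by metis
      qed (use as h in auto)
      have "?\<tau>' v = \<sigma>(d := \<sigma> d + eval x (map \<sigma> rs) (Sym a))"
        using as h(2) by (auto simp: k_def v_def)
      then have 5: "mk m x (v - v) (?\<tau>' v) y = mk m x 0 (\<sigma>(d := \<sigma> d + eval x (map \<sigma> rs) (Sym a))) y"
        by simp
      have 6: "mk m x (v - 0) (?\<tau>' 0) y = mk m x v (?\<tau>' 0) y" by simp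
      have "runs ?c (mk m x 0 \<sigma> y) (mk m x 0 (\<sigma>(d := \<sigma> d + eval x (map \<sigma> rs) (Sym a))) y)
        (poly p N + ((v * (1 + 1 + 2) + 1) + (4 + (v * (1 + 2) + 1))))"
        by (rule runs_Seq[OF 1(2)[unfolded t0] runs_Seq[OF 2 runs_Seq[OF 3 4[unfolded 5 6]]]])
      moreover have "poly p N + ((v * (1 + 1 + 2) + 1) + (4 + (v * (1 + 2) + 1))) \<le> poly ?P N" using 1(1) by simp
      ultimately show "runs ?c (mk m x 0 \<sigma> y) (mk m x 0 (\<sigma>(d := \<sigma> d + eval x (map \<sigma> rs) (Sym a))) y) (poly ?P N)"
        by (rule runs_mono)
      show "eval x (map \<sigma> rs) (Sym a) \<le> poly ?P N" using k2 by (auto simp: k_def v_def)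
    qed (use computes_wf[OF c] in auto)
    then show ?thesis by blast
  qed
  then show ?thesis unfolding computable_def by blast
qed

text \<open>The arguments of \<open>App\<close> go into consecutive fresh registers, which then form
  the environment of its body.\<close>

definition stores :: "exp list \<Rightarrow> nat \<Rightarrow> nat poly \<Rightarrow> nat list \<Rightarrow> nat \<Rightarrow> com \<Rightarrow> bool" where
  "stores es w p rs f c \<longleftrightarrow> (\<forall>K. wf_com K 3 c) \<and>
     (\<forall>m x \<sigma> y N. f + w \<le> Suc m \<longrightarrow> (\<forall>r\<ge>f. \<sigma> r = 0) \<longrightarrow> length x + sum_list (map \<sigma> rs) \<le> N \<longrightarrow>
        sum_list (map (eval x (map \<sigma> rs)) es) \<le> poly p N \<and>
        runs c (mk m x 0 \<sigma> y) (mk m x 0 (\<lambda>r. if f \<le> r \<and> r < f + length es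
          then eval x (map \<sigma> rs) (es ! (r - f)) else \<sigma> r) y) (poly p N))"

lemma storesD:
  assumes "stores es w p rs f c" "f + w \<le> Suc m" "\<forall>r\<ge>f. \<sigma> r = 0" "length x + sum_list (map \<sigma> rs) \<le> N"
  shows "sum_list (map (eval x (map \<sigma> rs)) es) \<le> poly p N"
    "runs c (mk m x 0 \<sigma> y) (mk m x 0 (\<lambda>r. if f \<le> r \<and> r < f + length es
          then eval x (map \<sigma> rs) (es ! (r - f)) else \<sigma> r) y) (poly p N)"
  using assms unfolding stores_def by blast+

lemma computable_stores:
  assumes "\<forall>a\<in>set es. computable a"
  shows "\<exists>w p. \<forall>rs f. set rs \<subseteq> {1..<f} \<longrightarrow> 1 \<le> f \<longrightarrow> (\<exists>c. stores es w p rs f c)"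
  using assms
proof (induction es)
  case Nil
  have "stores [] 1 [:1:] rs f (clear f)" if "1 \<le> f" for rs f
    unfolding stores_def
  proof (intro allI impI conjI)
    fix m and x :: "bool list" and \<sigma> :: "nat \<Rightarrow> nat" and y N
    assume h: "f + 1 \<le> Suc m" "\<forall>r\<ge>f. \<sigma> r = 0"
    have "(\<lambda>r. if f \<le> r \<and> r < f + length [] then eval x (map \<sigma> rs) ([] ! (r - f)) else \<sigma> r) = \<sigma>" by auto
    moreover have "runs (clear f) (mk m x 0 \<sigma> y) (mk m x 0 \<sigma> y) 1"
      by (rule runs_skip) (use h that in auto)
    ultimately show "runs (clear f) (mk m x 0 \<sigma> y) (mk m x 0 (\<lambda>r. if f \<le> r \<and> r < f + length []
          then eval x (map \<sigma> rs) ([] ! (r - f)) else \<sigma> r) y) (poly [:1:] N)"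
      by simp
  qed auto
  then show ?case by blast
next
  case (Cons a es)
  obtain w p where a: "\<And>rs d f. set rs \<subseteq> {1..<f} \<Longrightarrow> 1 \<le> d \<Longrightarrow> d < f \<Longrightarrow> d \<notin> set rs \<Longrightarrow> \<exists>c. computes a w p rs d f c"
    using Cons.prems unfolding computable_def by auto
  have "\<forall>a\<in>set es. computable a" using Cons.prems by simp
  then obtain w' p' where b: "\<And>rs f. set rs \<subseteq> {1..<f} \<Longrightarrow> 1 \<le> f \<Longrightarrow> \<exists>c. stores es w' p' rs f c"
    using Cons.IH by blast
  have "\<exists>c. stores (a # es) (w + w' + 1) (p + p') rs f c"
    if as: "set rs \<subseteq> {1..<f}" "1 \<le> f" for rs f
  proof -
    have rs: "set rs \<subseteq> {1..<Suc f}" using as(1) by auto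
    have nf: "f \<notin> set rs" using as(1) by auto
    obtain c where c: "computes a w p rs f (Suc f) c" using a[OF rs, of f] as nf by auto
    obtain c' where c': "stores es w' p' rs (Suc f) c'" using b[OF rs] by auto
    have "stores (a # es) (w + w' + 1) (p + p') rs f (Seq c c')"
      unfolding stores_def
    proof (intro allI impI conjI)
      fix m and x :: "bool list" and \<sigma> :: "nat \<Rightarrow> nat" and y N
      assume h: "f + (w + w' + 1) \<le> Suc m" "\<forall>r\<ge>f. \<sigma> r = 0" "length x + sum_list (map \<sigma> rs) \<le> N"
      define u where "u = eval x (map \<sigma> rs) a"
      have eq: "map (\<sigma>(f := u)) rs = map \<sigma> rs" using nf by (rule map_upd_notin)
      have 1: "u \<le> poly p N" "runs c (mk m x 0 \<sigma> y) (mk m x 0 (\<sigma>(f := u)) y) (poly p N)"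
        using computesD[OF c _ _ h(3), of m] h(1,2) unfolding u_def by auto
      have z: "Suc f + w' \<le> Suc m" "\<forall>r\<ge>Suc f. (\<sigma>(f := u)) r = 0" "length x + sum_list (map (\<sigma>(f := u)) rs) \<le> N"
        unfolding eq using h by auto
      note 2 = storesD[OF c' z, unfolded eq]
      have 3: "(\<lambda>r. if Suc f \<le> r \<and> r < Suc f + length es
          then eval x (map \<sigma> rs) (es ! (r - Suc f)) else (\<sigma>(f := u)) r) =
          (\<lambda>r. if f \<le> r \<and> r < f + length (a # es) then eval x (map \<sigma> rs) ((a # es) ! (r - f)) else \<sigma> r)"
        by (rule ext) (auto simp: u_def nth_Cons')
      show "sum_list (map (eval x (map \<sigma> rs)) (a # es)) \<le> poly (p + p') N"
        using 1(1) 2(1) by (simp add: u_def)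
      show "runs (Seq c c') (mk m x 0 \<sigma> y) (mk m x 0 (\<lambda>r. if f \<le> r \<and> r < f + length (a # es)
          then eval x (map \<sigma> rs) ((a # es) ! (r - f)) else \<sigma> r) y) (poly (p + p') N)"
        using runs_Seq[OF 1(2) 2(2)] unfolding 3 by simp
    qed (use computes_wf[OF c] c' in \<open>simp add: stores_def\<close>)
    then show ?thesis by blast
  qed
  then show ?case by blast
qed

fun clear_all :: "nat \<Rightarrow> nat list \<Rightarrow> com" where
  "clear_all t [] = clear t"
| "clear_all t (r # rs) = Seq (clear r) (clear_all t rs)"

lemma wf_clear_all: "wf_com K G (clear_all t rs)"
  by (induction rs) auto

lemma runs_clear_all:
  assumes "\<forall>r\<in>set rs. 1 \<le> r \<and> r \<le> m" "1 \<le> t" "t \<le> m" "distinct rs" "\<sigma> t = 0"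
  shows "runs (clear_all t rs) (mk m x h \<sigma> y) (mk m x h (\<lambda>r. if r \<in> set rs then 0 else \<sigma> r) y)
    (2 * sum_list (map \<sigma> rs) + length rs + 1)"
  using assms
proof (induction rs arbitrary: \<sigma>)
  case Nil
  then show ?case using runs_skip[of t m \<sigma> x h y] by simp
next
  case (Cons a rs)
  have 1: "runs (clear a) (mk m x h \<sigma> y) (mk m x h (\<sigma>(a := 0)) y) (\<sigma> a * 2 + 1)"
    by (rule runs_clear) (use Cons.prems in auto)
  have 2: "runs (clear_all t rs) (mk m x h (\<sigma>(a := 0)) y) (mk m x h (\<lambda>r. if r \<in> set rs then 0 else (\<sigma>(a := 0)) r) y)
    (2 * sum_list (map (\<sigma>(a := 0)) rs) + length rs + 1)"
    by (rule Cons.IH) (use Cons.prems in auto)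
  have 3: "map (\<sigma>(a := 0)) rs = map \<sigma> rs" using Cons.prems by (intro map_upd_notin) auto
  have 4: "(\<lambda>r. if r \<in> set rs then 0 else (\<sigma>(a := 0)) r) = (\<lambda>r. if r \<in> set (a # rs) then 0 else \<sigma> r)"
    by auto
  show ?case using runs_Seq[OF 1 2] unfolding 3 4 clear_all.simps
    by (rule runs_mono) simp
qed

lemma computable_App:
  assumes "computable e" "\<forall>a\<in>set es. computable a"
  shows "computable (App e es)"
proof -
  obtain w p where a: "\<And>rs d f. set rs \<subseteq> {1..<f} \<Longrightarrow> 1 \<le> d \<Longrightarrow> d < f \<Longrightarrow> d \<notin> set rs \<Longrightarrow> \<exists>c. computes e w p rs d f c"
    using assms(1) unfolding computable_def by blast
  obtain w' p' where b: "\<And>rs f. set rs \<subseteq> {1..<f} \<Longrightarrow> 1 \<le> f \<Longrightarrow> \<exists>c. stores es w' p' rs f c"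
    using computable_stores[OF assms(2)] by blast
  let ?n = "length es"
  define q where "q = p \<circ>\<^sub>p ([:0, 1:] + p')"
  have q: "poly q N = poly p (N + poly p' N)" for N by (simp add: q_def poly_pcompose)
  let ?P = "[:3:] * p' + q + [:?n + 1:]"
  have "\<exists>c. computes (App e es) (w + w' + ?n + 1) ?P rs d f c"
    if as: "set rs \<subseteq> {1..<f}" "1 \<le> d" "d < f" "d \<notin> set rs" for rs d f
  proof -
    let ?L = "[f..<f + ?n]"
    have L: "set ?L \<subseteq> {1..<f + ?n}" "d \<notin> set ?L" using as by auto
    obtain c where c: "stores es w' p' rs f c" using b[OF as(1)] as by auto
    obtain c' where c': "computes e w p ?L d (f + ?n) c'" using a[OF L(1), of d] L(2) as by auto
    let ?c = "Seq c (Seq c' (clear_all (f + ?n) ?L))"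
    have "computes (App e es) (w + w' + ?n + 1) ?P rs d f ?c"
      unfolding computes_def
    proof (intro allI impI conjI)
      fix m and x :: "bool list" and \<sigma> :: "nat \<Rightarrow> nat" and y N
      assume h: "f + (w + w' + ?n + 1) \<le> Suc m" "\<forall>r\<ge>f. \<sigma> r = 0" "length x + sum_list (map \<sigma> rs) \<le> N"
      let ?v = "map (eval x (map \<sigma> rs)) es"
      define \<sigma>1 where "\<sigma>1 = (\<lambda>r. if f \<le> r \<and> r < f + ?n then eval x (map \<sigma> rs) (es ! (r - f)) else \<sigma> r)"
      define k where "k = eval x (map \<sigma> rs) (App e es)"
      have m1: "map \<sigma>1 ?L = ?v"
        by (rule nth_equalityI) (auto simp: \<sigma>1_def)
      have 1: "sum_list ?v \<le> poly p' N" "runs c (mk m x 0 \<sigma> y) (mk m x 0 \<sigma>1 y) (poly p' N)"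
        using storesD[OF c _ h(2,3), of m] h(1) unfolding \<sigma>1_def by auto
      have z: "f + ?n + w \<le> Suc m" "\<forall>r\<ge>f + ?n. \<sigma>1 r = 0" "length x + sum_list (map \<sigma>1 ?L) \<le> N + poly p' N"
        unfolding m1 using h 1(1) by (auto simp: \<sigma>1_def)
      have k: "eval x (map \<sigma>1 ?L) e = k" unfolding m1 k_def by simp
      note 2 = computesD[OF c' z, unfolded k, folded q]
      let ?\<sigma>2 = "\<sigma>1(d := \<sigma>1 d + k)"
      have 3: "runs (clear_all (f + ?n) ?L) (mk m x 0 ?\<sigma>2 y) (mk m x 0 (\<lambda>r. if r \<in> set ?L then 0 else ?\<sigma>2 r) y)
        (2 * sum_list (map ?\<sigma>2 ?L) + length ?L + 1)"
        by (rule runs_clear_all) (use as h z in auto)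
      have 4: "map ?\<sigma>2 ?L = ?v" using map_upd_notin[OF L(2)] m1 by metis
      have 5: "(\<lambda>r. if r \<in> set ?L then 0 else ?\<sigma>2 r) = \<sigma>(d := \<sigma> d + k)"
        using as h(2) by (auto simp: \<sigma>1_def fun_eq_iff)
      show "eval x (map \<sigma> rs) (App e es) \<le> poly ?P N" using 2(1) unfolding k_def by simp
      have "runs ?c (mk m x 0 \<sigma> y) (mk m x 0 (\<sigma>(d := \<sigma> d + k)) y)
          (poly p' N + (poly q N + (2 * sum_list ?v + length ?L + 1)))"
        using runs_Seq[OF 1(2) runs_Seq[OF 2(2) 3]] unfolding 4 5 .
      moreover have "poly p' N + (poly q N + (2 * sum_list ?v + length ?L + 1)) \<le> poly ?P N"
        using 1(1) by simp
      ultimately show "runs ?c (mk m x 0 \<sigma> y) (mk m x 0 (\<sigma>(d := \<sigma> d + eval x (map \<sigma> rs) (App e es))) y) (poly ?P N)"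
        unfolding k_def by (rule runs_mono)
    qed (use computes_wf[OF c'] c in \<open>simp add: stores_def wf_clear_all\<close>)
    then show ?thesis by blast
  qed
  then show ?thesis unfolding computable_def by blast
qed

lemma all_computable: "computable e"
  by (induction e) (auto intro: computable_V computable_C computable_Len computable_Sym
      computable_Add computable_Sub computable_Sum computable_App)

section \<open>Output of a bit string, bit by bit\<close>

definition out_bit :: "nat \<Rightarrow> nat \<Rightarrow> com" where "out_bit r s = on_tape r (\<lambda>_. (s, MoveR))"

lemma wf_out_bit: "s < G \<Longrightarrow> wf_com K G (out_bit r s)"
  unfolding out_bit_def by (rule wf_on_tape) simp

lemma runs_out_bit:
  "runs (out_bit (Suc m) (bit_sym b)) (mk m x h \<sigma> y) (mk m x h \<sigma> (y @ [b])) 1"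
  unfolding out_bit_def
proof (rule runs_on_tape)
  have "(fst (input_tape y))(int (length y) := bit_sym b) = fst (input_tape (y @ [b]))"
    by (rule ext) (auto simp: input_tape_def nth_append)
  then show "mk m x h \<sigma> (y @ [b]) = (mk m x h \<sigma> y)[Suc m := tape_act
    (fst (bit_sym b, MoveR)) (snd (bit_sym b, MoveR)) (mk m x h \<sigma> y ! Suc m)]"
    by (intro nth_equalityI) (auto simp: nth_mk nth_list_update in_tape_def)
qed simp

text \<open>A blank tape does not represent the counter 0: the marker has to be written once on
  every tape except input and output.\<close>

definition mark_counters :: com where
  "mark_counters = Act (\<lambda>ss. (map (\<lambda>r. if r = 0 \<or> r = length ss - 1 then ss ! r else 1) [0..<length ss],
     replicate (length ss) Stay))"

lemma wf_mark_counters: "wf_com K 3 mark_counters"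
  by (auto simp: mark_counters_def valid_syms_def)

lemma runs_mark_counters:
  "runs mark_counters (input_tape x # replicate (m + 1) (input_tape [])) (mk m x 0 (\<lambda>_. 0) []) 1"
  unfolding mark_counters_def
proof (rule runs_Act, rule nth_equalityI)
  fix i assume "i < length (mk m x 0 (\<lambda>_. 0) [])"
  then show "mk m x 0 (\<lambda>_. 0) [] ! i = apply_act ((\<lambda>ss. (map (\<lambda>r. if r = 0 \<or> r = length ss - 1 then ss ! r else 1) [0..<length ss],
     replicate (length ss) Stay)) (map tape_read (input_tape x # replicate (m + 1) (input_tape []))))
     (input_tape x # replicate (m + 1) (input_tape [])) ! i"
    by (cases i) (auto simp: nth_mk in_tape_def input_tape_def ctr_def nth_append fun_eq_iff
        simp del: upt_Suc replicate_Suc)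
qed simp

theorem polytime_exp:
  "polytime_on UNIV (\<lambda>x. x) (\<lambda>x. map (\<lambda>i. eval x [i] eb \<noteq> 0) [0..<eval x [] el])"
proof -
  obtain w p where a: "\<And>rs d f. set rs \<subseteq> {1..<f} \<Longrightarrow> 1 \<le> d \<Longrightarrow> d < f \<Longrightarrow> d \<notin> set rs \<Longrightarrow> \<exists>c. computes el w p rs d f c"
    using all_computable[of el] unfolding computable_def by blast
  obtain w' p' where b: "\<And>rs d f. set rs \<subseteq> {1..<f} \<Longrightarrow> 1 \<le> d \<Longrightarrow> d < f \<Longrightarrow> d \<notin> set rs \<Longrightarrow> \<exists>c. computes eb w' p' rs d f c"
    using all_computable[of eb] unfolding computable_def by blast
  \<comment> \<open>Register 1 holds the number of output bits still to be written, 2 the index of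
    the current bit, 3 its value; scratch space begins at 4.\<close>
  obtain c where c: "computes el w p [] 1 4 c" using a[of "[]" 4 1] by auto
  obtain c' where c': "computes eb w' p' [2] 3 4 c'" using b[of "[2]" 4 3] by auto
  define m where "m = w + w' + 4"
  define q where "q = p' \<circ>\<^sub>p ([:0, 1:] + p)"
  have q: "poly q N = poly p' (N + poly p N)" for N by (simp add: q_def poly_pcompose)
  define W where "W = Cond (nz 3) (out_bit (Suc m) 2) (out_bit (Suc m) 1)"
  define B where "B = Seq c' (Seq W (Seq (clear 3) (inc 2)))"
  define cc where "cc = Seq mark_counters (Seq c (drain 1 B))"
  let ?P = "p + p * ([:3:] * q + [:6:]) + [:2:]"
  show ?thesis
  proof (rule polytime_by_com[where K = "m + 2" and G = 3 and c = cc and p = ?P])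
    show "wf_com (m + 2) 3 cc"
      using computes_wf[OF c] computes_wf[OF c']
      by (simp add: cc_def B_def W_def wf_mark_counters wf_out_bit)
    fix x :: "bool list"
    let ?N = "length x"
    define n where "n = eval x [] el"
    define bt where "bt i = eval x [i] eb" for i
    define out where "out i = map (\<lambda>i. bt i \<noteq> 0) [0..<i]" for i
    define \<tau> :: "nat \<Rightarrow> nat \<Rightarrow> nat" where "\<tau> i = (\<lambda>_. 0)(1 := n - i, 2 := i)" for i
    let ?z = "\<lambda>_::nat. 0::nat"
    have z: "4 + w \<le> Suc m" "4 + w' \<le> Suc m" by (simp_all add: m_def)
    have 1: "n \<le> poly p ?N" "runs c (mk m x 0 ?z []) (mk m x 0 (?z(1 := n)) []) (poly p ?N)"
      using computesD[OF c z(1), of ?z x ?N] by (auto simp: n_def)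
    have body: "runs B (mk m x 0 ((\<tau> i)(1 := n - Suc i)) (out i)) (mk m x 0 (\<tau> (Suc i)) (out (Suc i)))
        (poly q ?N + (2 + ((poly q ?N * 2 + 1) + 1)))" if i: "i < n" for i
    proof -
      let ?s = "(\<tau> i)(1 := n - Suc i)"
      have s: "map ?s [2] = [i]" by (simp add: \<tau>_def)
      have zz: "\<forall>r\<ge>4. ?s r = 0" "length x + sum_list (map ?s [2]) \<le> ?N + poly p ?N"
        unfolding s using i 1(1) by (auto simp: \<tau>_def)
      note D = computesD[OF c' z(2) zz, unfolded s, folded q bt_def]
      let ?s1 = "?s(3 := bt i)"
      have s3: "?s(3 := ?s 3 + bt i) = ?s1" by (auto simp: \<tau>_def)
      have 2: "runs W (mk m x 0 ?s1 (out i)) (mk m x 0 ?s1 (out (Suc i))) 2"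
      proof -
        have eq: "out (Suc i) = out i @ [bt i \<noteq> 0]" by (simp add: out_def)
        have nz3: "nz 3 (map tape_read (mk m x 0 ?s1 (out i))) \<longleftrightarrow> bt i \<noteq> 0"
          by (subst nz_mk) (auto simp: m_def)
        have "runs W (mk m x 0 ?s1 (out i)) (mk m x 0 ?s1 (out (Suc i))) (Suc 1)"
        proof (cases "bt i = 0")
          case True
          then show ?thesis unfolding W_def eq using nz3 runs_out_bit[of m False]
            by (intro runs_CondF) auto
        next
          case False
          then show ?thesis unfolding W_def eq using nz3 runs_out_bit[of m True]
            by (intro runs_CondT) auto
        qed
        then show ?thesis by (simp add: numeral_2_eq_2)
      qed
      have 3: "runs (clear 3) (mk m x 0 ?s1 (out (Suc i))) (mk m x 0 (?s1(3 := 0)) (out (Suc i))) (?s1 3 * 2 + 1)"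
        by (rule runs_clear) (auto simp: m_def)
      let ?s2 = "?s1(3 := 0)"
      have 4: "runs (inc 2) (mk m x 0 ?s2 (out (Suc i))) (mk m x 0 (?s2(2 := Suc (?s2 2))) (out (Suc i))) 1"
        by (rule runs_inc) (auto simp: m_def)
      have 5: "?s2(2 := Suc (?s2 2)) = \<tau> (Suc i)" by (auto simp: \<tau>_def)
      show ?thesis unfolding B_def
        by (rule runs_mono[OF runs_Seq[OF D(2)[unfolded s3] runs_Seq[OF 2 runs_Seq[OF 3 4[unfolded 5]]]]])
          (use D(1) in simp)
    qed
    have t0: "?z(1 := n) = \<tau> 0" by (auto simp: \<tau>_def)
    have o0: "[] = out 0" by (simp add: out_def)
    have 2: "runs (drain 1 B) (mk m x 0 (\<tau> 0) (out 0)) (mk m x 0 (\<tau> n) (out n))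
        (n * (poly q ?N + (2 + ((poly q ?N * 2 + 1) + 1)) + 2) + 1)"
    proof (rule runs_drain[where h = "\<lambda>_. 0"])
      show "\<tau> i 1 = n - i" for i by (simp add: \<tau>_def)
    qed (use body in \<open>auto simp: m_def\<close>)
    have "n * (3 * poly q ?N + 6) \<le> poly p ?N * (3 * poly q ?N + 6)" using 1(1) by (rule mult_le_mono1)
    then have le: "1 + (poly p ?N + (n * (poly q ?N + (2 + ((poly q ?N * 2 + 1) + 1)) + 2) + 1)) \<le> poly ?P ?N"
      by (simp add: algebra_simps)
    have "runs cc (input_tape x # replicate (m + 1) (input_tape [])) (mk m x 0 (\<tau> n) (out n)) (poly ?P ?N)"
      unfolding cc_def
      by (rule runs_mono[OF runs_Seq[OF runs_mark_counters runs_Seq[OF 1(2)[unfolded t0, unfolded o0] 2, folded o0]] le])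
    moreover have "last (mk m x 0 (\<tau> n) (out n)) = in_tape (out n) (length (out n))"
      by (simp add: mk_def)
    moreover have "tape_shows (in_tape (out n) (length (out n))) (out n)"
      by (auto simp: tape_shows_def in_tape_def input_tape_def)
    moreover have "out n = map (\<lambda>i. eval x [i] eb \<noteq> 0) [0..<eval x [] el]"
      by (simp add: out_def n_def bt_def)
    ultimately show "\<exists>ts. tape_shows (last ts) (map (\<lambda>i. eval x [i] eb \<noteq> 0) [0..<eval x [] el]) \<and>
       runs cc (input_tape x # replicate (m + 2 - 1) (input_tape [])) ts (poly ?P (length x))"
      by (intro exI[of _ "mk m x 0 (\<tau> n) (out n)"]) (simp del: replicate_Suc)
  qed simp_all
qed

section \<open>Composition of polynomial-time computations\<close>

lemma poly_mono_nat: "a \<le> b \<Longrightarrow> poly p a \<le> poly p (b :: nat)"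
  by (induction p) (auto intro: add_mono mult_mono)

text \<open>After \<open>i\<close> steps every cell from \<open>L + i\<close> on is still blank.
  This bounds the length of the output of the first machine, hence the running time of the
  second.\<close>

definition valid_cfg :: "tm \<Rightarrow> nat \<Rightarrow> nat \<Rightarrow> config \<Rightarrow> bool" where
  "valid_cfg M L i = (\<lambda>(q, ts). q \<le> nstates M \<and> length ts = ntapes M \<and>
     (\<forall>t\<in>set ts. (\<forall>j. fst t j < nsyms M) \<and> snd t \<le> int i \<and> (\<forall>j\<ge>int (L + i). fst t j = 0)))"

lemma valid_init:
  assumes "wf_tm M"
  shows "valid_cfg M (length x) 0 (init_config M x)"
proof -
  have "bit_sym b < nsyms M" for b using assms by (cases b) (auto simp: wf_tm_def)
  then show ?thesis using assms
    by (auto simp: valid_cfg_def init_config_def input_tape_def wf_tm_def)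
qed

lemma valid_reads:
  assumes "valid_cfg M L i (q, ts)"
  shows "valid_syms (ntapes M) (nsyms M) (map tape_read ts)"
  using assms by (force simp: valid_cfg_def valid_syms_def)

lemma wf_delta:
  assumes "wf_tm M" "q < nstates M" "valid_syms (ntapes M) (nsyms M) ss"
  obtains q' ws ms where "delta M q ss = (q', ws, ms)" "q' \<le> nstates M" "valid_syms (ntapes M) (nsyms M) ws"
    "length ms = ntapes M"
proof -
  obtain q' ws ms where *: "delta M q ss = (q', ws, ms)" by (cases "delta M q ss") auto
  have "case delta M q ss of (q', ws, ms) \<Rightarrow>
           q' \<le> nstates M \<and> length ws = ntapes M \<and> (\<forall>s\<in>set ws. s < nsyms M) \<and> length ms = ntapes M"
    using assms(1)[unfolded wf_tm_def, THEN conjunct2, THEN conjunct2, THEN conjunct2,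
        THEN spec, THEN spec, THEN mp, of q ss] assms(2,3) by (simp add: valid_syms_def)
  then show thesis using that * by (simp add: valid_syms_def)
qed

lemma valid_step:
  assumes "wf_tm M" "valid_cfg M L i (q, ts)"
  shows "valid_cfg M L (Suc i) (tm_step M (q, ts))"
proof (cases "q < nstates M")
  case True
  obtain q' ws ms where d: "delta M q (map tape_read ts) = (q', ws, ms)" "q' \<le> nstates M"
    "valid_syms (ntapes M) (nsyms M) ws" "length ms = ntapes M"
    using wf_delta[OF assms(1) True valid_reads[OF assms(2)]] by blast
  have len: "length ts = ntapes M" "length ws = ntapes M" using assms(2) d(3)
    by (auto simp: valid_cfg_def valid_syms_def)
  have "(\<forall>j. fst (tape_act w m t) j < nsyms M) \<and> snd (tape_act w m t) \<le> int (Suc i) \<and>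
      (\<forall>j\<ge>int (L + Suc i). fst (tape_act w m t) j = 0)"
    if "(t, w, m) \<in> set (zip ts (zip ws ms))" for t w m
  proof -
    have "t \<in> set ts" "w \<in> set ws" using that by (auto dest: set_zip_leftD set_zip_rightD)
    then have "w < nsyms M" "\<forall>j. fst t j < nsyms M" "snd t \<le> int i" "\<forall>j\<ge>int (L + i). fst t j = 0"
      using assms(2) d(3) by (auto simp: valid_cfg_def valid_syms_def)
    then show ?thesis by (cases t; cases m) auto
  qed
  then show ?thesis using True d len by (auto simp: valid_cfg_def tm_step.simps)
next
  case False
  then show ?thesis using assms(2) by (force simp: valid_cfg_def tm_step.simps)
qed

lemma valid_steps:
  assumes "wf_tm M"
  shows "valid_cfg M (length x) i ((tm_step M ^^ i) (init_config M x))"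
proof (induction i)
  case (Suc i)
  then show ?case using valid_step[OF assms] by (metis funpow.simps(2) o_apply prod.collapse)
qed (use valid_init[OF assms] in simp)

text \<open>A simulating loop tests for the halting state before every step, so it needs the first
  halting time, not just some time at which the machine has halted.\<close>

lemma tm_computes_first_halt:
  assumes "wf_tm M" "tm_computes_within M x y n"
  obtains i ts where "i \<le> n" "(tm_step M ^^ i) (init_config M x) = (nstates M, ts)" "tape_shows (last ts) y"
    "\<And>j. j < i \<Longrightarrow> fst ((tm_step M ^^ j) (init_config M x)) < nstates M"
    "length y \<le> length x + n"
proof -
  let ?cf = "\<lambda>i. (tm_step M ^^ i) (init_config M x)"
  obtain ts where ts: "?cf n = (nstates M, ts)" "tape_shows (last ts) y"
    using assms(2) by (cases "?cf n") (auto simp: tm_computes_within_def)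
  define i where "i = (LEAST i. fst (?cf i) = nstates M)"
  have i: "fst (?cf i) = nstates M" unfolding i_def by (rule LeastI[of _ n]) (simp add: ts)
  have le: "i \<le> n" unfolding i_def by (rule Least_le) (simp add: ts)
  have less: "fst (?cf j) < nstates M" if "j < i" for j
  proof -
    have "fst (?cf j) \<noteq> nstates M" using that not_less_Least unfolding i_def by blast
    moreover have "fst (?cf j) \<le> nstates M" using valid_steps[OF assms(1), of x j]
      by (auto simp: valid_cfg_def split: prod.splits)
    ultimately show ?thesis by simp
  qed
  have "?cf n = (tm_step M ^^ (n - i)) (?cf i)" using le by (metis funpow_add le_add_diff_inverse2 o_apply)
  also have "\<dots> = ?cf i" using tm_step_halted[where M = M and n = "n - i" and ts = "snd (?cf i)"] i by (metis prod.collapse)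
  finally have "?cf i = (nstates M, ts)" using ts by simp
  moreover have "length y \<le> length x + n"
  \<comment> \<open>Output cells carry bit symbols, which are not blank, so they cannot reach the
    part of the tape that is still blank after \<open>n\<close> steps.\<close>
  proof (rule ccontr)
    assume a: "\<not> length y \<le> length x + n"
    have v: "valid_cfg M (length x) n (nstates M, ts)" using valid_steps[OF assms(1), of x n] ts by simp
    have "ts \<noteq> []" using v assms(1) by (auto simp: valid_cfg_def wf_tm_def)
    then have "fst (last ts) (int (length x + n)) = 0" using v by (auto simp: valid_cfg_def)
    moreover have "fst (last ts) (int (length x + n)) = bit_sym (y ! (length x + n))"
      using ts(2) a unfolding tape_shows_def by (metis not_le)
    ultimately show False by (cases "y ! (length x + n)") auto
  qed
  ultimately show thesis using that le less ts(2) by blast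
qed

section \<open>Running two machines one after the other\<close>

definition cell :: "nat \<Rightarrow> tape" where "cell q = ((\<lambda>_. 0)(0 := q), 0)"

text \<open>No move is logged as the blank, so a blank cell marks the end of the log.\<close>

fun move_sym :: "move \<Rightarrow> nat" where
  "move_sym MoveL = 1" | "move_sym Stay = 2" | "move_sym MoveR = 3"

fun move_dir :: "move \<Rightarrow> int" where
  "move_dir MoveL = -1" | "move_dir Stay = 0" | "move_dir MoveR = 1"

lemma tape_move: "tape_act (tape_read t) m t = (fst t, snd t + move_dir m)"
  by (cases t; cases m) auto

definition undo :: "nat \<Rightarrow> move" where
  "undo s = (if s = 1 then MoveR else if s = 2 then Stay else MoveL)"

definition history :: "move list \<Rightarrow> int \<Rightarrow> tape" where
  "history ms h = (\<lambda>j. if 0 \<le> j \<and> j < int (length ms) then move_sym (ms ! nat j) else 0, h)"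

text \<open>One step of \<open>M\<close> on the first tapes. The state of \<open>M\<close> is kept on the tape behind them, and the
  moves of the last tape of \<open>M\<close> are logged on the next one: undoing them brings the head back to
  cell \<open>0\<close>, where the output starts.\<close>

definition sim_first :: "tm \<Rightarrow> com" where
  "sim_first M = Act (\<lambda>ss. let K = ntapes M; s = take K ss; q = ss ! K; rest = drop (K + 2) ss in
     if q < nstates M \<and> valid_syms K (nsyms M) s \<and> K + 2 \<le> length ss then
       (case delta M q s of (q', ws, ms) \<Rightarrow>
         (ws @ [q', move_sym (last ms)] @ rest, ms @ [Stay, MoveR] @ replicate (length rest) Stay))
     else (ss, replicate (length ss) Stay))"

definition sim_second :: "nat \<Rightarrow> tm \<Rightarrow> com" where
  "sim_second n M = Act (\<lambda>ss. let s = drop (Suc n) ss; q = ss ! n in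
     if q < nstates M \<and> valid_syms (ntapes M) (nsyms M) s \<and> n < length ss then
       (case delta M q s of (q', ws, ms) \<Rightarrow>
         (take n ss @ [q'] @ ws, replicate n Stay @ [Stay] @ ms))
     else (ss, replicate (length ss) Stay))"

lemma wf_sim_first:
  assumes "wf_tm M" "nsyms M \<le> G" "nstates M < G" "3 < G"
  shows "wf_com K' G (sim_first M)"
  unfolding wf_com.simps sim_first_def Let_def
proof (intro allI impI, goal_cases)
  case (1 ss)
  let ?K = "ntapes M"
  show ?case
  proof (cases "ss ! ?K < nstates M \<and> valid_syms ?K (nsyms M) (take ?K ss) \<and> ?K + 2 \<le> length ss")
    case True
    then obtain q' ws ms where d: "delta M (ss ! ?K) (take ?K ss) = (q', ws, ms)" "q' \<le> nstates M"
      "valid_syms ?K (nsyms M) ws" "length ms = ?K" using wf_delta[OF assms(1)] by blast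
    have "move_sym (last ms) < G" using assms(4) by (cases "last ms") auto
    then show ?thesis using True d 1 assms by (auto simp: valid_syms_def dest: in_set_dropD)
  qed (use 1 in \<open>auto simp: valid_syms_def\<close>)
qed

lemma wf_sim_second:
  assumes "wf_tm M" "nsyms M \<le> G" "nstates M < G"
  shows "wf_com K' G (sim_second n M)"
  unfolding wf_com.simps sim_second_def Let_def
proof (intro allI impI, goal_cases)
  case (1 ss)
  let ?K = "ntapes M"
  show ?case
  proof (cases "ss ! n < nstates M \<and> valid_syms ?K (nsyms M) (drop (Suc n) ss) \<and> n < length ss")
    case True
    then obtain q' ws ms where d: "delta M (ss ! n) (drop (Suc n) ss) = (q', ws, ms)" "q' \<le> nstates M"
      "valid_syms ?K (nsyms M) ws" "length ms = ?K" using wf_delta[OF assms(1)] by blast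
    then show ?thesis using True 1 assms by (auto simp: valid_syms_def dest: in_set_takeD)
  qed (use 1 in \<open>auto simp: valid_syms_def\<close>)
qed

lemma apply_act_append:
  "length ws = length ts \<Longrightarrow> length ms = length ts \<Longrightarrow>
   apply_act (ws @ ws', ms @ ms') (ts @ ts') = apply_act (ws, ms) ts @ apply_act (ws', ms') ts'"
  by simp

lemma tm_stepE:
  assumes "wf_tm M" "valid_cfg M L i (q, ts)" "q < nstates M" "tm_step M (q, ts) = (q', ts')"
  obtains ws ms where "delta M q (map tape_read ts) = (q', ws, ms)"
    "valid_syms (ntapes M) (nsyms M) ws" "length ms = ntapes M" "ts' = apply_act (ws, ms) ts"
proof -
  obtain r ws ms where d: "delta M q (map tape_read ts) = (r, ws, ms)"
    "valid_syms (ntapes M) (nsyms M) ws" "length ms = ntapes M"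
    using wf_delta[OF assms(1,3) valid_reads[OF assms(2)]] by blast
  then have "r = q'" "ts' = apply_act (ws, ms) ts" using assms(3,4) by (auto simp: tm_step.simps)
  then show thesis using that d by blast
qed

text \<open>The move \<open>m\<close> is fixed before the log \<open>H\<close> and the other tapes
  \<open>R\<close> are quantified, so that the whole sequence of moves can be chosen in
  advance.\<close>

lemma runs_sim_first:
  assumes "wf_tm M" "valid_cfg M L i (q, ts)" "q < nstates M"
    and "tm_step M (q, ts) = (q', ts')"
  shows "\<exists>m. snd (last ts') = snd (last ts) + move_dir m \<and>
    (\<forall>H R. length H = i \<longrightarrow> runs (sim_first M) (ts @ [cell q, history H (int i)] @ R) (ts' @ [cell q', history (H @ [m]) (int (Suc i))] @ R) 1)"
proof -
  let ?K = "ntapes M"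
  have len: "length ts = ?K" and K: "0 < ?K" using assms(1,2) by (auto simp: valid_cfg_def wf_tm_def)
  obtain ws ms where d: "delta M q (map tape_read ts) = (q', ws, ms)"
    "valid_syms ?K (nsyms M) ws" "length ms = ?K" "ts' = apply_act (ws, ms) ts"
    using tm_stepE[OF assms] by blast
  have lw: "length ws = ?K" using d(2) by (simp add: valid_syms_def)
  define m where "m = last ms"
  have "last ts' = tape_act (last ws) (last ms) (last ts)"
  proof -
    have "zip ts (zip ws ms) \<noteq> []" using len lw d(3) K by auto
    moreover have "ts \<noteq> []" "ws \<noteq> []" "ms \<noteq> []" using len lw d(3) K by auto
    ultimately show ?thesis unfolding d(4) using len lw d(3)
      by (simp add: last_map last_zip)
  qed
  then have "snd (last ts') = snd (last ts) + move_dir m"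
    unfolding m_def by (cases "last ts"; cases "last ms") auto
  moreover have "runs (sim_first M) (ts @ [cell q, history H (int i)] @ R) (ts' @ [cell q', history (H @ [m]) (int (Suc i))] @ R) 1"
    if lH: "length H = i" for H R
    unfolding sim_first_def
  proof (rule runs_Act)
    let ?T = "ts @ [cell q, history H (int i)] @ R"
    have r: "map tape_read ?T = map tape_read ts @ [q, 0] @ map tape_read R"
      using lH by (simp add: cell_def history_def)
    have v: "valid_syms ?K (nsyms M) (map tape_read ts)" by (rule valid_reads[OF assms(2)])
    have a: "(let K = ?K; s = take K (map tape_read ?T); q = map tape_read ?T ! K; rest = drop (K + 2) (map tape_read ?T) in
     if q < nstates M \<and> valid_syms K (nsyms M) s \<and> K + 2 \<le> length (map tape_read ?T) then
       (case delta M q s of (q', ws, ms) \<Rightarrow>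
         (ws @ [q', move_sym (last ms)] @ rest, ms @ [Stay, MoveR] @ replicate (length rest) Stay))
     else (map tape_read ?T, replicate (length (map tape_read ?T)) Stay)) =
      (ws @ [q', move_sym m] @ map tape_read R, ms @ [Stay, MoveR] @ replicate (length R) Stay)"
      unfolding r Let_def using len assms(3) v d(1) by (simp add: nth_append m_def)
    have c: "tape_act q' Stay (cell q) = cell q'" by (simp add: cell_def)
    have h: "tape_act (move_sym m) MoveR (history H (int i)) = history (H @ [m]) (int (Suc i))"
      using lH by (auto simp: history_def fun_eq_iff nth_append)
    show "ts' @ [cell q', history (H @ [m]) (int (Suc i))] @ R =
      apply_act ((\<lambda>ss. let K = ?K; s = take K ss; q = ss ! K; rest = drop (K + 2) ss in
     if q < nstates M \<and> valid_syms K (nsyms M) s \<and> K + 2 \<le> length ss then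
       (case delta M q s of (q', ws, ms) \<Rightarrow>
         (ws @ [q', move_sym (last ms)] @ rest, ms @ [Stay, MoveR] @ replicate (length rest) Stay))
     else (ss, replicate (length ss) Stay)) (map tape_read ?T)) ?T"
      unfolding a using apply_act_append[of ws ts ms] len lw d(3,4) c h apply_act_Stay[of R]
      by (simp del: apply_act_Stay)
  qed
  ultimately show ?thesis by blast
qed

lemma runs_sim_second:
  assumes "wf_tm M" "valid_cfg M L i (q, ts)" "q < nstates M" "length R = n"
    and "tm_step M (q, ts) = (q', ts')"
  shows "runs (sim_second n M) (R @ [cell q] @ ts) (R @ [cell q'] @ ts') 1"
  unfolding sim_second_def
proof (rule runs_Act)
  let ?K = "ntapes M"
  let ?T = "R @ [cell q] @ ts"
  have len: "length ts = ?K" and K: "0 < ?K" using assms(1,2) by (auto simp: valid_cfg_def wf_tm_def)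
  obtain ws ms where d: "delta M q (map tape_read ts) = (q', ws, ms)"
    "valid_syms ?K (nsyms M) ws" "length ms = ?K" "ts' = apply_act (ws, ms) ts"
    using tm_stepE[OF assms(1-3,5)] by blast
  have r: "map tape_read ?T = map tape_read R @ [q] @ map tape_read ts" by (simp add: cell_def)
  have v: "valid_syms ?K (nsyms M) (map tape_read ts)" by (rule valid_reads[OF assms(2)])
  have a: "(let s = drop (Suc n) (map tape_read ?T); q = map tape_read ?T ! n in
     if q < nstates M \<and> valid_syms ?K (nsyms M) s \<and> n < length (map tape_read ?T) then
       (case delta M q s of (q', ws, ms) \<Rightarrow>
         (take n (map tape_read ?T) @ [q'] @ ws, replicate n Stay @ [Stay] @ ms))
     else (map tape_read ?T, replicate (length (map tape_read ?T)) Stay)) =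
     (map tape_read R @ [q'] @ ws, replicate n Stay @ [Stay] @ ms)"
    unfolding r Let_def using assms(3,4) v d(1) by (simp add: nth_append)
  have c: "tape_act q' Stay (cell q) = cell q'" by (simp add: cell_def)
  show "R @ [cell q'] @ ts' = apply_act ((\<lambda>ss. let s = drop (Suc n) ss; q = ss ! n in
     if q < nstates M \<and> valid_syms ?K (nsyms M) s \<and> n < length ss then
       (case delta M q s of (q', ws, ms) \<Rightarrow>
         (take n ss @ [q'] @ ws, replicate n Stay @ [Stay] @ ms))
     else (ss, replicate (length ss) Stay)) (map tape_read ?T)) ?T"
    unfolding a using apply_act_append[of "map tape_read R" R "replicate n Stay"] d(4) c assms(4) apply_act_Stay[of R]
    by (simp del: apply_act_Stay)
qed

definition on_tapes :: "nat \<Rightarrow> nat \<Rightarrow> (nat \<Rightarrow> nat \<Rightarrow> (nat \<times> move) \<times> (nat \<times> move)) \<Rightarrow> com" where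
  "on_tapes r r' g = Act (\<lambda>ss. let z = g (ss ! r) (ss ! r') in
     (ss[r := fst (fst z), r' := fst (snd z)], (replicate (length ss) Stay)[r := snd (fst z), r' := snd (snd z)]))"

lemma runs_on_tapes:
  assumes "r < length ts" "r' < length ts" "r \<noteq> r'" "g (tape_read (ts ! r)) (tape_read (ts ! r')) = ((w, m), (w', m'))"
    and "ts' = ts[r := tape_act w m (ts ! r), r' := tape_act w' m' (ts ! r')]"
  shows "runs (on_tapes r r' g) ts ts' 1"
  unfolding on_tapes_def
proof (rule runs_Act)
  show "ts' = apply_act ((\<lambda>ss. let z = g (ss ! r) (ss ! r') in
     (ss[r := fst (fst z), r' := fst (snd z)], (replicate (length ss) Stay)[r := snd (fst z), r' := snd (snd z)])) (map tape_read ts)) ts"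
    using assms by (auto intro!: nth_equalityI simp: nth_list_update Let_def)
qed

lemma wf_on_tapes:
  assumes "\<And>s s'. s < G \<Longrightarrow> s' < G \<Longrightarrow> fst (fst (g s s')) < G \<and> fst (snd (g s s')) < G" "r < K" "r' < K"
  shows "wf_com K G (on_tapes r r' g)"
proof -
  have "s < G" if v: "valid_syms K G ss" and s: "s \<in> set (ss[r := fst (fst (g (ss ! r) (ss ! r'))), r' := fst (snd (g (ss ! r) (ss ! r')))])" for ss s
  proof -
    have "ss ! r < G" "ss ! r' < G" using v assms(2,3) by (auto simp: valid_syms_def)
    moreover have "s = fst (snd (g (ss ! r) (ss ! r'))) \<or> s = fst (fst (g (ss ! r) (ss ! r'))) \<or> s \<in> set ss"
      using s by (metis insert_iff set_update_subset_insert subsetD)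
    ultimately show ?thesis using assms(1) v by (auto simp: valid_syms_def)
  qed
  then show ?thesis by (auto simp: on_tapes_def valid_syms_def Let_def)
qed

lemma list_update_twice2: "r \<noteq> r' \<Longrightarrow> T[r := a, r' := b, r := a', r' := b'] = T[r := a', r' := b']"
  by (metis list_update_overwrite list_update_swap)

theorem polytime_compose:
  assumes "polytime_on D enc out" "polytime_on D' enc' out'"
    and \<phi>: "\<And>x. x \<in> D \<Longrightarrow> \<phi> x \<in> D' \<and> out x = enc' (\<phi> x)"
  shows "polytime_on D enc (\<lambda>x. out' (\<phi> x))"
proof -
  obtain M1 and p1 :: "nat poly" where M1: "wf_tm M1"
    "\<And>x. x \<in> D \<Longrightarrow> tm_computes_within M1 (enc x) (out x) (poly p1 (length (enc x)))"
    using assms(1) unfolding polytime_on_def by blast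
  obtain M2 and p2 :: "nat poly" where M2: "wf_tm M2"
    "\<And>x. x \<in> D' \<Longrightarrow> tm_computes_within M2 (enc' x) (out' x) (poly p2 (length (enc' x)))"
    using assms(2) unfolding polytime_on_def by blast
  define K1 where "K1 = ntapes M1"
  define K2 where "K2 = ntapes M2"
  have K: "0 < K1" "0 < K2" using M1(1) M2(1) by (auto simp: K1_def K2_def wf_tm_def)
  define G where "G = nsyms M1 + nsyms M2 + nstates M1 + nstates M2 + 4"
  \<comment> \<open>Tape layout: the \<open>K1\<close> tapes of \<open>M1\<close>, its state, the
    log, the state of \<open>M2\<close>, and from \<open>K1 + 3\<close> on the tapes of
    \<open>M2\<close>.\<close>
  define c1 where "c1 = While (\<lambda>ss. ss ! K1 \<noteq> nstates M1) (sim_first M1)"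
  define b3 where "b3 = on_tapes (K1 - 1) (K1 + 1) (\<lambda>s h. ((s, undo h), (h, MoveL)))"
  define c3 where "c3 = While (\<lambda>ss. ss ! (K1 + 1) \<noteq> 0) b3"
  \<comment> \<open>The output is copied symbol by symbol onto the first tape of \<open>M2\<close>,
    up to the first blank. Whatever \<open>M1\<close> left behind that blank stays where it is, so
    \<open>M2\<close> finds a clean input.\<close>
  define b4 where "b4 = on_tapes (K1 - 1) (K1 + 3) (\<lambda>s _. ((s, MoveR), (s, MoveR)))"
  define c4 where "c4 = While (\<lambda>ss. ss ! (K1 - 1) \<noteq> 0) b4"
  \<comment> \<open>Rewinding stops at the blank in cell -1; the final move to the right puts the
    head on cell 0, where \<open>M2\<close> expects it.\<close>
  define c6 where "c6 = While (\<lambda>ss. ss ! (K1 + 3) \<noteq> 0) (dec (K1 + 3))"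
  define c8 where "c8 = While (\<lambda>ss. ss ! (K1 + 2) \<noteq> nstates M2) (sim_second (K1 + 2) M2)"
  define cc where "cc = Seq c1 (Seq (dec (K1 + 1)) (Seq c3 (Seq c4 (Seq (dec (K1 + 3)) (Seq c6 (Seq (inc (K1 + 3)) c8))))))"
  define P where "P = [:8:] * p1 + [:4:] * [:0, 1:] + [:2:] * (p2 \<circ>\<^sub>p ([:0, 1:] + p1)) + [:12:]"
  show ?thesis
  proof (rule polytime_by_com[where K = "K1 + 3 + K2" and G = G and c = cc and p = P])
    show "wf_com (K1 + 3 + K2) G cc"
      unfolding cc_def c1_def c3_def c4_def c6_def c8_def b3_def b4_def using K
      by (auto intro!: wf_sim_first wf_sim_second wf_on_tapes M1(1) M2(1) simp: G_def)
    show "1 \<le> K1 + 3 + K2" "3 \<le> G" by (simp_all add: G_def)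
    fix x assume x: "x \<in> D"
    define y where "y = out x"
    define cf where "cf i = (tm_step M1 ^^ i) (init_config M1 (enc x))" for i
    let ?L = "length (enc x)"
    obtain n ts where n: "n \<le> poly p1 ?L" and ts: "cf n = (nstates M1, ts)" "tape_shows (last ts) y"
      and less: "\<And>j. j < n \<Longrightarrow> fst (cf j) < nstates M1" and ly: "length y \<le> ?L + poly p1 ?L"
      using tm_computes_first_halt[OF M1(1) M1(2)[OF x]] unfolding cf_def y_def by metis
    have val: "valid_cfg M1 ?L i (fst (cf i), snd (cf i))" for i
      using valid_steps[OF M1(1)] by (simp add: cf_def)
    have step: "tm_step M1 (fst (cf i), snd (cf i)) = (fst (cf (Suc i)), snd (cf (Suc i)))" for i
      by (simp add: cf_def)
    have "\<forall>i. \<exists>m. i < n \<longrightarrow> snd (last (snd (cf (Suc i)))) = snd (last (snd (cf i))) + move_dir m \<and>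
        (\<forall>H R. length H = i \<longrightarrow> runs (sim_first M1) (snd (cf i) @ [cell (fst (cf i)), history H (int i)] @ R)
          (snd (cf (Suc i)) @ [cell (fst (cf (Suc i))), history (H @ [m]) (int (Suc i))] @ R) 1)"
      using runs_sim_first[OF M1(1) val less step] by blast
    then obtain mv where mv: "\<And>i. i < n \<Longrightarrow> snd (last (snd (cf (Suc i)))) = snd (last (snd (cf i))) + move_dir (mv i)"
      and sim: "\<And>i H R. i < n \<Longrightarrow> length H = i \<Longrightarrow> runs (sim_first M1) (snd (cf i) @ [cell (fst (cf i)), history H (int i)] @ R)
          (snd (cf (Suc i)) @ [cell (fst (cf (Suc i))), history (H @ [mv i]) (int (Suc i))] @ R) 1"
      by metis
    define H where "H i = map mv [0..<i]" for i
    define pos where "pos i = snd (last (snd (cf i)))" for i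
    define bl where "bl = input_tape []"
    define R where "R = cell 0 # replicate K2 bl"
    have bl: "cell 0 = bl" "history (H 0) (int 0) = bl"
      by (auto simp: bl_def cell_def input_tape_def history_def H_def fun_eq_iff)
    have init: "input_tape (enc x) # replicate (K1 + 3 + K2 - 1) (input_tape []) =
        snd (cf 0) @ [cell (fst (cf 0)), history (H 0) (int 0)] @ R"
    proof -
      have "K1 + 3 + K2 - 1 = (K1 - 1) + (3 + K2)" using K by simp
      then have "replicate (K1 + 3 + K2 - 1) bl = replicate (K1 - 1) bl @ bl # bl # bl # replicate K2 bl"
        by (simp only: replicate_add) (simp add: numeral_3_eq_3)
      then show ?thesis using bl by (simp add: cf_def init_config_def R_def bl_def K1_def)
    qed
    have 1: "runs c1 (snd (cf 0) @ [cell (fst (cf 0)), history (H 0) (int 0)] @ R)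
      (snd (cf n) @ [cell (fst (cf n)), history (H n) (int n)] @ R) (n * Suc 1 + 1)"
      unfolding c1_def
    proof (rule runs_While[where S = "\<lambda>i. snd (cf i) @ [cell (fst (cf i)), history (H i) (int i)] @ R"])
      have len: "length (snd (cf i)) = K1" for i using val[of i] by (auto simp: valid_cfg_def K1_def split: prod.splits)
      have rd: "map tape_read (snd (cf i) @ [cell (fst (cf i)), history (H i) (int i)] @ R) ! K1 = fst (cf i)" for i
        by (simp add: nth_append len cell_def)
      fix i assume i: "i < n"
      show "map tape_read (snd (cf i) @ [cell (fst (cf i)), history (H i) (int i)] @ R) ! K1 \<noteq> nstates M1"
        unfolding rd using less[OF i] by simp
      show "runs (sim_first M1) (snd (cf i) @ [cell (fst (cf i)), history (H i) (int i)] @ R)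
         (snd (cf (Suc i)) @ [cell (fst (cf (Suc i))), history (H (Suc i)) (int (Suc i))] @ R) 1"
        using sim[OF i, of "H i" R] by (simp add: H_def)
    next
      have len: "length (snd (cf n)) = K1" using val[of n] by (auto simp: valid_cfg_def K1_def split: prod.splits)
      show "\<not> map tape_read (snd (cf n) @ [cell (fst (cf n)), history (H n) (int n)] @ R) ! K1 \<noteq> nstates M1"
        using len ts(1) by (simp add: nth_append cell_def)
    qed
    define T where "T = snd (cf n) @ [cell (fst (cf n)), history (H n) (int n)] @ R"
    have len: "length ts = K1" using val[of n] ts(1) by (simp add: valid_cfg_def K1_def)
    have lT: "length T = K1 + 3 + K2" by (simp add: T_def R_def ts(1) len)
    have Tn: "T ! (K1 - 1) = last ts" "T ! (K1 + 1) = history (H n) (int n)" "T ! (K1 + 2) = cell 0" "T ! (K1 + 3) = bl"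
      using len K by (auto simp: T_def ts(1) nth_append R_def last_conv_nth nth_Cons' numeral_eq_Suc)
    define c where "c = fst (last ts)"
    have lts: "last ts = (c, pos n)" by (simp add: c_def pos_def ts(1))
    define S3 where "S3 j = T[K1 - 1 := (c, pos (n - j)), K1 + 1 := history (H n) (int n - 1 - int j)]" for j
    have 2: "runs (dec (K1 + 1)) T (S3 0) 1"
      unfolding dec_def
    proof (rule runs_on_tape)
      have "T[K1 - 1 := (c, pos (n - 0))] = T" using Tn(1) lts by (metis list_update_id minus_nat.diff_0)
      moreover have "tape_act (tape_read (T ! (K1 + 1))) MoveL (T ! (K1 + 1)) = history (H n) (int n - 1)"
        unfolding Tn(2) tape_move by (simp add: history_def)
      ultimately show "S3 0 = T[K1 + 1 := tape_act (fst (tape_read (T ! (K1 + 1)), MoveL)) (snd (tape_read (T ! (K1 + 1)), MoveL)) (T ! (K1 + 1))]"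
        unfolding S3_def by simp
    qed (simp add: lT)
    have lH: "length (H n) = n" by (simp add: H_def)
    have 3: "runs c3 (S3 0) (S3 n) (n * Suc 1 + 1)"
      unfolding c3_def
    proof (rule runs_While)
      fix j assume j: "j < n"
      have S: "length (S3 j) = K1 + 3 + K2" "S3 j ! (K1 - 1) = (c, pos (n - j))" "S3 j ! (K1 + 1) = history (H n) (int n - 1 - int j)"
        using K by (auto simp: S3_def lT nth_list_update)
      have e: "int n - 1 - int j = int (n - Suc j)" using j by simp
      have sym: "tape_read (S3 j ! (K1 + 1)) = move_sym (mv (n - Suc j))"
      proof -
        have "nat (int n - 1 - int j) = n - Suc j" using j by linarith
        then show ?thesis unfolding S using lH j by (simp add: history_def H_def)
      qed
      have nz: "move_sym m \<noteq> 0" for m by (cases m) auto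
      show "map tape_read (S3 j) ! (K1 + 1) \<noteq> 0"
        using S(1) sym nz by simp
      show "runs b3 (S3 j) (S3 (Suc j)) 1"
        unfolding b3_def
      proof (rule runs_on_tapes)
        have "pos (n - j) = pos (n - Suc j) + move_dir (mv (n - Suc j))"
          using mv[of "n - Suc j"] j by (simp add: pos_def Suc_diff_Suc)
        then have "tape_act (tape_read (S3 j ! (K1 - 1))) (undo (tape_read (S3 j ! (K1 + 1)))) (S3 j ! (K1 - 1)) = (c, pos (n - Suc j))"
          unfolding tape_move sym unfolding S(2) by (cases "mv (n - Suc j)") (auto simp: undo_def)
        moreover have "tape_act (tape_read (S3 j ! (K1 + 1))) MoveL (S3 j ! (K1 + 1)) = history (H n) (int n - 1 - int (Suc j))"
          unfolding S(3) tape_move by (simp add: history_def)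
        ultimately show "S3 (Suc j) = (S3 j)[K1 - 1 := tape_act (tape_read (S3 j ! (K1 - 1))) (undo (tape_read (S3 j ! (K1 + 1)))) (S3 j ! (K1 - 1)),
            K1 + 1 := tape_act (tape_read (S3 j ! (K1 + 1))) MoveL (S3 j ! (K1 + 1))]"
          using K by (simp add: S3_def list_update_twice2)
      qed (use S K in auto)
    next
      have "S3 n ! (K1 + 1) = history (H n) (-1)" by (simp add: S3_def lT)
      then show "\<not> map tape_read (S3 n) ! (K1 + 1) \<noteq> 0" by (simp add: S3_def lT history_def)
    qed
    have p0: "pos 0 = 0"
    proof -
      have "\<forall>t\<in>set (input_tape (enc x) # replicate (ntapes M1 - 1) (input_tape [])). snd t = 0"
        by (auto simp: input_tape_def)
      then have "snd (last (input_tape (enc x) # replicate (ntapes M1 - 1) (input_tape []))) = 0"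
        by (rule bspec) (rule last_in_set, simp)
      then show ?thesis by (simp add: pos_def cf_def init_config_def)
    qed
    define T4 where "T4 = S3 n"
    have l4: "length T4 = K1 + 3 + K2" by (simp add: T4_def S3_def lT)
    have T4n: "T4 ! (K1 - 1) = (c, 0)" "T4 ! (K1 + 2) = cell 0" "T4 ! (K1 + 3) = bl" "drop (K1 + 3) T4 = replicate K2 bl"
      using K Tn by (auto simp: T4_def S3_def lT nth_list_update p0 drop_update_cancel T_def R_def ts(1) len)
    define S4 where "S4 j = T4[K1 - 1 := (c, int j), K1 + 3 := in_tape (take j y) j]" for j
    have sh: "c (int i) = bit_sym (y ! i)" if "i < length y" for i using ts(2) that by (simp add: tape_shows_def c_def)
    have she: "c (int (length y)) = 0" using ts(2) by (simp add: tape_shows_def c_def)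
    have bn: "bit_sym b \<noteq> 0" for b by (cases b) auto
    have S40: "T4 = S4 0"
    proof -
      have "in_tape (take 0 y) 0 = bl" by (simp add: in_tape_def bl_def input_tape_def)
      then show ?thesis unfolding S4_def using T4n by (metis int_eq_iff list_update_id of_nat_0)
    qed
    have 4: "runs c4 (S4 0) (S4 (length y)) (length y * Suc 1 + 1)"
      unfolding c4_def
    proof (rule runs_While)
      fix j assume j: "j < length y"
      have S: "length (S4 j) = K1 + 3 + K2" "S4 j ! (K1 - 1) = (c, int j)" "S4 j ! (K1 + 3) = in_tape (take j y) j"
        using K by (auto simp: S4_def l4 nth_list_update)
      show "map tape_read (S4 j) ! (K1 - 1) \<noteq> 0"
        using S sh[OF j] bn K by simp
      show "runs b4 (S4 j) (S4 (Suc j)) 1"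
        unfolding b4_def
      proof (rule runs_on_tapes)
        have "tape_act (tape_read (S4 j ! (K1 - 1))) MoveR (S4 j ! (K1 - 1)) = (c, int (Suc j))"
          unfolding tape_move S by simp
        moreover have "tape_act (tape_read (S4 j ! (K1 - 1))) MoveR (S4 j ! (K1 + 3)) = in_tape (take (Suc j) y) (Suc j)"
          unfolding S using sh[OF j] j by (auto simp: in_tape_def input_tape_def fun_eq_iff nth_append take_Suc_conv_app_nth)
        ultimately show "S4 (Suc j) = (S4 j)[K1 - 1 := tape_act (tape_read (S4 j ! (K1 - 1))) MoveR (S4 j ! (K1 - 1)),
            K1 + 3 := tape_act (tape_read (S4 j ! (K1 - 1))) MoveR (S4 j ! (K1 + 3))]"
          using K by (simp add: S4_def list_update_twice2)
      qed (use S K in auto)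
    next
      show "\<not> map tape_read (S4 (length y)) ! (K1 - 1) \<noteq> 0"
        using K she by (simp add: S4_def l4 nth_list_update)
    qed
    define T5 where "T5 = S4 (length y)"
    have l5: "length T5 = K1 + 3 + K2" by (simp add: T5_def S4_def l4)
    have T5n: "T5 ! (K1 + 3) = in_tape y (length y)" "T5 ! (K1 + 2) = cell 0"
        "drop (K1 + 3) T5 = (replicate K2 bl)[0 := in_tape y (length y)]"
      using K T4n by (auto simp: T5_def S4_def l4 nth_list_update drop_update_cancel drop_update_swap)
    define S6 where "S6 j = T5[K1 + 3 := (fst (input_tape y), int (length y) - 1 - int j)]" for j
    have 5: "runs (dec (K1 + 3)) T5 (S6 0) 1"
      unfolding dec_def by (rule runs_on_tape) (use K in \<open>simp_all add: tape_move l5 S6_def T5n in_tape_def\<close>)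
    have 6: "runs c6 (S6 0) (S6 (length y)) (length y * Suc 1 + 1)"
      unfolding c6_def
    proof (rule runs_While)
      fix j assume j: "j < length y"
      have e: "int (length y) - 1 - int j = int (length y - Suc j)" using j by simp
      have S: "length (S6 j) = K1 + 3 + K2" "S6 j ! (K1 + 3) = (fst (input_tape y), int (length y - Suc j))"
        using K j by (auto simp: S6_def l5 nth_list_update)
      show "map tape_read (S6 j) ! (K1 + 3) \<noteq> 0"
        using S K bn j by (simp add: input_tape_def)
      show "runs (dec (K1 + 3)) (S6 j) (S6 (Suc j)) 1"
        unfolding dec_def by (rule runs_on_tape) (use K in \<open>simp_all add: tape_move l5 S6_def\<close>)
    next
      show "\<not> map tape_read (S6 (length y)) ! (K1 + 3) \<noteq> 0"
        using K by (simp add: S6_def l5 input_tape_def)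
    qed
    define T7 where "T7 = T5[K1 + 3 := input_tape y]"
    have 7: "runs (inc (K1 + 3)) (S6 (length y)) T7 1"
      unfolding inc_def
    proof (rule runs_on_tape)
      have "S6 (length y) ! (K1 + 3) = (fst (input_tape y), -1)" using K by (simp add: S6_def l5)
      then have "tape_act (tape_read (S6 (length y) ! (K1 + 3))) MoveR (S6 (length y) ! (K1 + 3)) = input_tape y"
        unfolding tape_move by (simp add: input_tape_def)
      then show "T7 = (S6 (length y))[K1 + 3 := tape_act (fst (tape_read (S6 (length y) ! (K1 + 3)), MoveR))
          (snd (tape_read (S6 (length y) ! (K1 + 3)), MoveR)) (S6 (length y) ! (K1 + 3))]"
        by (simp add: T7_def S6_def)
    qed (use K in \<open>simp add: S6_def l5\<close>)
    have y: "\<phi> x \<in> D'" "y = enc' (\<phi> x)" using \<phi>[OF x] by (auto simp: y_def)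
    define cg where "cg i = (tm_step M2 ^^ i) (init_config M2 y)" for i
    obtain n' ts' where n': "n' \<le> poly p2 (length y)" and ts': "cg n' = (nstates M2, ts')" "tape_shows (last ts') (out' (\<phi> x))"
      and less': "\<And>j. j < n' \<Longrightarrow> fst (cg j) < nstates M2"
      using tm_computes_first_halt[OF M2(1) M2(2)[OF y(1)]] unfolding cg_def y(2) by metis
    have val': "valid_cfg M2 (length y) i (fst (cg i), snd (cg i))" for i
      using valid_steps[OF M2(1)] by (simp add: cg_def)
    have step': "tm_step M2 (fst (cg i), snd (cg i)) = (fst (cg (Suc i)), snd (cg (Suc i)))" for i
      by (simp add: cg_def)
    define Q where "Q = take (K1 + 2) T7"
    have lQ: "length Q = K1 + 2" using l5 by (simp add: Q_def T7_def)
    have T7: "T7 = Q @ [cell (fst (cg 0))] @ snd (cg 0)"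
    proof -
      have "T7 = take (K1 + 2) T7 @ T7 ! (K1 + 2) # drop (Suc (K1 + 2)) T7"
        by (rule id_take_nth_drop) (use l5 in \<open>simp add: T7_def\<close>)
      moreover have "T7 ! (K1 + 2) = cell 0" using T5n(2) by (simp add: T7_def)
      moreover have "Suc (K1 + 2) = K1 + 3" by simp
      moreover have "drop (K1 + 3) T7 = input_tape y # replicate (K2 - 1) bl"
        using T5n(3) K by (cases K2) (auto simp: T7_def drop_update_swap)
      ultimately have "T7 = Q @ cell 0 # input_tape y # replicate (K2 - 1) bl"
        unfolding Q_def by (simp only:)
      then show ?thesis by (simp add: cg_def init_config_def K2_def bl_def)
    qed
    have 8: "runs c8 (Q @ [cell (fst (cg 0))] @ snd (cg 0)) (Q @ [cell (fst (cg n'))] @ snd (cg n')) (n' * Suc 1 + 1)"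
      unfolding c8_def
    proof (rule runs_While[where S = "\<lambda>i. Q @ [cell (fst (cg i))] @ snd (cg i)"])
      fix i assume i: "i < n'"
      show "map tape_read (Q @ [cell (fst (cg i))] @ snd (cg i)) ! (K1 + 2) \<noteq> nstates M2"
        using less'[OF i] lQ by (simp add: nth_append cell_def)
      show "runs (sim_second (K1 + 2) M2) (Q @ [cell (fst (cg i))] @ snd (cg i)) (Q @ [cell (fst (cg (Suc i)))] @ snd (cg (Suc i))) 1"
        by (rule runs_sim_second[OF M2(1) val' less'[OF i] lQ step'])
    next
      show "\<not> map tape_read (Q @ [cell (fst (cg n'))] @ snd (cg n')) ! (K1 + 2) \<noteq> nstates M2"
        using ts'(1) lQ by (simp add: nth_append cell_def)
    qed
    have "runs cc (input_tape (enc x) # replicate (K1 + 3 + K2 - 1) (input_tape []))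
      (Q @ [cell (fst (cg n'))] @ snd (cg n')) (n * Suc 1 + 1 + (1 + ((n * Suc 1 + 1) + ((length y * Suc 1 + 1) +
        (1 + ((length y * Suc 1 + 1) + (1 + (n' * Suc 1 + 1))))))))"
      unfolding cc_def init
      using runs_Seq[OF 1[folded T_def] runs_Seq[OF 2 runs_Seq[OF 3 runs_Seq[OF 4[folded S40, unfolded T4_def, folded T5_def]
        runs_Seq[OF 5 runs_Seq[OF 6 runs_Seq[OF 7 8[folded T7]]]]]]]] unfolding T_def .
    moreover have "n' \<le> poly p2 (?L + poly p1 ?L)" using n' poly_mono_nat[OF ly, of p2] by simp
    then have "n * Suc 1 + 1 + (1 + ((n * Suc 1 + 1) + ((length y * Suc 1 + 1) +
        (1 + ((length y * Suc 1 + 1) + (1 + (n' * Suc 1 + 1))))))) \<le> poly P ?L"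
      using n ly by (simp add: P_def poly_pcompose)
    ultimately have "runs cc (input_tape (enc x) # replicate (K1 + 3 + K2 - 1) (input_tape []))
      (Q @ [cell (fst (cg n'))] @ snd (cg n')) (poly P ?L)" by (rule runs_mono)
    moreover have "last (Q @ [cell (fst (cg n'))] @ snd (cg n')) = last ts'"
      using val'[of n'] ts'(1) K by (auto simp: valid_cfg_def K2_def)
    ultimately show "\<exists>ts. tape_shows (last ts) (out' (\<phi> x)) \<and>
        runs cc (input_tape (enc x) # replicate (K1 + 3 + K2 - 1) (input_tape [])) ts (poly P ?L)"
      using ts'(2) by (intro exI[of _ "Q @ [cell (fst (cg n'))] @ snd (cg n')"]) simp
  qed
qed

section \<open>Biased product measures on the subsets of a finite set\<close>

definition weight :: "real \<Rightarrow> 'a set \<Rightarrow> 'a set \<Rightarrow> real" where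
  "weight q A F = q ^ card F * (1 - q) ^ card (A - F)"

definition expect :: "real \<Rightarrow> 'a set \<Rightarrow> ('a set \<Rightarrow> real) \<Rightarrow> real" where
  "expect q A f = (\<Sum>F\<in>Pow A. weight q A F * f F)"

lemma expect_empty [simp]: "expect q {} f = f {}"
  by (simp add: expect_def weight_def)

text \<open>Conditioning on the single coordinate \<open>a\<close>; the later inductions over the
  ground set rest on this.\<close>

lemma expect_insert:
  assumes "finite A" "a \<notin> A"
  shows "expect q (insert a A) f = q * expect q A (\<lambda>F. f (insert a F)) + (1 - q) * expect q A f"
proof -
  have inj: "inj_on (insert a) (Pow A)" using assms(2) by (auto simp: inj_on_def)
  have disj: "Pow A \<inter> insert a ` Pow A = {}" using assms(2) by auto
  have 1: "weight q (insert a A) F = (1 - q) * weight q A F" if "F \<in> Pow A" for F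
  proof -
    have "insert a A - F = insert a (A - F)" using that assms(2) by auto
    then show ?thesis using assms by (simp add: weight_def)
  qed
  have 2: "weight q (insert a A) (insert a F) = q * weight q A F" if "F \<in> Pow A" for F
  proof -
    have "insert a A - insert a F = A - F" using assms(2) by auto
    moreover have "card (insert a F) = Suc (card F)"
      using that assms by (auto intro: card_insert_disjoint finite_subset)
    ultimately show ?thesis by (simp add: weight_def)
  qed
  have "expect q (insert a A) f = (\<Sum>F\<in>Pow A. weight q (insert a A) F * f F) +
      (\<Sum>F\<in>insert a ` Pow A. weight q (insert a A) F * f F)"
    unfolding expect_def Pow_insert using assms(1) disj by (intro sum.union_disjoint) auto
  also have "(\<Sum>F\<in>insert a ` Pow A. weight q (insert a A) F * f F) = q * expect q A (\<lambda>F. f (insert a F))"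
    unfolding sum.reindex[OF inj] expect_def sum_distrib_left o_def
    by (rule sum.cong) (auto simp: 2)
  also have "(\<Sum>F\<in>Pow A. weight q (insert a A) F * f F) = (1 - q) * expect q A f"
    unfolding expect_def sum_distrib_left by (rule sum.cong) (auto simp: 1)
  finally show ?thesis by simp
qed

lemma expect_cong: "(\<And>F. F \<subseteq> A \<Longrightarrow> f F = g F) \<Longrightarrow> expect q A f = expect q A g"
  unfolding expect_def by (rule sum.cong) auto

lemma expect_add: "expect q A (\<lambda>F. f F + g F) = expect q A f + expect q A g"
  by (simp add: expect_def algebra_simps sum.distrib)

lemma expect_diff: "expect q A (\<lambda>F. f F - g F) = expect q A f - expect q A g"
  by (simp add: expect_def algebra_simps sum_subtractf)

lemma expect_cmult: "expect q A (\<lambda>F. c * f F) = c * expect q A f"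
  by (simp add: expect_def sum_distrib_left algebra_simps)

lemma expect_sum: "expect q A (\<lambda>F. \<Sum>i\<in>I. f i F) = (\<Sum>i\<in>I. expect q A (f i))"
  unfolding expect_def sum_distrib_left by (rule sum.swap)

lemma weight_nonneg: "0 \<le> q \<Longrightarrow> q \<le> 1 \<Longrightarrow> 0 \<le> weight q A F"
  by (simp add: weight_def)

lemma expect_mono:
  assumes "0 \<le> q" "q \<le> 1" "\<And>F. F \<subseteq> A \<Longrightarrow> f F \<le> g F"
  shows "expect q A f \<le> expect q A g"
  unfolding expect_def using assms by (intro sum_mono mult_left_mono weight_nonneg) auto

lemma expect_const: "finite A \<Longrightarrow> expect q A (\<lambda>_. c) = c"
  by (induction A rule: finite_induct) (auto simp: expect_insert algebra_simps)

lemma expect_nonneg: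
  assumes "0 \<le> q" "q \<le> 1" "\<And>F. F \<subseteq> A \<Longrightarrow> 0 \<le> f F"
  shows "0 \<le> expect q A f"
  unfolding expect_def using assms by (intro sum_nonneg mult_nonneg_nonneg weight_nonneg) auto

lemma expect_union:
  assumes "finite A" "finite B" "A \<inter> B = {}"
  shows "expect q (A \<union> B) f = expect q A (\<lambda>F. expect q B (\<lambda>G. f (F \<union> G)))"
  using assms(1,3)
proof (induction A arbitrary: f rule: finite_induct)
  case (insert a A)
  then have "expect q (insert a A \<union> B) f = q * expect q (A \<union> B) (\<lambda>F. f (insert a F)) + (1 - q) * expect q (A \<union> B) f"
    using assms(2) by (simp add: expect_insert)
  then show ?case using insert by (simp add: expect_insert)
qed simp

lemma expect_Cauchy_Schwarz:
  assumes "0 \<le> q" "q \<le> 1"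
  shows "(expect q A (\<lambda>F. f F * g F))\<^sup>2 \<le> expect q A (\<lambda>F. (f F)\<^sup>2) * expect q A (\<lambda>F. (g F)\<^sup>2)"
proof -
  define X where "X = expect q A (\<lambda>F. (f F)\<^sup>2)"
  define Y where "Y = expect q A (\<lambda>F. (g F)\<^sup>2)"
  define Z where "Z = expect q A (\<lambda>F. f F * g F)"
  \<comment> \<open>The quadratic form of the second moments is nonnegative. Evaluated at
    \<open>(Y, - Z)\<close> or \<open>(- Z, X)\<close> it gives the claim multiplied by
    \<open>Y\<close> or \<open>X\<close>, hence the case distinction; if both vanish, the points
    \<open>(1, 1)\<close> and \<open>(1, -1)\<close> force \<open>Z = 0\<close>.\<close>
  have quad: "0 \<le> a\<^sup>2 * X + 2 * a * b * Z + b\<^sup>2 * Y" for a b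
  proof -
    have "0 \<le> expect q A (\<lambda>F. (a * f F + b * g F)\<^sup>2)" by (rule expect_nonneg[OF assms]) auto
    also have "\<dots> = expect q A (\<lambda>F. a\<^sup>2 * (f F)\<^sup>2 + (2 * a * b) * (f F * g F) + b\<^sup>2 * (g F)\<^sup>2)"
      by (rule expect_cong) (simp add: power2_eq_square algebra_simps)
    finally show ?thesis by (simp add: expect_add expect_cmult X_def Y_def Z_def)
  qed
  have XY: "0 \<le> X" "0 \<le> Y" unfolding X_def Y_def by (rule expect_nonneg[OF assms]; simp)+
  consider "0 < Y" | "0 < X" | "X = 0" "Y = 0" using XY by linarith
  then have "Z\<^sup>2 \<le> X * Y"
  proof cases
    case 1
    have "0 \<le> Y * (X * Y - Z\<^sup>2)" using quad[of Y "- Z"] by (simp add: power2_eq_square algebra_simps)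
    then show ?thesis using 1 by (simp add: zero_le_mult_iff)
  next
    case 2
    have "0 \<le> X * (X * Y - Z\<^sup>2)" using quad[of "- Z" X] by (simp add: power2_eq_square algebra_simps)
    then show ?thesis using 2 by (simp add: zero_le_mult_iff)
  next
    case 3
    then show ?thesis using quad[of 1 1] quad[of 1 "-1"] by simp
  qed
  then show ?thesis by (simp add: X_def Y_def Z_def)
qed

lemma expect_mono_bias:
  assumes "finite A" "0 \<le> q" "q \<le> q'" "q' \<le> 1" "\<And>F G. F \<subseteq> G \<Longrightarrow> G \<subseteq> A \<Longrightarrow> f F \<le> f G"
  shows "expect q A f \<le> expect q' A f"
  using assms(1,5)
proof (induction A arbitrary: f rule: finite_induct)
  case (insert a A)
  have 1: "expect q A (\<lambda>F. f (insert a F)) \<le> expect q' A (\<lambda>F. f (insert a F))"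
    by (rule insert.IH) (use insert.prems in \<open>auto intro!: insert.prems\<close>)
  have 2: "expect q A f \<le> expect q' A f"
    by (rule insert.IH) (use insert.prems in \<open>auto intro!: insert.prems\<close>)
  have 3: "expect q A f \<le> expect q A (\<lambda>F. f (insert a F))"
    by (rule expect_mono) (use assms in \<open>auto intro!: insert.prems\<close>)
  have "q * expect q A (\<lambda>F. f (insert a F)) + (1 - q) * expect q A f
     \<le> q' * expect q A (\<lambda>F. f (insert a F)) + (1 - q') * expect q A f"
    using mult_mono[OF assms(3) 3] mult_nonneg_nonneg[of "q' - q" "expect q A (\<lambda>F. f (insert a F)) - expect q A f"] assms 3
    by (simp add: algebra_simps)
  also have "\<dots> \<le> q' * expect q' A (\<lambda>F. f (insert a F)) + (1 - q') * expect q' A f"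
    using 1 2 assms by (intro add_mono mult_left_mono) auto
  finally show ?case using insert by (simp add: expect_insert)
qed simp

section \<open>Influences and Russo's formula\<close>

definition influence :: "real \<Rightarrow> 'a set \<Rightarrow> ('a set \<Rightarrow> real) \<Rightarrow> 'a \<Rightarrow> real" where
  "influence q A f i = expect q (A - {i}) (\<lambda>F. f (insert i F) - f F)"

text \<open>Russo's formula, here for arbitrary functions: after conditioning on \<open>a\<close>
  the product rule yields the influence of \<open>a\<close> plus the mixture of the derivatives for
  the two restrictions.\<close>

lemma expect_has_derivative:
  assumes "finite A"
  shows "((\<lambda>q. expect q A f) has_real_derivative (\<Sum>i\<in>A. influence q A f i)) (at q)"
  using assms
proof (induction A arbitrary: f rule: finite_induct)
  case (insert a A)
  let ?g = "\<lambda>F. f (insert a F)"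
  have "((\<lambda>q. q * expect q A ?g + (1 - q) * expect q A f) has_real_derivative
     (expect q A ?g + q * (\<Sum>i\<in>A. influence q A ?g i)) + (- expect q A f + (1 - q) * (\<Sum>i\<in>A. influence q A f i))) (at q)"
    by (auto intro!: derivative_eq_intros insert.IH)
  moreover have "influence q (insert a A) f a = expect q A ?g - expect q A f"
    using insert.hyps by (simp add: influence_def expect_diff)
  moreover have "influence q (insert a A) f i = q * influence q A ?g i + (1 - q) * influence q A f i" if "i \<in> A" for i
  proof -
    have "insert a A - {i} = insert a (A - {i})" using that insert.hyps by auto
    then show ?thesis using insert.hyps that by (simp add: influence_def expect_insert insert_commute)
  qed
  then have "(\<Sum>i\<in>A. influence q (insert a A) f i) = q * (\<Sum>i\<in>A. influence q A ?g i) + (1 - q) * (\<Sum>i\<in>A. influence q A f i)"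
    by (simp add: sum.distrib sum_distrib_left)
  ultimately show ?case unfolding expect_insert[OF insert.hyps]
    using insert.hyps by (elim DERIV_cong) simp
qed simp

section \<open>Biased Fourier analysis\<close>

definition dev :: "real \<Rightarrow> real" where "dev q = sqrt (q * (1 - q))"

text \<open>The normalised coordinate: for \<open>0 < q < 1\<close> it has mean 0 and variance 1 at
  bias \<open>q\<close>, and its products \<open>char\<close> are orthonormal.\<close>

definition digit_char :: "real \<Rightarrow> bool \<Rightarrow> real" where
  "digit_char q b = (if b then (1 - q) / dev q else - q / dev q)"

definition char :: "real \<Rightarrow> 'a set \<Rightarrow> 'a set \<Rightarrow> real" where
  "char q S F = (\<Prod>i\<in>S. digit_char q (i \<in> F))"

definition fourier :: "real \<Rightarrow> 'a set \<Rightarrow> ('a set \<Rightarrow> real) \<Rightarrow> 'a set \<Rightarrow> real" where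
  "fourier q A f S = expect q A (\<lambda>F. f F * char q S F)"

definition pol :: "real \<Rightarrow> 'a set \<Rightarrow> ('a set \<Rightarrow> real) \<Rightarrow> 'a set \<Rightarrow> real" where
  "pol q A w F = (\<Sum>S\<in>Pow A. w S * char q S F)"

lemma dev_sq: "0 < q \<Longrightarrow> q < 1 \<Longrightarrow> (dev q)\<^sup>2 = q * (1 - q)"
  by (simp add: dev_def)

lemma dev_pos: "0 < q \<Longrightarrow> q < 1 \<Longrightarrow> 0 < dev q"
  by (simp add: dev_def)

lemma char_insert_notin: "a \<notin> S \<Longrightarrow> char q S (insert a F) = char q S F"
  unfolding char_def by (rule prod.cong) (auto intro!: arg_cong[where f = "digit_char q"])

lemma char_insert: "finite S \<Longrightarrow> a \<notin> S \<Longrightarrow> char q (insert a S) F = digit_char q (a \<in> F) * char q S F"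
  by (simp add: char_def)

lemma sum_Pow_insert:
  assumes "finite A" "a \<notin> A"
  shows "(\<Sum>S\<in>Pow (insert a A). g S) = (\<Sum>S\<in>Pow A. g S) + (\<Sum>S\<in>Pow A. g (insert a S) :: real)"
proof -
  have inj: "inj_on (insert a) (Pow A)" using assms(2) by (auto simp: inj_on_def)
  have disj: "Pow A \<inter> insert a ` Pow A = {}" using assms(2) by auto
  show ?thesis unfolding Pow_insert using assms(1) disj
    by (subst sum.union_disjoint) (auto simp: sum.reindex[OF inj])
qed

text \<open>Coefficients split by whether the set contains \<open>a\<close>: those without it belong
  to the average over the coordinate \<open>a\<close>, those with it to \<open>dev q\<close> times
  the derivative in direction \<open>a\<close>. The second half is what turns influences into
  Fourier weight.\<close>

lemma fourier_insert:
  assumes "finite A" "a \<notin> A" "S \<subseteq> A" "0 < q" "q < 1"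
  shows "fourier q (insert a A) f S = fourier q A (\<lambda>F. q * f (insert a F) + (1 - q) * f F) S"
    and "fourier q (insert a A) f (insert a S) = fourier q A (\<lambda>F. dev q * (f (insert a F) - f F)) S"
proof -
  have aS: "a \<notin> S" "finite S" using assms finite_subset by auto
  show "fourier q (insert a A) f S = fourier q A (\<lambda>F. q * f (insert a F) + (1 - q) * f F) S"
    unfolding fourier_def using assms(1,2) aS
    by (simp add: expect_insert char_insert_notin expect_add[symmetric] expect_cmult[symmetric] algebra_simps)
  have 1: "q * digit_char q True = dev q" "(1 - q) * digit_char q False = - dev q"
    using dev_pos[OF assms(4,5)] dev_sq[OF assms(4,5)]
    by (simp_all add: digit_char_def field_simps power2_eq_square)
  have "fourier q (insert a A) f (insert a S) =
      q * expect q A (\<lambda>F. f (insert a F) * (digit_char q True * char q S F)) +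
      (1 - q) * expect q A (\<lambda>F. f F * (digit_char q False * char q S F))"
    unfolding fourier_def expect_insert[OF assms(1,2)]
  proof (intro arg_cong2[where f = "(+)"] arg_cong2[where f = "(*)"] refl expect_cong)
    fix F assume "F \<subseteq> A"
    then have "a \<notin> F" using assms(2) by auto
    then show "char q (insert a S) (insert a F) = digit_char q True * char q S F"
      "char q (insert a S) F = digit_char q False * char q S F"
      using aS by (simp_all add: char_insert char_insert_notin)
  qed
  also have "\<dots> = (q * digit_char q True) * expect q A (\<lambda>F. f (insert a F) * char q S F) +
      ((1 - q) * digit_char q False) * expect q A (\<lambda>F. f F * char q S F)"
    by (simp add: expect_cmult[symmetric] algebra_simps)
  also have "\<dots> = fourier q A (\<lambda>F. dev q * (f (insert a F) - f F)) S"
    unfolding 1 fourier_def by (simp add: mult.assoc expect_cmult left_diff_distrib expect_diff right_diff_distrib)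
  finally show "fourier q (insert a A) f (insert a S) = fourier q A (\<lambda>F. dev q * (f (insert a F) - f F)) S" .
qed

lemma Parseval:
  assumes "finite A" "0 < q" "q < 1"
  shows "(\<Sum>S\<in>Pow A. (fourier q A f S)\<^sup>2) = expect q A (\<lambda>F. (f F)\<^sup>2)"
  using assms(1)
proof (induction A arbitrary: f rule: finite_induct)
  case empty
  then show ?case by (simp add: fourier_def char_def)
next
  case (insert a A)
  let ?g = "\<lambda>F. q * f (insert a F) + (1 - q) * f F"
  let ?h = "\<lambda>F. dev q * (f (insert a F) - f F)"
  have "(\<Sum>S\<in>Pow (insert a A). (fourier q (insert a A) f S)\<^sup>2) =
      (\<Sum>S\<in>Pow A. (fourier q A ?g S)\<^sup>2) + (\<Sum>S\<in>Pow A. (fourier q A ?h S)\<^sup>2)"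
    unfolding sum_Pow_insert[OF insert.hyps] using insert.hyps assms(2,3)
    by (intro arg_cong2[where f = "(+)"] sum.cong refl) (auto simp: fourier_insert)
  also have "\<dots> = expect q A (\<lambda>F. (?g F)\<^sup>2 + (?h F)\<^sup>2)" by (simp add: insert.IH expect_add)
  \<comment> \<open>For each \<open>F\<close>, the second moment of a two-point variable is its
    squared mean plus its variance.\<close>
  also have "\<dots> = expect q A (\<lambda>F. q * (f (insert a F))\<^sup>2 + (1 - q) * (f F)\<^sup>2)"
  proof (rule expect_cong)
    fix F
    show "(?g F)\<^sup>2 + (?h F)\<^sup>2 = q * (f (insert a F))\<^sup>2 + (1 - q) * (f F)\<^sup>2"
      unfolding power_mult_distrib dev_sq[OF assms(2,3)] by (simp add: power2_eq_square algebra_simps)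
  qed
  also have "\<dots> = expect q (insert a A) (\<lambda>F. (f F)\<^sup>2)"
    using insert.hyps by (simp add: expect_insert expect_add expect_cmult)
  finally show ?case .
qed

section \<open>Low-degree polynomials and Bonami's lemma\<close>

lemma pol_insert:
  assumes "finite A" "a \<notin> A" "F \<subseteq> A"
  shows "pol q (insert a A) w F = pol q A w F + digit_char q False * pol q A (\<lambda>S. w (insert a S)) F"
    and "pol q (insert a A) w (insert a F) = pol q A w F + digit_char q True * pol q A (\<lambda>S. w (insert a S)) F"
proof -
  have "w (insert a S) * char q (insert a S) F = digit_char q False * (w (insert a S) * char q S F)"
    "w S * char q S (insert a F) = w S * char q S F"
    "w (insert a S) * char q (insert a S) (insert a F) = digit_char q True * (w (insert a S) * char q S F)"
    if "S \<in> Pow A" for S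
  proof -
    have aS: "a \<notin> S" "finite S" "a \<notin> F" using that assms finite_subset by auto
    then show "w (insert a S) * char q (insert a S) F = digit_char q False * (w (insert a S) * char q S F)"
      "w S * char q S (insert a F) = w S * char q S F"
      "w (insert a S) * char q (insert a S) (insert a F) = digit_char q True * (w (insert a S) * char q S F)"
      by (simp_all add: char_insert char_insert_notin)
  qed
  then show "pol q (insert a A) w F = pol q A w F + digit_char q False * pol q A (\<lambda>S. w (insert a S)) F"
    "pol q (insert a A) w (insert a F) = pol q A w F + digit_char q True * pol q A (\<lambda>S. w (insert a S)) F"
    unfolding pol_def sum_Pow_insert[OF assms(1,2)] sum_distrib_left
    by (auto intro!: arg_cong2[where f = "(+)"] sum.cong)
qed

text \<open>Both higher moments are governed by \<open>q * (1 - q)\<close>, which is at least 3/16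
  for \<open>q\<close> in \<open>[1/4, 1/2]\<close>; the bounds 4/3 and 7/3 are the values at
  \<open>q = 1/4\<close>.\<close>

lemma digit_char_moments:
  assumes "1/4 \<le> q" "q \<le> 1/2"
  defines "u \<equiv> digit_char q True" and "v \<equiv> digit_char q False"
  shows "q * u + (1 - q) * v = 0" "q * u\<^sup>2 + (1 - q) * v\<^sup>2 = 1"
    "(q * u ^ 3 + (1 - q) * v ^ 3)\<^sup>2 \<le> 4/3" "q * u ^ 4 + (1 - q) * v ^ 4 \<le> 7/3"
proof -
  have q: "0 < q" "q < 1" using assms by auto
  note s = dev_pos[OF q] and s2 = dev_sq[OF q]
  have s4: "dev q ^ 4 = (q * (1 - q))\<^sup>2" using s2 by (metis power2_eq_square power4_eq_xxxx mult.assoc)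
  show "q * u + (1 - q) * v = 0" using s by (simp add: u_def v_def digit_char_def field_simps)
  have "q * u\<^sup>2 + (1 - q) * v\<^sup>2 = (q * (1 - q)\<^sup>2 + (1 - q) * q\<^sup>2) / (dev q)\<^sup>2"
    by (simp add: u_def v_def digit_char_def power_divide add_divide_distrib)
  also have "q * (1 - q)\<^sup>2 + (1 - q) * q\<^sup>2 = q * (1 - q)" by (simp add: power2_eq_square algebra_simps)
  finally show "q * u\<^sup>2 + (1 - q) * v\<^sup>2 = 1" using q by (simp add: s2)
  have lo: "3/16 \<le> q * (1 - q)"
  proof -
    have "0 \<le> (q - 1/4) * (3/4 - q)" using assms by (intro mult_nonneg_nonneg) auto
    then show ?thesis by (simp add: field_simps)
  qed
  have "q * u ^ 3 + (1 - q) * v ^ 3 = (q * (1 - q) ^ 3 - (1 - q) * q ^ 3) / dev q ^ 3"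
  proof -
    have "u ^ 3 = (1 - q) ^ 3 / dev q ^ 3" "v ^ 3 = - (q ^ 3 / dev q ^ 3)"
      by (simp_all add: u_def v_def digit_char_def power_divide)
    then show ?thesis by (simp only: diff_divide_distrib) simp
  qed
  also have "q * (1 - q) ^ 3 - (1 - q) * q ^ 3 = (1 - 2 * q) * (dev q)\<^sup>2"
    unfolding s2 by (simp add: power2_eq_square power3_eq_cube algebra_simps)
  also have "(1 - 2 * q) * (dev q)\<^sup>2 / dev q ^ 3 = (1 - 2 * q) / dev q"
    using s by (simp add: power2_eq_square power3_eq_cube)
  finally have "(q * u ^ 3 + (1 - q) * v ^ 3)\<^sup>2 = (1 - 2 * q)\<^sup>2 / (q * (1 - q))"
    by (simp add: power_divide s2)
  also have "\<dots> \<le> 4/3"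
  proof -
    have "(1 - 2 * q)\<^sup>2 = 1 - 4 * (q * (1 - q))" by (simp add: power2_eq_square algebra_simps)
    then have "(1 - 2 * q)\<^sup>2 \<le> 4/3 * (q * (1 - q))" using lo by simp
    then show ?thesis using q by (simp add: pos_divide_le_eq)
  qed
  finally show "(q * u ^ 3 + (1 - q) * v ^ 3)\<^sup>2 \<le> 4/3" .
  have "q * u ^ 4 + (1 - q) * v ^ 4 = (q * (1 - q) ^ 4 + (1 - q) * q ^ 4) / dev q ^ 4"
    by (simp add: u_def v_def digit_char_def power_divide add_divide_distrib)
  also have "q * (1 - q) ^ 4 + (1 - q) * q ^ 4 = (q * (1 - q)) * (1 - 3 * (q * (1 - q)))"
    by (simp add: power4_eq_xxxx algebra_simps)
  also have "(q * (1 - q)) * (1 - 3 * (q * (1 - q))) / dev q ^ 4 = (1 - 3 * (q * (1 - q))) / (q * (1 - q))"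
    unfolding s4 using q by (simp add: power2_eq_square)
  also have "\<dots> \<le> 7/3" using q lo by (simp add: pos_divide_le_eq)
  finally show "q * u ^ 4 + (1 - q) * v ^ 4 \<le> 7/3" .
qed

text \<open>The third moment of a biased coordinate need not vanish; its cross term is absorbed by
  two squares, so the mixed term gets the coefficient \<open>6 + 2\<close> and the last one
  \<open>8/3 + 7/3\<close>, below 16. The constants 8 and 16 are those that complete the square
  \<open>16 ^ d * (G + H)^2\<close> in the induction that follows.\<close>

lemma two_point_fourth_moment:
  assumes "1/4 \<le> q" "q \<le> 1/2"
  shows "q * (g + digit_char q True * h) ^ 4 + (1 - q) * (g + digit_char q False * h) ^ 4
    \<le> g ^ 4 + 8 * (g\<^sup>2 * h\<^sup>2) + 16 * h ^ 4"
proof -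
  define u where "u = digit_char q True"
  define v where "v = digit_char q False"
  define k3 where "k3 = q * u ^ 3 + (1 - q) * v ^ 3"
  define k4 where "k4 = q * u ^ 4 + (1 - q) * v ^ 4"
  have m: "q * u + (1 - q) * v = 0" "q * u\<^sup>2 + (1 - q) * v\<^sup>2 = 1" "k3\<^sup>2 \<le> 4/3" "k4 \<le> 7/3"
    unfolding k3_def k4_def u_def v_def by (rule digit_char_moments[OF assms])+
  have "q * (g + u * h) ^ 4 + (1 - q) * (g + v * h) ^ 4 =
      g ^ 4 + 4 * g ^ 3 * h * (q * u + (1 - q) * v) + 6 * g\<^sup>2 * h\<^sup>2 * (q * u\<^sup>2 + (1 - q) * v\<^sup>2)
      + 4 * g * h ^ 3 * k3 + h ^ 4 * k4"
    unfolding k3_def k4_def by (simp add: power4_eq_xxxx power3_eq_cube power2_eq_square algebra_simps)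
  also have "\<dots> = g ^ 4 + 6 * g\<^sup>2 * h\<^sup>2 + 4 * g * h ^ 3 * k3 + h ^ 4 * k4" by (simp add: m(1,2))
  also have "4 * g * h ^ 3 * k3 \<le> 2 * (g\<^sup>2 * h\<^sup>2) + 2 * k3\<^sup>2 * h ^ 4"
  proof -
    have "0 \<le> 2 * (g * h - k3 * h\<^sup>2)\<^sup>2" by simp
    then show ?thesis by (simp add: power4_eq_xxxx power3_eq_cube power2_eq_square algebra_simps)
  qed
  also have "2 * k3\<^sup>2 * h ^ 4 \<le> 2 * (4/3) * h ^ 4" using m(3) by (intro mult_right_mono) auto
  also have "h ^ 4 * k4 \<le> h ^ 4 * (7/3)" using m(4) by (intro mult_left_mono) auto
  finally have "q * (g + u * h) ^ 4 + (1 - q) * (g + v * h) ^ 4 \<le>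
    g ^ 4 + 6 * g\<^sup>2 * h\<^sup>2 + (2 * (g\<^sup>2 * h\<^sup>2) + 2 * (4/3) * h ^ 4) + h ^ 4 * (7/3)" by simp
  moreover have "0 \<le> h ^ 4" by simp
  ultimately show ?thesis unfolding u_def v_def by linarith
qed

text \<open>Induction on the ground set. The part containing \<open>a\<close> has degree lower by
  one, which pays for the factor 16; Cauchy-Schwarz bounds the mixed term by the two fourth moments
  already known.\<close>

lemma hypercontractive:
  assumes "finite A" "1/4 \<le> q" "q \<le> 1/2" "\<And>S. S \<subseteq> A \<Longrightarrow> d < card S \<Longrightarrow> w S = 0"
  shows "expect q A (\<lambda>F. (pol q A w F) ^ 4) \<le> 16 ^ d * (\<Sum>S\<in>Pow A. (w S)\<^sup>2)\<^sup>2"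
  using assms(1,4)
proof (induction A arbitrary: w d rule: finite_induct)
  case empty
  have "1 * (w {}) ^ 4 \<le> 16 ^ d * (w {}) ^ 4" by (intro mult_right_mono) auto
  then show ?case by (simp add: pol_def char_def)
next
  case (insert a A)
  have q: "0 \<le> q" "q \<le> 1" using assms by auto
  let ?w = "\<lambda>S. w (insert a S)"
  let ?g = "pol q A w" and ?h = "pol q A ?w"
  let ?G = "\<Sum>S\<in>Pow A. (w S)\<^sup>2" and ?H = "\<Sum>S\<in>Pow A. (?w S)\<^sup>2"
  have G0: "0 \<le> ?G" "0 \<le> ?H" by (auto intro: sum_nonneg)
  have cs: "card (insert a S) = Suc (card S)" if "S \<subseteq> A" for S
    using that insert.hyps by (meson card_insert_disjoint finite_subset subsetD)
  have g4: "expect q A (\<lambda>F. (?g F) ^ 4) \<le> 16 ^ d * ?G\<^sup>2"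
    by (rule insert.IH) (use insert.prems in auto)
  have "expect q (insert a A) (\<lambda>F. (pol q (insert a A) w F) ^ 4) =
      expect q A (\<lambda>F. q * (?g F + digit_char q True * ?h F) ^ 4 + (1 - q) * (?g F + digit_char q False * ?h F) ^ 4)"
    unfolding expect_insert[OF insert.hyps] expect_cmult[symmetric] expect_add[symmetric]
    by (rule expect_cong) (simp add: pol_insert[OF insert.hyps])
  also have "\<dots> \<le> expect q A (\<lambda>F. (?g F) ^ 4 + 8 * ((?g F)\<^sup>2 * (?h F)\<^sup>2) + 16 * (?h F) ^ 4)"
    using q assms by (intro expect_mono two_point_fourth_moment) auto
  also have "\<dots> = expect q A (\<lambda>F. (?g F) ^ 4) + 8 * expect q A (\<lambda>F. (?g F)\<^sup>2 * (?h F)\<^sup>2) + 16 * expect q A (\<lambda>F. (?h F) ^ 4)"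
    by (simp add: expect_add expect_cmult)
  also have "\<dots> \<le> 16 ^ d * (?G + ?H)\<^sup>2"
  proof (cases d)
    case 0
    have "?w S = 0" if "S \<in> Pow A" for S using insert.prems[of "insert a S"] that cs[of S] 0 by auto
    then have "?h F = 0" "?H = 0" for F by (simp_all add: pol_def)
    then show ?thesis using g4 expect_const[OF insert.hyps(1), of q 0] by simp
  next
    case (Suc d')
    have h4: "expect q A (\<lambda>F. (?h F) ^ 4) \<le> 16 ^ d' * ?H\<^sup>2"
    proof (rule insert.IH)
      fix S assume "S \<subseteq> A" "d' < card S"
      then show "?w S = 0" using insert.prems[of "insert a S"] cs[of S] Suc by auto
    qed
    let ?X = "expect q A (\<lambda>F. (?g F)\<^sup>2 * (?h F)\<^sup>2)"
    have "?X\<^sup>2 \<le> expect q A (\<lambda>F. ((?g F)\<^sup>2)\<^sup>2) * expect q A (\<lambda>F. ((?h F)\<^sup>2)\<^sup>2)"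
      by (rule expect_Cauchy_Schwarz[OF q])
    also have "\<dots> = expect q A (\<lambda>F. (?g F) ^ 4) * expect q A (\<lambda>F. (?h F) ^ 4)" by simp
    also have "\<dots> \<le> (16 ^ d * ?G\<^sup>2) * (16 ^ d' * ?H\<^sup>2)"
      using g4 h4 q by (intro mult_mono expect_nonneg) auto
    also have "\<dots> = (4 * 16 ^ d' * (?G * ?H))\<^sup>2"
      by (simp add: Suc power_mult_distrib power2_eq_square algebra_simps)
    finally have "?X \<le> 4 * 16 ^ d' * (?G * ?H)"
      by (rule power2_le_imp_le) (use G0 in auto)
    then have "expect q A (\<lambda>F. (?g F) ^ 4) + 8 * ?X + 16 * expect q A (\<lambda>F. (?h F) ^ 4)
      \<le> 16 ^ d * ?G\<^sup>2 + 8 * (4 * 16 ^ d' * (?G * ?H)) + 16 * (16 ^ d' * ?H\<^sup>2)"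
      using g4 h4 by linarith
    also have "\<dots> = 16 ^ d * (?G + ?H)\<^sup>2"
      by (simp add: Suc power2_eq_square algebra_simps)
    finally show ?thesis .
  qed
  finally show ?case unfolding sum_Pow_insert[OF insert.hyps] .
qed

section \<open>Fourier weight outside the influential coordinates\<close>

lemma fourier_remove:
  assumes "finite A" "i \<in> A" "S \<subseteq> A - {i}" "0 < q" "q < 1"
  shows "fourier q A f (insert i S) = fourier q (A - {i}) (\<lambda>F. dev q * (f (insert i F) - f F)) S"
proof -
  have "A = insert i (A - {i})" using assms(2) by auto
  then show ?thesis using fourier_insert(2)[of "A - {i}" i S q f] assms by simp
qed

lemma sum_Pow_member:
  assumes "finite A" "i \<in> A"
  shows "(\<Sum>S\<in>{S\<in>Pow A. i \<in> S}. g S :: real) = (\<Sum>S\<in>Pow (A - {i}). g (insert i S))"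
proof -
  have "inj_on (insert i) (Pow (A - {i}))" by (auto simp: inj_on_def)
  moreover have "{S\<in>Pow A. i \<in> S} = insert i ` Pow (A - {i})"
  proof (intro equalityI subsetI)
    fix S assume "S \<in> {S\<in>Pow A. i \<in> S}"
    then have "S = insert i (S - {i})" "S - {i} \<in> Pow (A - {i})" by auto
    then show "S \<in> insert i ` Pow (A - {i})" by blast
  qed (use assms in auto)
  ultimately show ?thesis by (simp add: sum.reindex)
qed

text \<open>A level inequality: a 0/1 function \<open>k\<close> of small mean \<open>I\<close> has
  little weight \<open>W\<close> on low levels. With \<open>P\<close> the low-degree part,
  \<open>W\<close> is \<open>dev q\<close> times the expectation of \<open>k * P\<close>; since
  \<open>k = k * k\<close>, Cauchy-Schwarz applies twice and leaves the fourth moment of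
  \<open>P\<close>, so that \<open>W * W \<le> I * sqrt I * 4 ^ d * W\<close>.\<close>

lemma low_level_weight:
  assumes "finite B" "1/4 \<le> q" "q \<le> 1/2" "\<And>F. F \<subseteq> B \<Longrightarrow> k F = 0 \<or> k F = (1 :: real)"
  shows "(\<Sum>S\<in>{S\<in>Pow B. card S \<le> d}. (fourier q B (\<lambda>F. dev q * k F) S)\<^sup>2)
    \<le> expect q B k * sqrt (expect q B k) * 4 ^ d"
proof -
  have q: "0 \<le> q" "q \<le> 1" "0 < q" "q < 1" using assms by auto
  let ?h = "\<lambda>F. dev q * k F"
  define w where "w S = (if card S \<le> d then fourier q B ?h S else 0)" for S
  define W where "W = (\<Sum>S\<in>Pow B. (w S)\<^sup>2)"
  define I where "I = expect q B k"
  let ?P = "pol q B w"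
  have W: "(\<Sum>S\<in>{S\<in>Pow B. card S \<le> d}. (fourier q B ?h S)\<^sup>2) = W"
    unfolding W_def sum.inter_filter[OF finite_Pow_iff[THEN iffD2, OF assms(1)]]
    by (rule sum.cong) (auto simp: w_def)
  have W0: "0 \<le> W" unfolding W_def by (rule sum_nonneg) simp
  have kk: "k F * k F = k F" if "F \<subseteq> B" for F using assms(4)[OF that] by auto
  have k2: "expect q B (\<lambda>F. (k F)\<^sup>2) = I"
    unfolding I_def by (rule expect_cong) (simp add: power2_eq_square kk)
  have I0: "0 \<le> I" unfolding k2[symmetric] using q by (intro expect_nonneg) auto
  have "expect q B (\<lambda>F. ?h F * ?P F) = (\<Sum>S\<in>Pow B. w S * fourier q B ?h S)"
    unfolding pol_def sum_distrib_left expect_sum fourier_def expect_cmult[symmetric]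
    by (simp add: algebra_simps)
  also have "\<dots> = W" unfolding W_def by (rule sum.cong) (auto simp: w_def power2_eq_square)
  finally have WE: "W = dev q * expect q B (\<lambda>F. k F * ?P F)"
    by (simp add: mult.assoc expect_cmult)
  have d2: "(dev q)\<^sup>2 \<le> 1" unfolding dev_sq[OF q(3,4)] using q by (intro mult_le_one) auto
  have "expect q B (\<lambda>F. k F * ?P F) = expect q B (\<lambda>F. k F * (k F * ?P F))"
    by (rule expect_cong) (simp add: kk mult.assoc[symmetric])
  then have "(expect q B (\<lambda>F. k F * ?P F))\<^sup>2 \<le> expect q B (\<lambda>F. (k F)\<^sup>2) * expect q B (\<lambda>F. (k F * ?P F)\<^sup>2)"
    using expect_Cauchy_Schwarz[OF q(1,2)] by simp
  also have "expect q B (\<lambda>F. (k F * ?P F)\<^sup>2) = expect q B (\<lambda>F. k F * (?P F)\<^sup>2)"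
    by (rule expect_cong) (simp add: kk power_mult_distrib power2_eq_square[of "k _"])
  finally have 1: "(expect q B (\<lambda>F. k F * ?P F))\<^sup>2 \<le> I * expect q B (\<lambda>F. k F * (?P F)\<^sup>2)" unfolding k2 .
  have "(expect q B (\<lambda>F. k F * (?P F)\<^sup>2))\<^sup>2 \<le> expect q B (\<lambda>F. (k F)\<^sup>2) * expect q B (\<lambda>F. ((?P F)\<^sup>2)\<^sup>2)"
    by (rule expect_Cauchy_Schwarz[OF q(1,2)])
  also have "\<dots> \<le> I * (16 ^ d * W\<^sup>2)"
    unfolding k2 W_def using hypercontractive[OF assms(1-3), of d w] I0
    by (intro mult_left_mono) (auto simp: w_def)
  also have "\<dots> = (sqrt I * 4 ^ d * W)\<^sup>2"
  proof -
    have "(16::real) ^ d = (4 ^ d)\<^sup>2" by (simp add: power2_eq_square power_mult_distrib[symmetric])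
    then show ?thesis using I0 by (simp add: power_mult_distrib)
  qed
  finally have 2: "expect q B (\<lambda>F. k F * (?P F)\<^sup>2) \<le> sqrt I * 4 ^ d * W"
    by (rule power2_le_imp_le) (use I0 W0 in simp)
  have "W\<^sup>2 \<le> 1 * (I * (sqrt I * 4 ^ d * W))"
    unfolding WE[THEN arg_cong, of "\<lambda>x. x\<^sup>2"] power_mult_distrib
    using d2 1 2 I0 W0 by (intro mult_mono order_trans[OF 1] mult_left_mono) auto
  then have "W * W \<le> (I * sqrt I * 4 ^ d) * W" by (simp add: power2_eq_square algebra_simps)
  then have "W \<le> I * sqrt I * 4 ^ d"
    using W0 I0 by (cases "W = 0") auto
  then show ?thesis unfolding W I_def .
qed

text \<open>Sets with more than \<open>d\<close> elements carry weight at most \<open>K / d\<close>,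
  because the weights multiplied by \<open>card S\<close> sum to at most the total influence. A
  smaller set not inside \<open>J\<close> contains a coordinate of influence at most \<tau>, and the
  level inequality is applied to the derivative in that direction.\<close>

lemma fourier_weight_outside:
  assumes A: "finite A" and q: "1/4 \<le> q" "q \<le> 1/2"
    and bool: "\<And>F. F \<subseteq> A \<Longrightarrow> f F = 0 \<or> f F = (1 :: real)"
    and mono: "\<And>F G. F \<subseteq> G \<Longrightarrow> G \<subseteq> A \<Longrightarrow> f F \<le> f G"
    and tot: "(\<Sum>i\<in>A. influence q A f i) \<le> K"
    and J: "J \<subseteq> A" "\<And>i. i \<in> A - J \<Longrightarrow> influence q A f i \<le> \<tau>" and d: "0 < d" "0 \<le> \<tau>"
  shows "(\<Sum>S\<in>Pow A - Pow J. (fourier q A f S)\<^sup>2) \<le> K / d + 4 ^ d * sqrt \<tau> * K"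
proof -
  have q': "0 \<le> q" "q \<le> 1" "0 < q" "q < 1" using q by auto
  let ?c = "\<lambda>S. (fourier q A f S)\<^sup>2"
  let ?I = "influence q A f"
  let ?k = "\<lambda>i F. f (insert i F) - f F"
  \<comment> \<open>By monotonicity the derivative is again 0/1-valued, so its mean, the influence,
    is also its second moment.\<close>
  have k01: "?k i F = 0 \<or> ?k i F = 1" if "i \<in> A" "F \<subseteq> A - {i}" for i F
  proof -
    have "F \<subseteq> A" "insert i F \<subseteq> A" using that by auto
    moreover from this have "f F \<le> f (insert i F)" by (intro mono subset_insertI)
    ultimately show ?thesis using bool[of F] bool[of "insert i F"] by auto
  qed
  have I0: "0 \<le> ?I i" if "i \<in> A" for i
    unfolding influence_def
  proof (rule expect_nonneg[OF q'(1,2)])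
    fix F assume "F \<subseteq> A - {i}"
    then show "0 \<le> ?k i F" using k01[OF that, of F] by auto
  qed
  have mem: "(\<Sum>S\<in>{S\<in>Pow A. i \<in> S}. ?c S) \<le> ?I i" if i: "i \<in> A" for i
  proof -
    have "(\<Sum>S\<in>{S\<in>Pow A. i \<in> S}. ?c S) = (\<Sum>S\<in>Pow (A - {i}). (fourier q (A - {i}) (\<lambda>F. dev q * ?k i F) S)\<^sup>2)"
      unfolding sum_Pow_member[OF A i] by (rule sum.cong) (use A i q' in \<open>auto simp: fourier_remove\<close>)
    also have "\<dots> = expect q (A - {i}) (\<lambda>F. (dev q * ?k i F)\<^sup>2)" using A q' by (intro Parseval) auto
    also have "\<dots> = (dev q)\<^sup>2 * expect q (A - {i}) (?k i)"
      unfolding expect_cmult[symmetric]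
    proof (rule expect_cong)
      fix F assume "F \<subseteq> A - {i}"
      then have "(?k i F)\<^sup>2 = ?k i F" using k01[OF i, of F] by auto
      then show "(dev q * ?k i F)\<^sup>2 = (dev q)\<^sup>2 * ?k i F" by (simp add: power_mult_distrib)
    qed
    also have "\<dots> \<le> 1 * ?I i"
      unfolding influence_def[symmetric] using I0[OF i] q' dev_sq[of q] mult_le_one[of q "1 - q"]
      by (intro mult_right_mono) auto
    finally show ?thesis by simp
  qed
  have low: "(\<Sum>S\<in>{S\<in>Pow A. i \<in> S \<and> card S \<le> d}. ?c S) \<le> ?I i * (sqrt \<tau> * 4 ^ d)" if i: "i \<in> A - J" for i
  proof -
    have iA: "i \<in> A" using i by auto
    have inj: "inj_on (insert i) {S\<in>Pow (A - {i}). card (insert i S) \<le> d}" by (auto simp: inj_on_def)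
    have img: "{S\<in>Pow A. i \<in> S \<and> card S \<le> d} = insert i ` {S\<in>Pow (A - {i}). card (insert i S) \<le> d}"
    proof (intro equalityI subsetI)
      fix S assume S: "S \<in> {S\<in>Pow A. i \<in> S \<and> card S \<le> d}"
      then have "S = insert i (S - {i})" by auto
      moreover from this have "S - {i} \<in> {S\<in>Pow (A - {i}). card (insert i S) \<le> d}" using S by auto
      ultimately show "S \<in> insert i ` {S\<in>Pow (A - {i}). card (insert i S) \<le> d}" by blast
    qed (use iA in auto)
    have "(\<Sum>S\<in>{S\<in>Pow A. i \<in> S \<and> card S \<le> d}. ?c S) =
        (\<Sum>S\<in>{S\<in>Pow (A - {i}). card (insert i S) \<le> d}. (fourier q (A - {i}) (\<lambda>F. dev q * ?k i F) S)\<^sup>2)"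
      unfolding img sum.reindex[OF inj] o_def by (rule sum.cong) (use A iA q' in \<open>auto simp: fourier_remove\<close>)
    also have "\<dots> \<le> (\<Sum>S\<in>{S\<in>Pow (A - {i}). card S \<le> d}. (fourier q (A - {i}) (\<lambda>F. dev q * ?k i F) S)\<^sup>2)"
    proof (rule sum_mono2)
      show "{S\<in>Pow (A - {i}). card (insert i S) \<le> d} \<subseteq> {S\<in>Pow (A - {i}). card S \<le> d}"
        by (auto intro: order_trans[OF card_insert_le])
    qed (use A in auto)
    also have "\<dots> \<le> ?I i * sqrt (?I i) * 4 ^ d"
      unfolding influence_def using A q k01[OF iA] by (intro low_level_weight) auto
    also have "\<dots> \<le> ?I i * sqrt \<tau> * 4 ^ d"
      using J(2)[OF i] I0[OF iA] by (intro mult_right_mono mult_left_mono) auto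
    finally show ?thesis by simp
  qed
  have K: "(\<Sum>i\<in>A - J. ?I i) \<le> K"
    using sum_mono2[of A "A - J" ?I] A I0 tot by auto
  have high: "(\<Sum>S\<in>{S\<in>Pow A. d < card S}. ?c S) \<le> K / d"
  proof -
    have "d * (\<Sum>S\<in>{S\<in>Pow A. d < card S}. ?c S) \<le> (\<Sum>S\<in>{S\<in>Pow A. d < card S}. card S * ?c S)"
      unfolding sum_distrib_left by (intro sum_mono mult_right_mono) auto
    also have "\<dots> \<le> (\<Sum>S\<in>Pow A. card S * ?c S)" using A by (intro sum_mono2) auto
    also have "\<dots> = (\<Sum>S\<in>Pow A. \<Sum>i\<in>A. if i \<in> S then ?c S else 0)"
    proof (rule sum.cong)
      fix S assume "S \<in> Pow A"
      then have "A \<inter> S = S" by auto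
      then show "card S * ?c S = (\<Sum>i\<in>A. if i \<in> S then ?c S else 0)"
        using A sum.inter_restrict[of A "\<lambda>_. ?c S" S] by simp
    qed simp
    also have "\<dots> = (\<Sum>i\<in>A. \<Sum>S\<in>Pow A. if i \<in> S then ?c S else 0)" by (rule sum.swap)
    also have "\<dots> = (\<Sum>i\<in>A. \<Sum>S\<in>{S\<in>Pow A. i \<in> S}. ?c S)"
      by (intro sum.cong refl sum.inter_filter[symmetric]) (use A in auto)
    also have "\<dots> \<le> K" using sum_mono[OF mem, of A "\<lambda>i. i"] tot by simp
    finally show ?thesis using d by (simp add: pos_le_divide_eq mult.commute)
  qed
  \<comment> \<open>Each set outside \<open>Pow J\<close> is charged either to its size or to one of
    its elements outside \<open>J\<close>.\<close>
  let ?l = "\<lambda>i S. if i \<in> S \<and> card S \<le> d then ?c S else 0"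
  let ?u = "\<lambda>S. if d < card S then ?c S else 0"
  have "(\<Sum>S\<in>Pow A - Pow J. ?c S) \<le> (\<Sum>S\<in>Pow A - Pow J. ?u S + (\<Sum>i\<in>A - J. ?l i S))"
  proof (rule sum_mono)
    fix S assume S: "S \<in> Pow A - Pow J"
    have n0: "0 \<le> (\<Sum>i\<in>A - J. ?l i S)" by (rule sum_nonneg) simp
    show "?c S \<le> ?u S + (\<Sum>i\<in>A - J. ?l i S)"
    proof (cases "d < card S")
      case False
      obtain i where i: "i \<in> A - J" "i \<in> S" using S by blast
      have "?l i S \<le> (\<Sum>i\<in>A - J. ?l i S)" using i(1) A by (intro member_le_sum) auto
      then show ?thesis using False i(2) by simp
    qed (use n0 in simp)
  qed
  also have "\<dots> \<le> (\<Sum>S\<in>Pow A. ?u S + (\<Sum>i\<in>A - J. ?l i S))"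
    using A by (intro sum_mono2) (auto intro!: add_nonneg_nonneg sum_nonneg)
  also have "\<dots> = (\<Sum>S\<in>{S\<in>Pow A. d < card S}. ?c S) + (\<Sum>i\<in>A - J. \<Sum>S\<in>Pow A. ?l i S)"
    unfolding sum.distrib sum.swap[of _ "A - J"] using A by (simp only: sum.inter_filter finite_Pow_iff)
  also have "(\<Sum>i\<in>A - J. \<Sum>S\<in>Pow A. ?l i S) = (\<Sum>i\<in>A - J. \<Sum>S\<in>{S\<in>Pow A. i \<in> S \<and> card S \<le> d}. ?c S)"
    using A by (simp only: sum.inter_filter finite_Pow_iff)
  also have "\<dots> \<le> (\<Sum>i\<in>A - J. ?I i * (sqrt \<tau> * 4 ^ d))" by (rule sum_mono) (rule low)
  also have "\<dots> = (\<Sum>i\<in>A - J. ?I i) * (sqrt \<tau> * 4 ^ d)" by (rule sum_distrib_right[symmetric])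
  also have "\<dots> \<le> 4 ^ d * sqrt \<tau> * K"
    using mult_right_mono[OF K, of "sqrt \<tau> * 4 ^ d"] d(2) by (simp add: mult.commute mult.left_commute)
  finally show ?thesis using high by linarith
qed

section \<open>Cores of monotone families\<close>

text \<open>Every trace \<open>Y\<close> on \<open>X\<close> has probability at least
  \<open>q ^ card X\<close>, since \<open>q \<le> 1 - q\<close>; conditioning on it therefore costs
  at most the inverse of this factor.\<close>

lemma expect_restrict:
  assumes "finite A" "0 \<le> q" "q \<le> 1/2" "X \<subseteq> A" "Y \<subseteq> X" "\<And>F. F \<subseteq> A \<Longrightarrow> 0 \<le> k F"
  shows "q ^ card X * expect q (A - X) (\<lambda>G. k (Y \<union> G)) \<le> expect q A k"
proof -
  have fX: "finite X" using assms finite_subset by auto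
  have AX: "A = X \<union> (A - X)" using assms by auto
  have nn: "0 \<le> expect q (A - X) (\<lambda>G. k (F \<union> G))" if "F \<subseteq> X" for F
    using assms(1-5) that by (intro expect_nonneg assms(6)) auto
  have "q ^ card X \<le> weight q X Y"
  proof -
    have "card X = card Y + card (X - Y)"
      using fX assms(5) by (metis card_Diff_subset card_mono finite_subset le_add_diff_inverse)
    then have "q ^ card X = q ^ card Y * q ^ card (X - Y)" by (simp add: power_add)
    also have "\<dots> \<le> weight q X Y" unfolding weight_def
      using assms by (intro mult_left_mono power_mono) auto
    finally show ?thesis .
  qed
  then have "q ^ card X * expect q (A - X) (\<lambda>G. k (Y \<union> G)) \<le> weight q X Y * expect q (A - X) (\<lambda>G. k (Y \<union> G))"
    using nn assms by (intro mult_right_mono) auto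
  also have "\<dots> \<le> expect q X (\<lambda>F. expect q (A - X) (\<lambda>G. k (F \<union> G)))"
    unfolding expect_def[of q X] using fX assms nn
    by (intro member_le_sum[where f = "\<lambda>F. weight q X F * expect q (A - X) (\<lambda>G. k (F \<union> G))"])
      (auto intro!: mult_nonneg_nonneg weight_nonneg)
  also have "\<dots> = expect q (X \<union> (A - X)) k"
    using assms fX by (intro expect_union[symmetric]) auto
  finally show ?thesis using AX by simp
qed

lemma fourier_subset:
  assumes "finite A" "J \<subseteq> A" "S \<subseteq> J"
  shows "fourier q A f S = fourier q J (\<lambda>F. expect q (A - J) (\<lambda>G. f (F \<union> G))) S"
proof -
  have fJ: "finite J" using assms finite_subset by auto
  have AJ: "A = J \<union> (A - J)" using assms by auto
  have "fourier q A f S = expect q (J \<union> (A - J)) (\<lambda>F. f F * char q S F)"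
    unfolding fourier_def using AJ by simp
  also have "\<dots> = expect q J (\<lambda>F. expect q (A - J) (\<lambda>G. f (F \<union> G) * char q S (F \<union> G)))"
    using assms fJ by (intro expect_union) auto
  also have "\<dots> = expect q J (\<lambda>F. expect q (A - J) (\<lambda>G. char q S F * f (F \<union> G)))"
  proof (intro expect_cong)
    fix F G assume "F \<subseteq> J" "G \<subseteq> A - J"
    then have "char q S (F \<union> G) = char q S F"
      unfolding char_def using assms(3) by (intro prod.cong refl arg_cong[where f = "digit_char q"]) auto
    then show "f (F \<union> G) * char q S (F \<union> G) = char q S F * f (F \<union> G)" by simp
  qed
  finally show ?thesis by (simp add: fourier_def expect_cmult mult.commute)
qed

text \<open>By monotonicity the conditional mean is largest, say \<open>M\<close>, when all of
  \<open>J\<close> is present. The squared coefficients inside \<open>J\<close> sum to the second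
  moment of the conditional mean, hence to at most \<open>M\<close> times the mean of
  \<open>f\<close>. By Parseval at least \<open>1 - M\<close> times that mean lies outside, so
  \<open>(1 - M) * \<delta> \<le> \<delta> / 4\<close> unless \<open>M > 1\<close>.\<close>

lemma junta_full:
  assumes A: "finite A" and q: "1/4 \<le> q" "q \<le> 1/2"
    and bool: "\<And>F. F \<subseteq> A \<Longrightarrow> f F = 0 \<or> f F = (1 :: real)"
    and mono: "\<And>F G. F \<subseteq> G \<Longrightarrow> G \<subseteq> A \<Longrightarrow> f F \<le> f G"
    and J: "J \<subseteq> A" "(\<Sum>S\<in>Pow A - Pow J. (fourier q A f S)\<^sup>2) \<le> \<delta> / 4"
    and \<delta>: "0 < \<delta>" "\<delta> \<le> expect q A f"
  shows "3/4 \<le> expect q (A - J) (\<lambda>G. f (J \<union> G))"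
proof -
  have q': "0 \<le> q" "q \<le> 1" "0 < q" "q < 1" using q by auto
  have fJ: "finite J" using A J finite_subset by auto
  let ?c = "\<lambda>S. (fourier q A f S)\<^sup>2"
  define g where "g F = expect q (A - J) (\<lambda>G. f (F \<union> G))" for F
  define M where "M = g J"
  have g0: "0 \<le> g F" if "F \<subseteq> J" for F
    unfolding g_def
  proof (rule expect_nonneg[OF q'(1,2)])
    fix G assume "G \<subseteq> A - J"
    then have "F \<union> G \<subseteq> A" using that J by auto
    then show "0 \<le> f (F \<union> G)" using bool[of "F \<union> G"] by auto
  qed
  have gM: "g F \<le> M" if "F \<subseteq> J" for F
    unfolding g_def M_def using that J q' by (intro expect_mono mono) auto
  have AJ: "A = J \<union> (A - J)" using J by auto
  have Ef: "expect q A f = expect q J g"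
    unfolding g_def using expect_union[of J "A - J" q f] fJ A AJ by auto
  have "(\<Sum>S\<in>Pow J. ?c S) = expect q J (\<lambda>F. (g F)\<^sup>2)"
    unfolding Parseval[OF fJ q'(3,4), symmetric] g_def
    by (rule sum.cong) (use A J in \<open>auto simp: fourier_subset\<close>)
  also have "\<dots> \<le> expect q J (\<lambda>F. M * g F)"
    using q' g0 gM by (intro expect_mono) (auto simp: power2_eq_square intro: mult_right_mono)
  also have "\<dots> = M * expect q A f" by (simp add: expect_cmult Ef)
  finally have 1: "(\<Sum>S\<in>Pow J. ?c S) \<le> M * expect q A f" .
  have "expect q A f = expect q A (\<lambda>F. (f F)\<^sup>2)"
  proof (rule expect_cong)
    show "f F = (f F)\<^sup>2" if "F \<subseteq> A" for F using bool[OF that] by auto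
  qed
  also have "\<dots> = (\<Sum>S\<in>Pow A. ?c S)" using A q' by (intro Parseval[symmetric]) auto
  also have "\<dots> = (\<Sum>S\<in>Pow A - Pow J. ?c S) + (\<Sum>S\<in>Pow J. ?c S)"
    using A J by (intro sum.subset_diff) auto
  finally have "(1 - M) * expect q A f \<le> \<delta> / 4" using 1 J(2) by (simp add: algebra_simps)
  moreover have "(1 - M) * \<delta> \<le> (1 - M) * expect q A f" if "M \<le> 1" using that \<delta> by (intro mult_left_mono) auto
  ultimately have "M \<le> 1 \<Longrightarrow> (1 - M) * \<delta> \<le> 1/4 * \<delta>" by simp
  then have "M \<le> 1 \<Longrightarrow> 1 - M \<le> 1/4" using \<delta>(1) by (simp only: mult_le_cancel_right_pos)
  then show ?thesis unfolding M_def g_def by linarith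
qed

text \<open>The coordinates of \<open>T\<close> are switched off one at a time. Each change is an
  influence conditioned on at most \<open>2 * t\<close> further coordinates, whose prescribed values
  have probability at least \<open>(1/4) ^ (2 * t)\<close>; this is the factor
  \<open>16 ^ t\<close>.\<close>

lemma drop_low_influence:
  assumes A: "finite A" and q: "1/4 \<le> q" "q \<le> 1/2"
    and mono: "\<And>F G. F \<subseteq> G \<Longrightarrow> G \<subseteq> A \<Longrightarrow> f F \<le> (f G :: real)"
    and J: "J \<subseteq> A" "T \<subseteq> A - J" "card J \<le> t" "card T \<le> t"
    and small: "\<And>i. i \<in> T \<Longrightarrow> influence q A f i \<le> \<tau>" and \<tau>: "0 \<le> \<tau>"
  shows "expect q (A - J) (\<lambda>G. f (J \<union> G)) - t * \<tau> * 16 ^ t \<le> expect q (A - J - T) (\<lambda>G. f (J \<union> G))"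
proof -
  have q': "0 \<le> q" "q \<le> 1" "0 < q" using q by auto
  have fin: "finite J" "finite T" using A J finite_subset by blast+
  let ?B = "A - J - T"
  let ?e = "\<lambda>U. expect q ?B (\<lambda>G. f (J \<union> U \<union> G))"
  have step: "?e U - card U * (\<tau> * 16 ^ t) \<le> ?e {}" if "finite U" "U \<subseteq> T" for U
    using that
  proof (induction U rule: finite_induct)
    case (insert i U)
    have iT: "i \<in> T" "i \<notin> U" "i \<in> A" "i \<notin> J" using insert J by auto
    let ?k = "\<lambda>F. f (insert i F) - f F"
    let ?X = "(J \<union> T) - {i}"
    have cX: "card ?X \<le> 2 * t"
      using card_Un_le[of J T] J(3,4) card_mono[of "J \<union> T" ?X] fin by (auto intro: order_trans)
    have pos: "0 < q ^ card ?X" using q' by simp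
    have "A - {i} - ?X = ?B" using iT by auto
    then have "q ^ card ?X * expect q ?B (\<lambda>G. ?k ((J \<union> U) \<union> G)) \<le> expect q (A - {i}) ?k"
      using expect_restrict[of "A - {i}" q ?X "J \<union> U" ?k] A q q' J insert iT
      by (auto intro!: mono)
    also have "\<dots> \<le> \<tau>" using small[OF iT(1)] by (simp add: influence_def)
    finally have 1: "q ^ card ?X * expect q ?B (\<lambda>G. ?k ((J \<union> U) \<union> G)) \<le> \<tau>" .
    have "(1/16) ^ t = ((1/4::real) ^ 2) ^ t" by (simp add: power2_eq_square)
    also have "\<dots> = (1/4) ^ (2 * t)" by (simp only: power_mult)
    also have "\<dots> \<le> (1/4) ^ card ?X" using cX by (intro power_decreasing) auto
    also have "\<dots> \<le> q ^ card ?X" using q by (intro power_mono) auto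
    finally have 2: "(1/16) ^ t \<le> q ^ card ?X" .
    have k0: "0 \<le> expect q ?B (\<lambda>G. ?k ((J \<union> U) \<union> G))"
      using q' insert J iT by (intro expect_nonneg) (auto intro!: mono)
    have "(1/16) ^ t * expect q ?B (\<lambda>G. ?k ((J \<union> U) \<union> G)) \<le> \<tau>"
      using mult_right_mono[OF 2 k0] 1 by linarith
    then have "expect q ?B (\<lambda>G. ?k ((J \<union> U) \<union> G)) \<le> \<tau> * 16 ^ t"
      by (simp add: power_one_over field_simps)
    moreover have "expect q ?B (\<lambda>G. ?k ((J \<union> U) \<union> G)) = ?e (insert i U) - ?e U"
      by (simp add: expect_diff)
    moreover have "?e U - card U * (\<tau> * 16 ^ t) \<le> ?e {}" using insert by auto
    ultimately show ?case using insert.hyps by (simp add: algebra_simps)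
  qed simp
  have AJ: "A - J = T \<union> ?B" using J by auto
  have "expect q (A - J) (\<lambda>G. f (J \<union> G)) = expect q T (\<lambda>F. expect q ?B (\<lambda>G. f (J \<union> (F \<union> G))))"
    by (subst AJ) (use fin A in \<open>intro expect_union, auto\<close>)
  also have "\<dots> \<le> expect q T (\<lambda>_. ?e T)"
    using q' J by (intro expect_mono mono) auto
  also have "\<dots> = ?e T" using fin by (rule_tac expect_const)
  finally have "expect q (A - J) (\<lambda>G. f (J \<union> G)) \<le> ?e T" .
  moreover have "card T * (\<tau> * 16 ^ t) \<le> t * (\<tau> * 16 ^ t)" using J \<tau> by (intro mult_right_mono) auto
  ultimately show ?thesis using step[OF fin(2)] by (simp add: mult.assoc)
qed

text \<open>\<open>J\<close> is forced to be present, and \<open>L\<close> marks the coordinates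
  that must not be tampered with: when at most \<open>t\<close> coordinates outside \<open>L\<close>
  are switched off, a strict majority of the completions still lies in the family. The majority is
  counted uniformly because complementation preserves the uniform measure.\<close>

definition is_core :: "nat \<Rightarrow> 'a set \<Rightarrow> 'a set set \<Rightarrow> 'a set \<Rightarrow> 'a set \<Rightarrow> bool" where
  "is_core t A \<F> J L \<longleftrightarrow> J \<subseteq> L \<and> L \<subseteq> A \<and> card J \<le> t \<and> (\<forall>T \<subseteq> A - L. card T \<le> t \<longrightarrow>
     2 ^ card (A - J - T) < 2 * card {Z \<in> Pow (A - J - T). J \<union> Z \<in> \<F>})"

section \<open>Existence and crossing of cores\<close>

lemma expect_half:
  assumes "finite B"
  shows "expect (1/2) B (\<lambda>Z. of_bool (P Z)) = card {Z \<in> Pow B. P Z} / 2 ^ card B"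
proof -
  have "weight (1/2) B Z = 1 / 2 ^ card B" if "Z \<in> Pow B" for Z
  proof -
    have "card B = card Z + card (B - Z)"
      using assms that by (metis PowD card_Diff_subset card_mono finite_subset le_add_diff_inverse)
    then show ?thesis by (simp add: weight_def power_add power_one_over)
  qed
  then have "expect (1/2) B (\<lambda>Z. of_bool (P Z)) = (\<Sum>Z\<in>Pow B. 1 / 2 ^ card B * of_bool (P Z))"
    unfolding expect_def by (intro sum.cong) auto
  also have "\<dots> = 1 / 2 ^ card B * card {Z \<in> Pow B. P Z}"
    unfolding sum_distrib_left[symmetric] using assms by (simp add: of_bool_def sum.inter_filter[symmetric])
  finally show ?thesis by simp
qed

theorem core_exists:
  assumes p: "1/4 \<le> p" "p < 1/2" and \<delta>: "0 < \<delta>"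
  shows "\<exists>t t'. \<forall>A \<F>. finite (A :: 'a set) \<longrightarrow> (\<forall>F G. F \<in> \<F> \<longrightarrow> F \<subseteq> G \<longrightarrow> G \<subseteq> A \<longrightarrow> G \<in> \<F>) \<longrightarrow>
    \<delta> \<le> expect p A (\<lambda>F. of_bool (F \<in> \<F>)) \<longrightarrow> (\<exists>J L. is_core t A \<F> J L \<and> card L \<le> t')"
proof -
  \<comment> \<open>Between \<open>p\<close> and \<open>1/2\<close> the measure grows by at most 1,
    so at some bias in between its derivative, the total influence, is at most
    \<open>K\<close>.\<close>
  define K where "K = 1 / (1/2 - p)"
  have K0: "0 < K" using p by (simp add: K_def)
  \<comment> \<open>\<open>d\<close> and \<tau> make both error terms of
    \<open>fourier_weight_outside\<close> at most \<open>\<delta> / 8\<close>, which gives the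
    \<open>\<delta> / 4\<close> required by \<open>junta_full\<close>.\<close>
  obtain d :: nat where d: "8 * K / \<delta> < d" using reals_Archimedean2 by blast
  have d0: "0 < d" using d K0 \<delta> by (metis divide_pos_pos mult_pos_pos of_nat_0_less_iff order_less_trans zero_less_numeral)
  have dK: "K / d \<le> \<delta> / 8" using d d0 \<delta> by (simp add: field_simps)
  define \<tau> where "\<tau> = (\<delta> / (8 * 4 ^ d * K))\<^sup>2"
  have \<tau>0: "0 < \<tau>" using \<delta> K0 by (simp add: \<tau>_def)
  have \<tau>K: "4 ^ d * sqrt \<tau> * K \<le> \<delta> / 8" using \<delta> K0 by (simp add: \<tau>_def)
  define t where "t = nat \<lfloor>K / \<tau>\<rfloor>"
  \<comment> \<open>\<open>t\<close> bounds the number of coordinates of influence at least \<tau>.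
    The second threshold is so low that switching off \<open>t\<close> coordinates below it costs
    less than the 1/4 by which 3/4 exceeds one half.\<close>
  define \<tau>' where "\<tau>' = min \<tau> (1 / (4 * (real t + 1) * 16 ^ t))"
  have \<tau>'0: "0 < \<tau>'" using \<tau>0 by (simp add: \<tau>'_def)
  have small: "t * \<tau>' * 16 ^ t < 1/4"
  proof -
    have "t * \<tau>' * 16 ^ t \<le> t * (1 / (4 * (real t + 1) * 16 ^ t)) * 16 ^ t"
      by (intro mult_right_mono mult_left_mono) (auto simp: \<tau>'_def)
    also have "\<dots> = t / (4 * (real t + 1))" by simp
    also have "\<dots> < 1/4" by (subst pos_divide_less_eq) auto
    finally show ?thesis .
  qed
  define t' where "t' = nat \<lfloor>K / \<tau>'\<rfloor>"
  have "\<exists>J L. is_core t A \<F> J L \<and> card L \<le> t'"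
    if A: "finite A" and up: "\<And>F G. F \<in> \<F> \<Longrightarrow> F \<subseteq> G \<Longrightarrow> G \<subseteq> A \<Longrightarrow> G \<in> \<F>"
      and big: "\<delta> \<le> expect p A (\<lambda>F. of_bool (F \<in> \<F>))" for A :: "'a set" and \<F>
  proof -
    define f :: "'a set \<Rightarrow> real" where "f = (\<lambda>F. of_bool (F \<in> \<F>))"
    have bool: "f F = 0 \<or> f F = 1" for F by (simp add: f_def)
    have mono: "f F \<le> f G" if "F \<subseteq> G" "G \<subseteq> A" for F G using up that by (auto simp: f_def)
    have f1: "f F \<le> 1" "0 \<le> f F" for F by (simp_all add: f_def)
    obtain q where q: "p < q" "q < 1/2" and mvt: "expect (1/2) A f - expect p A f = (1/2 - p) * (\<Sum>i\<in>A. influence q A f i)"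
      using MVT2[of p "1/2" "\<lambda>q. expect q A f" "\<lambda>q. \<Sum>i\<in>A. influence q A f i"] p expect_has_derivative[OF A] by blast
    have "expect (1/2) A f \<le> expect (1/2) A (\<lambda>_. 1)" using f1 by (intro expect_mono) auto
    moreover have "0 \<le> expect p A f" using f1 p by (intro expect_nonneg) auto
    ultimately have "expect (1/2) A f - expect p A f \<le> 1"
      using expect_const[OF A, of "1/2" 1] by simp
    then have tot: "(\<Sum>i\<in>A. influence q A f i) \<le> K" using p unfolding mvt K_def by (simp add: field_simps)
    have q': "1/4 \<le> q" "q \<le> 1/2" "0 \<le> q" "q \<le> 1" using q p by auto
    have I0: "0 \<le> influence q A f i" if "i \<in> A" for i
      unfolding influence_def using q' that by (intro expect_nonneg) (auto intro!: mono)
    have card_bound: "card {i\<in>A. s \<le> influence q A f i} \<le> nat \<lfloor>K / s\<rfloor>" if "0 < s" for s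
    proof -
      have "s * card {i\<in>A. s \<le> influence q A f i} = (\<Sum>i\<in>{i\<in>A. s \<le> influence q A f i}. s)" by simp
      also have "\<dots> \<le> (\<Sum>i\<in>{i\<in>A. s \<le> influence q A f i}. influence q A f i)" by (rule sum_mono) auto
      also have "\<dots> \<le> (\<Sum>i\<in>A. influence q A f i)" using A I0 by (intro sum_mono2) auto
      finally have "card {i\<in>A. s \<le> influence q A f i} \<le> K / s" using tot that by (simp add: field_simps)
      then show ?thesis by (simp add: le_nat_floor)
    qed
    define J where "J = {i\<in>A. \<tau> \<le> influence q A f i}"
    define L where "L = {i\<in>A. \<tau>' \<le> influence q A f i}"
    have JL: "J \<subseteq> L" "L \<subseteq> A" "J \<subseteq> A" unfolding J_def L_def \<tau>'_def by auto
    have cJ: "card J \<le> t" unfolding J_def t_def by (rule card_bound[OF \<tau>0])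
    have cL: "card L \<le> t'" unfolding L_def t'_def by (rule card_bound[OF \<tau>'0])
    have "(\<Sum>S\<in>Pow A - Pow J. (fourier q A f S)\<^sup>2) \<le> K / d + 4 ^ d * sqrt \<tau> * K"
      by (rule fourier_weight_outside[OF A q'(1,2) _ _ tot JL(3) _ d0]) (use bool mono \<tau>0 in \<open>auto simp: J_def\<close>)
    also have "\<dots> \<le> \<delta> / 8 + \<delta> / 8" using dK \<tau>K by (rule add_mono)
    also have "\<dots> = \<delta> / 4" by simp
    finally have out: "(\<Sum>S\<in>Pow A - Pow J. (fourier q A f S)\<^sup>2) \<le> \<delta> / 4" .
    have "expect p A f \<le> expect q A f" using A p q mono by (intro expect_mono_bias) auto
    then have "\<delta> \<le> expect q A f" using big by (simp add: f_def)
    then have full: "3/4 \<le> expect q (A - J) (\<lambda>G. f (J \<union> G))"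
      using junta_full[OF A q'(1,2) bool mono JL(3) out \<delta>] by blast
    have "2 ^ card (A - J - T) < 2 * card {Z \<in> Pow (A - J - T). J \<union> Z \<in> \<F>}"
      if T: "T \<subseteq> A - L" "card T \<le> t" for T
    proof -
      let ?B = "A - J - T"
      have "expect q (A - J) (\<lambda>G. f (J \<union> G)) - t * \<tau>' * 16 ^ t \<le> expect q ?B (\<lambda>G. f (J \<union> G))"
        by (rule drop_low_influence[OF A q'(1,2) mono JL(3)]) (use T JL cJ \<tau>'0 in \<open>auto simp: L_def\<close>)
      then have "1/2 < expect q ?B (\<lambda>G. f (J \<union> G))" using full small by linarith
      \<comment> \<open>The bias \<open>q\<close> depends on the family; monotonicity moves the
        majority to the common bias 1/2.\<close>
      also have "\<dots> \<le> expect (1/2) ?B (\<lambda>G. f (J \<union> G))"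
        using A q q' JL by (intro expect_mono_bias) (auto intro!: mono)
      also have "\<dots> = card {Z \<in> Pow ?B. J \<union> Z \<in> \<F>} / 2 ^ card ?B"
        unfolding f_def using A by (intro expect_half) auto
      finally have "2 ^ card ?B < (2 * card {Z \<in> Pow ?B. J \<union> Z \<in> \<F>} :: real)"
        by (simp add: field_simps)
      then show ?thesis by (metis (mono_tags, lifting) of_nat_less_iff of_nat_mult of_nat_numeral of_nat_power)
    qed
    then have "is_core t A \<F> J L" using JL cJ by (simp add: is_core_def)
    then show ?thesis using cL by blast
  qed
  then show ?thesis by blast
qed

text \<open>Otherwise one side can fix \<open>J\<close> present and the preimage of
  \<open>J'\<close> absent, the other \<open>J'\<close> present and the image of \<open>J\<close>
  absent. On the remaining coordinates the two strict majorities must contain a set and the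
  complement of its image, which yields two members that do not cross.\<close>

lemma core_cross:
  assumes A: "finite A" and c: "is_core t A \<F> J L" "is_core t A \<G> J' L'"
    and \<rho>: "bij_betw \<rho> A A"
    and cross: "\<And>F G. F \<in> \<F> \<Longrightarrow> G \<in> \<G> \<Longrightarrow> F \<subseteq> A \<Longrightarrow> G \<subseteq> A \<Longrightarrow> \<rho> ` F \<inter> G \<noteq> {}"
  shows "\<rho> ` L \<inter> L' \<noteq> {}"
proof
  assume disj: "\<rho> ` L \<inter> L' = {}"
  have inj: "inj_on \<rho> A" and im: "\<rho> ` A = A" using \<rho> by (auto simp: bij_betw_def)
  have JL: "J \<subseteq> L" "L \<subseteq> A" "card J \<le> t" "J' \<subseteq> L'" "L' \<subseteq> A" "card J' \<le> t"
    using c by (auto simp: is_core_def)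
  define T where "T = {i\<in>A. \<rho> i \<in> J'}"
  define T' where "T' = \<rho> ` J"
  have \<rho>T: "\<rho> ` T = J'"
  proof
    show "J' \<subseteq> \<rho> ` T"
    proof
      fix j assume "j \<in> J'"
      moreover from this obtain i where "i \<in> A" "j = \<rho> i" using JL im by blast
      ultimately show "j \<in> \<rho> ` T" by (auto simp: T_def)
    qed
  qed (auto simp: T_def)
  have T: "T \<subseteq> A - L" using disj JL by (auto simp: T_def)
  have "card T = card J'" using card_image[of \<rho> T] inj \<rho>T by (metis (no_types, lifting) Diff_subset T inj_on_subset order_trans)
  then have cT: "card T \<le> t" using JL by simp
  have T': "T' \<subseteq> A - L'"
  proof
    fix j assume "j \<in> T'"
    then obtain i where "i \<in> J" "j = \<rho> i" by (auto simp: T'_def)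
    moreover from this have "\<rho> i \<in> A" using JL im by blast
    moreover have "\<rho> i \<notin> L'" using disj JL calculation by blast
    ultimately show "j \<in> A - L'" by simp
  qed
  have "card T' \<le> card J" unfolding T'_def using A JL by (intro card_image_le) (auto intro: finite_subset)
  then have cT': "card T' \<le> t" using JL by simp
  define B where "B = A - J - T"
  define B' where "B' = A - J' - T'"
  have \<rho>B: "\<rho> ` B = B'"
  proof -
    have "\<rho> ` (A - (J \<union> T)) = \<rho> ` A - \<rho> ` (J \<union> T)"
      using inj JL T by (intro inj_on_image_set_diff) auto
    then show ?thesis using im \<rho>T by (auto simp: B_def B'_def T'_def image_Un Diff_eq)
  qed
  have BA: "B \<subseteq> A" "B' \<subseteq> A" by (auto simp: B_def B'_def)
  then have fin: "finite B" "finite B'" using A finite_subset by auto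
  have injB: "inj_on \<rho> B" using inj BA by (auto intro: inj_on_subset)
  have cB: "card B' = card B" using card_image[OF injB] \<rho>B by simp
  define X where "X = {Z \<in> Pow B. J \<union> Z \<in> \<F>}"
  define Y where "Y = {Z \<in> Pow B'. J' \<union> Z \<in> \<G>}"
  have X: "2 ^ card B < 2 * card X" using c(1) T cT unfolding is_core_def X_def B_def by blast
  have Y: "2 ^ card B' < 2 * card Y" using c(2) T' cT' unfolding is_core_def Y_def B'_def by blast
  \<comment> \<open>Transport followed by complementation is injective, and each of the two
    majorities exceeds half of \<open>Pow B'\<close> in number, so the image of \<open>X\<close>
    meets \<open>Y\<close>.\<close>
  define g where "g Z = B' - \<rho> ` Z" for Z
  have "inj_on g (Pow B)"
  proof (rule inj_onI)
    fix U V assume UV: "U \<in> Pow B" "V \<in> Pow B" "g U = g V"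
    then have "\<rho> ` U \<subseteq> B'" "\<rho> ` V \<subseteq> B'" using \<rho>B by auto
    then have "\<rho> ` U = \<rho> ` V" using UV(3) unfolding g_def by blast
    then show "U = V" using UV injB by (simp add: inj_on_image_eq_iff)
  qed
  then have "card (g ` X) = card X" by (intro card_image) (auto simp: X_def intro: inj_on_subset)
  moreover have "g ` X \<subseteq> Pow B'" "Y \<subseteq> Pow B'" by (auto simp: g_def Y_def)
  moreover have "finite (Pow B')" using fin by simp
  ultimately have "g ` X \<inter> Y \<noteq> {}"
  proof -
    assume a: "card (g ` X) = card X" "g ` X \<subseteq> Pow B'" "Y \<subseteq> Pow B'" "finite (Pow B')"
    show ?thesis
    proof
      assume "g ` X \<inter> Y = {}"
      then have "card (g ` X \<union> Y) = card X + card Y"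
        using a by (metis card_Un_disjoint finite_subset)
      moreover have "card (g ` X \<union> Y) \<le> card (Pow B')" using a by (intro card_mono) auto
      ultimately show False using X Y cB fin by (simp add: card_Pow)
    qed
  qed
  then obtain Z where Z: "Z \<in> X" "g Z \<in> Y" by blast
  have "\<rho> ` (J \<union> Z) \<inter> (J' \<union> g Z) \<noteq> {}"
    using Z JL BA by (intro cross) (auto simp: X_def Y_def g_def)
  moreover have "\<rho> ` J \<inter> J' = {}" using disj JL by auto
  moreover have "\<rho> ` J \<inter> g Z = {}" by (auto simp: g_def B'_def T'_def)
  moreover have "\<rho> ` Z \<inter> J' = {}" using Z \<rho>B by (auto simp: X_def B'_def)
  moreover have "\<rho> ` Z \<inter> g Z = {}" by (auto simp: g_def)
  ultimately show False by auto
qed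

lemma core_cross2:
  assumes A: "finite A" and c: "is_core t A \<F> J L" "is_core t A \<G> J' L'"
    and \<sigma>: "bij_betw \<sigma> A A" "bij_betw \<sigma>' A A"
    and cross: "\<And>F G. F \<in> \<F> \<Longrightarrow> G \<in> \<G> \<Longrightarrow> F \<subseteq> A \<Longrightarrow> G \<subseteq> A \<Longrightarrow> \<sigma> ` F \<inter> \<sigma>' ` G \<noteq> {}"
  shows "\<sigma> ` L \<inter> \<sigma>' ` L' \<noteq> {}"
proof -
  let ?\<rho> = "inv_into A \<sigma>' \<circ> \<sigma>"
  have bij: "bij_betw ?\<rho> A A" using \<sigma> bij_betw_inv_into bij_betw_trans by blast
  have rho: "?\<rho> x = y \<longleftrightarrow> \<sigma> x = \<sigma>' y" if "x \<in> A" "y \<in> A" for x y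
    using that \<sigma> by (metis bij_betw_apply bij_betw_inv_into_left bij_betw_inv_into_right comp_apply)
  have "?\<rho> ` L \<inter> L' \<noteq> {}"
  proof (rule core_cross[OF A c bij])
    fix F G assume FG: "F \<in> \<F>" "G \<in> \<G>" "F \<subseteq> A" "G \<subseteq> A"
    then obtain x y where "x \<in> F" "y \<in> G" "\<sigma> x = \<sigma>' y" using cross by blast
    then show "?\<rho> ` F \<inter> G \<noteq> {}" using rho FG by blast
  qed
  moreover have "L \<subseteq> A" "L' \<subseteq> A" using c by (auto simp: is_core_def)
  ultimately show ?thesis using rho by blast
qed

section \<open>Digits\<close>

definition dig :: "nat \<Rightarrow> nat \<Rightarrow> nat \<Rightarrow> nat" where
  "dig B i n = (n div B ^ i) mod B"

lemma sum_split_nat: "(\<Sum>v<A * B. f v) = (\<Sum>b<B. \<Sum>a<A. f (a + A * b) :: real)" for A B :: nat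
proof (induction B)
  case (Suc B)
  have "(\<Sum>v<A * Suc B. f v) = (\<Sum>v<A * B. f v) + (\<Sum>v=A * B..<A * B + A. f v)"
    using sum.atLeastLessThan_concat[of 0 "A * B" "A * B + A" f] by (simp add: atLeast0LessThan add.commute)
  also have "(\<Sum>v=A * B..<A * B + A. f v) = (\<Sum>a<A. f (a + A * B))"
    using sum.shift_bounds_nat_ivl[of f 0 "A * B" A] by (simp add: atLeast0LessThan add.commute)
  finally show ?case using Suc by simp
qed simp

lemma dig_less: "0 < B \<Longrightarrow> dig B i n < B"
  by (simp add: dig_def)

lemma dig_low: "x < B \<Longrightarrow> dig B 0 (x + B * t) = x"
  by (simp add: dig_def)

lemma dig_Suc_low: "x < B \<Longrightarrow> dig B (Suc i) (x + B * t) = dig B i t"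
  by (simp add: dig_def div_mult2_eq)

lemma dig_add_high:
  assumes "i < n" "0 < B"
  shows "dig B i (t + B ^ n * x) = dig B i t"
proof -
  obtain e where n: "n = Suc (i + e)" using assms(1) less_imp_Suc_add by blast
  have "t + B ^ n * x = t + B ^ i * (B * (B ^ e * x))" by (simp add: n power_add)
  then have "(t + B ^ n * x) div B ^ i = B * (B ^ e * x) + t div B ^ i"
    using assms(2) by (simp only: div_mult_self2 power_eq_0_iff) simp
  then show ?thesis by (simp add: dig_def)
qed

lemma dig_top:
  assumes "t < B ^ n" "x < B"
  shows "dig B n (t + B ^ n * x) = x"
  using assms by (simp add: dig_def)

lemma sum_digit:
  assumes "i < n" "0 < B"
  shows "(\<Sum>t<B ^ n. g (dig B i t)) = B ^ (n - 1) * (\<Sum>x<B. g x :: real)"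
  using assms(1)
proof (induction i arbitrary: n)
  case 0
  then obtain m where n: "n = Suc m" by (cases n) auto
  show ?case unfolding n power_Suc sum_split_nat by (simp add: dig_low)
next
  case (Suc i)
  then obtain m where n: "n = Suc m" "i < m" by (cases n) auto
  then obtain m' where m: "m = Suc m'" by (cases m) auto
  show ?case unfolding n(1) power_Suc sum_split_nat
    using Suc.IH[OF n(2)] by (simp add: dig_Suc_low sum_distrib_left[symmetric] m)
qed

text \<open>Two different digits of a uniform \<open>n\<close>-digit number are independent and
  uniform; this is the independence of two sampled half-edges at a variable.\<close>

lemma sum_two_digits:
  assumes "i < j" "j < n" "0 < B"
  shows "(\<Sum>t<B ^ n. g (dig B i t) (dig B j t)) = B ^ (n - 2) * (\<Sum>x<B. \<Sum>y<B. g x y :: real)"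
  using assms(1,2)
proof (induction i arbitrary: n j)
  case 0
  then obtain m j' where n: "n = Suc m" "j = Suc j'" "j' < m" by (cases n; cases j) auto
  have "(\<Sum>t<B ^ n. g (dig B 0 t) (dig B j t)) = (\<Sum>x<B. \<Sum>t<B ^ m. g x (dig B j' t))"
    unfolding n power_Suc sum_split_nat by (subst sum.swap) (simp add: dig_low dig_Suc_low)
  also have "\<dots> = (\<Sum>x<B. B ^ (m - 1) * (\<Sum>y<B. g x y))"
    using sum_digit[OF n(3) assms(3)] by simp
  finally show ?case by (simp add: n sum_distrib_left)
next
  case (Suc i)
  then obtain m j' where n: "n = Suc m" "j = Suc j'" "j' < m" "i < j'" by (cases n; cases j) auto
  then obtain m' where m: "m = Suc (Suc m')" by (cases m; cases "m - 1") auto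
  show ?case unfolding n power_Suc sum_split_nat
    using Suc.IH[OF n(4,3)] by (simp add: dig_Suc_low sum_distrib_left[symmetric] m)
qed

text \<open>For uniform \<open>Z\<close> below \<open>b ^ k\<close> this is a random set of bias
  \<open>a / b\<close>: counting codes replaces the biased measure, so that the graph needs no
  vertex weights.\<close>

definition fset :: "nat \<Rightarrow> nat \<Rightarrow> nat \<Rightarrow> nat \<Rightarrow> nat set" where
  "fset a b k Z = {c. c < k \<and> dig b c Z < a}"

lemma sum_fset:
  assumes "0 < b" "a \<le> b"
  shows "(\<Sum>Z<b ^ k. g (fset a b k Z)) = b ^ k * expect (a / b) {..<k} g"
proof (induction k arbitrary: g)
  case 0
  then show ?case by (simp add: fset_def)
next
  case (Suc k)
  have fs: "fset a b (Suc k) (Z + b ^ k * x) = (if x < a then insert k (fset a b k Z) else fset a b k Z)"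
    if "Z < b ^ k" "x < b" for Z x
    using that assms by (auto simp: fset_def less_Suc_eq dig_add_high dig_top)
  let ?S = "\<lambda>g. \<Sum>Z<b ^ k. g (fset a b k Z)"
  have "(\<Sum>Z<b ^ Suc k. g (fset a b (Suc k) Z)) = (\<Sum>Z<b ^ k * b. g (fset a b (Suc k) Z))"
    by (simp add: mult.commute)
  also have "\<dots> = (\<Sum>x<b. \<Sum>Z<b ^ k. if x < a then g (insert k (fset a b k Z)) else g (fset a b k Z))"
    unfolding sum_split_nat by (intro sum.cong refl) (simp add: fs)
  also have "\<dots> = (\<Sum>x<b. if x < a then ?S (\<lambda>F. g (insert k F)) else ?S g)"
    by (intro sum.cong) auto
  also have "\<dots> = (\<Sum>x<a. ?S (\<lambda>F. g (insert k F))) + (\<Sum>x=a..<b. ?S g)"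
    using sum.atLeastLessThan_concat[of 0 a b "\<lambda>x. if x < a then ?S (\<lambda>F. g (insert k F)) else ?S g"] assms
    by (simp add: atLeast0LessThan)
  also have "\<dots> = a * (b ^ k * expect (a / b) {..<k} (\<lambda>F. g (insert k F))) + real (b - a) * (b ^ k * expect (a / b) {..<k} g)"
    using Suc.IH[of g] Suc.IH[of "\<lambda>F. g (insert k F)"] by simp
  also have "\<dots> = b ^ Suc k * expect (a / b) {..<Suc k} g"
    using assms by (simp add: lessThan_Suc expect_insert of_nat_diff field_simps)
  finally show ?case by simp
qed

text \<open>All digits of \<open>b ^ k - 1\<close> are \<open>b - 1\<close>, so the subtraction
  never borrows.\<close>

lemma dig_complement:
  assumes "Z < b ^ k" "c < k" "0 < b"
  shows "dig b c (b ^ k - 1 - Z) = b - 1 - dig b c Z"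
  using assms(1,2)
proof (induction c arbitrary: k Z)
  case (0 k Z)
  then obtain m where k: "k = Suc m" by (cases k) auto
  define q r where "q = Z div b" and "r = Z mod b"
  have Z: "Z = r + b * q" "r < b" "q < b ^ m" using 0 assms(3) k
    by (auto simp: q_def r_def less_mult_imp_div_less mult.commute)
  have "b ^ k - 1 - Z = (b - 1 - r) + b * (b ^ m - 1 - q)"
  proof -
    obtain r' where r': "b = Suc (r + r')" using Z(2) less_imp_Suc_add by blast
    obtain q' where q': "b ^ m = Suc (q + q')" using Z(3) less_imp_Suc_add by blast
    have "b ^ k = b * b ^ m" by (simp add: k)
    also have "\<dots> = b * q + b * q' + b" by (simp add: q' algebra_simps)
    finally show ?thesis using Z r' q' by simp
  qed
  then show ?case using Z dig_low[of "b - 1 - r" b] dig_low[of r b] assms(3) by simp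
next
  case (Suc c k Z)
  then obtain m where k: "k = Suc m" "c < m" by (cases k) auto
  define q r where "q = Z div b" and "r = Z mod b"
  have Z: "Z = r + b * q" "r < b" "q < b ^ m" using Suc.prems assms(3) k
    by (auto simp: q_def r_def less_mult_imp_div_less mult.commute)
  have "b ^ k - 1 - Z = (b - 1 - r) + b * (b ^ m - 1 - q)"
  proof -
    obtain r' where r': "b = Suc (r + r')" using Z(2) less_imp_Suc_add by blast
    obtain q' where q': "b ^ m = Suc (q + q')" using Z(3) less_imp_Suc_add by blast
    have "b ^ k = b * b ^ m" by (simp add: k)
    also have "\<dots> = b * q + b * q' + b" by (simp add: q' algebra_simps)
    finally show ?thesis using Z r' q' by simp
  qed
  then show ?case using Z dig_Suc_low[of "b - 1 - r" b] dig_Suc_low[of r b] assms(3) Suc.IH[OF Z(3) k(2)] by simp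
qed

section \<open>Rounding fractional labellings\<close>

text \<open>Labels are drawn independently from the distributions \<open>P v\<close>; as
  \<open>u \<noteq> v\<close> in every constraint, the left-hand side is the expected number of
  satisfied constraints, and some labelling reaches the expectation.\<close>

lemma rounding:
  fixes C :: "(nat \<times> nat \<times> nat list) list" and P :: "nat \<Rightarrow> nat \<Rightarrow> real"
  assumes k: "1 \<le> k" and C: "\<And>u v \<pi>. (u, v, \<pi>) \<in> set C \<Longrightarrow> u < n \<and> v < n \<and> u \<noteq> v"
    and P: "\<And>v c. v < n \<Longrightarrow> 0 \<le> P v c" "\<And>v. v < n \<Longrightarrow> (\<Sum>c<k. P v c) = 1"
  shows "\<exists>l \<in> {..<n} \<rightarrow>\<^sub>E {..<k}. (\<Sum>(u, v, \<pi>)\<leftarrow>C. \<Sum>c<k. \<Sum>c'<k. P u c * P v c' * of_bool (\<pi> ! c = c'))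
    \<le> real (length (filter (\<lambda>(u, v, \<pi>). \<pi> ! l u = l v) C))"
proof (rule ccontr)
  assume neg: "\<not> ?thesis"
  let ?X = "{..<n} \<rightarrow>\<^sub>E {..<k}"
  define w where "w l = (\<Prod>v<n. P v (l v))" for l
  define S where "S = (\<Sum>(u, v, \<pi>)\<leftarrow>C. \<Sum>c<k. \<Sum>c'<k. P u c * P v c' * of_bool (\<pi> ! c = c'))"
  define cnt where "cnt l = real (length (filter (\<lambda>(u, v, \<pi>). \<pi> ! l u = l v) C))" for l
  have fin: "finite ?X" by (intro finite_PiE) auto
  have prods: "(\<Sum>l\<in>?X. \<Prod>v<n. R v (l v)) = (\<Prod>v<n. \<Sum>c<k. R v c)" for R :: "nat \<Rightarrow> nat \<Rightarrow> real"
    by (rule prod_sum_PiE[symmetric]) auto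
  have w1: "(\<Sum>l\<in>?X. w l) = 1" unfolding w_def prods using P by simp
  have w0: "0 \<le> w l" for l unfolding w_def using P by (intro prod_nonneg) auto
  have pair: "(\<Sum>l\<in>?X. w l * of_bool (l u = c \<and> l v = c')) = P u c * P v c'"
    if "u < n" "v < n" "u \<noteq> v" "c < k" "c' < k" for u v c c'
  proof -
    \<comment> \<open>The indicator of two prescribed labels is absorbed into the factors, so that
      the expectation remains a product over the variables.\<close>
    define R where "R x d = P x d * (if x = u then of_bool (d = c) else if x = v then of_bool (d = c') else 1)" for x d
    have "w l * of_bool (l u = c \<and> l v = c') = (\<Prod>x<n. R x (l x))" for l
    proof -
      have "(\<Prod>x<n. R x (l x)) = w l * (\<Prod>x<n. if x = u then of_bool (l x = c) else if x = v then of_bool (l x = c') else 1)"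
        unfolding R_def w_def prod.distrib ..
      also have "(\<Prod>x<n. if x = u then of_bool (l x = c) else if x = v then of_bool (l x = c') else (1::real)) =
          (\<Prod>x\<in>{u, v}. if x = u then of_bool (l x = c) else if x = v then of_bool (l x = c') else 1)"
        using that by (intro prod.mono_neutral_right) auto
      also have "\<dots> = of_bool (l u = c \<and> l v = c')" using that by simp
      finally show ?thesis by simp
    qed
    then have "(\<Sum>l\<in>?X. w l * of_bool (l u = c \<and> l v = c')) = (\<Prod>x<n. \<Sum>d<k. R x d)" by (simp add: prods)
    also have "\<dots> = (\<Prod>x\<in>{u, v}. \<Sum>d<k. R x d)"
      using that P(2) by (intro prod.mono_neutral_right) (auto simp: R_def)
    also have "\<dots> = P u c * P v c'"
    proof -
      have "(\<Sum>d<k. R u d) = (\<Sum>d<k. if d = c then P u c else 0)" by (rule sum.cong) (auto simp: R_def)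
      moreover have "(\<Sum>d<k. R v d) = (\<Sum>d<k. if d = c' then P v c' else 0)"
        using that by (intro sum.cong) (auto simp: R_def)
      ultimately show ?thesis using that by simp
    qed
    finally show ?thesis .
  qed
  have one: "(\<Sum>l\<in>?X. w l * of_bool (\<pi> ! l u = l v)) = (\<Sum>c<k. \<Sum>c'<k. P u c * P v c' * of_bool (\<pi> ! c = c'))"
    if "(u, v, \<pi>) \<in> set C" for u v \<pi>
  proof -
    have uv: "u < n" "v < n" "u \<noteq> v" using C[OF that] by auto
    have "w l * of_bool (\<pi> ! l u = l v) = (\<Sum>c<k. \<Sum>c'<k. w l * of_bool (l u = c \<and> l v = c') * of_bool (\<pi> ! c = c'))"
      if "l \<in> ?X" for l
    proof -
      have "l u < k" "l v < k" using that uv by (auto simp: PiE_iff)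
      have "(\<Sum>c<k. \<Sum>c'<k. w l * of_bool (l u = c \<and> l v = c') * of_bool (\<pi> ! c = c')) =
          (\<Sum>c<k. \<Sum>c'<k. if c' = l v then (if c = l u then w l * of_bool (\<pi> ! l u = l v) else 0) else 0)"
        by (intro sum.cong) auto
      also have "\<dots> = w l * of_bool (\<pi> ! l u = l v)" using \<open>l u < k\<close> \<open>l v < k\<close> by simp
      finally show ?thesis by simp
    qed
    then have "(\<Sum>l\<in>?X. w l * of_bool (\<pi> ! l u = l v)) =
        (\<Sum>l\<in>?X. \<Sum>c<k. \<Sum>c'<k. w l * of_bool (l u = c \<and> l v = c') * of_bool (\<pi> ! c = c'))"
      by (intro sum.cong) auto
    also have "\<dots> = (\<Sum>c<k. \<Sum>l\<in>?X. \<Sum>c'<k. w l * of_bool (l u = c \<and> l v = c') * of_bool (\<pi> ! c = c'))"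
      by (rule sum.swap)
    also have "\<dots> = (\<Sum>c<k. \<Sum>c'<k. \<Sum>l\<in>?X. w l * of_bool (l u = c \<and> l v = c') * of_bool (\<pi> ! c = c'))"
      by (intro sum.cong refl sum.swap)
    also have "\<dots> = (\<Sum>c<k. \<Sum>c'<k. P u c * P v c' * of_bool (\<pi> ! c = c'))"
      unfolding sum_distrib_right[symmetric] using pair[OF uv] by (intro sum.cong) auto
    finally show ?thesis .
  qed
  have cnt_eq: "cnt l = (\<Sum>(u, v, \<pi>)\<leftarrow>C. of_bool (\<pi> ! l u = l v))" for l
    unfolding cnt_def by (induction C) auto
  have "(\<Sum>l\<in>?X. w l * (\<Sum>(u, v, \<pi>)\<leftarrow>C'. of_bool (\<pi> ! l u = l v))) =
      (\<Sum>(u, v, \<pi>)\<leftarrow>C'. \<Sum>c<k. \<Sum>c'<k. P u c * P v c' * of_bool (\<pi> ! c = c'))" if "set C' \<subseteq> set C" for C'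
    using that
  proof (induction C')
    case (Cons e C')
    obtain u v \<pi> where e: "e = (u, v, \<pi>)" by (cases e)
    show ?case using Cons one[of u v \<pi>] by (simp add: e distrib_left sum.distrib)
  qed simp
  then have "(\<Sum>l\<in>?X. w l * cnt l) = S" unfolding cnt_eq S_def by simp
  moreover have "(\<Sum>l\<in>?X. w l * cnt l) < (\<Sum>l\<in>?X. w l * S)"
  proof -
    have lt: "cnt l < S" if "l \<in> ?X" for l using neg that unfolding S_def cnt_def by (meson not_le)
    obtain l where l: "l \<in> ?X" "0 < w l"
    proof (rule ccontr)
      assume "\<not> thesis"
      then have "w l = 0" if "l \<in> ?X" for l using that w0[of l] \<open>\<And>l. l \<in> ?X \<Longrightarrow> 0 < w l \<Longrightarrow> thesis\<close> by fastforce
      then show False using w1 by simp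
    qed
    show ?thesis
    proof (rule sum_strict_mono_ex1)
      show "\<forall>l\<in>?X. w l * cnt l \<le> w l * S" by (intro ballI mult_left_mono less_imp_le[OF lt] w0)
      show "\<exists>l\<in>?X. w l * cnt l < w l * S" using l lt by (intro bexI[of _ l] mult_strict_left_mono) auto
    qed (rule fin)
  qed
  ultimately show False using w1 by (simp add: sum_distrib_right[symmetric])
qed

section \<open>From unique games to vertex cover\<close>

text \<open>The half-edges \<open>2 * e\<close> and \<open>2 * e + 1\<close> are the constraint \<open>C ! e\<close> seen from its two variables.\<close>

definition he_x :: "(nat \<times> nat \<times> nat list) list \<Rightarrow> nat \<Rightarrow> nat" where
  "he_x C h = (case C ! (h div 2) of (u, v, \<pi>) \<Rightarrow> if even h then u else v)"

definition he_y :: "(nat \<times> nat \<times> nat list) list \<Rightarrow> nat \<Rightarrow> nat" where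
  "he_y C h = (case C ! (h div 2) of (u, v, \<pi>) \<Rightarrow> if even h then v else u)"

definition he_rel :: "(nat \<times> nat \<times> nat list) list \<Rightarrow> nat \<Rightarrow> nat \<Rightarrow> nat \<Rightarrow> bool" where
  "he_rel C h c d = (case C ! (h div 2) of (u, v, \<pi>) \<Rightarrow> if even h then \<pi> ! c = d else \<pi> ! d = c)"

definition halves :: "(nat \<times> nat \<times> nat list) list \<Rightarrow> nat \<Rightarrow> nat list" where
  "halves C u = filter (\<lambda>h. he_x C h = u) [0..<2 * length C]"

text \<open>Reduction modulo the degree is only almost uniform: a half-edge can be hit up to twice
  as often as its share. This is the source of the factors 2 and 4 in the averaging lemmas.\<close>

definition pick :: "(nat \<times> nat \<times> nat list) list \<Rightarrow> nat \<Rightarrow> nat \<Rightarrow> nat" where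
  "pick C u j = halves C u ! (j mod length (halves C u))"

text \<open>Reading off the variable of a random half-edge weights variables by their degree, so
  that a random half-edge at that variable is again uniform among all half-edges.\<close>

definition nbr :: "(nat \<times> nat \<times> nat list) list \<Rightarrow> nat \<Rightarrow> nat \<Rightarrow> nat \<Rightarrow> nat" where
  "nbr C l t i = pick C (he_x C (dig (2 * length C) l t)) (dig (2 * length C) i t)"

text \<open>A vertex \<open>v\<close> encodes a set of labels (its last \<open>k\<close> digits in base \<open>2 * s\<close>; each label is present
  with probability \<open>(s - 1) / (2 * s)\<close>) and a half-edge, whose variable is \<open>x\<close>, together with \<open>l\<close>
  almost uniformly chosen half-edges at \<open>x\<close>.\<close>

definition conflict :: "(nat \<times> nat \<times> nat list) list \<Rightarrow> nat \<Rightarrow> nat \<Rightarrow> nat \<Rightarrow> nat \<Rightarrow> nat \<Rightarrow> bool" where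
  "conflict C k s l v v' \<longleftrightarrow> (\<exists>i<l. \<exists>i'<l.
     he_y C (nbr C l (v div (2 * s) ^ k) i) = he_y C (nbr C l (v' div (2 * s) ^ k) i') \<and>
     \<not> (\<exists>c<k. \<exists>c'<k. \<exists>d<k. dig (2 * s) c v < s - 1 \<and> dig (2 * s) c' v' < s - 1 \<and>
          he_rel C (nbr C l (v div (2 * s) ^ k) i) c d \<and> he_rel C (nbr C l (v' div (2 * s) ^ k) i') c' d))"

section \<open>The conflict graph of a unique game\<close>

locale ug_graph =
  fixes n :: nat and C :: "(nat \<times> nat \<times> nat list) list" and k s l :: nat
  assumes wf: "wf_unique_game k (n, C)" and k: "1 \<le> k" and s: "2 \<le> s" and l: "1 \<le> l"
begin

definition "M = 2 * length C"
definition "b = 2 * s"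
definition "N0 = b ^ k * M ^ Suc l"

lemma M_pos: "0 < M" using wf by (simp add: wf_unique_game_def M_def)

lemma b_pos: "0 < b" using s by (simp add: b_def)

lemma nbr_eq: "nbr C l t i = pick C (he_x C (dig M l t)) (dig M i t)"
  by (simp add: nbr_def M_def)

lemma conflict_iff: "conflict C k s l v v' \<longleftrightarrow> (\<exists>i<l. \<exists>i'<l.
     he_y C (nbr C l (v div b ^ k) i) = he_y C (nbr C l (v' div b ^ k) i') \<and>
     \<not> (\<exists>c<k. \<exists>c'<k. \<exists>d<k. dig b c v < s - 1 \<and> dig b c' v' < s - 1 \<and>
          he_rel C (nbr C l (v div b ^ k) i) c d \<and> he_rel C (nbr C l (v' div b ^ k) i') c' d))"
  unfolding conflict_def b_def ..

lemma constraint: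
  assumes "h < M"
  obtains u v \<pi> where "C ! (h div 2) = (u, v, \<pi>)" "(u, v, \<pi>) \<in> set C" "u < n" "v < n" "u \<noteq> v"
    "bij_betw ((!) \<pi>) {..<k} {..<k}"
proof -
  obtain u v \<pi> where e: "C ! (h div 2) = (u, v, \<pi>)" by (cases "C ! (h div 2)")
  have mem: "(u, v, \<pi>) \<in> set C" using assms e by (metis M_def less_mult_imp_div_less mult.commute nth_mem)
  then have "u < n" "v < n" "u \<noteq> v" and \<pi>: "distinct \<pi>" "set \<pi> = {..<k}"
    using wf by (auto simp: wf_unique_game_def)
  moreover have "length \<pi> = k" using distinct_card[OF \<pi>(1)] \<pi>(2) by simp
  then have "bij_betw ((!) \<pi>) {..<k} {..<k}" using \<pi> by (intro bij_betw_nth) auto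
  ultimately show thesis using that e mem by blast
qed

definition perm :: "nat \<Rightarrow> nat \<Rightarrow> nat" where
  "perm h c = (case C ! (h div 2) of (u, v, \<pi>) \<Rightarrow> if even h then \<pi> ! c else inv_into {..<k} ((!) \<pi>) c)"

lemma bij_perm: "h < M \<Longrightarrow> bij_betw (perm h) {..<k} {..<k}"
proof (erule constraint)
  fix u v \<pi> assume "C ! (h div 2) = (u, v, \<pi>)" and b: "bij_betw ((!) \<pi>) {..<k} {..<k}"
  then have "perm h = (if even h then (!) \<pi> else inv_into {..<k} ((!) \<pi>))" by (auto simp: perm_def fun_eq_iff)
  then show ?thesis using b bij_betw_inv_into by auto
qed

lemma rel_perm:
  assumes "h < M" "c < k" "d < k"
  shows "he_rel C h c d \<longleftrightarrow> perm h c = d"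
proof -
  obtain u v \<pi> where e: "C ! (h div 2) = (u, v, \<pi>)" and b: "bij_betw ((!) \<pi>) {..<k} {..<k}"
    using constraint[OF assms(1)] by metis
  have "inv_into {..<k} ((!) \<pi>) c = d \<longleftrightarrow> \<pi> ! d = c"
    using bij_betw_inv_into_left[OF b, of d] bij_betw_inv_into_right[OF b, of c] assms by auto
  then show ?thesis by (simp add: he_rel_def perm_def e)
qed

lemma perm_less: "h < M \<Longrightarrow> c < k \<Longrightarrow> perm h c < k"
  using bij_perm[of h] by (auto simp: bij_betw_def)

lemma he_less: "h < M \<Longrightarrow> he_x C h < n" "h < M \<Longrightarrow> he_y C h < n"
  by (erule constraint; simp add: he_x_def he_y_def)+

lemma set_halves: "set (halves C u) = {h. h < M \<and> he_x C h = u}"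
  by (auto simp: halves_def M_def)

lemma distinct_halves: "distinct (halves C u)"
  by (simp add: halves_def)

abbreviation "deg u \<equiv> length (halves C u)"

lemma deg_le: "deg u \<le> M"
  unfolding halves_def M_def using length_filter_le[of _ "[0..<2 * length C]"] by simp

lemma deg_pos: "h < M \<Longrightarrow> 0 < deg (he_x C h)"
  using set_halves[of "he_x C h"] by (metis (mono_tags, lifting) length_greater_0_conv list.set(1) empty_iff mem_Collect_eq)

lemma pick_mem: "0 < deg u \<Longrightarrow> pick C u j < M \<and> he_x C (pick C u j) = u"
proof -
  assume "0 < deg u"
  then have "pick C u j \<in> set (halves C u)" by (simp add: pick_def)
  then show ?thesis by (simp add: set_halves)
qed

section \<open>Averaging over sampled half-edges\<close>

definition hsum :: "nat \<Rightarrow> (nat \<Rightarrow> real) \<Rightarrow> real" where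
  "hsum u w = (\<Sum>h\<in>set (halves C u). w h)"

lemma sum_pick_le:
  assumes "0 < deg u" "\<And>h. 0 \<le> w h"
  shows "(\<Sum>j<M. w (pick C u j)) \<le> 2 * M / deg u * hsum u w"
proof -
  let ?d = "deg u"
  \<comment> \<open>\<open>M\<close> is rounded up to a multiple of the degree, which at most
    doubles it because the degree is at most \<open>M\<close>.\<close>
  define q where "q = M div ?d + 1"
  have "M < ?d * q" using assms(1) unfolding q_def
    by (metis Suc_eq_plus1 add.commute dividend_less_times_div mult_Suc_right)
  then have "(\<Sum>j<M. w (pick C u j)) \<le> (\<Sum>j<?d * q. w (pick C u j))"
    using assms(2) by (intro sum_mono2) auto
  also have "\<dots> = (\<Sum>x<q. \<Sum>a<?d. w (halves C u ! a))"
    unfolding sum_split_nat by (intro sum.cong refl) (simp add: pick_def)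
  also have "\<dots> = q * hsum u w"
  proof -
    have "(\<Sum>a<?d. w (halves C u ! a)) = hsum u w"
      unfolding hsum_def using bij_betw_nth[OF distinct_halves refl refl] by (rule sum.reindex_bij_betw)
    then show ?thesis by simp
  qed
  also have "\<dots> \<le> 2 * M / ?d * hsum u w"
  proof (rule mult_right_mono)
    have "1 \<le> M div ?d" using deg_le assms(1) by (simp add: div_greater_zero_iff Suc_leI)
    then have "q \<le> 2 * (M div ?d)" by (simp add: q_def)
    then have "real q \<le> 2 * real (M div ?d)" by (metis of_nat_le_iff of_nat_mult of_nat_numeral)
    also have "real (M div ?d) \<le> M / ?d" 
      using assms(1) by (subst pos_le_divide_eq) (auto simp: div_times_less_eq_dividend simp flip: of_nat_mult)
    finally show "real q \<le> 2 * M / ?d" by simp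
    show "0 \<le> hsum u w" unfolding hsum_def using assms(2) by (intro sum_nonneg)
  qed
  finally show ?thesis .
qed

text \<open>Double counting: each variable is reached as often as its degree says, which cancels the
  averaging over its half-edges.\<close>

lemma sum_average: "(\<Sum>h<M. 1 / deg (he_x C h) * hsum (he_x C h) w) = (\<Sum>h<M. w h)"
proof -
  have H: "hsum u w = (\<Sum>h<M. if he_x C h = u then w h else 0)" for u w
    unfolding hsum_def set_halves by (subst sum.inter_filter[symmetric]) (auto intro!: sum.cong)
  have "(\<Sum>h<M. 1 / deg (he_x C h) * hsum (he_x C h) w) =
      (\<Sum>h<M. \<Sum>h'<M. if he_x C h' = he_x C h then 1 / deg (he_x C h') * w h' else 0)"
    unfolding H sum_distrib_left by (intro sum.cong) auto
  also have "\<dots> = (\<Sum>h'<M. \<Sum>h<M. if he_x C h' = he_x C h then 1 / deg (he_x C h') * w h' else 0)"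
    by (rule sum.swap)
  also have "\<dots> = (\<Sum>h'<M. w h')"
  proof (rule sum.cong)
    fix h' assume "h' \<in> {..<M}"
    then have d: "0 < deg (he_x C h')" using deg_pos by auto
    have "(\<Sum>h<M. if he_x C h' = he_x C h then 1 / deg (he_x C h') * w h' else 0) =
        (\<Sum>h<M. if he_x C h = he_x C h' then 1 / deg (he_x C h') * w h' else 0)" by (rule sum.cong) auto
    also have "\<dots> = hsum (he_x C h') (\<lambda>_. 1 / deg (he_x C h') * w h')" unfolding H ..
    also have "\<dots> = w h'" using d distinct_card[OF distinct_halves[of "he_x C h'"]] by (simp add: hsum_def)
    finally show "(\<Sum>h<M. if he_x C h' = he_x C h then 1 / deg (he_x C h') * w h' else 0) = w h'" .
  qed simp
  finally show ?thesis .
qed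

lemma nbr_split:
  assumes "t < M ^ l" "h < M" "i < l"
  shows "nbr C l (t + M ^ l * h) i = pick C (he_x C h) (dig M i t)"
  using assms M_pos by (simp add: nbr_eq dig_top dig_add_high)

lemma nbr_mem:
  "nbr C l t i < M \<and> he_x C (nbr C l t i) = he_x C (dig M l t)"
  unfolding nbr_eq using pick_mem deg_pos dig_less[OF M_pos] by blast

lemma sum_nbr_le:
  fixes w :: "nat \<Rightarrow> real"
  assumes "i < l" "\<And>h. 0 \<le> w h"
  shows "(\<Sum>t<M ^ Suc l. w (nbr C l t i)) \<le> 2 * M ^ l * (\<Sum>h<M. w h)"
proof -
  have "(\<Sum>t<M ^ Suc l. w (nbr C l t i)) = (\<Sum>t<M ^ l * M. w (nbr C l t i))" by (simp add: mult.commute)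
  also have "\<dots> = (\<Sum>h<M. \<Sum>t<M ^ l. w (pick C (he_x C h) (dig M i t)))"
    unfolding sum_split_nat[where A = "M ^ l" and B = M] using assms(1) by (intro sum.cong refl) (simp add: nbr_split)
  also have "\<dots> = (\<Sum>h<M. M ^ (l - 1) * (\<Sum>j<M. w (pick C (he_x C h) j)))"
  proof (intro sum.cong refl)
    fix h
    show "(\<Sum>t<M ^ l. w (pick C (he_x C h) (dig M i t))) = M ^ (l - 1) * (\<Sum>j<M. w (pick C (he_x C h) j))"
      using sum_digit[OF assms(1) M_pos, of "\<lambda>j. w (pick C (he_x C h) j)"] by simp
  qed
  also have "\<dots> \<le> (\<Sum>h<M. M ^ (l - 1) * (2 * M / deg (he_x C h) * hsum (he_x C h) w))"
    using assms(2) deg_pos by (intro sum_mono mult_left_mono sum_pick_le) auto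
  also have "\<dots> = (2 * M ^ l) * (\<Sum>h<M. 1 / deg (he_x C h) * hsum (he_x C h) w)"
  proof -
    have "real M ^ l = M * M ^ (l - 1)" using l by (cases l) auto
    then show ?thesis by (simp add: sum_distrib_left algebra_simps)
  qed
  finally show ?thesis unfolding sum_average by simp
qed

text \<open>The set consists of the vertices whose whole sample is satisfied and whose label set
  contains the label of their variable; two of them with a common neighbour meet in the label of
  that neighbour. The loss is a union bound over the \<open>l\<close> samples, doubled by the
  imperfect sampling.\<close>

lemma completeness:
  fixes \<epsilon> :: real
  assumes lab: "\<And>u. u < n \<Longrightarrow> lab u < k"
    and unsat: "(\<Sum>h<M. of_bool (perm h (lab (he_x C h)) \<noteq> lab (he_y C h))) \<le> \<epsilon> * real M"
  shows "\<exists>I \<subseteq> {..<N0}. (\<forall>v\<in>I. \<forall>v'\<in>I. \<not> conflict C k s l v v') \<and>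
    (1 - 2 * l * \<epsilon>) * (real (s - 1) / b) * N0 \<le> card I"
proof -
  define un where "un h = (of_bool (perm h (lab (he_x C h)) \<noteq> lab (he_y C h)) :: real)" for h
  define good where "good t \<longleftrightarrow> (\<forall>i<l. un (nbr C l t i) = 0)" for t
  define root where "root t = he_x C (dig M l t)" for t
  define I where "I = {v. v < N0 \<and> good (v div b ^ k) \<and> dig b (lab (root (v div b ^ k))) v < s - 1}"
  note b0 = b_pos
  have rootn: "root t < n" for t unfolding root_def using he_less dig_less[OF M_pos] by blast
  have noconf: "\<not> conflict C k s l v v'" if "v \<in> I" "v' \<in> I" for v v'
  proof
    assume "conflict C k s l v v'"
    then obtain i i' where i: "i < l" "i' < l" and y: "he_y C (nbr C l (v div b ^ k) i) = he_y C (nbr C l (v' div b ^ k) i')"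
      and no: "\<And>c c' d. c < k \<Longrightarrow> c' < k \<Longrightarrow> d < k \<Longrightarrow> dig b c v < s - 1 \<Longrightarrow> dig b c' v' < s - 1 \<Longrightarrow>
          he_rel C (nbr C l (v div b ^ k) i) c d \<Longrightarrow> he_rel C (nbr C l (v' div b ^ k) i') c' d \<Longrightarrow> False"
      unfolding conflict_iff by blast
    have r: "he_rel C (nbr C l t j) (lab (root t)) (lab (he_y C (nbr C l t j)))" if "good t" "j < l" for t j
    proof -
      have "un (nbr C l t j) = 0" using that by (simp add: good_def)
      then have "perm (nbr C l t j) (lab (root t)) = lab (he_y C (nbr C l t j))"
        using nbr_mem[of t j] by (auto simp: un_def root_def)
      then show ?thesis using rel_perm nbr_mem[of t j] lab rootn he_less by blast
    qed
    show False
      by (rule no[of "lab (root (v div b ^ k))" "lab (root (v' div b ^ k))" "lab (he_y C (nbr C l (v div b ^ k) i))"])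
        (use that i r[of "v div b ^ k" i] r[of "v' div b ^ k" i'] lab rootn he_less nbr_mem y in \<open>auto simp: I_def\<close>)
  qed
  have "real (card I) = (\<Sum>v<N0. of_bool (good (v div b ^ k) \<and> dig b (lab (root (v div b ^ k))) v < s - 1))"
    by (subst sum_of_bool_eq) (auto simp: I_def intro!: arg_cong[where f = card])
  also have "\<dots> = (\<Sum>t<M ^ Suc l. \<Sum>Z<b ^ k. of_bool (good t \<and> dig b (lab (root t)) Z < s - 1))"
    unfolding N0_def sum_split_nat using lab rootn b0
    by (intro sum.cong refl) (auto simp: dig_add_high)
  also have "\<dots> = (\<Sum>t<M ^ Suc l. of_bool (good t) * (\<Sum>Z<b ^ k. of_bool (dig b (lab (root t)) Z < s - 1)))"
    by (simp add: of_bool_conj sum_distrib_left del: sum_of_bool_eq)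
  also have "\<dots> = (\<Sum>t<M ^ Suc l. of_bool (good t) * (b ^ (k - 1) * real (s - 1)))"
  proof (intro sum.cong refl arg_cong2[where f = "(*)"])
    fix t
    have "(\<Sum>x<b. of_bool (x < s - 1) :: real) = (\<Sum>x<s - 1. 1)"
      by (rule sum.mono_neutral_cong_right) (auto simp: b_def)
    then show "(\<Sum>Z<b ^ k. of_bool (dig b (lab (root t)) Z < s - 1)) = b ^ (k - 1) * real (s - 1)"
      using sum_digit[OF lab[OF rootn[of t]] b0, of "\<lambda>x. of_bool (x < s - 1)"] by simp
  qed
  also have "\<dots> = (\<Sum>t<M ^ Suc l. of_bool (good t)) * (b ^ (k - 1) * real (s - 1))"
    by (rule sum_distrib_right[symmetric])
  finally have cI: "real (card I) = (\<Sum>t<M ^ Suc l. of_bool (good t)) * (b ^ (k - 1) * real (s - 1))" .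
  have "real (M ^ Suc l) - (\<Sum>t<M ^ Suc l. of_bool (good t)) = (\<Sum>t<M ^ Suc l. 1 - of_bool (good t))"
    by (simp add: sum_subtractf del: sum_of_bool_eq)
  also have "\<dots> \<le> (\<Sum>t<M ^ Suc l. \<Sum>i<l. un (nbr C l t i))"
  proof (rule sum_mono)
    fix t
    have n0: "0 \<le> un h" for h by (simp add: un_def)
    show "1 - of_bool (good t) \<le> (\<Sum>i<l. un (nbr C l t i))"
    proof (cases "good t")
      case False
      then obtain i where i: "i < l" "un (nbr C l t i) \<noteq> 0" by (auto simp: good_def)
      then have "un (nbr C l t i) = 1" by (auto simp: un_def split: if_splits)
      moreover have "un (nbr C l t i) \<le> (\<Sum>i<l. un (nbr C l t i))"
        using i n0 by (intro member_le_sum) auto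
      ultimately show ?thesis using False by simp
    qed (use n0 in \<open>simp add: sum_nonneg\<close>)
  qed
  also have "\<dots> = (\<Sum>i<l. \<Sum>t<M ^ Suc l. un (nbr C l t i))" by (rule sum.swap)
  also have "\<dots> \<le> (\<Sum>i<l. 2 * M ^ l * (\<Sum>h<M. un h))" by (intro sum_mono sum_nbr_le) (auto simp: un_def)
  also have "\<dots> \<le> (\<Sum>i<l. 2 * M ^ l * (\<epsilon> * real M))"
    using unsat by (intro sum_mono mult_left_mono) (auto simp: un_def)
  finally have g: "(1 - 2 * l * \<epsilon>) * real (M ^ Suc l) \<le> (\<Sum>t<M ^ Suc l. of_bool (good t))"
    by (simp add: algebra_simps)
  have "(1 - 2 * l * \<epsilon>) * (real (s - 1) / b) * N0 = ((1 - 2 * l * \<epsilon>) * real (M ^ Suc l)) * (b ^ (k - 1) * real (s - 1))"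
  proof -
    have "real b ^ k = b * b ^ (k - 1)" using k by (cases k) auto
    then have "real (s - 1) / b * real N0 = real (M ^ Suc l) * (b ^ (k - 1) * real (s - 1))"
      unfolding N0_def using b0 by simp
    then show ?thesis by (simp only: mult.assoc)
  qed
  also have "\<dots> \<le> real (card I)" unfolding cI using g by (intro mult_right_mono) auto
  finally show ?thesis using noconf by (intro exI[of _ I]) (auto simp: I_def)
qed

text \<open>Complementary digits add up to \<open>2 * s - 1\<close>, so they cannot both be below
  \<open>s - 1\<close> and the two label sets are disjoint. At a common sampled half-edge labels are
  matched injectively, so disjoint sets share nothing there.\<close>

lemma conflict_complement:
  assumes "v < N0"
  defines "v' \<equiv> b ^ k * (v div b ^ k) + (b ^ k - 1 - v mod b ^ k)"
  shows "conflict C k s l v v'" "v' < N0" "v' div b ^ k = v div b ^ k" "v' mod b ^ k = b ^ k - 1 - v mod b ^ k"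
proof -
  have b0: "0 < b" "0 < b ^ k" using b_pos by auto
  let ?t = "v div b ^ k" and ?Z = "v mod b ^ k"
  let ?Z' = "b ^ k - 1 - ?Z"
  have Z: "?Z < b ^ k" "?Z' < b ^ k" using b0 by auto
  have v': "v' = ?Z' + b ^ k * ?t" unfolding v'_def by simp
  have v: "v = ?Z + b ^ k * ?t" by simp
  show dv: "v' div b ^ k = ?t" and "v' mod b ^ k = ?Z'" unfolding v' using Z b0 by auto
  have "?t < M ^ Suc l" using assms(1) unfolding N0_def by (metis less_mult_imp_div_less mult.commute)
  then have "b ^ k * ?t + b ^ k \<le> N0" unfolding N0_def
    by (metis Suc_leI add.commute mult_Suc_right mult_le_mono2)
  then show "v' < N0" unfolding v' using Z by linarith
  have d: "dig b c v' = b - 1 - dig b c v" if "c < k" for c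
  proof -
    have "dig b c v' = dig b c ?Z'" unfolding v' using that b0 by (rule_tac dig_add_high)
    moreover have "dig b c v = dig b c ?Z" using dig_add_high[OF that b0(1), of ?Z ?t] v by simp
    ultimately show ?thesis using dig_complement[OF Z(1) that b0(1)] by simp
  qed
  let ?h = "nbr C l ?t 0"
  have "\<not> (\<exists>c<k. \<exists>c'<k. \<exists>d<k. dig b c v < s - 1 \<and> dig b c' v' < s - 1 \<and> he_rel C ?h c d \<and> he_rel C ?h c' d)"
  proof (intro notI, elim exE conjE)
    fix c c' d' assume h: "c < k" "c' < k" "d' < k" "dig b c v < s - 1" "dig b c' v' < s - 1" "he_rel C ?h c d'" "he_rel C ?h c' d'"
    then have "perm ?h c = perm ?h c'" using rel_perm nbr_mem by auto
    then have "c = c'" using bij_perm[of ?h] nbr_mem[of ?t 0] h by (auto simp: bij_betw_def inj_on_def)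
    then show False using h d[of c] by (simp add: b_def)
  qed
  moreover have "0 < l" using l by simp
  ultimately show "conflict C k s l v v'"
    unfolding conflict_iff dv by (intro exI[of _ 0] conjI refl)
qed

text \<open>Each copy of a vertex is paired with the corresponding copy of its complement, so the
  vertices outside a cover inject into the cover.\<close>

lemma cover_ge_half:
  assumes D: "1 \<le> D" and X: "X \<subseteq> {..<N0 * D}"
    and cover: "\<And>I I'. I < N0 * D \<Longrightarrow> I' < N0 * D \<Longrightarrow> I \<noteq> I' \<Longrightarrow> conflict C k s l (I div D) (I' div D) \<Longrightarrow> I \<in> X \<or> I' \<in> X"
  shows "N0 * D \<le> 2 * card X"
proof -
  define cmp where "cmp v = b ^ k * (v div b ^ k) + (b ^ k - 1 - v mod b ^ k)" for v
  define \<tau> where "\<tau> I = cmp (I div D) * D + I mod D" for I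
  have b0: "0 < b ^ k" using b_pos by simp
  have lt: "I div D < N0" if "I < N0 * D" for I using that by (simp add: less_mult_imp_div_less)
  have \<tau>: "\<tau> I div D = cmp (I div D)" "\<tau> I mod D = I mod D" for I using D by (simp_all add: \<tau>_def)
  have \<tau>N: "\<tau> I < N0 * D" if "I < N0 * D" for I
  proof -
    have "Suc (cmp (I div D)) \<le> N0" using conflict_complement(2)[OF lt[OF that]] by (simp add: cmp_def)
    then have "cmp (I div D) * D + D \<le> N0 * D" by (metis add.commute mult_Suc mult_le_mono1)
    moreover have "I mod D < D" using D by simp
    ultimately show ?thesis unfolding \<tau>_def by linarith
  qed
  \<comment> \<open>\<open>b ^ k\<close> is even, so no code is its own complement and no vertex is
    paired with itself.\<close>
  have par: False if "x = y - 1 - x" "even y" "x < y" for x y :: nat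
    using that by presburger
  have ne: "\<tau> I \<noteq> I" if "I < N0 * D" for I
  proof
    assume "\<tau> I = I"
    then have "cmp (I div D) = I div D" using \<tau>(1)[of I] by simp
    then have "(I div D) mod b ^ k = b ^ k - 1 - (I div D) mod b ^ k"
      using conflict_complement(4)[OF lt[OF that]] by (simp add: cmp_def)
    moreover have "even (b ^ k)" using k by (simp add: b_def)
    moreover have "(I div D) mod b ^ k < b ^ k" using b0 by simp
    ultimately show False by (rule par)
  qed
  have "inj_on \<tau> ({..<N0 * D} - X)"
  proof (rule inj_onI)
    fix I I' assume I: "I \<in> {..<N0 * D} - X" "I' \<in> {..<N0 * D} - X" "\<tau> I = \<tau> I'"
    then have md: "I mod D = I' mod D" "cmp (I div D) = cmp (I' div D)" using \<tau> by metis+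
    have l': "I div D < N0" "I' div D < N0" using I lt by auto
    have "(I div D) div b ^ k = (I' div D) div b ^ k"
      using conflict_complement(3)[OF l'(1), folded cmp_def] conflict_complement(3)[OF l'(2), folded cmp_def] md(2) by metis
    moreover have "b ^ k - 1 - (I div D) mod b ^ k = b ^ k - 1 - (I' div D) mod b ^ k"
      using conflict_complement(4)[OF l'(1), folded cmp_def] conflict_complement(4)[OF l'(2), folded cmp_def] md(2) by metis
    moreover have "(I div D) mod b ^ k < b ^ k" "(I' div D) mod b ^ k < b ^ k" using b0 by simp_all
    then have "(I div D) mod b ^ k \<le> b ^ k - 1" "(I' div D) mod b ^ k \<le> b ^ k - 1" by linarith+
    ultimately have "(I div D) mod b ^ k = (I' div D) mod b ^ k" "(I div D) div b ^ k = (I' div D) div b ^ k"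
      by linarith+
    then have "I div D = I' div D" by (metis mult_div_mod_eq)
    then show "I = I'" using md(1) by (metis mult_div_mod_eq)
  qed
  moreover have "\<tau> ` ({..<N0 * D} - X) \<subseteq> X"
  proof
    fix J assume "J \<in> \<tau> ` ({..<N0 * D} - X)"
    then obtain I where I: "I < N0 * D" "I \<notin> X" "J = \<tau> I" by auto
    have "conflict C k s l (I div D) (\<tau> I div D)"
      unfolding \<tau>(1) cmp_def by (rule conflict_complement(1)[OF lt[OF I(1)]])
    then show "J \<in> X" using cover[of I "\<tau> I"] I \<tau>N ne by metis
  qed
  moreover have fX: "finite X" using X finite_subset by blast
  ultimately have "card ({..<N0 * D} - X) \<le> card X" by (metis card_inj_on_le)
  moreover have "card ({..<N0 * D} - X) = N0 * D - card X" using X fX by (simp add: card_Diff_subset)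
  ultimately show ?thesis by simp
qed

text \<open>The blow-up by \<open>D\<close> makes up for the absence of loops: an independent set of the blow-up that
  contains two copies of \<open>v\<close> shows that \<open>v\<close> does not conflict with itself.\<close>

lemma independent_of_cover:
  assumes D: "1 \<le> D" and X: "X \<subseteq> {..<N0 * D}"
    and cover: "\<And>I I'. I < N0 * D \<Longrightarrow> I' < N0 * D \<Longrightarrow> I \<noteq> I' \<Longrightarrow> conflict C k s l (I div D) (I' div D) \<Longrightarrow> I \<in> X \<or> I' \<in> X"
  obtains Ind where "Ind \<subseteq> {..<N0}" "\<And>v v'. v \<in> Ind \<Longrightarrow> v' \<in> Ind \<Longrightarrow> \<not> conflict C k s l v v'"
    "N0 * D - card X \<le> D * card Ind + N0"
proof -
  define U where "U v = {I \<in> {..<N0 * D} - X. I div D = v}" for v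
  define Ind where "Ind = {v. v < N0 \<and> 2 \<le> card (U v)}"
  have fU: "finite (U v)" for v by (simp add: U_def)
  have Ub: "card (U v) \<le> D" for v
  proof -
    have "U v \<subseteq> {v * D..<v * D + D}"
    proof
      fix I assume "I \<in> U v"
      then have "I = v * D + I mod D" by (auto simp: U_def)
      moreover have "I mod D < D" using D by simp
      ultimately show "I \<in> {v * D..<v * D + D}" by (metis atLeastLessThan_iff le_add1 nat_add_left_cancel_less)
    qed
    then show ?thesis using card_mono[of "{v * D..<v * D + D}" "U v"] by simp
  qed
  have "\<not> conflict C k s l v v'" if v: "v \<in> Ind" "v' \<in> Ind" for v v'
  proof
    assume c: "conflict C k s l v v'"
    have "card (U v) > 0" "card (U v') \<ge> 2" using v by (auto simp: Ind_def)
    then obtain I where I: "I \<in> U v" by (metis card.empty equals0I less_numeral_extra(3))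
    have "U v' - {I} \<noteq> {}"
    proof
      assume "U v' - {I} = {}"
      then have "U v' \<subseteq> {I}" by auto
      then have "card (U v') \<le> 1" using card_mono[of "{I}" "U v'"] by simp
      then show False using \<open>card (U v') \<ge> 2\<close> by simp
    qed
    then obtain I' where I': "I' \<in> U v'" "I' \<noteq> I" by blast
    then show False using cover[of I I'] I c by (auto simp: U_def)
  qed
  moreover have "N0 * D - card X \<le> D * card Ind + N0"
  proof -
    have fX: "finite X" using X finite_subset by blast
    have "N0 * D - card X = card ({..<N0 * D} - X)" using X fX by (simp add: card_Diff_subset)
    also have "{..<N0 * D} - X = (\<Union>v<N0. U v)" by (auto simp: U_def less_mult_imp_div_less)
    also have "card \<dots> \<le> (\<Sum>v<N0. card (U v))" by (rule card_UN_le) simp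
    also have "\<dots> \<le> (\<Sum>v<N0. (if v \<in> Ind then D else 0) + 1)"
    proof (rule sum_mono)
      fix v assume "v \<in> {..<N0}"
      then show "card (U v) \<le> (if v \<in> Ind then D else 0) + 1"
        using Ub[of v] by (cases "2 \<le> card (U v)") (auto simp: Ind_def)
    qed
    also have "\<dots> = D * card Ind + N0"
    proof -
      have "{..<N0} \<inter> Ind = Ind" by (auto simp: Ind_def)
      then have "(\<Sum>v<N0. if v \<in> Ind then D else 0) = D * card Ind"
        using sum.inter_restrict[of "{..<N0}" "\<lambda>_. D" Ind] by (simp add: mult.commute)
      then show ?thesis unfolding sum.distrib by simp
    qed
    finally show ?thesis .
  qed
  ultimately show thesis using that[of Ind] by (auto simp: Ind_def)
qed

end

section \<open>Soundness: from independent sets to labellings\<close>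

context ug_graph begin

lemma hsum_cong: "(\<And>h. h < M \<Longrightarrow> he_x C h = u \<Longrightarrow> f h = g h) \<Longrightarrow> hsum u f = hsum u g"
  unfolding hsum_def by (rule sum.cong) (auto simp: set_halves)

lemma hsum_cmult: "hsum u (\<lambda>h. c * f h) = c * hsum u f"
  unfolding hsum_def by (rule sum_distrib_left[symmetric])

text \<open>Given the variable, the two samples are independent, and each costs a factor 2 against
  the uniform choice. Averaging over the first sample then turns the outer sum into one over all
  half-edges \<open>h\<close>.\<close>

lemma sum_nbr_pair_le:
  fixes w :: "nat \<Rightarrow> nat \<Rightarrow> real"
  assumes "i < j" "j < l" "\<And>h h'. 0 \<le> w h h'"
  shows "(\<Sum>t<M ^ Suc l. w (nbr C l t i) (nbr C l t j)) \<le>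
    4 * M ^ l * (\<Sum>h<M. 1 / deg (he_x C h) * hsum (he_x C h) (w h))"
proof -
  define W where "W u = hsum u (\<lambda>h. hsum u (w h))" for u
  have il: "i < l" using assms by simp
  have W0: "0 \<le> hsum u (w h)" for u h unfolding hsum_def using assms(3) by (intro sum_nonneg)
  have "(\<Sum>t<M ^ Suc l. w (nbr C l t i) (nbr C l t j)) = (\<Sum>t<M ^ l * M. w (nbr C l t i) (nbr C l t j))"
    by (simp add: mult.commute)
  also have "\<dots> = (\<Sum>h<M. \<Sum>t<M ^ l. w (pick C (he_x C h) (dig M i t)) (pick C (he_x C h) (dig M j t)))"
    unfolding sum_split_nat[where A = "M ^ l" and B = M] using assms(2) il
    by (intro sum.cong refl) (simp add: nbr_split)
  also have "\<dots> = (\<Sum>h<M. real M ^ (l - 2) * (\<Sum>x<M. \<Sum>y<M. w (pick C (he_x C h) x) (pick C (he_x C h) y)))"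
  proof (intro sum.cong refl)
    fix h
    show "(\<Sum>t<M ^ l. w (pick C (he_x C h) (dig M i t)) (pick C (he_x C h) (dig M j t))) =
        real M ^ (l - 2) * (\<Sum>x<M. \<Sum>y<M. w (pick C (he_x C h) x) (pick C (he_x C h) y))"
      using sum_two_digits[OF assms(1,2) M_pos, of "\<lambda>x y. w (pick C (he_x C h) x) (pick C (he_x C h) y)"] by simp
  qed
  also have "\<dots> \<le> (\<Sum>h<M. real M ^ (l - 2) * ((2 * M / deg (he_x C h))\<^sup>2 * W (he_x C h)))"
  proof (intro sum_mono mult_left_mono)
    fix h assume "h \<in> {..<M}"
    then have d: "0 < deg (he_x C h)" using deg_pos by auto
    let ?u = "he_x C h"
    have "(\<Sum>x<M. \<Sum>y<M. w (pick C ?u x) (pick C ?u y)) \<le> (\<Sum>x<M. 2 * M / deg ?u * hsum ?u (w (pick C ?u x)))"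
      using d assms(3) by (intro sum_mono sum_pick_le) auto
    also have "\<dots> = 2 * M / deg ?u * (\<Sum>x<M. hsum ?u (w (pick C ?u x)))" by (rule sum_distrib_left[symmetric])
    also have "\<dots> \<le> 2 * M / deg ?u * (2 * M / deg ?u * W ?u)"
      unfolding W_def using d W0 by (intro mult_left_mono sum_pick_le) auto
    finally show "(\<Sum>x<M. \<Sum>y<M. w (pick C ?u x) (pick C ?u y)) \<le> (2 * M / deg ?u)\<^sup>2 * W ?u"
      by (simp add: power2_eq_square mult.assoc)
  qed auto
  also have "\<dots> = 4 * M ^ l * (\<Sum>h<M. 1 / deg (he_x C h) * hsum (he_x C h) (\<lambda>h'. 1 / deg (he_x C h') * hsum (he_x C h') (w h')))"
    unfolding sum_distrib_left
  proof (intro sum.cong refl)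
    fix h
    let ?u = "he_x C h"
    have "hsum ?u (\<lambda>h'. 1 / deg (he_x C h') * hsum (he_x C h') (w h')) = hsum ?u (\<lambda>h'. 1 / deg ?u * hsum ?u (w h'))"
      by (rule hsum_cong) simp
    also have "\<dots> = 1 / deg ?u * W ?u" unfolding W_def by (rule hsum_cmult)
    finally have "hsum ?u (\<lambda>h'. 1 / deg (he_x C h') * hsum (he_x C h') (w h')) = 1 / deg ?u * W ?u" .
    moreover have "real M ^ l = M * M * M ^ (l - 2)"
    proof -
      obtain l' where "l = Suc (Suc l')" using assms(1,2) by (metis Suc_lessE less_trans_Suc not_less_zero old.nat.exhaust less_Suc_eq)
      then show ?thesis by simp
    qed
    ultimately show "real M ^ (l - 2) * ((2 * M / deg ?u)\<^sup>2 * W ?u) =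
        4 * M ^ l * (1 / deg ?u * hsum ?u (\<lambda>h'. 1 / deg (he_x C h') * hsum (he_x C h') (w h')))"
      by (simp add: power2_eq_square)
  qed
  finally show ?thesis unfolding sum_average .
qed

text \<open>The permutation of the odd half-edge inverts that of the even one, so both ends see the
  same value; sums over constraints thus become sums over half-edges.\<close>

lemma perm_value:
  assumes "e < length C" "C ! e = (u, v, \<pi>)"
  shows "(\<Sum>c<k. \<Sum>c'<k. P u c * P v c' * of_bool (\<pi> ! c = c')) =
      (\<Sum>c<k. P (he_x C (2 * e)) c * P (he_y C (2 * e)) (perm (2 * e) c) :: real)"
    and "(\<Sum>c<k. \<Sum>c'<k. P u c * P v c' * of_bool (\<pi> ! c = c')) =
      (\<Sum>c<k. P (he_x C (2 * e + 1)) c * P (he_y C (2 * e + 1)) (perm (2 * e + 1) c))"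
proof -
  have h: "2 * e < M" "2 * e + 1 < M" using assms(1) by (simp_all add: M_def)
  have "(\<Sum>c'<k. P u c * P v c' * of_bool (\<pi> ! c = c')) = P u c * P v (\<pi> ! c)" if "c < k" for c
  proof -
    have "\<pi> ! c < k" using perm_less[OF h(1) that] assms by (simp add: perm_def)
    moreover have "(\<Sum>c'<k. P u c * P v c' * of_bool (\<pi> ! c = c')) = (\<Sum>c'<k. if c' = \<pi> ! c then P u c * P v (\<pi> ! c) else 0)"
      by (intro sum.cong) auto
    ultimately show ?thesis by simp
  qed
  then have 1: "(\<Sum>c<k. \<Sum>c'<k. P u c * P v c' * of_bool (\<pi> ! c = c')) = (\<Sum>c<k. P u c * P v (\<pi> ! c))" by simp
  then show "(\<Sum>c<k. \<Sum>c'<k. P u c * P v c' * of_bool (\<pi> ! c = c')) =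
      (\<Sum>c<k. P (he_x C (2 * e)) c * P (he_y C (2 * e)) (perm (2 * e) c))"
    using assms by (simp add: he_x_def he_y_def perm_def)
  have bij: "bij_betw (perm (2 * e + 1)) {..<k} {..<k}" by (rule bij_perm[OF h(2)])
  have "\<pi> ! (perm (2 * e + 1) c) = c" if "c < k" for c
    using rel_perm[OF h(2) that perm_less[OF h(2) that]] assms(2) by (simp add: he_rel_def)
  then have "(\<Sum>c<k. P u (perm (2 * e + 1) c) * P v (\<pi> ! (perm (2 * e + 1) c))) = (\<Sum>c<k. P u (perm (2 * e + 1) c) * P v c)"
    by (intro sum.cong) auto
  then have "(\<Sum>c<k. P u c * P v (\<pi> ! c)) = (\<Sum>c<k. P u (perm (2 * e + 1) c) * P v c)"
    using sum.reindex_bij_betw[OF bij, of "\<lambda>c. P u c * P v (\<pi> ! c)"] by simp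
  then show "(\<Sum>c<k. \<Sum>c'<k. P u c * P v c' * of_bool (\<pi> ! c = c')) =
      (\<Sum>c<k. P (he_x C (2 * e + 1)) c * P (he_y C (2 * e + 1)) (perm (2 * e + 1) c))"
    unfolding 1 using assms by (simp add: he_x_def he_y_def mult.commute)
qed

text \<open>Every variable takes a label from its own list or the label suggested by the list of a random
  neighbour, with probability \<open>1/2\<close> each.\<close>

lemma label_from_lists:
  assumes Ly: "\<And>v. Ly v \<subseteq> {..<k}" "\<And>v. Ly v \<noteq> {}" "\<And>v. card (Ly v) \<le> r"
  defines "W \<equiv> \<lambda>h h'. (of_bool (\<exists>c<k. perm h c \<in> Ly (he_y C h) \<and> perm h' c \<in> Ly (he_y C h')) :: real)"
  shows "\<exists>lab \<in> {..<n} \<rightarrow>\<^sub>E {..<k}. (\<Sum>h<M. 1 / deg (he_x C h) * hsum (he_x C h) (W h)) / (8 * (real r)\<^sup>2)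
    \<le> real (length (filter (\<lambda>(u, v, \<pi>). \<pi> ! lab u = lab v) C))"
proof -
  define U where "U v c = (of_bool (c \<in> Ly v) / card (Ly v) :: real)" for v c
  \<comment> \<open>A variable without half-edges has no neighbour to ask; falling back on its own
    list keeps \<open>Q v\<close> a probability distribution.\<close>
  define Q where "Q v c = (if deg v = 0 then U v c else 1 / deg v * hsum v (\<lambda>h. U (he_y C h) (perm h c)))" for v c
  define P where "P v c = 1/2 * U v c + 1/2 * Q v c" for v c
  have fL: "finite (Ly v)" for v using Ly(1) finite_subset by blast
  have cL: "0 < card (Ly v)" for v using fL Ly(2) by (simp add: card_gt_0_iff)
  then have r0: "0 < r" using Ly(3) by (metis gr0I leD)
  have U0: "0 \<le> U v c" for v c by (simp add: U_def)
  have Q0: "0 \<le> Q v c" for v c unfolding Q_def hsum_def using U0 by (simp add: sum_nonneg)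
  have U1: "(\<Sum>c<k. U v c) = 1" for v
  proof -
    have "(\<Sum>c<k. U v c) = (\<Sum>c<k. of_bool (c \<in> Ly v)) / card (Ly v)" unfolding U_def by (rule sum_divide_distrib[symmetric])
    also have "(\<Sum>c<k. of_bool (c \<in> Ly v) :: real) = card ({..<k} \<inter> Ly v)" by simp
    also have "{..<k} \<inter> Ly v = Ly v" using Ly(1) by auto
    finally show ?thesis using cL by simp
  qed
  have Q1: "(\<Sum>c<k. Q v c) = 1" for v
  proof (cases "deg v = 0")
    case False
    have "(\<Sum>c<k. Q v c) = 1 / deg v * hsum v (\<lambda>h. \<Sum>c<k. U (he_y C h) (perm h c))"
      using False unfolding Q_def hsum_def sum_distrib_left by (simp add: sum.swap[of _ "{..<k}"])
    also have "\<dots> = 1 / deg v * hsum v (\<lambda>h. 1)"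
      unfolding hsum_def
    proof (intro arg_cong2[where f = "(*)"] refl sum.cong)
      fix h assume "h \<in> set (halves C v)"
      then have "h < M" by (simp add: set_halves)
      then show "(\<Sum>c<k. U (he_y C h) (perm h c)) = 1"
        using sum.reindex_bij_betw[OF bij_perm, of h "U (he_y C h)"] U1 by simp
    qed
    also have "\<dots> = 1" using False distinct_card[OF distinct_halves[of v]] by (simp add: hsum_def)
    finally show ?thesis .
  qed (simp add: Q_def U1)
  have P0: "0 \<le> P v c" for v c unfolding P_def using U0 Q0 by simp
  have P1: "(\<Sum>c<k. P v c) = 1" for v
    unfolding P_def sum.distrib sum_distrib_left[symmetric] U1 Q1 by simp
  have Cn: "\<And>u v \<pi>. (u, v, \<pi>) \<in> set C \<Longrightarrow> u < n \<and> v < n \<and> u \<noteq> v"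
    using wf by (auto simp: wf_unique_game_def)
  have "\<exists>lab \<in> {..<n} \<rightarrow>\<^sub>E {..<k}. (\<Sum>(u, v, \<pi>)\<leftarrow>C. \<Sum>c<k. \<Sum>c'<k. P u c * P v c' * of_bool (\<pi> ! c = c'))
    \<le> real (length (filter (\<lambda>(u, v, \<pi>). \<pi> ! lab u = lab v) C))"
    by (rule rounding[OF k]) (use Cn P0 P1 in auto)
  then obtain lab where lab: "lab \<in> {..<n} \<rightarrow>\<^sub>E {..<k}"
    "(\<Sum>(u, v, \<pi>)\<leftarrow>C. \<Sum>c<k. \<Sum>c'<k. P u c * P v c' * of_bool (\<pi> ! c = c'))
    \<le> real (length (filter (\<lambda>(u, v, \<pi>). \<pi> ! lab u = lab v) C))"
    by blast
  define val where "val h = (\<Sum>c<k. P (he_x C h) c * P (he_y C h) (perm h c))" for h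
  have "2 * (\<Sum>(u, v, \<pi>)\<leftarrow>C. \<Sum>c<k. \<Sum>c'<k. P u c * P v c' * of_bool (\<pi> ! c = c')) = (\<Sum>h<M. val h)"
  proof -
    let ?g = "\<lambda>(u, v, \<pi>). \<Sum>c<k. \<Sum>c'<k. P u c * P v c' * of_bool (\<pi> ! c = c')"
    have "(\<Sum>x\<leftarrow>C. ?g x) = (\<Sum>e<length C. ?g (C ! e))"
      by (simp add: sum_list_sum_nth atLeast0LessThan)
    moreover have "2 * ?g (C ! e) = val (0 + 2 * e) + val (1 + 2 * e)" if "e < length C" for e
    proof -
      obtain u v \<pi> where e: "C ! e = (u, v, \<pi>)" by (cases "C ! e")
      show ?thesis using perm_value[OF that e, of P] by (simp add: e val_def)
    qed
    ultimately have "2 * (\<Sum>x\<leftarrow>C. ?g x) = (\<Sum>e<length C. val (0 + 2 * e) + val (1 + 2 * e))"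
      by (simp add: sum_distrib_left)
    also have "\<dots> = (\<Sum>h<2 * length C. val h)"
      unfolding sum_split_nat[where A = 2] by (simp add: numeral_2_eq_2)
    finally show ?thesis by (simp add: M_def)
  qed
  moreover have "(\<Sum>h<M. 1 / deg (he_x C h) * hsum (he_x C h) (W h) / (4 * (real r)\<^sup>2)) \<le> (\<Sum>h<M. val h)"
  proof (rule sum_mono)
    fix h assume "h \<in> {..<M}"
    then have h: "h < M" by simp
    let ?u = "he_x C h" and ?y = "he_y C h"
    have d: "0 < deg ?u" by (rule deg_pos[OF h])
    \<comment> \<open>One of the four combinations suffices: the near end follows a random half-edge
      \<open>h'\<close>, the far end its own list. If \<open>W h h' = 1\<close>, they then agree
      with probability at least \<open>1 / r^2\<close>.\<close>
    have "1/4 * (\<Sum>c<k. Q ?u c * U ?y (perm h c)) = (\<Sum>c<k. (1/2 * Q ?u c) * (1/2 * U ?y (perm h c)))"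
      by (simp add: sum_distrib_left)
    also have "\<dots> \<le> val h"
      unfolding val_def P_def using U0 Q0 by (intro sum_mono mult_mono) auto
    finally have 1: "1/4 * (\<Sum>c<k. Q ?u c * U ?y (perm h c)) \<le> val h" .
    have e1: "(\<Sum>c<k. Q ?u c * U ?y (perm h c)) =
        1 / deg ?u * hsum ?u (\<lambda>h'. \<Sum>c<k. U (he_y C h') (perm h' c) * U ?y (perm h c))"
      using d unfolding Q_def hsum_def
      by (simp add: sum_distrib_left sum_distrib_right sum.swap[of _ "{..<k}"])
    have e2: "hsum ?u (\<lambda>h'. W h h' / r\<^sup>2) \<le> hsum ?u (\<lambda>h'. \<Sum>c<k. U (he_y C h') (perm h' c) * U ?y (perm h c))"
      unfolding hsum_def
    proof (rule sum_mono)
      fix h'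
      have nn: "0 \<le> (\<Sum>c<k. U (he_y C h') (perm h' c) * U ?y (perm h c))" using U0 by (intro sum_nonneg) auto
      show "W h h' / r\<^sup>2 \<le> (\<Sum>c<k. U (he_y C h') (perm h' c) * U ?y (perm h c))"
      proof (cases "\<exists>c<k. perm h c \<in> Ly ?y \<and> perm h' c \<in> Ly (he_y C h')")
        case True
        then obtain c where c: "c < k" "perm h c \<in> Ly ?y" "perm h' c \<in> Ly (he_y C h')" by blast
        have Ur: "1 / r \<le> U v d" if "d \<in> Ly v" for v d
          unfolding U_def using that cL[of v] Ly(3)[of v] by (simp add: frac_le)
        have "W h h' / r\<^sup>2 = 1 / r * (1 / r)" using True by (simp add: W_def power2_eq_square)
        also have "\<dots> \<le> U (he_y C h') (perm h' c) * U ?y (perm h c)"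
          using c Ur U0 by (intro mult_mono) auto
        also have "\<dots> \<le> (\<Sum>c<k. U (he_y C h') (perm h' c) * U ?y (perm h c))"
          using c U0 by (intro member_le_sum[where f = "\<lambda>c. U (he_y C h') (perm h' c) * U ?y (perm h c)"]) auto
        finally show ?thesis .
      next
        case False
        then have "W h h' = 0" unfolding W_def by simp
        then show ?thesis using nn by simp
      qed
    qed
    have e3: "hsum ?u (\<lambda>h'. W h h' / r\<^sup>2) = hsum ?u (W h) / r\<^sup>2"
      unfolding hsum_def by (rule sum_divide_distrib[symmetric])
    have "1 / deg ?u * (hsum ?u (W h) / r\<^sup>2) \<le> (\<Sum>c<k. Q ?u c * U ?y (perm h c))"
      unfolding e1 using e2[unfolded e3] by (intro mult_left_mono) auto
    then have "1/4 * (1 / deg ?u * (hsum ?u (W h) / r\<^sup>2)) \<le> val h" using 1 by linarith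
    then show "1 / deg ?u * hsum ?u (W h) / (4 * (real r)\<^sup>2) \<le> val h" by simp
  qed
  then have "(\<Sum>h<M. 1 / deg (he_x C h) * hsum (he_x C h) (W h)) / (4 * (real r)\<^sup>2) \<le> (\<Sum>h<M. val h)"
    by (simp only: sum_divide_distrib)
  ultimately have "(\<Sum>h<M. 1 / deg (he_x C h) * hsum (he_x C h) (W h)) / (8 * (real r)\<^sup>2)
    \<le> real (length (filter (\<lambda>(u, v, \<pi>). \<pi> ! lab u = lab v) C))" using lab(2) by simp
  then show ?thesis using lab(1) by (rule bexI)
qed

text \<open>Samples with many codes in \<open>Ind\<close> give upward closed families with cores,
  and independence makes any two of these cores cross at a common neighbour. One representative core
  per neighbour therefore serves as its list, met by all the others; the satisfied constraints come
  from pairs of sampled half-edges along which a single label leads into both lists.\<close>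

theorem soundness:
  fixes \<delta> :: real
  assumes core: "\<And>\<F>. (\<And>F G. F \<in> \<F> \<Longrightarrow> F \<subseteq> G \<Longrightarrow> G \<subseteq> {..<k} \<Longrightarrow> G \<in> \<F>) \<Longrightarrow>
      \<delta> \<le> expect (real (s - 1) / b) {..<k} (\<lambda>F. of_bool (F \<in> \<F>)) \<Longrightarrow>
      \<exists>J L. is_core \<kappa> {..<k} \<F> J L \<and> card L \<le> r"
    and r: "1 \<le> r" "l = Suc r" and \<delta>: "0 < \<delta>"
    and Ind: "Ind \<subseteq> {..<N0}" "\<And>v v'. v \<in> Ind \<Longrightarrow> v' \<in> Ind \<Longrightarrow> \<not> conflict C k s l v v'"
      "2 * \<delta> * N0 \<le> card Ind"
  shows "\<exists>lab \<in> {..<n} \<rightarrow>\<^sub>E {..<k}. \<delta> / (16 * l\<^sup>2 * r\<^sup>2) \<le> sat_fraction C lab"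
proof -
  define a where "a = s - 1"
  have ab: "a \<le> b" by (simp add: a_def b_def)
  define cnt where "cnt t = (\<Sum>Z<b ^ k. of_bool (Z + b ^ k * t \<in> Ind) :: real)" for t
  define heavy where "heavy t \<longleftrightarrow> \<delta> * b ^ k \<le> cnt t" for t
  define hv1 :: "nat \<Rightarrow> real" where "hv1 t = of_bool (heavy t)" for t
  have cnt_le: "cnt t \<le> b ^ k" for t
  proof -
    have "cnt t \<le> (\<Sum>Z<b ^ k. 1)" unfolding cnt_def by (rule sum_mono) auto
    then show ?thesis by simp
  qed
  have "real (card Ind) = (\<Sum>v<N0. of_bool (v \<in> Ind))"
  proof -
    have "{..<N0} \<inter> Ind = Ind" using Ind(1) by auto
    then show ?thesis by simp
  qed
  also have "\<dots> = (\<Sum>t<M ^ Suc l. cnt t)" unfolding N0_def sum_split_nat[where A = "b ^ k"] cnt_def ..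
  \<comment> \<open>Light samples contribute at most \<delta> each, in units of
    \<open>b ^ k\<close>; half of the density \<open>2 * \<delta>\<close> is left for the heavy
    ones, which are thus at least a fraction \<delta> of all samples.\<close>
  also have "\<dots> \<le> (\<Sum>t<M ^ Suc l. hv1 t * b ^ k + \<delta> * b ^ k)"
  proof (rule sum_mono)
    show "cnt t \<le> hv1 t * b ^ k + \<delta> * b ^ k" for t
      using cnt_le[of t] \<delta> by (cases "heavy t") (auto simp: hv1_def heavy_def add_increasing2)
  qed
  also have "\<dots> = (\<Sum>t<M ^ Suc l. hv1 t) * b ^ k + \<delta> * N0"
    unfolding sum.distrib sum_distrib_right[symmetric] by (simp add: N0_def del: sum_of_bool_eq)
  finally have "\<delta> * N0 \<le> (\<Sum>t<M ^ Suc l. hv1 t) * b ^ k" using Ind(3) by linarith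
  then have "(\<delta> * M ^ Suc l) * b ^ k \<le> (\<Sum>t<M ^ Suc l. hv1 t) * b ^ k"
    by (simp add: N0_def mult.commute mult.left_commute del: sum_of_bool_eq)
  then have hv: "\<delta> * M ^ Suc l \<le> (\<Sum>t<M ^ Suc l. hv1 t)"
    using b_pos by (simp only: mult_le_cancel_right_pos of_nat_0_less_iff zero_less_power)
  \<comment> \<open>Crossing survives enlarging the sets, so independence of \<open>Ind\<close>
    still applies to the upward closure.\<close>
  define fam where "fam t = {G. G \<subseteq> {..<k} \<and> (\<exists>Z<b ^ k. Z + b ^ k * t \<in> Ind \<and> fset a b k Z \<subseteq> G)}" for t
  have ex: "\<exists>J L. is_core \<kappa> {..<k} (fam t) J L \<and> card L \<le> r" if "heavy t" for t
  proof (rule core)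
    show "G \<in> fam t" if "F \<in> fam t" "F \<subseteq> G" "G \<subseteq> {..<k}" for F G
      using that unfolding fam_def by blast
    have "\<delta> * b ^ k \<le> cnt t" using that by (simp add: heavy_def)
    also have "\<dots> \<le> (\<Sum>Z<b ^ k. of_bool (fset a b k Z \<in> fam t))"
      unfolding cnt_def
    proof (rule sum_mono)
      show "(of_bool (Z + b ^ k * t \<in> Ind) :: real) \<le> of_bool (fset a b k Z \<in> fam t)" if "Z \<in> {..<b ^ k}" for Z
        using that by (auto simp: fam_def fset_def)
    qed
    also have "\<dots> = b ^ k * expect (real a / b) {..<k} (\<lambda>F. of_bool (F \<in> fam t))"
      using sum_fset[OF b_pos ab, of "\<lambda>F. of_bool (F \<in> fam t)" k] by (simp del: sum_of_bool_eq)
    finally have "\<delta> * real (b ^ k) \<le> expect (real a / b) {..<k} (\<lambda>F. of_bool (F \<in> fam t)) * real (b ^ k)"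
      by (simp add: mult.commute)
    moreover have "0 < real (b ^ k)" using b_pos by simp
    ultimately show "\<delta> \<le> expect (real (s - 1) / b) {..<k} (\<lambda>F. of_bool (F \<in> fam t))"
      unfolding a_def[symmetric] by (simp only: mult_le_cancel_right_pos)
  qed
  then obtain J L where JL: "\<And>t. heavy t \<Longrightarrow> is_core \<kappa> {..<k} (fam t) (J t) (L t)" "\<And>t. heavy t \<Longrightarrow> card (L t) \<le> r"
    by metis
  have Lk: "L t \<subseteq> {..<k}" if "heavy t" for t using JL(1)[OF that] by (simp add: is_core_def)
  have cross: "perm (nbr C l t i) ` L t \<inter> perm (nbr C l t' i') ` L t' \<noteq> {}"
    if t: "heavy t" "heavy t'" "i < l" "i' < l" and y: "he_y C (nbr C l t i) = he_y C (nbr C l t' i')" for t t' i i'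
  proof (rule core_cross2[OF _ JL(1)[OF t(1)] JL(1)[OF t(2)]])
    fix F G assume F: "F \<in> fam t" and G: "G \<in> fam t'"
    obtain Z where Z: "Z < b ^ k" "Z + b ^ k * t \<in> Ind" "fset a b k Z \<subseteq> F" using F by (auto simp: fam_def)
    obtain Z' where Z': "Z' < b ^ k" "Z' + b ^ k * t' \<in> Ind" "fset a b k Z' \<subseteq> G" using G by (auto simp: fam_def)
    have dv: "(Z + b ^ k * t) div b ^ k = t" "(Z' + b ^ k * t') div b ^ k = t'" using Z(1) Z'(1) b_pos by simp_all
    have "\<not> conflict C k s l (Z + b ^ k * t) (Z' + b ^ k * t')" by (rule Ind(2)[OF Z(2) Z'(2)])
    then obtain c c' d where c: "c < k" "c' < k" "d < k" "dig b c (Z + b ^ k * t) < a" "dig b c' (Z' + b ^ k * t') < a"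
       "he_rel C (nbr C l t i) c d" "he_rel C (nbr C l t' i') c' d"
      using y t(3,4) unfolding conflict_iff dv a_def by blast
    have "c \<in> F" "c' \<in> G" using c Z(3) Z'(3) b_pos by (auto simp: fset_def dig_add_high)
    moreover have "perm (nbr C l t i) c = d" "perm (nbr C l t' i') c' = d" using c rel_perm nbr_mem by blast+
    ultimately show "perm (nbr C l t i) ` F \<inter> perm (nbr C l t' i') ` G \<noteq> {}" by blast
  qed (use bij_perm nbr_mem in auto)
  define src where "src y = (SOME ti. heavy (fst ti) \<and> snd ti < l \<and> he_y C (nbr C l (fst ti) (snd ti)) = y)" for y
  define has where "has y \<longleftrightarrow> (\<exists>ti. heavy (fst ti) \<and> snd ti < l \<and> he_y C (nbr C l (fst ti) (snd ti)) = y)" for y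
  have src: "heavy (fst (src y))" "snd (src y) < l" "he_y C (nbr C l (fst (src y)) (snd (src y))) = y" if "has y" for y
    using someI_ex[OF that[unfolded has_def]] unfolding src_def by auto
  \<comment> \<open>The list of a neighbour comes from one fixed heavy sample that touches it. All
    other variables get the dummy list \<open>{0}\<close>, because lists must be nonempty.\<close>
  define Ly where "Ly y = (if has y then perm (nbr C l (fst (src y)) (snd (src y))) ` L (fst (src y)) else {0})" for y
  have Ly1: "Ly y \<subseteq> {..<k}" for y
  proof (cases "has y")
    case True
    then show ?thesis using Lk[OF src(1)[OF True]] perm_less nbr_mem by (auto simp: Ly_def)
  qed (use k in \<open>auto simp: Ly_def\<close>)
  have Ly2: "Ly y \<noteq> {}" for y
  proof (cases "has y")
    case True
    then show ?thesis using cross[OF src(1)[OF True] src(1)[OF True] src(2)[OF True] src(2)[OF True]] by (auto simp: Ly_def)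
  qed (simp add: Ly_def)
  have Ly3: "card (Ly y) \<le> r" for y
  proof (cases "has y")
    case True
    have "finite (L (fst (src y)))" using Lk[OF src(1)[OF True]] finite_subset by blast
    then show ?thesis using True JL(2)[OF src(1)[OF True]] card_image_le[of "L (fst (src y))" "perm (nbr C l (fst (src y)) (snd (src y)))"]
      by (simp add: Ly_def)
  qed (use r in \<open>simp add: Ly_def\<close>)
  define W where "W h h' = (of_bool (\<exists>c<k. perm h c \<in> Ly (he_y C h) \<and> perm h' c \<in> Ly (he_y C h')) :: real)" for h h'
  have pair: "\<exists>i j. i < j \<and> j < l \<and> W (nbr C l t i) (nbr C l t j) = 1" if t: "heavy t" for t
  proof -
    have "\<exists>c\<in>L t. perm (nbr C l t i) c \<in> Ly (he_y C (nbr C l t i))" if i: "i < l" for i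
    proof -
      let ?y = "he_y C (nbr C l t i)"
      have "has ?y" using t i unfolding has_def by (intro exI[of _ "(t, i)"]) simp
      then have "perm (nbr C l t i) ` L t \<inter> Ly ?y \<noteq> {}"
        using cross[OF t src(1) i src(2)] src(3) by (simp add: Ly_def)
      then show ?thesis by blast
    qed
    \<comment> \<open>The \<open>l = Suc r\<close> sampled half-edges choose labels from a list of
      at most \<open>r\<close>, so two of them choose the same one.\<close>
    then obtain c where c: "\<And>i. i < l \<Longrightarrow> c i \<in> L t \<and> perm (nbr C l t i) (c i) \<in> Ly (he_y C (nbr C l t i))" by metis
    have "finite (L t)" using Lk[OF t] finite_subset by blast
    then have "card (c ` {..<l}) \<le> card (L t)" using c by (intro card_mono) auto
    then have "card (c ` {..<l}) < card {..<l}" using JL(2)[OF t] r by simp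
    then have "\<not> inj_on c {..<l}" by (rule pigeonhole)
    then obtain i j where "i < l" "j < l" "i \<noteq> j" "c i = c j" by (auto simp: inj_on_def)
    then obtain i j where ij: "i < j" "j < l" "c i = c j" by (metis linorder_neqE_nat)
    then have "i < l" by simp
    have "c i < k" using c[OF \<open>i < l\<close>] Lk[OF t] by auto
    then have "W (nbr C l t i) (nbr C l t j) = 1"
      unfolding W_def using c[OF \<open>i < l\<close>] c[OF ij(2)] ij(3) by auto
    then show ?thesis using ij by blast
  qed
  define q where "q = (\<Sum>h<M. 1 / deg (he_x C h) * hsum (he_x C h) (W h))"
  have q0: "0 \<le> q" unfolding q_def hsum_def by (intro sum_nonneg mult_nonneg_nonneg) (auto simp: W_def)
  \<comment> \<open>Union bound over the pairs \<open>i < j\<close>; each is estimated by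
    \<open>sum_nbr_pair_le\<close>, which leads to the factor \<open>4 * l^2\<close>.\<close>
  have "(\<Sum>t<M ^ Suc l. hv1 t) \<le> (\<Sum>t<M ^ Suc l. \<Sum>i<l. \<Sum>j<l. of_bool (i < j) * W (nbr C l t i) (nbr C l t j))"
  proof (rule sum_mono)
    fix t
    have nn: "0 \<le> (of_bool (i < j) :: real) * W (nbr C l t i) (nbr C l t j)" for i j by (simp add: W_def)
    show "hv1 t \<le> (\<Sum>i<l. \<Sum>j<l. of_bool (i < j) * W (nbr C l t i) (nbr C l t j))"
    proof (cases "heavy t")
      case True
      then obtain i j where ij: "i < j" "j < l" "W (nbr C l t i) (nbr C l t j) = 1" using pair by blast
      then have "(1::real) = of_bool (i < j) * W (nbr C l t i) (nbr C l t j)" by simp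
      also have "\<dots> \<le> (\<Sum>j<l. of_bool (i < j) * W (nbr C l t i) (nbr C l t j))"
        using ij nn by (intro member_le_sum[where f = "\<lambda>j. of_bool (i < j) * W (nbr C l t i) (nbr C l t j)"]) auto
      also have "\<dots> \<le> (\<Sum>i<l. \<Sum>j<l. of_bool (i < j) * W (nbr C l t i) (nbr C l t j))"
        using ij nn by (intro member_le_sum[where f = "\<lambda>i. \<Sum>j<l. of_bool (i < j) * W (nbr C l t i) (nbr C l t j)"] sum_nonneg) auto
      finally show ?thesis using True by (simp add: hv1_def)
    next
      case False
      have "0 \<le> (\<Sum>i<l. \<Sum>j<l. of_bool (i < j) * W (nbr C l t i) (nbr C l t j))" by (intro sum_nonneg nn)
      then show ?thesis using False by (simp add: hv1_def)
    qed
  qed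
  also have "\<dots> = (\<Sum>i<l. \<Sum>t<M ^ Suc l. \<Sum>j<l. of_bool (i < j) * W (nbr C l t i) (nbr C l t j))" by (rule sum.swap)
  also have "\<dots> = (\<Sum>i<l. \<Sum>j<l. \<Sum>t<M ^ Suc l. of_bool (i < j) * W (nbr C l t i) (nbr C l t j))"
    by (intro sum.cong refl sum.swap)
  also have "\<dots> \<le> (\<Sum>i<l. \<Sum>j<l. 4 * M ^ l * q)"
  proof (intro sum_mono)
    fix i j assume "j \<in> {..<l}"
    then show "(\<Sum>t<M ^ Suc l. of_bool (i < j) * W (nbr C l t i) (nbr C l t j)) \<le> 4 * M ^ l * q"
      unfolding sum_distrib_left[symmetric] using sum_nbr_pair_le[of i j W] q0
      by (cases "i < j") (auto simp: q_def W_def)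
  qed
  also have "\<dots> = (4 * l\<^sup>2 * q) * M ^ l" by (simp add: power2_eq_square)
  finally have "(\<delta> * M) * M ^ l \<le> (4 * l\<^sup>2 * q) * M ^ l" using hv by (simp add: mult.assoc del: sum_of_bool_eq)
  then have qM: "\<delta> * M \<le> 4 * l\<^sup>2 * q"
    using M_pos by (simp only: mult_le_cancel_right_pos of_nat_0_less_iff zero_less_power)
  have Weq: "W = (\<lambda>h h'. of_bool (\<exists>c<k. perm h c \<in> Ly (he_y C h) \<and> perm h' c \<in> Ly (he_y C h')))"
    by (intro ext W_def)
  have "\<exists>lab \<in> {..<n} \<rightarrow>\<^sub>E {..<k}. q / (8 * (real r)\<^sup>2) \<le> real (length (filter (\<lambda>(u, v, \<pi>). \<pi> ! lab u = lab v) C))"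
    unfolding q_def Weq by (rule label_from_lists[where Ly = Ly and r = r]) (rule Ly1 Ly2 Ly3)+
  then obtain lab where lab: "lab \<in> {..<n} \<rightarrow>\<^sub>E {..<k}" "q / (8 * (real r)\<^sup>2) \<le> real (length (filter (\<lambda>(u, v, \<pi>). \<pi> ! lab u = lab v) C))"
    by blast
  have pos: "0 < real (l\<^sup>2)" "0 < real (r\<^sup>2)" "0 < length C" using l r M_pos by (auto simp: M_def)
  have "\<delta> / (16 * l\<^sup>2 * r\<^sup>2) * length C = (\<delta> * M) / (4 * l\<^sup>2) / (8 * (real r)\<^sup>2)" by (simp add: M_def)
  also have "\<dots> \<le> q / (8 * (real r)\<^sup>2)"
    using qM pos by (intro divide_right_mono) (simp_all add: pos_divide_le_eq mult.commute)
  also note lab(2)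
  finally have "\<delta> / (16 * l\<^sup>2 * r\<^sup>2) \<le> sat_fraction C lab"
    unfolding sat_fraction_def using pos(3) by (simp add: pos_le_divide_eq)
  then show ?thesis using lab(1) by blast
qed

end

section \<open>Disjoint copies with predictions\<close>

definition covers :: "nat \<Rightarrow> (nat \<Rightarrow> nat \<Rightarrow> bool) \<Rightarrow> nat set \<Rightarrow> bool" where
  "covers N R X \<longleftrightarrow> X \<subseteq> {..<N} \<and> (\<forall>I<N. \<forall>I'<N. R I I' \<longrightarrow> I \<in> X \<or> I' \<in> X)"

text \<open>\<open>c1 + c2\<close> copies of the graph \<open>R\<close> on \<open>{..<N}\<close> and \<open>c3\<close> copies of a perfect matching. The prediction
  contains everything on the first \<open>c1\<close> copies, nothing on the next \<open>c2\<close>, and is optimal on the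
  matchings.\<close>

definition copies_adj :: "nat \<Rightarrow> (nat \<Rightarrow> nat \<Rightarrow> bool) \<Rightarrow> nat \<Rightarrow> nat \<Rightarrow> nat \<Rightarrow> bool" where
  "copies_adj N R c J J' \<longleftrightarrow> J div N = J' div N \<and>
     (if J div N < c then R (J mod N) (J' mod N) else J mod N + J' mod N + 1 = N)"

definition copies_pred :: "nat \<Rightarrow> nat \<Rightarrow> nat \<Rightarrow> nat \<Rightarrow> bool" where
  "copies_pred N c1 c J \<longleftrightarrow> J div N < c1 \<or> c \<le> J div N \<and> 2 * (J mod N) < N"

text \<open>\<open>half\<close> keeps the optimum of the whole instance at half of its vertices or
  more, which is what relates absolute prediction errors to relative ones. As \<open>N\<close> is
  even, no position is its own mirror image, so mirroring is a matching without loops.\<close>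

locale copies =
  fixes N :: nat and R :: "nat \<Rightarrow> nat \<Rightarrow> bool" and c1 c2 c3 :: nat
  assumes N: "even N" "0 < N" and sym: "\<And>I I'. R I I' \<Longrightarrow> R I' I" and irr: "\<And>I. \<not> R I I"
    and half: "\<And>X. covers N R X \<Longrightarrow> N \<le> 2 * card X"
    and c0: "0 < c1 + c2 + c3"
begin

definition "nv = N * (c1 + c2 + c3)"
definition "edges = {{J, J'} | J J'. J < nv \<and> J' < nv \<and> copies_adj N R (c1 + c2) J J'}"
definition "pred = {J. J < nv \<and> copies_pred N c1 (c1 + c2) J}"

lemma adj_sym: "copies_adj N R c J J' \<Longrightarrow> copies_adj N R c J' J"
  using sym by (auto simp: copies_adj_def split: if_splits)

lemma adj_irr: "\<not> copies_adj N R c J J"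
proof -
  have "x + x + 1 \<noteq> N" for x using N(1) by presburger
  then show ?thesis using irr by (auto simp: copies_adj_def split: if_splits)
qed

lemma edge_iff: "{J, J'} \<in> edges \<longleftrightarrow> J < nv \<and> J' < nv \<and> copies_adj N R (c1 + c2) J J'"
  unfolding edges_def using adj_sym by (auto simp: doubleton_eq_iff)

lemma simple: "simple_graph {..<nv} edges"
  unfolding simple_graph_def
proof (intro conjI ballI)
  fix e assume "e \<in> edges"
  then obtain J J' where e: "e = {J, J'}" "J < nv" "J' < nv" "copies_adj N R (c1 + c2) J J'" by (auto simp: edges_def)
  then have "J \<noteq> J'" using adj_irr by auto
  then show "e \<subseteq> {..<nv}" "card e = 2" using e by auto
qed simp

lemma pred_sub: "pred \<subseteq> {..<nv}" by (auto simp: pred_def)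

definition "slice Y q = {I. I < N \<and> I + N * q \<in> Y}"

lemma card_slices:
  assumes "Y \<subseteq> {..<nv}"
  shows "card Y = (\<Sum>q<c1 + c2 + c3. card (slice Y q))"
proof -
  have "{..<nv} \<inter> Y = Y" using assms by auto
  then have "real (card Y) = (\<Sum>J<N * (c1 + c2 + c3). of_bool (J \<in> Y))" by (simp add: nv_def)
  also have "\<dots> = (\<Sum>q<c1 + c2 + c3. \<Sum>I<N. of_bool (I + N * q \<in> Y))" by (rule sum_split_nat)
  also have "\<dots> = (\<Sum>q<c1 + c2 + c3. real (card (slice Y q)))"
  proof (rule sum.cong)
    fix q
    have "{..<N} \<inter> {I. I + N * q \<in> Y} = slice Y q" by (auto simp: slice_def)
    then show "(\<Sum>I<N. of_bool (I + N * q \<in> Y)) = real (card (slice Y q))" by simp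
  qed simp
  finally have "real (card Y) = real (\<Sum>q<c1 + c2 + c3. card (slice Y q))" by simp
  then show ?thesis by (simp only: of_nat_eq_iff)
qed

lemma pos_less: "I < N \<Longrightarrow> q < c1 + c2 + c3 \<Longrightarrow> I + N * q < nv"
proof -
  assume "I < N" "q < c1 + c2 + c3"
  then have "Suc q \<le> c1 + c2 + c3" by simp
  then have "N * Suc q \<le> nv" unfolding nv_def by (rule mult_le_mono2)
  then show ?thesis using \<open>I < N\<close> by simp
qed

lemma slice_cover:
  assumes "vertex_cover {..<nv} edges Y" "q < c1 + c2"
  shows "covers N R (slice Y q)"
  unfolding covers_def
proof (intro conjI allI impI)
  fix I I' assume I: "I < N" "I' < N" "R I I'"
  then have "copies_adj N R (c1 + c2) (I + N * q) (I' + N * q)" using assms(2) by (simp add: copies_adj_def)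
  then have "{I + N * q, I' + N * q} \<in> edges" using I assms(2) pos_less[of _ q] by (simp add: edge_iff)
  then have "{I + N * q, I' + N * q} \<inter> Y \<noteq> {}" using assms(1) by (auto simp: vertex_cover_def)
  then show "I \<in> slice Y q \<or> I' \<in> slice Y q" using I by (auto simp: slice_def)
qed (auto simp: slice_def)

lemma slice_matching:
  assumes "vertex_cover {..<nv} edges Y" "c1 + c2 \<le> q" "q < c1 + c2 + c3"
  shows "N \<le> 2 * card (slice Y q)"
proof -
  have "(\<lambda>I. N - 1 - I) ` ({..<N} - slice Y q) \<subseteq> slice Y q"
  proof
    fix K assume "K \<in> (\<lambda>I. N - 1 - I) ` ({..<N} - slice Y q)"
    then obtain I where I: "I < N" "I \<notin> slice Y q" "K = N - 1 - I" by auto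
    have K: "K < N" using I by simp
    have "copies_adj N R (c1 + c2) (I + N * q) (K + N * q)"
    proof -
      have "I + K + 1 = N" using I by simp
      then show ?thesis using I(1) K assms(2) by (simp add: copies_adj_def)
    qed
    then have "{I + N * q, K + N * q} \<in> edges"
      unfolding edge_iff using pos_less[OF I(1) assms(3)] pos_less[OF K assms(3)] by blast
    then have "{I + N * q, K + N * q} \<inter> Y \<noteq> {}" using assms(1) by (auto simp: vertex_cover_def)
    then show "K \<in> slice Y q" using I K by (auto simp: slice_def)
  qed
  moreover have "inj_on (\<lambda>I. N - 1 - I) ({..<N} - slice Y q)" by (auto simp: inj_on_def)
  moreover have fin: "finite (slice Y q)" by (simp add: slice_def)
  ultimately have "card ({..<N} - slice Y q) \<le> card (slice Y q)" by (metis card_inj_on_le)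
  moreover have "card ({..<N} - slice Y q) = N - card (slice Y q)"
    using fin by (subst card_Diff_subset) (auto simp: slice_def)
  ultimately show ?thesis by simp
qed

lemma sum_three: "(\<Sum>q<c1 + c2 + c3. g q) = (\<Sum>q<c1. g q) + (\<Sum>q=c1..<c1 + c2. g q) + (\<Sum>q=c1 + c2..<c1 + c2 + c3. g q :: nat)"
  using sum.atLeastLessThan_concat[of 0 c1 "c1 + c2" g] sum.atLeastLessThan_concat[of 0 "c1 + c2" "c1 + c2 + c3" g]
  by (simp add: atLeast0LessThan)

lemma cover_lower:
  assumes "vertex_cover {..<nv} edges Y" "\<And>X. covers N R X \<Longrightarrow> m \<le> card X"
  shows "(c1 + c2) * m + c3 * (N div 2) \<le> card Y"
proof -
  have "(\<Sum>q<c1. m) + (\<Sum>q=c1..<c1 + c2. m) + (\<Sum>q=c1 + c2..<c1 + c2 + c3. N div 2) \<le> (\<Sum>q<c1 + c2 + c3. card (slice Y q))"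
    unfolding sum_three
  proof (intro add_mono sum_mono)
    fix q assume "q \<in> {c1 + c2..<c1 + c2 + c3}"
    then show "N div 2 \<le> card (slice Y q)" using slice_matching[OF assms(1), of q] by auto
  qed (use slice_cover[OF assms(1)] assms(2) in auto)
  then show ?thesis using card_slices[of Y] assms(1) by (simp add: vertex_cover_def algebra_simps)
qed

context
  fixes X0 assumes X0: "covers N R X0" and min: "\<And>X. covers N R X \<Longrightarrow> card X0 \<le> card X"
begin

definition "best = {J. J < nv \<and> (if J div N < c1 + c2 then J mod N \<in> X0 else 2 * (J mod N) < N)}"

lemma X0_sub: "X0 \<subseteq> {..<N}" using X0 by (simp add: covers_def)

lemma best_cover: "vertex_cover {..<nv} edges best"
  unfolding vertex_cover_def
proof (intro conjI ballI)
  fix e assume "e \<in> edges"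
  then obtain J J' where e: "e = {J, J'}" "J < nv" "J' < nv" "copies_adj N R (c1 + c2) J J'" by (auto simp: edges_def)
  have m: "J mod N < N" "J' mod N < N" using N by auto
  have "J \<in> best \<or> J' \<in> best"
    using e m X0 by (auto simp: best_def copies_adj_def covers_def split: if_splits)
  then show "e \<inter> best \<noteq> {}" using e by auto
qed (auto simp: best_def)

lemma card_half: "card {I. I < N \<and> 2 * I < N} = N div 2"
proof -
  have "{I. I < N \<and> 2 * I < N} = {..<N div 2}" using N by auto
  then show ?thesis by simp
qed

lemma card_best: "card best = (c1 + c2) * card X0 + c3 * (N div 2)"
proof -
  have "slice best q = X0" if "q < c1 + c2" for q
    using that X0_sub pos_less[of _ q] by (auto simp: slice_def best_def)
  moreover have "slice best q = {I. I < N \<and> 2 * I < N}" if "c1 + c2 \<le> q" "q < c1 + c2 + c3" for q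
    using that pos_less[of _ q] by (auto simp: slice_def best_def)
  ultimately have "(\<Sum>q<c1 + c2 + c3. card (slice best q)) = (\<Sum>q<c1. card X0) + (\<Sum>q=c1..<c1 + c2. card X0) + (\<Sum>q=c1 + c2..<c1 + c2 + c3. N div 2)"
    unfolding sum_three by (intro arg_cong2[where f = "(+)"] sum.cong refl) (auto simp: card_half)
  then show ?thesis using card_slices[of best] by (simp add: best_def subset_iff algebra_simps)
qed

lemma opt: "opt_vc {..<nv} edges = (c1 + c2) * card X0 + c3 * (N div 2)"
  unfolding opt_vc_def
proof (rule Min_eqI)
  have "{X. vertex_cover {..<nv} edges X} \<subseteq> Pow {..<nv}" by (auto simp: vertex_cover_def)
  then show "finite (card ` {X. vertex_cover {..<nv} edges X})" using finite_subset by blast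
  show "(c1 + c2) * card X0 + c3 * (N div 2) \<in> card ` {X. vertex_cover {..<nv} edges X}"
    using best_cover card_best by (intro image_eqI[of _ _ best]) auto
  show "(c1 + c2) * card X0 + c3 * (N div 2) \<le> y" if "y \<in> card ` {X. vertex_cover {..<nv} edges X}" for y
    using that cover_lower[OF _ min] by auto
qed

lemma best_min: "min_vertex_cover {..<nv} edges best"
  unfolding min_vertex_cover_def opt using best_cover card_best by simp

lemma card_pred_best: "card (pred - best) = c1 * (N - card X0)"
proof -
  have "slice (pred - best) q = {..<N} - X0" if "q < c1" for q
    using that X0_sub pos_less[of _ q] by (auto simp: slice_def best_def pred_def copies_pred_def)
  moreover have "slice (pred - best) q = {}" if "c1 \<le> q" for q
    using that by (auto simp: slice_def best_def pred_def copies_pred_def)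
  moreover have "card ({..<N} - X0) = N - card X0" using X0_sub by (subst card_Diff_subset) (auto intro: finite_subset)
  ultimately have "(\<Sum>q<c1 + c2 + c3. card (slice (pred - best) q)) = (\<Sum>q<c1. N - card X0) + (\<Sum>q=c1..<c1 + c2. 0) + (\<Sum>q=c1 + c2..<c1 + c2 + c3. 0)"
    unfolding sum_three by (intro arg_cong2[where f = "(+)"] sum.cong refl) auto
  then show ?thesis using card_slices[of "pred - best"] pred_sub by (simp add: subset_iff)
qed

lemma card_best_pred: "card (best - pred) = c2 * card X0"
proof -
  have "slice (best - pred) q = X0" if "c1 \<le> q" "q < c1 + c2" for q
    using that X0_sub pos_less[of _ q] by (auto simp: slice_def best_def pred_def copies_pred_def)
  moreover have "slice (best - pred) q = {}" if "q < c1 \<or> c1 + c2 \<le> q" for q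
    using that by (auto simp: slice_def best_def pred_def copies_pred_def)
  ultimately have "(\<Sum>q<c1 + c2 + c3. card (slice (best - pred) q)) = (\<Sum>q<c1. 0) + (\<Sum>q=c1..<c1 + c2. card X0) + (\<Sum>q=c1 + c2..<c1 + c2 + c3. 0)"
    unfolding sum_three by (intro arg_cong2[where f = "(+)"] sum.cong refl) auto
  then show ?thesis using card_slices[of "best - pred"] by (simp add: best_def subset_iff)
qed

end

section \<open>The algorithm on instances with small and with large covers\<close>

lemma min_cover_exists:
  obtains X0 where "covers N R X0" "\<And>X. covers N R X \<Longrightarrow> card X0 \<le> card X"
proof -
  have "covers N R {..<N}" by (auto simp: covers_def)
  then show thesis using that ex_has_least_nat[of "covers N R" "{..<N}" card] by auto
qed

text \<open>The optimum is at least \<open>c * (N / 2)\<close> for \<open>c\<close> copies. A fully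
  predicted copy has error \<open>N - card X0\<close>, at most \<open>N / 2\<close>; an unpredicted
  one has error \<open>card X0\<close>, at most \<open>(1/2 + \<epsilon>) * N\<close>, which
  explains the factor \<open>1 + 2 * \<epsilon>\<close> in the condition on
  \<open>c2\<close>.\<close>

lemma algorithm_yes:
  fixes f :: "real \<Rightarrow> real \<Rightarrow> real" and \<epsilon> x y :: real
  assumes f_nonneg: "\<And>x y. 0 \<le> x \<Longrightarrow> 0 \<le> y \<Longrightarrow> 0 \<le> f x y"
    and f_mono1: "\<And>x x' y. 0 \<le> x \<Longrightarrow> x \<le> x' \<Longrightarrow> 0 \<le> y \<Longrightarrow> f x y \<le> f x' y"
    and f_mono2: "\<And>x y y'. 0 \<le> x \<Longrightarrow> 0 \<le> y \<Longrightarrow> y \<le> y' \<Longrightarrow> f x y \<le> f x y'"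
    and bound: "\<And>Xopt. min_vertex_cover {..<nv} edges Xopt \<Longrightarrow>
      out \<le> (1 + f (real (card (pred - Xopt)) / real (opt_vc {..<nv} edges))
               (real (card (Xopt - pred)) / real (opt_vc {..<nv} edges))) * real (opt_vc {..<nv} edges)"
    and yes: "covers N R X" "real (card X) \<le> (1/2 + \<epsilon>) * N" and \<epsilon>: "0 \<le> \<epsilon>"
    and c: "real c1 \<le> x * (c1 + c2 + c3)" "c2 * (1 + 2 * \<epsilon>) \<le> y * (c1 + c2 + c3)"
  shows "out \<le> (1 + f x y) * (1/2 + \<epsilon>) * nv"
proof -
  obtain X0 where X0: "covers N R X0" "\<And>X. covers N R X \<Longrightarrow> card X0 \<le> card X" using min_cover_exists by blast
  define O1 where "O1 = real (opt_vc {..<nv} edges)"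
  define c where "c = real (c1 + c2 + c3)"
  have c0': "0 < c" unfolding c_def using c0 by (simp only: of_nat_0_less_iff)
  have N0: "0 < real N" using N by simp
  have lo: "real N / 2 \<le> card X0" using half[OF X0(1)] by linarith
  have hi: "real (card X0) \<le> (1/2 + \<epsilon>) * N" using X0(2)[OF yes(1)] yes(2) by linarith
  have "card X0 \<le> N" using X0(1) card_mono[of "{..<N}" X0] by (simp add: covers_def)
  then have sub: "real (N - card X0) = real N - real (card X0)" by (simp add: of_nat_diff)
  have N2: "real (N div 2) = N / 2" using N(1) by (simp add: real_of_nat_div)
  have optX: "opt_vc {..<nv} edges = (c1 + c2) * card X0 + c3 * (N div 2)" by (rule opt[OF X0])
  have O1: "O1 = real (c1 + c2) * real (card X0) + real c3 * (real N / 2)" unfolding O1_def optX by (simp add: N2)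
  have "real (c1 + c2) * (real N / 2) + real c3 * (real N / 2) \<le> O1" unfolding O1 using lo by (intro add_mono mult_left_mono) auto
  then have O1lo: "c * (N / 2) \<le> O1" by (simp add: c_def field_simps)
  have "real (c1 + c2) * real (card X0) + real c3 * (real N / 2) \<le> real (c1 + c2) * ((1/2 + \<epsilon>) * N) + real c3 * ((1/2 + \<epsilon>) * N)"
    using hi \<epsilon> N0 by (intro add_mono mult_left_mono) auto
  then have O1hi: "O1 \<le> (1/2 + \<epsilon>) * nv" unfolding O1 by (simp add: nv_def field_simps)
  have O10: "0 < O1" using O1lo c0' N0 by (meson less_le_trans mult_pos_pos half_gt_zero)
  have cp: "card (pred - best X0) = c1 * (N - card X0)" by (rule card_pred_best[OF X0])
  have cb: "card (best X0 - pred) = c2 * card X0" by (rule card_best_pred[OF X0])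
  have x: "real (card (pred - best X0)) / O1 \<le> x"
  proof -
    have "real (card (pred - best X0)) \<le> c1 * (N / 2)"
      unfolding cp of_nat_mult sub using lo by (intro mult_left_mono) auto
    also have "\<dots> \<le> x * (c * (N / 2))" using mult_right_mono[OF c(1), of "N / 2"] by (simp add: c_def mult.assoc)
    also have "\<dots> \<le> x * O1"
    proof (intro mult_left_mono O1lo)
      have "0 \<le> x * c" using c(1) by (simp add: c_def order_trans[of 0 "real c1"])
      then show "0 \<le> x" using c0' by (simp add: zero_le_mult_iff)
    qed
    finally show ?thesis using O10 by (simp add: pos_divide_le_eq)
  qed
  have y: "real (card (best X0 - pred)) / O1 \<le> y"
  proof -
    have "real (card (best X0 - pred)) \<le> c2 * ((1/2 + \<epsilon>) * N)"
      unfolding cb of_nat_mult using hi by (intro mult_left_mono) auto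
    also have "\<dots> = c2 * (1 + 2 * \<epsilon>) * (N / 2)" by (simp add: algebra_simps)
    also have "\<dots> \<le> y * c * (N / 2)" using c(2) by (intro mult_right_mono) (auto simp: c_def)
    also have "\<dots> = y * (c * (N / 2))" by simp
    also have "\<dots> \<le> y * O1"
    proof (intro mult_left_mono O1lo)
      have "0 \<le> real c2 * (1 + 2 * \<epsilon>)" using \<epsilon> by simp
      then have "0 \<le> y * c" using c(2) unfolding c_def by linarith
      then show "0 \<le> y" using c0' by (simp add: zero_le_mult_iff)
    qed
    finally show ?thesis using O10 by (simp add: pos_divide_le_eq)
  qed
  let ?x = "real (card (pred - best X0)) / O1" and ?y = "real (card (best X0 - pred)) / O1"
  have n0: "0 \<le> ?x" "0 \<le> ?y" using O10 by auto
  have "out \<le> (1 + f ?x ?y) * O1" using bound[OF best_min[OF X0]] by (simp add: O1_def)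
  also have "f ?x ?y \<le> f x y" using f_mono1[OF n0(1) x n0(2)] f_mono2[of x ?y y] n0 x y by linarith
  then have "(1 + f ?x ?y) * O1 \<le> (1 + f x y) * O1" using O10 by (intro mult_right_mono) auto
  also have "\<dots> \<le> (1 + f x y) * ((1/2 + \<epsilon>) * nv)"
    using O1hi f_nonneg[of x y] n0 x y by (intro mult_left_mono) auto
  finally show ?thesis by (simp add: mult.assoc)
qed

lemma algorithm_no:
  fixes \<epsilon> :: real
  assumes cover: "vertex_cover {..<nv} edges Y" and no: "\<And>X. covers N R X \<Longrightarrow> (1 - \<epsilon>) * N \<le> card X"
  shows "((c1 + c2) * (1 - \<epsilon>) + c3 / 2) * N \<le> card Y"
proof -
  obtain X0 where X0: "covers N R X0" "\<And>X. covers N R X \<Longrightarrow> card X0 \<le> card X" using min_cover_exists by blast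
  have N2: "real (N div 2) = N / 2" using N(1) by (simp add: real_of_nat_div)
  have "((c1 + c2) * (1 - \<epsilon>) + c3 / 2) * N = real (c1 + c2) * ((1 - \<epsilon>) * N) + real c3 * (N / 2)" by (simp add: algebra_simps)
  also have "\<dots> \<le> real (c1 + c2) * real (card X0) + real c3 * (N / 2)"
    using no[OF X0(1)] by (intro add_mono mult_left_mono) auto
  also have "\<dots> = real ((c1 + c2) * card X0 + c3 * (N div 2))" by (simp add: N2)
  also have "\<dots> \<le> card Y" using cover_lower[OF cover X0(2)] by (simp only: of_nat_le_iff)
  finally show ?thesis .
qed

end

section \<open>The reduction as an expression\<close>

text \<open>A product as an iterated sum. \<open>App\<close> evaluates the arguments first and gives
  the body an environment of known length; without it, the number of a summation index would depend
  on the context.\<close>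

definition mulE :: "exp \<Rightarrow> exp \<Rightarrow> exp" where "mulE a b = App (Sum (Var 0) (Var 1)) [a, b]"
definition notE :: "exp \<Rightarrow> exp" where "notE a = Sub (Const 1) a"
definition leE :: "exp \<Rightarrow> exp \<Rightarrow> exp" where "leE a b = notE (Sub a b)"
definition ltE :: "exp \<Rightarrow> exp \<Rightarrow> exp" where "ltE a b = leE (Add a (Const 1)) b"
definition eqE :: "exp \<Rightarrow> exp \<Rightarrow> exp" where "eqE a b = notE (Add (Sub a b) (Sub b a))"
text \<open>The double negation turns any nonzero condition into 1.\<close>

definition ifE :: "exp \<Rightarrow> exp \<Rightarrow> exp \<Rightarrow> exp" where
  "ifE c a b = Add (mulE (notE (notE c)) a) (mulE (notE c) b)"
text \<open>The number of positive multiples of the divisor up to \<open>a\<close>. For the divisor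
  0 this would be \<open>a\<close> instead of 0, so the evaluation lemmas assume a positive
  divisor.\<close>

definition divE :: "exp \<Rightarrow> exp \<Rightarrow> exp" where
  "divE a b = App (Sum (Var 0) (leE (mulE (Add (Var 2) (Const 1)) (Var 1)) (Var 0))) [a, b]"
definition modE :: "exp \<Rightarrow> exp \<Rightarrow> exp" where "modE a b = Sub a (mulE b (divE a b))"
text \<open>A sum unrolled into a fixed expression, in which \<open>i\<close> is a number and not a
  value: positions of digits are exponents, and \<open>powE\<close> takes these as numbers.\<close>

definition sumE :: "nat \<Rightarrow> (nat \<Rightarrow> exp) \<Rightarrow> exp" where "sumE n g = foldr Add (map g [0..<n]) (Const 0)"
fun powE :: "exp \<Rightarrow> nat \<Rightarrow> exp" where "powE e 0 = Const 1" | "powE e (Suc n) = mulE e (powE e n)"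
definition digE :: "exp \<Rightarrow> nat \<Rightarrow> exp \<Rightarrow> exp" where "digE B i n = modE (divE n (powE B i)) B"

lemma eval_mulE [simp]: "eval x \<rho> (mulE a b) = eval x \<rho> a * eval x \<rho> b"
  by (simp add: mulE_def)
lemma eval_notE [simp]: "eval x \<rho> (notE a) = of_bool (eval x \<rho> a = 0)"
  by (simp add: notE_def)
lemma eval_leE [simp]: "eval x \<rho> (leE a b) = of_bool (eval x \<rho> a \<le> eval x \<rho> b)"
  by (simp add: leE_def)
lemma eval_ltE [simp]: "eval x \<rho> (ltE a b) = of_bool (eval x \<rho> a < eval x \<rho> b)"
  by (simp add: ltE_def Suc_le_eq)
lemma eval_eqE [simp]: "eval x \<rho> (eqE a b) = of_bool (eval x \<rho> a = eval x \<rho> b)"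
  by (auto simp: eqE_def)
lemma eval_ifE [simp]: "eval x \<rho> (ifE c a b) = (if eval x \<rho> c \<noteq> 0 then eval x \<rho> a else eval x \<rho> b)"
  by (simp add: ifE_def)
lemma eval_sumE [simp]: "eval x \<rho> (sumE n g) = (\<Sum>i<n. eval x \<rho> (g i))"
proof -
  have "eval x \<rho> (foldr Add (map g is) (Const 0)) = sum_list (map (\<lambda>i. eval x \<rho> (g i)) is)" for "is"
    by (induction "is") auto
  then show ?thesis by (simp add: sumE_def interv_sum_list_conv_sum_set_nat atLeast0LessThan)
qed
lemma eval_powE [simp]: "eval x \<rho> (powE e n) = eval x \<rho> e ^ n"
  by (induction n) auto

lemma card_of_bool: "(\<Sum>i<n. of_bool (P i) :: nat) = card {i. i < n \<and> P i}" for n :: nat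
proof -
  have "{..<n} \<inter> {i. P i} = {i. i < n \<and> P i}" by auto
  then show ?thesis by simp
qed

lemma eval_divE:
  assumes "0 < eval x \<rho> b"
  shows "eval x \<rho> (divE a b) = eval x \<rho> a div eval x \<rho> b"
proof -
  define A where "A = eval x \<rho> a"
  define B where "B = eval x \<rho> b"
  have B: "0 < B" using assms by (simp add: B_def)
  have "{i. i < A \<and> Suc i * B \<le> A} = {..<A div B}"
  proof (intro equalityI subsetI)
    fix i assume "i \<in> {i. i < A \<and> Suc i * B \<le> A}"
    then show "i \<in> {..<A div B}" using B by (simp add: less_eq_div_iff_mult_less_eq flip: Suc_le_eq)
  next
    fix i assume i: "i \<in> {..<A div B}"
    then have "Suc i * B \<le> A" using B by (simp add: less_eq_div_iff_mult_less_eq flip: Suc_le_eq)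
    moreover have "i < A" using i by (meson div_le_dividend lessThan_iff order_less_le_trans)
    ultimately show "i \<in> {i. i < A \<and> Suc i * B \<le> A}" using i by auto
  qed
  then have "card {i. i < A \<and> Suc i * B \<le> A} = A div B" by simp
  moreover have "eval x \<rho> (divE a b) = (\<Sum>i<A. of_bool (Suc i * B \<le> A))"
    by (simp add: divE_def A_def B_def del: sum_of_bool_eq)
  ultimately show ?thesis unfolding card_of_bool by (simp add: A_def B_def)
qed

lemma eval_modE:
  assumes "0 < eval x \<rho> b"
  shows "eval x \<rho> (modE a b) = eval x \<rho> a mod eval x \<rho> b"
  using assms by (simp add: modE_def eval_divE minus_mult_div_eq_mod)

lemma eval_digE:
  assumes "0 < eval x \<rho> B"
  shows "eval x \<rho> (digE B i n) = dig (eval x \<rho> B) i (eval x \<rho> n)"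
  using assms by (simp add: digE_def dig_def eval_modE eval_divE)

text \<open>The \<open>j\<close>-th number of the input is the number of \<open>True\<close> bits preceded by exactly \<open>j\<close> \<open>False\<close> bits.\<close>

definition falseE :: "exp \<Rightarrow> exp" where
  "falseE p = App (Sum (Var 0) (eqE (Sym (Var 1)) (Const 1))) [p]"
definition tokE :: "exp \<Rightarrow> exp" where
  "tokE j = App (Sum Len (mulE (eqE (Sym (Var 1)) (Const 2)) (eqE (falseE (Var 1)) (Var 0)))) [j]"

definition falses :: "bool list \<Rightarrow> nat \<Rightarrow> nat" where
  "falses x p = (\<Sum>q<p. of_bool (sym_at x q = 1))"
definition tok :: "bool list \<Rightarrow> nat \<Rightarrow> nat" where
  "tok x j = (\<Sum>p<length x. of_bool (sym_at x p = 2 \<and> falses x p = j))"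

lemma eval_falseE [simp]: "eval x \<rho> (falseE p) = falses x (eval x \<rho> p)"
  by (simp add: falseE_def falses_def del: sum_of_bool_eq)

lemma eval_tokE [simp]: "eval x \<rho> (tokE j) = tok x (eval x \<rho> j)"
  by (simp add: tokE_def tok_def of_bool_conj del: sum_of_bool_eq)

section \<open>Decoding numbers written in unary\<close>

lemma sum_lessThan_add: "(\<Sum>i<a + b. f i) = (\<Sum>i<a. f i) + (\<Sum>i<b. f (a + i) :: nat)" for a b :: nat
  by (induction b) auto

lemma enc_nats_Cons: "enc_nats (m # ms) = replicate m True @ False # enc_nats ms"
  by (simp add: enc_nats_def)

lemma sym_at_block:
  "p < m \<Longrightarrow> sym_at (replicate m True @ False # y) p = 2"
  "sym_at (replicate m True @ False # y) m = 1"
  "sym_at (replicate m True @ False # y) (Suc m + p) = sym_at y p"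
  by (auto simp: sym_at_def nth_append nth_Cons')

lemma falses_block:
  "p \<le> m \<Longrightarrow> falses (replicate m True @ False # y) p = 0"
  "falses (replicate m True @ False # y) (Suc m + p) = Suc (falses y p)"
proof -
  show 1: "falses (replicate m True @ False # y) p = 0" if "p \<le> m" for p
    unfolding falses_def using that by (intro sum.neutral) (auto simp: sym_at_block)
  have "falses (replicate m True @ False # y) (Suc m + p) = falses (replicate m True @ False # y) (Suc m) + falses y p"
    unfolding falses_def sum_lessThan_add sym_at_block(3) ..
  moreover have "falses (replicate m True @ False # y) (Suc m) = falses (replicate m True @ False # y) m + 1"
    unfolding falses_def by (simp add: sym_at_block del: sum_of_bool_eq)
  ultimately show "falses (replicate m True @ False # y) (Suc m + p) = Suc (falses y p)" using 1[of m] by simp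
qed

lemma tok_block:
  "tok (replicate m True @ False # y) 0 = m"
  "tok (replicate m True @ False # y) (Suc j) = tok y j"
proof -
  let ?x = "replicate m True @ False # y"
  have len: "length ?x = Suc m + length y" by simp
  have *: "tok ?x j = (\<Sum>p<m. of_bool (0 = j)) + (\<Sum>p<length y. of_bool (sym_at y p = 2 \<and> Suc (falses y p) = j))" for j
  proof -
    have "tok ?x j = (\<Sum>p<Suc m. of_bool (sym_at ?x p = 2 \<and> falses ?x p = j)) +
        (\<Sum>p<length y. of_bool (sym_at ?x (Suc m + p) = 2 \<and> falses ?x (Suc m + p) = j))"
      unfolding tok_def len by (rule sum_lessThan_add)
    also have "(\<Sum>p<Suc m. of_bool (sym_at ?x p = 2 \<and> falses ?x p = j)) = (\<Sum>p<m. of_bool (0 = j))"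
      by (simp add: sym_at_block falses_block del: sum_of_bool_eq)
    finally show ?thesis unfolding sym_at_block falses_block .
  qed
  show "tok ?x 0 = m" unfolding * by simp
  show "tok ?x (Suc j) = tok y j" unfolding * by (simp add: tok_def del: sum_of_bool_eq)
qed

lemma tok_enc_nats: "j < length ms \<Longrightarrow> tok (enc_nats ms) j = ms ! j"
proof (induction ms arbitrary: j)
  case (Cons m ms)
  then show ?case by (cases j) (auto simp: enc_nats_Cons tok_block)
qed simp

lemma falses_enc_nats: "falses (enc_nats ms) (length (enc_nats ms)) = length ms"
proof (induction ms)
  case (Cons m ms)
  have "length (enc_nats (m # ms)) = Suc m + length (enc_nats ms)" by (simp add: enc_nats_Cons)
  then show ?case using Cons falses_block(2)[of m "enc_nats ms" "length (enc_nats ms)"]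
    by (simp only: enc_nats_Cons) simp
qed (simp add: falses_def enc_nats_def)

lemma nth_concat_uniform:
  assumes "\<And>z. z \<in> set C \<Longrightarrow> length (g z) = w" "e < length C" "i < w"
  shows "concat (map g C) ! (e * w + i) = g (C ! e) ! i" "e * w + i < length (concat (map g C))"
  using assms
proof (induction C arbitrary: e)
  case (Cons z C)
  {
    case 1
    then show ?case using Cons.IH(1)[of "e - 1"] by (cases e) (auto simp: nth_append)
  next
    case 2
    then show ?case using Cons.IH(2)[of "e - 1"] by (cases e) (auto simp: add.assoc)
  }
qed auto

text \<open>The entry is the unique selected \<open>h\<close> with exactly \<open>r\<close> selected
  numbers below it, so a sum over all \<open>h\<close> retrieves it; this is the form that
  \<open>pickE\<close> can express.\<close>

lemma filter_upt_nth:
  assumes "r < length (filter P [0..<n])"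
  shows "filter P [0..<n] ! r = (\<Sum>h<n. h * of_bool (P h \<and> (\<Sum>h'<h. of_bool (P h')) = r))"
  using assms
proof (induction n)
  case (Suc n)
  have len: "length (filter P [0..<m]) = (\<Sum>h<m. of_bool (P h))" for m by (induction m) auto
  show ?case
  proof (cases "r < length (filter P [0..<n])")
    case True
    then show ?thesis using Suc.IH len[of n] by (auto simp: nth_append simp del: sum_of_bool_eq)
  next
    case False
    then have Pn: "P n" "r = length (filter P [0..<n])" using Suc.prems by (auto split: if_splits)
    have "(\<Sum>h'<h. of_bool (P h') :: nat) \<noteq> r" if "h < n" "P h" for h
    proof -
      have "(\<Sum>h'<Suc h. of_bool (P h') :: nat) \<le> (\<Sum>h'<n. of_bool (P h'))" using that(1) by (intro sum_mono2) auto
      then show ?thesis using that(2) Pn(2) len[of n] by (simp del: sum_of_bool_eq)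
    qed
    then have "(\<Sum>h<n. h * of_bool (P h \<and> (\<Sum>h'<h. of_bool (P h')) = r)) = 0"
      by (intro sum.neutral) (auto simp del: sum_of_bool_eq)
    then show ?thesis using Pn len[of n] by (simp add: nth_append del: sum_of_bool_eq)
  qed
qed simp

text \<open>The input lists the number of variables and then \<open>k + 2\<close> numbers per
  constraint; each number ends with one \<open>False\<close>, so counting these counts the
  numbers.\<close>

definition consE :: "nat \<Rightarrow> exp" where
  "consE k = divE (Sub (falseE Len) (Const 1)) (Const (k + 2))"
definition halfE :: "nat \<Rightarrow> exp" where "halfE k = mulE (Const 2) (consE k)"
text \<open>Fields 0 and 1 of a constraint are its variables, and the values of the permutation
  start at field 2; the offset 1 skips the number of variables.\<close>

definition fieldE :: "nat \<Rightarrow> exp \<Rightarrow> exp \<Rightarrow> exp" where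
  "fieldE k h i = tokE (Add (Const 1) (Add (mulE (divE h (Const 2)) (Const (k + 2))) i))"
definition xE :: "nat \<Rightarrow> exp \<Rightarrow> exp" where "xE k h = fieldE k h (modE h (Const 2))"
definition yE :: "nat \<Rightarrow> exp \<Rightarrow> exp" where "yE k h = fieldE k h (Sub (Const 1) (modE h (Const 2)))"
definition relE :: "nat \<Rightarrow> exp \<Rightarrow> nat \<Rightarrow> nat \<Rightarrow> exp" where
  "relE k h c d = ifE (modE h (Const 2)) (eqE (fieldE k h (Const (d + 2))) (Const c)) (eqE (fieldE k h (Const (c + 2))) (Const d))"
definition degE :: "nat \<Rightarrow> exp \<Rightarrow> exp" where
  "degE k u = App (Sum (halfE k) (eqE (xE k (Var 1)) (Var 0))) [u]"
definition rankE :: "nat \<Rightarrow> exp \<Rightarrow> exp \<Rightarrow> exp" where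
  "rankE k u h = App (Sum (Var 1) (eqE (xE k (Var 2)) (Var 0))) [u, h]"
definition pickE :: "nat \<Rightarrow> exp \<Rightarrow> exp \<Rightarrow> exp" where
  "pickE k u j = App (Sum (halfE k) (mulE (Var 2) (mulE (eqE (xE k (Var 2)) (Var 0))
     (eqE (rankE k (Var 0) (Var 2)) (modE (Var 1) (degE k (Var 0))))))) [u, j]"
definition nbrE :: "nat \<Rightarrow> nat \<Rightarrow> exp \<Rightarrow> nat \<Rightarrow> exp" where
  "nbrE k l t i = App (pickE k (xE k (digE (halfE k) l (Var 0))) (digE (halfE k) i (Var 0))) [t]"
definition meetE :: "nat \<Rightarrow> nat \<Rightarrow> exp" where
  "meetE k s = sumE k (\<lambda>c. mulE (ltE (digE (Const (2 * s)) c (Var 0)) (Const (s - 1)))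
     (sumE k (\<lambda>c'. mulE (ltE (digE (Const (2 * s)) c' (Var 1)) (Const (s - 1)))
       (sumE k (\<lambda>d. mulE (relE k (Var 2) c d) (relE k (Var 3) c' d))))))"
definition conflictE :: "nat \<Rightarrow> nat \<Rightarrow> nat \<Rightarrow> exp \<Rightarrow> exp \<Rightarrow> exp" where
  "conflictE k s l v v' = App (sumE l (\<lambda>i. sumE l (\<lambda>i'.
     App (mulE (eqE (yE k (Var 2)) (yE k (Var 3))) (notE (meetE k s)))
       [Var 0, Var 1, nbrE k l (divE (Var 0) (Const ((2 * s) ^ k))) i, nbrE k l (divE (Var 1) (Const ((2 * s) ^ k))) i'])))
     [v, v']"

section \<open>Values of the expressions on an encoded unique game\<close>

context ug_graph begin

context
  fixes x :: "bool list"
  assumes x: "x = enc_unique_game (n, C)"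
begin

lemma field:
  assumes "e < length C" "C ! e = (u, v, \<pi>)" "i < k + 2"
  shows "tok x (1 + (e * (k + 2) + i)) = (u # v # \<pi>) ! i"
proof -
  let ?g = "\<lambda>(u, v, \<pi>). u # v # \<pi>"
  have len: "length (?g z) = k + 2" if "z \<in> set C" for z
  proof -
    obtain u v \<pi> where z: "z = (u, v, \<pi>)" by (cases z)
    then have "distinct \<pi>" "set \<pi> = {..<k}" using wf that by (auto simp: wf_unique_game_def)
    then show ?thesis using distinct_card[of \<pi>] z by simp
  qed
  have "tok x (1 + (e * (k + 2) + i)) = (n # concat (map ?g C)) ! (1 + (e * (k + 2) + i))"
    unfolding x enc_unique_game_def using nth_concat_uniform(2)[of C ?g "k + 2" e i, OF len assms(1,3)]
    by (simp add: tok_enc_nats)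
  also have "\<dots> = ?g (C ! e) ! i" using nth_concat_uniform(1)[of C ?g "k + 2" e i, OF len assms(1,3)] by simp
  finally show ?thesis using assms(2) by simp
qed

lemma eval_consE [simp]: "eval x \<rho> (consE k) = length C"
proof -
  let ?g = "\<lambda>(u, v, \<pi>). u # v # \<pi>"
  have "length (?g z) = k + 2" if "z \<in> set C" for z
  proof -
    obtain u v \<pi> where z: "z = (u, v, \<pi>)" by (cases z)
    then have "distinct \<pi>" "set \<pi> = {..<k}" using wf that by (auto simp: wf_unique_game_def)
    then show ?thesis using distinct_card[of \<pi>] z by simp
  qed
  then have "length (concat (map ?g C)) = length C * (k + 2)"
    by (simp add: length_concat comp_def sum_list_triv cong: map_cong)
  then have "falses x (length x) = Suc (length C * (k + 2))"
    unfolding x enc_unique_game_def using falses_enc_nats[of "n # concat (map ?g C)"] by simp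
  then show ?thesis by (simp add: consE_def eval_divE del: mult_Suc_right)
qed

lemma eval_halfE [simp]: "eval x \<rho> (halfE k) = M"
  by (simp add: halfE_def M_def)

lemma eval_fieldE:
  assumes "eval x \<rho> h < M" "C ! (eval x \<rho> h div 2) = (u, v, \<pi>)" "eval x \<rho> i < k + 2"
  shows "eval x \<rho> (fieldE k h i) = (u # v # \<pi>) ! eval x \<rho> i"
proof -
  have "eval x \<rho> h div 2 < length C" using assms(1) by (simp add: M_def)
  then show ?thesis using field[OF _ assms(2,3)] by (simp add: fieldE_def eval_divE)
qed

lemma eval_xE:
  assumes "eval x \<rho> h < M"
  shows "eval x \<rho> (xE k h) = he_x C (eval x \<rho> h)"
proof -
  obtain u v \<pi> where e: "C ! (eval x \<rho> h div 2) = (u, v, \<pi>)" by (cases "C ! (eval x \<rho> h div 2)")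
  have "eval x \<rho> (modE h (Const 2)) < k + 2" by (simp add: eval_modE trans_less_add2)
  then show ?thesis unfolding xE_def using eval_fieldE[OF assms e, of "modE h (Const 2)"]
    by (cases "even (eval x \<rho> h)") (auto simp: he_x_def e eval_modE odd_iff_mod_2_eq_one)
qed

lemma eval_yE:
  assumes "eval x \<rho> h < M"
  shows "eval x \<rho> (yE k h) = he_y C (eval x \<rho> h)"
proof -
  obtain u v \<pi> where e: "C ! (eval x \<rho> h div 2) = (u, v, \<pi>)" by (cases "C ! (eval x \<rho> h div 2)")
  have "eval x \<rho> (Sub (Const 1) (modE h (Const 2))) < k + 2" by simp
  then show ?thesis unfolding yE_def using eval_fieldE[OF assms e, of "Sub (Const 1) (modE h (Const 2))"]
    by (cases "even (eval x \<rho> h)") (auto simp: he_y_def e eval_modE odd_iff_mod_2_eq_one)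
qed

lemma eval_relE:
  assumes "eval x \<rho> h < M" "c < k" "d < k"
  shows "eval x \<rho> (relE k h c d) = of_bool (he_rel C (eval x \<rho> h) c d)"
proof -
  obtain u v \<pi> where e: "C ! (eval x \<rho> h div 2) = (u, v, \<pi>)" by (cases "C ! (eval x \<rho> h div 2)")
  show ?thesis unfolding relE_def
    using eval_fieldE[OF assms(1) e, of "Const (c + 2)"] eval_fieldE[OF assms(1) e, of "Const (d + 2)"] assms(2,3)
    by (cases "even (eval x \<rho> h)") (auto simp: he_rel_def e eval_modE odd_iff_mod_2_eq_one)
qed

lemma eval_degE: "eval x \<rho> (degE k u) = deg (eval x \<rho> u)"
proof -
  have "eval x \<rho> (degE k u) = (\<Sum>h<M. of_bool (he_x C h = eval x \<rho> u))"
    by (simp add: degE_def eval_xE del: sum_of_bool_eq)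
  also have "\<dots> = card (set (halves C (eval x \<rho> u)))" unfolding card_of_bool set_halves ..
  also have "\<dots> = deg (eval x \<rho> u)" by (rule distinct_card[OF distinct_halves])
  finally show ?thesis .
qed

lemma eval_rankE:
  assumes "eval x \<rho> h \<le> M"
  shows "eval x \<rho> (rankE k u h) = (\<Sum>h'<eval x \<rho> h. of_bool (he_x C h' = eval x \<rho> u))"
  using assms by (simp add: rankE_def eval_xE del: sum_of_bool_eq)

lemma eval_pickE:
  assumes "0 < deg (eval x \<rho> u)"
  shows "eval x \<rho> (pickE k u j) = pick C (eval x \<rho> u) (eval x \<rho> j)"
proof -
  define U where "U = eval x \<rho> u"
  define J where "J = eval x \<rho> j"
  have "eval x \<rho> (pickE k u j) = (\<Sum>h<M. h * (of_bool (he_x C h = U) * of_bool ((\<Sum>h'<h. of_bool (he_x C h' = U)) = J mod deg U)))"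
    using assms by (simp add: pickE_def eval_xE eval_rankE eval_modE eval_degE U_def J_def del: sum_of_bool_eq)
  also have "\<dots> = (\<Sum>h<M. h * of_bool (he_x C h = U \<and> (\<Sum>h'<h. of_bool (he_x C h' = U)) = J mod deg U))"
    by (simp add: of_bool_conj del: sum_of_bool_eq)
  also have "\<dots> = pick C U J"
    unfolding pick_def using assms filter_upt_nth[of "J mod deg U" "\<lambda>h. he_x C h = U" M]
    by (simp add: U_def halves_def M_def del: sum_of_bool_eq)
  finally show ?thesis by (simp add: U_def J_def)
qed

lemma eval_nbrE: "eval x \<rho> (nbrE k l t i) = nbr C l (eval x \<rho> t) i"
proof -
  let ?t = "eval x \<rho> t"
  have d: "eval x [?t] (digE (halfE k) j (Var 0)) = dig M j ?t" for j
    using M_pos by (simp add: eval_digE)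
  have "eval x [?t] (xE k (digE (halfE k) l (Var 0))) = he_x C (dig M l ?t)"
    using eval_xE[of "[?t]" "digE (halfE k) l (Var 0)"] d dig_less[OF M_pos] by simp
  moreover have "0 < deg (he_x C (dig M l ?t))" using deg_pos dig_less[OF M_pos] by blast
  ultimately show ?thesis
    using eval_pickE[of "[?t]" "xE k (digE (halfE k) l (Var 0))" "digE (halfE k) i (Var 0)"] d
    by (simp add: nbrE_def nbr_eq)
qed

lemma eval_conflictE:
  "eval x \<rho> (conflictE k s l v v') \<noteq> 0 \<longleftrightarrow> conflict C k s l (eval x \<rho> v) (eval x \<rho> v')"
proof -
  define V where "V = eval x \<rho> v"
  define V' where "V' = eval x \<rho> v'"
  have b0: "0 < 2 * s" using s by simp
  have dg: "eval x [V, V', h, h'] (digE (Const (2 * s)) c (Var 0)) = dig b c V"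
    "eval x [V, V', h, h'] (digE (Const (2 * s)) c (Var 1)) = dig b c V'" for h h' c
    using b0 by (simp_all add: eval_digE b_def)
  have meet: "eval x [V, V', h, h'] (meetE k s) = 0 \<longleftrightarrow>
      \<not> (\<exists>c<k. \<exists>c'<k. \<exists>d<k. dig b c V < s - 1 \<and> dig b c' V' < s - 1 \<and> he_rel C h c d \<and> he_rel C h' c' d)"
    if "h < M" "h' < M" for h h'
  proof -
    have r: "eval x [V, V', h, h'] (relE k (Var 2) c d) = of_bool (he_rel C h c d)"
      "eval x [V, V', h, h'] (relE k (Var 3) c d) = of_bool (he_rel C h' c d)" if "c < k" "d < k" for c d
      using eval_relE[of "[V, V', h, h']" "Var 2" c d] eval_relE[of "[V, V', h, h']" "Var 3" c d] that \<open>h < M\<close> \<open>h' < M\<close> by auto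
    have "eval x [V, V', h, h'] (meetE k s) = (\<Sum>c<k. of_bool (dig b c V < s - 1) *
        (\<Sum>c'<k. of_bool (dig b c' V' < s - 1) * (\<Sum>d<k. of_bool (he_rel C h c d) * of_bool (he_rel C h' c' d))))"
      unfolding meetE_def by (simp add: dg r del: sum_of_bool_eq One_nat_def)
    then show ?thesis by auto
  qed
  have nb: "eval x [V, V'] (nbrE k l (divE (Var 0) (Const ((2 * s) ^ k))) i) = nbr C l (V div b ^ k) i"
    "eval x [V, V'] (nbrE k l (divE (Var 1) (Const ((2 * s) ^ k))) i) = nbr C l (V' div b ^ k) i" for i
    using b0 by (simp_all add: eval_nbrE eval_divE b_def)
  have y: "eval x [V, V', h, h'] (yE k (Var 2)) = he_y C h" "eval x [V, V', h, h'] (yE k (Var 3)) = he_y C h'"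
    if "h < M" "h' < M" for h h'
    using that eval_yE[of "[V, V', h, h']" "Var 2"] eval_yE[of "[V, V', h, h']" "Var 3"] by simp_all
  have vv: "(if 0 < length [V, V'] then [V, V'] ! 0 else 0) = V" "(if 1 < length [V, V'] then [V, V'] ! 1 else 0) = V'"
    by simp_all
  have nM: "nbr C l t i < M" for t i using nbr_mem by blast
  have "eval x \<rho> (conflictE k s l v v') = (\<Sum>i<l. \<Sum>i'<l.
      of_bool (he_y C (nbr C l (V div b ^ k) i) = he_y C (nbr C l (V' div b ^ k) i')) *
      of_bool (eval x [V, V', nbr C l (V div b ^ k) i, nbr C l (V' div b ^ k) i'] (meetE k s) = 0))"
    by (simp only: conflictE_def eval.simps eval_sumE list.map V_def[symmetric] V'_def[symmetric] nb eval_mulE eval_eqE eval_notE vv y[OF nM nM])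
  then have "eval x \<rho> (conflictE k s l v v') \<noteq> 0 \<longleftrightarrow> conflict C k s l V V'"
    unfolding conflict_iff by (simp add: meet[OF nM nM]) blast
  then show ?thesis by (simp add: V_def V'_def)
qed

end

end

section \<open>The gap for vertex cover\<close>

definition base_size :: "(nat \<times> nat \<times> nat list) list \<Rightarrow> nat \<Rightarrow> nat \<Rightarrow> nat \<Rightarrow> nat \<Rightarrow> nat" where
  "base_size C k s l D = (2 * s) ^ k * (2 * length C) ^ Suc l * D"

definition base_adj :: "(nat \<times> nat \<times> nat list) list \<Rightarrow> nat \<Rightarrow> nat \<Rightarrow> nat \<Rightarrow> nat \<Rightarrow> nat \<Rightarrow> nat \<Rightarrow> bool" where
  "base_adj C k s l D I I' \<longleftrightarrow> I \<noteq> I' \<and> conflict C k s l (I div D) (I' div D)"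

lemma conflict_sym: "conflict C k s l v v' \<Longrightarrow> conflict C k s l v' v"
proof -
  assume "conflict C k s l v v'"
  then obtain i i' where "i < l" "i' < l"
    "he_y C (nbr C l (v div (2 * s) ^ k) i) = he_y C (nbr C l (v' div (2 * s) ^ k) i')"
    "\<And>c c' d. \<lbrakk>c < k; c' < k; d < k; dig (2 * s) c v < s - 1; dig (2 * s) c' v' < s - 1;
          he_rel C (nbr C l (v div (2 * s) ^ k) i) c d; he_rel C (nbr C l (v' div (2 * s) ^ k) i') c' d\<rbrakk> \<Longrightarrow> False"
    unfolding conflict_def by blast
  then show ?thesis unfolding conflict_def by (intro exI[of _ i'] conjI exI[of _ i]) auto
qed

context ug_graph begin

lemma base_size_eq: "base_size C k s l D = N0 * D"
  by (simp add: base_size_def N0_def M_def b_def)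

lemma copies_base:
  assumes "1 \<le> D" "0 < c1 + c2 + c3"
  shows "copies (base_size C k s l D) (base_adj C k s l D) c1 c2 c3"
proof
  show "even (base_size C k s l D)" using k by (simp add: base_size_def)
  show "0 < base_size C k s l D" using assms s M_pos by (simp add: base_size_def M_def)
  show "base_adj C k s l D I' I" if "base_adj C k s l D I I'" for I I'
    using that conflict_sym by (auto simp: base_adj_def)
  show "\<not> base_adj C k s l D I I" for I by (simp add: base_adj_def)
  show "base_size C k s l D \<le> 2 * card X" if "covers (base_size C k s l D) (base_adj C k s l D) X" for X
    unfolding base_size_eq using that assms(1) by (intro cover_ge_half) (auto simp: covers_def base_adj_def base_size_eq)
qed (use assms in auto)

text \<open>Each constraint is seen by exactly two half-edges, which are violated together.\<close>

lemma unsat_halves: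
  "(\<Sum>h<M. of_bool (perm h (lab (he_x C h)) \<noteq> lab (he_y C h))) = (1 - sat_fraction C lab) * M"
  if lab: "\<And>u. u < n \<Longrightarrow> lab u < k" for lab
proof -
  let ?P = "\<lambda>(u, v, \<pi>). \<pi> ! lab u = lab v"
  define un where "un h = (of_bool (perm h (lab (he_x C h)) \<noteq> lab (he_y C h)) :: real)" for h
  have un: "un (a + 2 * e) = 1 - of_bool (?P (C ! e))" if "e < length C" "a < 2" for e a
  proof -
    obtain u v \<pi> where e: "C ! e = (u, v, \<pi>)" by (cases "C ! e")
    have h: "a + 2 * e < M" using that by (simp add: M_def)
    have dv: "(a + 2 * e) div 2 = e" using that by simp
    have "perm (a + 2 * e) (lab (he_x C (a + 2 * e))) = lab (he_y C (a + 2 * e)) \<longleftrightarrow> he_rel C (a + 2 * e) (lab (he_x C (a + 2 * e))) (lab (he_y C (a + 2 * e)))"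
      using rel_perm[OF h] lab he_less h by blast
    also have "\<dots> \<longleftrightarrow> \<pi> ! lab u = lab v"
      by (cases "even (a + 2 * e)") (auto simp: he_rel_def he_x_def he_y_def dv e)
    finally show ?thesis by (simp add: un_def e)
  qed
  have "(\<Sum>h<M. un h) = (\<Sum>e<length C. \<Sum>a<2. un (a + 2 * e))" unfolding M_def by (rule sum_split_nat)
  also have "\<dots> = (\<Sum>e<length C. 2 * (1 - of_bool (?P (C ! e))))" by (intro sum.cong refl) (simp add: un)
  also have "\<dots> = 2 * (length C - real (length (filter ?P C)))"
  proof -
    have "(\<Sum>e<length C. of_bool (?P (C ! e)) :: real) = length (filter ?P C)"
      unfolding length_filter_conv_card by (auto intro!: arg_cong[where f = card])
    then show ?thesis by (simp add: sum_distrib_left[symmetric] sum_subtractf del: sum_of_bool_eq)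
  qed
  also have "\<dots> = (1 - sat_fraction C lab) * M"
    using M_pos by (simp add: sat_fraction_def M_def field_simps)
  finally show ?thesis unfolding un_def .
qed

lemma small_cover:
  fixes \<epsilon> :: real
  assumes D: "1 \<le> D" and lab: "lab \<in> {..<n} \<rightarrow>\<^sub>E {..<k}" "1 - \<epsilon> \<le> sat_fraction C lab"
  shows "\<exists>X. covers (base_size C k s l D) (base_adj C k s l D) X \<and>
    card X \<le> (1 - (1 - 2 * l * \<epsilon>) * (real (s - 1) / (2 * s))) * base_size C k s l D"
proof -
  have labk: "lab u < k" if "u < n" for u using lab that by (auto simp: PiE_iff)
  have "(1 - sat_fraction C lab) * M \<le> \<epsilon> * M" using lab(2) by (intro mult_right_mono) auto
  then have un: "(\<Sum>h<M. of_bool (perm h (lab (he_x C h)) \<noteq> lab (he_y C h))) \<le> \<epsilon> * M"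
    using unsat_halves[where lab = lab, OF labk] by simp
  obtain I where I: "I \<subseteq> {..<N0}" "\<forall>v\<in>I. \<forall>v'\<in>I. \<not> conflict C k s l v v'"
    "(1 - 2 * l * \<epsilon>) * (real (s - 1) / b) * N0 \<le> card I"
    using completeness[where lab = lab and \<epsilon> = \<epsilon>, OF labk un] by blast
  define Y where "Y = {J. J < N0 * D \<and> J div D \<in> I}"
  define X where "X = {..<N0 * D} - Y"
  have "real (card Y) = (\<Sum>J<D * N0. of_bool (J div D \<in> I))"
    by (subst sum_of_bool_eq) (auto simp: Y_def mult.commute intro!: arg_cong[where f = card])
  also have "\<dots> = (\<Sum>v<N0. \<Sum>a<D. of_bool (v \<in> I))" unfolding sum_split_nat[where A = D] by (intro sum.cong refl) auto
  also have "\<dots> = D * card I"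
  proof -
    have "{..<N0} \<inter> I = I" using I(1) by auto
    then show ?thesis by (simp add: sum_distrib_left[symmetric])
  qed
  finally have cY: "real (card Y) = D * card I" .
  have "card X = N0 * D - card Y" unfolding X_def by (subst card_Diff_subset) (auto simp: Y_def)
  moreover have "card Y \<le> N0 * D" using card_mono[of "{..<N0 * D}" Y] by (auto simp: Y_def)
  ultimately have "real (card X) = real (N0 * D) - real (card Y)" by (simp add: of_nat_diff)
  then have cX: "real (card X) = real D * (real N0 - real (card I))" unfolding cY by (simp add: algebra_simps)
  have "covers (N0 * D) (base_adj C k s l D) X"
    unfolding covers_def using I(2) by (auto simp: X_def Y_def base_adj_def)
  moreover have "real (card X) \<le> (1 - (1 - 2 * l * \<epsilon>) * (real (s - 1) / (2 * s))) * real (N0 * D)"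
  proof -
    have "real N0 - card I \<le> N0 - (1 - 2 * l * \<epsilon>) * (real (s - 1) / b) * N0" using I(3) by simp
    then have "D * (real N0 - card I) \<le> D * (N0 - (1 - 2 * l * \<epsilon>) * (real (s - 1) / b) * N0)" by (intro mult_left_mono) auto
    then show ?thesis unfolding cX by (simp add: b_def algebra_simps)
  qed
  ultimately show ?thesis unfolding base_size_eq by blast
qed

text \<open>A cover that is too small leaves an independent set of density more than \<epsilon> in
  the blow-up. Vertices with a single uncovered copy account for at most
  \<open>N0 \<le> \<epsilon> / 2 * (N0 * D)\<close> of it; the remaining density
  \<open>\<epsilon> / 2\<close>, that is \<open>2 * (\<epsilon> / 4)\<close>, feeds soundness with
  \<open>\<epsilon> / 4\<close>.\<close>

lemma large_covers:
  fixes \<epsilon> :: real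
  assumes core: "\<And>\<F>. (\<And>F G. F \<in> \<F> \<Longrightarrow> F \<subseteq> G \<Longrightarrow> G \<subseteq> {..<k} \<Longrightarrow> G \<in> \<F>) \<Longrightarrow>
      \<epsilon> / 4 \<le> expect (real (s - 1) / (2 * s)) {..<k} (\<lambda>F. of_bool (F \<in> \<F>)) \<Longrightarrow>
      \<exists>J L. is_core \<kappa> {..<k} \<F> J L \<and> card L \<le> r"
    and r: "1 \<le> r" "l = Suc r" and \<epsilon>: "0 < \<epsilon>" and D: "1 \<le> D" "2 / \<epsilon> \<le> D"
    and X: "covers (base_size C k s l D) (base_adj C k s l D) X"
    and low: "\<And>lab. lab \<in> {..<n} \<rightarrow>\<^sub>E {..<k} \<Longrightarrow> sat_fraction C lab < \<epsilon> / 4 / (16 * l\<^sup>2 * r\<^sup>2)"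
  shows "(1 - \<epsilon>) * base_size C k s l D \<le> card X"
proof (rule ccontr)
  assume neg: "\<not> ?thesis"
  have Xs: "X \<subseteq> {..<N0 * D}" using X by (simp add: covers_def base_size_eq)
  obtain Ind where Ind: "Ind \<subseteq> {..<N0}" "\<And>v v'. v \<in> Ind \<Longrightarrow> v' \<in> Ind \<Longrightarrow> \<not> conflict C k s l v v'"
    "N0 * D - card X \<le> D * card Ind + N0"
    using independent_of_cover[OF D(1) Xs] X unfolding covers_def base_adj_def base_size_eq by metis
  have "real (card X) < (1 - \<epsilon>) * (N0 * D)" using neg by (simp add: base_size_eq)
  moreover have "real (N0 * D) \<le> real (card X + (D * card Ind + N0))" using Ind(3) by (simp only: of_nat_le_iff)
  ultimately have "\<epsilon> * (N0 * D) < D * card Ind + N0" by (simp add: algebra_simps)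
  moreover have "real N0 \<le> \<epsilon> / 2 * (N0 * D)"
  proof -
    have "1 \<le> \<epsilon> / 2 * D" using D(2) \<epsilon> by (simp add: field_simps)
    then have "real N0 * 1 \<le> real N0 * (\<epsilon> / 2 * D)" by (intro mult_left_mono) auto
    then show ?thesis by (simp add: algebra_simps)
  qed
  ultimately have "D * (2 * (\<epsilon> / 4) * N0) \<le> D * real (card Ind)" by (simp add: algebra_simps)
  then have "2 * (\<epsilon> / 4) * N0 \<le> card Ind" using D(1) by simp
  then have "\<exists>lab \<in> {..<n} \<rightarrow>\<^sub>E {..<k}. \<epsilon> / 4 / (16 * l\<^sup>2 * r\<^sup>2) \<le> sat_fraction C lab"
    using core \<epsilon> by (intro soundness[where Ind = Ind and \<kappa> = \<kappa>] r Ind(1) Ind(2)) (auto simp: b_def)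
  then show False using low by force
qed

end

lemma ug_value_cases:
  assumes "1 \<le> k"
  shows "\<exists>lab \<in> {..<n} \<rightarrow>\<^sub>E {..<k}. ug_value k (n, C) = sat_fraction C lab"
    "lab \<in> {..<n} \<rightarrow>\<^sub>E {..<k} \<Longrightarrow> sat_fraction C lab \<le> ug_value k (n, C)"
proof -
  let ?X = "{..<n} \<rightarrow>\<^sub>E {..<k}"
  have fin: "finite (sat_fraction C ` ?X)" by (intro finite_imageI finite_PiE) auto
  have "(\<lambda>u. if u < n then 0 else undefined) \<in> ?X" using assms by (auto simp: PiE_iff extensional_def)
  then have "sat_fraction C ` ?X \<noteq> {}" by blast
  from Max_in[OF fin this] show "\<exists>lab \<in> ?X. ug_value k (n, C) = sat_fraction C lab" by (auto simp: ug_value_def)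
  show "sat_fraction C lab \<le> ug_value k (n, C)" if "lab \<in> ?X" using Max_ge[OF fin] that by (simp add: ug_value_def)
qed

theorem unique_games_to_vertex_cover:
  fixes \<epsilon> :: real
  assumes \<epsilon>: "0 < \<epsilon>"
  shows "\<exists>s l D \<zeta> \<gamma>. 2 \<le> s \<and> 1 \<le> l \<and> 1 \<le> D \<and> 0 < \<zeta> \<and> 0 < \<gamma> \<and>
    (\<forall>n C k. 1 \<le> k \<longrightarrow> wf_unique_game k (n, C) \<longrightarrow>
      (1 - \<zeta> \<le> ug_value k (n, C) \<longrightarrow>
        (\<exists>X. covers (base_size C k s l D) (base_adj C k s l D) X \<and> card X \<le> (1/2 + \<epsilon>) * base_size C k s l D)) \<and>
      (ug_value k (n, C) \<le> \<gamma> \<longrightarrow>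
        (\<forall>X. covers (base_size C k s l D) (base_adj C k s l D) X \<longrightarrow> (1 - \<epsilon>) * base_size C k s l D \<le> card X)))"
proof -
  \<comment> \<open>The bias is \<open>1/2 - 1 / (2 * s)\<close>. With
    \<open>1 / s \<le> \<epsilon>\<close>, half of the allowed excess \<epsilon> goes to the bias
    and the other half to unsatisfied samples.\<close>
  obtain s0 :: nat where s0: "1 / \<epsilon> < s0" using reals_Archimedean2 by blast
  define s where "s = max 2 s0"
  have s: "2 \<le> s" by (simp add: s_def)
  have s\<epsilon>: "1 / s \<le> \<epsilon>"
  proof -
    have "1 / \<epsilon> < s" using s0 by (simp add: s_def)
    then show ?thesis using \<epsilon> s by (simp add: field_simps)
  qed
  define p where "p = real (s - 1) / (2 * s)"
  have p: "p = 1/2 - 1 / s / 2" using s by (simp add: p_def of_nat_diff field_simps)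
  have p4: "1/4 \<le> p" "p < 1/2" using s unfolding p by (auto simp: field_simps)
  have "0 < \<epsilon> / 4" using \<epsilon> by simp
  from core_exists[OF p4 this] obtain \<kappa> t' where core: "\<forall>A \<F>. finite (A :: nat set) \<longrightarrow> (\<forall>F G. F \<in> \<F> \<longrightarrow> F \<subseteq> G \<longrightarrow> G \<subseteq> A \<longrightarrow> G \<in> \<F>) \<longrightarrow>
    \<epsilon> / 4 \<le> expect p A (\<lambda>F. of_bool (F \<in> \<F>)) \<longrightarrow> (\<exists>J L. is_core \<kappa> A \<F> J L \<and> card L \<le> t')" by blast
  define r where "r = max 1 t'"
  define l where "l = Suc r"
  have r: "1 \<le> r" by (simp add: r_def)
  obtain D0 :: nat where D0: "2 / \<epsilon> < D0" using reals_Archimedean2 by blast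
  define D where "D = max 1 D0"
  have D: "1 \<le> D" "2 / \<epsilon> \<le> D" using D0 by (auto simp: D_def)
  \<comment> \<open>Chosen to make the sampling loss \<open>2 * l * \<zeta>\<close> equal to
    \<epsilon>.\<close>
  define \<zeta> where "\<zeta> = \<epsilon> / (2 * l)"
  \<comment> \<open>Half of the value guaranteed by soundness, so that a value up to \<gamma> lies
    strictly below it.\<close>
  define \<gamma> where "\<gamma> = \<epsilon> / 4 / (16 * l\<^sup>2 * r\<^sup>2) / 2"
  have lr: "0 < real (16 * l\<^sup>2 * r\<^sup>2)" using r by (simp add: l_def)
  have g0: "0 < \<zeta>" "0 < \<gamma>" using \<epsilon> lr unfolding \<zeta>_def \<gamma>_def by (auto simp: l_def intro!: divide_pos_pos)
  have g1: "\<gamma> < \<epsilon> / 4 / (16 * l\<^sup>2 * r\<^sup>2)" using g0(2) unfolding \<gamma>_def by simp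
  have "(1 - \<zeta> \<le> ug_value k (n, C) \<longrightarrow>
        (\<exists>X. covers (base_size C k s l D) (base_adj C k s l D) X \<and> card X \<le> (1/2 + \<epsilon>) * base_size C k s l D)) \<and>
      (ug_value k (n, C) \<le> \<gamma> \<longrightarrow>
        (\<forall>X. covers (base_size C k s l D) (base_adj C k s l D) X \<longrightarrow> (1 - \<epsilon>) * base_size C k s l D \<le> card X))"
    if k: "1 \<le> k" and wf: "wf_unique_game k (n, C)" for n C k
  proof -
    interpret ug_graph n C k s l using wf k s by unfold_locales (auto simp: l_def)
    show ?thesis
    proof (intro conjI impI allI)
      assume "1 - \<zeta> \<le> ug_value k (n, C)"
      then obtain lab where "lab \<in> {..<n} \<rightarrow>\<^sub>E {..<k}" "1 - \<zeta> \<le> sat_fraction C lab" using ug_value_cases(1)[OF k, of n C] by auto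
      then obtain X where X: "covers (base_size C k s l D) (base_adj C k s l D) X"
        "card X \<le> (1 - (1 - 2 * l * \<zeta>) * p) * base_size C k s l D" using small_cover[OF D(1)] unfolding p_def by blast
      have z: "2 * l * \<zeta> = \<epsilon>" by (simp add: \<zeta>_def l_def)
      have "1 - (1 - 2 * l * \<zeta>) * p = 1 - p + \<epsilon> * p" unfolding z by (simp add: algebra_simps)
      also have "\<dots> \<le> 1 - p + \<epsilon> / 2" using mult_left_mono[of p "1/2" \<epsilon>] p4 \<epsilon> by simp
      also have "\<dots> \<le> 1/2 + \<epsilon>" using s\<epsilon> unfolding p by simp
      finally have "(1 - (1 - 2 * l * \<zeta>) * p) * base_size C k s l D \<le> (1/2 + \<epsilon>) * base_size C k s l D" by (intro mult_right_mono) auto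
      then show "\<exists>X. covers (base_size C k s l D) (base_adj C k s l D) X \<and> card X \<le> (1/2 + \<epsilon>) * base_size C k s l D"
        using X by (intro exI[of _ X]) auto
    next
      fix X assume low: "ug_value k (n, C) \<le> \<gamma>" and X: "covers (base_size C k s l D) (base_adj C k s l D) X"
      show "(1 - \<epsilon>) * base_size C k s l D \<le> card X"
      proof (rule large_covers[OF _ r l_def \<epsilon> D X])
        show "sat_fraction C lab < \<epsilon> / 4 / (16 * l\<^sup>2 * r\<^sup>2)" if "lab \<in> {..<n} \<rightarrow>\<^sub>E {..<k}" for lab
          using ug_value_cases(2)[OF k that, of C] low g1 by linarith
        show "\<exists>J L. is_core \<kappa> {..<k} \<F> J L \<and> card L \<le> r"
          if "\<And>F G. F \<in> \<F> \<Longrightarrow> F \<subseteq> G \<Longrightarrow> G \<subseteq> {..<k} \<Longrightarrow> G \<in> \<F>"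
            "\<epsilon> / 4 \<le> expect (real (s - 1) / (2 * s)) {..<k} (\<lambda>F. of_bool (F \<in> \<F>))" for \<F>
        proof -
          have "\<exists>J L. is_core \<kappa> {..<k} \<F> J L \<and> card L \<le> t'"
            by (rule core[rule_format]) (use that in \<open>auto simp: p_def\<close>)
          then show ?thesis unfolding r_def by (meson max.coboundedI2)
        qed
      qed
    qed
  qed
  then show ?thesis using s D(1) g0 by (intro exI[of _ s] exI[of _ l] exI[of _ D] exI[of _ \<zeta>] exI[of _ \<gamma>]) (auto simp: l_def)
qed

section \<open>The decision procedure\<close>

definition sizeE :: "nat \<Rightarrow> nat \<Rightarrow> nat \<Rightarrow> nat \<Rightarrow> exp" where
  "sizeE k s l D = mulE (Const ((2 * s) ^ k * D)) (powE (halfE k) (Suc l))"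
definition baseE :: "nat \<Rightarrow> nat \<Rightarrow> nat \<Rightarrow> nat \<Rightarrow> exp \<Rightarrow> exp \<Rightarrow> exp" where
  "baseE k s l D I I' = mulE (notE (eqE I I')) (conflictE k s l (divE I (Const D)) (divE I' (Const D)))"
text \<open>The size expression has no free variables, so it may be repeated inside
  \<open>App\<close> without change of value.\<close>

definition adjE :: "nat \<Rightarrow> nat \<Rightarrow> nat \<Rightarrow> nat \<Rightarrow> nat \<Rightarrow> exp \<Rightarrow> exp \<Rightarrow> exp" where
  "adjE k s l D c J J' = (let N = sizeE k s l D in
     App (mulE (eqE (divE (Var 0) N) (divE (Var 1) N)) (ifE (ltE (divE (Var 0) N) (Const c))
       (baseE k s l D (modE (Var 0) N) (modE (Var 1) N))
       (eqE (Add (Add (modE (Var 0) N) (modE (Var 1) N)) (Const 1)) N))) [J, J'])"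
definition predE :: "nat \<Rightarrow> nat \<Rightarrow> nat \<Rightarrow> nat \<Rightarrow> nat \<Rightarrow> nat \<Rightarrow> exp \<Rightarrow> exp" where
  "predE k s l D c1 c J = (let N = sizeE k s l D in
     App (Add (ltE (divE (Var 0) N) (Const c1))
       (mulE (leE (Const c) (divE (Var 0) N)) (ltE (mulE (Const 2) (modE (Var 0) N)) N))) [J])"
definition lenE :: "nat \<Rightarrow> nat \<Rightarrow> nat \<Rightarrow> nat \<Rightarrow> nat \<Rightarrow> exp" where
  "lenE k s l D c = (let V = mulE (sizeE k s l D) (Const c) in Add (Add (Add V (Const 1)) (mulE V V)) V)"
definition bitE :: "nat \<Rightarrow> nat \<Rightarrow> nat \<Rightarrow> nat \<Rightarrow> nat \<Rightarrow> nat \<Rightarrow> nat \<Rightarrow> exp" where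
  "bitE k s l D c1 c2 c3 = (let V = mulE (sizeE k s l D) (Const (c1 + c2 + c3)); t = Sub (Var 0) (Add V (Const 1)) in
     ifE (ltE (Var 0) V) (Const 1) (ifE (eqE (Var 0) V) (Const 0)
       (ifE (ltE t (mulE V V)) (adjE k s l D (c1 + c2) (divE t V) (modE t V))
         (predE k s l D c1 (c1 + c2) (Sub t (mulE V V))))))"

section \<open>The instance as a bit string\<close>

lemma concat_table: "concat (map (\<lambda>i. map (g i) [0..<n]) [0..<m]) = map (\<lambda>t. g (t div n) (t mod n)) [0..<m * n]"
proof (induction m)
  case (Suc m)
  have "map (\<lambda>t. g (t div n) (t mod n)) [m * n..<m * n + n] = map (g m) [0..<n]"
    by (rule nth_equalityI) auto
  then show ?case using Suc by (simp add: upt_add_eq_append[of 0 "m * n" n] add.commute[of n])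
qed simp

lemma enc_graph_vertex_set:
  assumes "\<And>i j. i < V \<Longrightarrow> j < V \<Longrightarrow> {i, j} \<in> E \<longleftrightarrow> Q i j"
    and "\<And>i. i < V \<Longrightarrow> i \<in> X \<longleftrightarrow> P i"
  shows "enc_graph V E @ enc_vertex_set V X = map (\<lambda>i. if i < V then True else if i = V then False
    else if i - (V + 1) < V * V then Q ((i - (V + 1)) div V) ((i - (V + 1)) mod V) else P (i - (V + 1) - V * V)) [0..<V + 1 + V * V + V]"
proof (rule nth_equalityI)
  let ?T = "concat (map (\<lambda>i. map (\<lambda>j. {i, j} \<in> E) [0..<V]) [0..<V])"
  have T: "?T = map (\<lambda>t. {t div V, t mod V} \<in> E) [0..<V * V]" by (rule concat_table)
  then have lT: "length ?T = V * V" by simp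
  show "length (enc_graph V E @ enc_vertex_set V X) = length (map (\<lambda>i. if i < V then True else if i = V then False
    else if i - (V + 1) < V * V then Q ((i - (V + 1)) div V) ((i - (V + 1)) mod V) else P (i - (V + 1) - V * V)) [0..<V + 1 + V * V + V])"
    unfolding enc_graph_def T by (simp add: enc_vertex_set_def)
  fix i assume "i < length (enc_graph V E @ enc_vertex_set V X)"
  then have i: "i < V + 1 + V * V + V" unfolding enc_graph_def T by (simp add: enc_vertex_set_def)
  consider "i < V" | "i = V" | "V < i" "i - (V + 1) < V * V" | "V < i" "V * V \<le> i - (V + 1)" by linarith
  then have "(enc_graph V E @ enc_vertex_set V X) ! i = (if i < V then True else if i = V then False
    else if i - (V + 1) < V * V then Q ((i - (V + 1)) div V) ((i - (V + 1)) mod V) else P (i - (V + 1) - V * V))"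
  proof cases
    case 3
    let ?t = "i - (V + 1)"
    have V0: "0 < V" using 3 by (cases V) auto
    have q: "?t div V < V" "?t mod V < V" using 3 V0 by (auto simp: less_mult_imp_div_less)
    have "(enc_graph V E @ enc_vertex_set V X) ! i = ({?t div V, ?t mod V} \<in> E)"
      unfolding enc_graph_def T using 3 by (simp add: nth_append nth_Cons')
    then show ?thesis using 3 assms(1)[OF q] by simp
  next
    case 4
    let ?t = "i - (V + 1) - V * V"
    have t: "?t < V" using 4 i by linarith
    have "(enc_graph V E @ enc_vertex_set V X) ! i = (?t \<in> X)"
      unfolding enc_graph_def T using 4 t by (simp add: nth_append nth_Cons' enc_vertex_set_def)
    then show ?thesis using 4 assms(2)[OF t] by simp
  qed (auto simp: enc_graph_def nth_append)
  then show "(enc_graph V E @ enc_vertex_set V X) ! i = map (\<lambda>i. if i < V then True else if i = V then False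
    else if i - (V + 1) < V * V then Q ((i - (V + 1)) div V) ((i - (V + 1)) mod V) else P (i - (V + 1) - V * V)) [0..<V + 1 + V * V + V] ! i"
    using i by (simp del: upt_Suc)
qed

lemma (in ug_graph) eval_instance:
  fixes D c1 c2 c3 :: nat
  assumes D: "1 \<le> D" and c: "0 < c1 + c2 + c3" and x: "x = enc_unique_game (n, C)"
  defines "N \<equiv> base_size C k s l D" and "R \<equiv> base_adj C k s l D"
  shows "map (\<lambda>i. eval x [i] (bitE k s l D c1 c2 c3) \<noteq> 0) [0..<eval x [] (lenE k s l D (c1 + c2 + c3))] =
    enc_graph (copies.nv N c1 c2 c3) (copies.edges N R c1 c2 c3) @ enc_vertex_set (copies.nv N c1 c2 c3) (copies.pred N c1 c2 c3)"
proof -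
  interpret cp: copies N R c1 c2 c3 unfolding N_def R_def by (rule copies_base[OF D c])
  have sz: "eval x \<rho> (sizeE k s l D) = N" for \<rho>
    using eval_halfE[OF x] by (simp add: sizeE_def N_def base_size_def M_def algebra_simps)
  have N0: "0 < N" by (rule cp.N)
  let ?V = "cp.nv"
  have V: "eval x \<rho> (mulE (sizeE k s l D) (Const (c1 + c2 + c3))) = ?V" for \<rho> by (simp add: sz cp.nv_def)
  have V0: "0 < ?V" using N0 c by (simp add: cp.nv_def)
  have base: "eval x \<rho> (baseE k s l D I I') \<noteq> 0 \<longleftrightarrow> R (eval x \<rho> I) (eval x \<rho> I')" for \<rho> I I'
  proof -
    have "eval x \<rho> (divE a (Const D)) = eval x \<rho> a div D" for a using D by (simp add: eval_divE)
    then show ?thesis using eval_conflictE[OF x, of \<rho> "divE I (Const D)" "divE I' (Const D)"]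
      by (simp add: baseE_def R_def base_adj_def)
  qed
  have dm: "eval x \<rho> (divE a (sizeE k s l D)) = eval x \<rho> a div N" "eval x \<rho> (modE a (sizeE k s l D)) = eval x \<rho> a mod N" for \<rho> a
    using N0 by (simp_all add: eval_divE eval_modE sz)
  have adj: "eval x \<rho> (adjE k s l D (c1 + c2) J J') \<noteq> 0 \<longleftrightarrow> copies_adj N R (c1 + c2) (eval x \<rho> J) (eval x \<rho> J')" for \<rho> J J'
    unfolding adjE_def Let_def copies_adj_def using base[of "[eval x \<rho> J, eval x \<rho> J']" "modE (Var 0) (sizeE k s l D)" "modE (Var 1) (sizeE k s l D)"]
    by (simp add: dm sz)
  have pr: "eval x \<rho> (predE k s l D c1 (c1 + c2) J) \<noteq> 0 \<longleftrightarrow> copies_pred N c1 (c1 + c2) (eval x \<rho> J)" for \<rho> J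
    unfolding predE_def Let_def copies_pred_def by (simp add: dm sz)
  define t where "t i = i - (?V + 1)" for i
  have bit: "eval x [i] (bitE k s l D c1 c2 c3) \<noteq> 0 \<longleftrightarrow> (if i < ?V then True else if i = ?V then False
    else if i - (?V + 1) < ?V * ?V then copies_adj N R (c1 + c2) ((i - (?V + 1)) div ?V) ((i - (?V + 1)) mod ?V)
      else copies_pred N c1 (c1 + c2) (i - (?V + 1) - ?V * ?V))" for i
  proof -
    let ?VE = "mulE (sizeE k s l D) (Const (c1 + c2 + c3))"
    let ?tE = "Sub (Var 0) (Add ?VE (Const 1))"
    have tE: "eval x [i] ?tE = i - (?V + 1)" using V[of "[i]"] by (simp only: eval.simps) simp
    have dv: "eval x [i] (divE ?tE ?VE) = (i - (?V + 1)) div ?V" "eval x [i] (modE ?tE ?VE) = (i - (?V + 1)) mod ?V"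
      using V0 by (simp_all only: eval_divE eval_modE V tE)
    have sb: "eval x [i] (Sub ?tE (mulE ?VE ?VE)) = i - (?V + 1) - ?V * ?V"
      using tE V[of "[i]"] by (simp only: eval.simps(6) eval_mulE[of x "[i]" ?VE ?VE])
    have v0: "eval x [i] (Var 0) = i" by simp
    have lt: "eval x [i] (ltE ?tE (mulE ?VE ?VE)) = of_bool (i - (?V + 1) < ?V * ?V)"
      using tE V[of "[i]"] by (simp only: eval_ltE eval_mulE[of x "[i]" ?VE ?VE])
    show ?thesis unfolding bitE_def Let_def eval_ifE lt
      using adj[of "[i]" "divE ?tE ?VE" "modE ?tE ?VE"] pr[of "[i]" "Sub ?tE (mulE ?VE ?VE)"] V[of "[i]"]
      unfolding dv sb eval_ltE eval_eqE v0 by (simp only: eval.simps(2)) simp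
  qed
  have len: "eval x [] (lenE k s l D (c1 + c2 + c3)) = ?V + 1 + ?V * ?V + ?V"
    unfolding lenE_def Let_def using V[of "[]"]
    by (simp only: eval.simps(2,5) eval_mulE[of x "[]" "mulE (sizeE k s l D) (Const (c1 + c2 + c3))"])
  show ?thesis unfolding bit len
    by (rule enc_graph_vertex_set[symmetric]) (auto simp: cp.edge_iff cp.pred_def)
qed

section \<open>P is contained in NP\<close>

lemma polytime_on_enc: "polytime_on UNIV (\<lambda>x. x) F \<Longrightarrow> polytime_on D enc (\<lambda>x. F (enc x))"
  unfolding polytime_on_def by blast

text \<open>In an encoded pair the even positions hold \<open>True\<close> until the separator at
  \<open>2 * length x\<close>. The sum counts the \<open>i\<close> for which all even positions up
  to \<open>2 * i\<close> hold \<open>True\<close>, so bits of the witness behind the separator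
  cannot interfere.\<close>

definition fst_lenE :: exp where
  "fst_lenE = Sum Len (notE (Sum (Add (Var 0) (Const 1)) (notE (eqE (Sym (mulE (Const 2) (Var 1))) (Const 2)))))"
definition fst_bitE :: exp where
  "fst_bitE = eqE (Sym (Add (mulE (Const 2) (Var 0)) (Const 1))) (Const 2)"

lemma enc_pair_nth:
  shows "j < length x \<Longrightarrow> enc_pair (x, w) ! (2 * j) = True \<and> enc_pair (x, w) ! (2 * j + 1) = x ! j"
    and "enc_pair (x, w) ! (2 * length x) = False"
    and "length (enc_pair (x, w)) = 2 * length x + 1 + length w"
proof -
  have C: "enc_pair (b # y, w) = True # b # enc_pair (y, w)" for b y by (simp add: enc_pair_def)
  show "enc_pair (x, w) ! (2 * j) = True \<and> enc_pair (x, w) ! (2 * j + 1) = x ! j" if "j < length x"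
    using that
  proof (induction x arbitrary: j)
    case (Cons b y)
    then show ?case by (cases j) (auto simp: C)
  qed simp
  show "enc_pair (x, w) ! (2 * length x) = False"
    by (induction x) (auto simp: C enc_pair_def)
  show "length (enc_pair (x, w)) = 2 * length x + 1 + length w"
    by (induction x) (auto simp: C enc_pair_def)
qed

lemma fst_exp:
  "map (\<lambda>i. eval (enc_pair (x, w)) [i] fst_bitE \<noteq> 0) [0..<eval (enc_pair (x, w)) [] fst_lenE] = x"
proof -
  let ?z = "enc_pair (x, w)"
  have s1: "sym_at ?z (2 * j) = 2" "sym_at ?z (2 * j + 1) = bit_sym (x ! j)" if "j < length x" for j
    using enc_pair_nth(1)[OF that, of w] that by (auto simp: sym_at_def enc_pair_nth(3))
  have s2: "sym_at ?z (2 * length x) = 1" by (simp add: sym_at_def enc_pair_nth(2,3))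
  have all: "(\<forall>j<i + 1. sym_at ?z (2 * j) = 2) \<longleftrightarrow> i < length x" for i
  proof
    assume a: "\<forall>j<i + 1. sym_at ?z (2 * j) = 2"
    show "i < length x"
    proof (rule ccontr)
      assume "\<not> i < length x"
      then have "sym_at ?z (2 * length x) = 2" using a by simp
      then show False using s2 by simp
    qed
  qed (use s1 in auto)
  have "eval ?z [] fst_lenE = (\<Sum>i<length ?z. of_bool (\<forall>j<i + 1. sym_at ?z (2 * j) = 2))"
    unfolding fst_lenE_def by (auto intro!: sum.cong simp: less_Suc_eq simp del: sum_of_bool_eq)
  also have "\<dots> = (\<Sum>i<length ?z. of_bool (i < length x))" by (simp only: all)
  also have "\<dots> = card {..<length x}"
    unfolding card_of_bool by (rule arg_cong[where f = card]) (auto simp: enc_pair_nth(3))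
  finally have len: "eval ?z [] fst_lenE = length x" by simp
  have bit: "0 < eval ?z [i] fst_bitE \<longleftrightarrow> x ! i" if "i < length x" for i
    using s1(2)[OF that] by (cases "x ! i") (simp_all add: fst_bitE_def)
  show ?thesis unfolding len by (rule nth_equalityI) (auto simp: bit)
qed

text \<open>The verifier ignores the witness, but it is given the encoded pair, from which
  \<open>x\<close> has to be decoded before the decision machine can run.\<close>

lemma class_P_subset_class_NP: "class_P \<subseteq> class_NP"
proof
  fix L assume "L \<in> class_P"
  then have L: "polytime_on UNIV (\<lambda>x. x) (\<lambda>x. [x \<in> L])" by (simp add: class_P_def)
  let ?F = "\<lambda>z. map (\<lambda>i. eval z [i] fst_bitE \<noteq> 0) [0..<eval z [] fst_lenE]"
  have "polytime_on UNIV enc_pair (\<lambda>z. [fst z \<in> L])"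
  proof (rule polytime_compose[OF polytime_on_enc[OF polytime_exp[of fst_bitE fst_lenE], of UNIV enc_pair] L])
    fix z :: "bool list \<times> bool list"
    show "fst z \<in> UNIV \<and> ?F (enc_pair z) = fst z" using fst_exp[of "fst z" "snd z"] by simp
  qed
  then have "polytime_on UNIV enc_pair (\<lambda>(x, w). [x \<in> L])" unfolding case_prod_unfold .
  then show "L \<in> class_NP"
    unfolding class_NP_def by (intro CollectI exI[of _ "\<lambda>x w. x \<in> L"] exI[of _ 0] conjI) auto
qed

section \<open>The threshold test and the numbers of copies\<close>

definition thresholdE :: "nat \<Rightarrow> nat \<Rightarrow> exp" where
  "thresholdE \<alpha> \<beta> = leE (mulE (Const \<beta>) (Sum Len (eqE (Sym (Var 1)) (Const 2)))) (mulE (Const \<alpha>) Len)"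

lemma eval_thresholdE:
  assumes "Y \<subseteq> {..<n}"
  shows "eval (enc_vertex_set n Y) [i] (thresholdE \<alpha> \<beta>) \<noteq> 0 \<longleftrightarrow> \<beta> * card Y \<le> \<alpha> * n"
proof -
  have "(\<Sum>p<n. of_bool (sym_at (enc_vertex_set n Y) p = 2)) = (\<Sum>p<n. of_bool (p \<in> Y) :: nat)"
  proof (rule sum.cong)
    show "(of_bool (sym_at (enc_vertex_set n Y) p = 2) :: nat) = of_bool (p \<in> Y)" if "p \<in> {..<n}" for p
      using that by (cases "p \<in> Y") (auto simp: sym_at_def enc_vertex_set_def)
  qed simp
  also have "\<dots> = card Y" using assms by (simp add: Int_absorb1)
  finally show ?thesis by (simp add: thresholdE_def enc_vertex_set_def del: sum_of_bool_eq)
qed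

lemma copy_numbers:
  fixes x y f0 :: real
  assumes xy: "0 \<le> x" "0 \<le> y" "x + y \<le> 1" and f0: "0 \<le> f0" "f0 < x + y"
  shows "\<exists>(\<epsilon> :: real) (c1 :: nat) (c2 :: nat) (c3 :: nat). 0 < \<epsilon> \<and> 0 < c1 + c2 + c3 \<and> real c1 \<le> x * (c1 + c2 + c3) \<and>
    c2 * (1 + 2 * \<epsilon>) \<le> y * (c1 + c2 + c3) \<and>
    (1 + f0) * (1/2 + \<epsilon>) * (c1 + c2 + c3) < (c1 + c2) * (1 - \<epsilon>) + c3 / 2"
proof -
  define g where "g = x + y - f0"
  have g: "0 < g" "g \<le> 1" using xy f0 by (auto simp: g_def)
  \<comment> \<open>The final comparison needs \<open>4 * \<epsilon> * c + 1 < g * c / 2\<close>: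
    the term with \<epsilon> uses up half of the right-hand side, and \<open>4 < g * c\<close> makes
    the other half exceed the 1 lost by rounding.\<close>
  define \<epsilon> where "\<epsilon> = g / 16"
  have \<epsilon>: "0 < \<epsilon>" "\<epsilon> < 1/2" using g by (auto simp: \<epsilon>_def)
  obtain c :: nat where c: "4 / g < c" using reals_Archimedean2 by blast
  have c0: "0 < real c" using c g by (meson divide_pos_pos less_trans zero_less_numeral)
  define c1 where "c1 = nat \<lfloor>x * c\<rfloor>"
  \<comment> \<open>Divided by \<open>1 + 2 * \<epsilon>\<close> since an optimal cover of one copy
    may exceed \<open>N / 2\<close> by this factor.\<close>
  define c2 where "c2 = nat \<lfloor>y * c / (1 + 2 * \<epsilon>)\<rfloor>"
  define c3 where "c3 = c - c1 - c2"
  have y0: "0 \<le> y * c / (1 + 2 * \<epsilon>)" using xy \<epsilon> by simp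
  have fl: "real (nat \<lfloor>v\<rfloor>) \<le> v \<and> v - 1 \<le> real (nat \<lfloor>v\<rfloor>)" if "0 \<le> v" for v :: real
  proof -
    have "real (nat \<lfloor>v\<rfloor>) = real_of_int \<lfloor>v\<rfloor>" using that by simp
    then show ?thesis by linarith
  qed
  have c1: "real c1 \<le> x * c" "x * c - 1 \<le> c1" using fl[of "x * c"] xy by (simp_all add: c1_def)
  have c2: "real c2 \<le> y * c / (1 + 2 * \<epsilon>)" "y * c / (1 + 2 * \<epsilon>) - 1 \<le> c2"
    using fl[OF y0] by (simp_all add: c2_def)
  have c2': "c2 * (1 + 2 * \<epsilon>) \<le> y * c" using c2(1) \<epsilon> by (simp add: pos_le_divide_eq)
  have "real c2 * 1 \<le> c2 * (1 + 2 * \<epsilon>)" using \<epsilon> by (intro mult_left_mono) auto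
  then have "real c1 + real c2 \<le> (x + y) * c" using c1 c2' by (simp add: algebra_simps)
  also have "\<dots> \<le> 1 * real c" using xy by (intro mult_right_mono) auto
  finally have le: "c1 + c2 \<le> c" by (simp flip: of_nat_add)
  then have sum: "c1 + c2 + c3 = c" by (simp add: c3_def)
  have ylow: "y * c - 2 * \<epsilon> * c \<le> y * c / (1 + 2 * \<epsilon>)"
  proof -
    have "(y - 2 * \<epsilon>) * (1 + 2 * \<epsilon>) \<le> y"
    proof -
      have "y * (2 * \<epsilon>) \<le> 1 * (2 * \<epsilon>)" using xy \<epsilon> by (intro mult_right_mono) auto
      moreover have "0 \<le> 2 * \<epsilon> * (2 * \<epsilon>)" using \<epsilon> by simp
      moreover have "(y - 2 * \<epsilon>) * (1 + 2 * \<epsilon>) = y + y * (2 * \<epsilon>) - 1 * (2 * \<epsilon>) - 2 * \<epsilon> * (2 * \<epsilon>)"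
        by (simp add: algebra_simps)
      ultimately show ?thesis by linarith
    qed
    then have "(y - 2 * \<epsilon>) * (1 + 2 * \<epsilon>) * c \<le> y * c" using c0 by (intro mult_right_mono) auto
    moreover have "(y * c - 2 * \<epsilon> * c) * (1 + 2 * \<epsilon>) = (y - 2 * \<epsilon>) * (1 + 2 * \<epsilon>) * c"
      by (simp add: algebra_simps)
    moreover have "0 < 1 + 2 * \<epsilon>" using \<epsilon> by simp
    ultimately show ?thesis by (simp only: pos_le_divide_eq)
  qed
  define T where "T = real c1 + real c2"
  have Tlo: "(x + y) * c - 2 * \<epsilon> * c - 2 \<le> T" using c1(2) c2(2) ylow unfolding T_def by (simp add: algebra_simps)
  have Thi: "T \<le> c" using le unfolding T_def by (simp flip: of_nat_add)
  have c3: "real c3 = c - T" using sum unfolding T_def by (simp flip: of_nat_add add: algebra_simps)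
  have "(1 + f0) * (1/2 + \<epsilon>) * c = c / 2 + f0 * c / 2 + \<epsilon> * c + f0 * (\<epsilon> * c)" by (simp add: algebra_simps)
  also have "\<dots> \<le> c / 2 + f0 * c / 2 + \<epsilon> * c + 1 * (\<epsilon> * c)"
    using f0 xy \<epsilon> c0 by (intro add_left_mono mult_right_mono) auto
  also have "\<dots> = c / 2 + (x + y) * c / 2 - g * c / 2 + 2 * (\<epsilon> * c)" by (simp add: g_def field_simps)
  also have "\<dots> < c / 2 + (x + y) * c / 2 - 2 * (\<epsilon> * c) - 1"
  proof -
    have "4 < g * c" using c g by (simp add: field_simps)
    then show ?thesis by (simp add: \<epsilon>_def)
  qed
  also have "\<dots> \<le> c / 2 + T / 2 - \<epsilon> * T"
  proof -
    have "\<epsilon> * T \<le> \<epsilon> * c" using Thi \<epsilon> by (intro mult_left_mono) auto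
    moreover have "(x + y) * c / 2 - \<epsilon> * c - 1 \<le> T / 2" using Tlo by (simp add: field_simps)
    ultimately show ?thesis by linarith
  qed
  also have "\<dots> = T * (1 - \<epsilon>) + c3 / 2" unfolding c3 by (simp add: field_simps)
  finally have "(1 + f0) * (1/2 + \<epsilon>) * c < T * (1 - \<epsilon>) + c3 / 2" .
  moreover have "0 < c" using c0 by simp
  ultimately show ?thesis using \<epsilon>(1) c1(1) c2' sum unfolding T_def
    by (intro exI[of _ \<epsilon>] exI[of _ c1] exI[of _ c2] exI[of _ c3]) (auto simp flip: of_nat_add)
qed

theorem theorem5:
  fixes A :: "nat \<Rightarrow> nat set set \<Rightarrow> nat set \<Rightarrow> nat set"
    and f :: "real \<Rightarrow> real \<Rightarrow> real"
  assumes UGC: "unique_games_conjecture"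
    and P_neq_NP: "class_P \<noteq> class_NP"
    and f_nonneg: "\<And>x y. 0 \<le> x \<Longrightarrow> 0 \<le> y \<Longrightarrow> 0 \<le> f x y"
    and f_mono1: "\<And>x x' y. 0 \<le> x \<Longrightarrow> x \<le> x' \<Longrightarrow> 0 \<le> y \<Longrightarrow> f x y \<le> f x' y"
    and f_mono2: "\<And>x y y'. 0 \<le> x \<Longrightarrow> 0 \<le> y \<Longrightarrow> y \<le> y' \<Longrightarrow> f x y \<le> f x y'"
    and A_polytime: "polytime_vc_algorithm A"
    and A_cover: "\<And>n E Xhat. simple_graph {..<n} E \<Longrightarrow> Xhat \<subseteq> {..<n} \<Longrightarrow>
      vertex_cover {..<n} E (A n E Xhat)"
    and A_bound: "\<And>n E Xhat Xopt. simple_graph {..<n} E \<Longrightarrow> Xhat \<subseteq> {..<n} \<Longrightarrow>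
      min_vertex_cover {..<n} E Xopt \<Longrightarrow>
      real (card (A n E Xhat)) \<le>
        (1 + f (real (card (Xhat - Xopt)) / real (opt_vc {..<n} E))
               (real (card (Xopt - Xhat)) / real (opt_vc {..<n} E)))
        * real (opt_vc {..<n} E)"
  shows "\<forall>x y. 0 \<le> x \<and> 0 \<le> y \<and> x + y \<le> 1 \<longrightarrow> f x y \<ge> x + y"
proof (intro allI impI, rule ccontr)
  fix x y assume "0 \<le> x \<and> 0 \<le> y \<and> x + y \<le> 1" and "\<not> x + y \<le> f x y"
  then have xy: "0 \<le> x" "0 \<le> y" "x + y \<le> 1" and less: "f x y < x + y" by auto
  obtain \<epsilon> :: real and c1 c2 c3 :: nat where \<epsilon>: "0 < \<epsilon>" and c0: "0 < c1 + c2 + c3" and c1: "real c1 \<le> x * (c1 + c2 + c3)"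
    and c2: "c2 * (1 + 2 * \<epsilon>) \<le> y * (c1 + c2 + c3)"
    and gap: "(1 + f x y) * (1/2 + \<epsilon>) * (c1 + c2 + c3) < (c1 + c2) * (1 - \<epsilon>) + c3 / 2"
    using copy_numbers[OF xy f_nonneg[OF xy(1,2)] less] by (elim exE conjE) (rule that)
  define c where "c = real (c1 + c2 + c3)"
  have cpos: "0 < c" unfolding c_def using c0 by (simp only: of_nat_0_less_iff)
  have "(1 + f x y) * (1/2 + \<epsilon>) < ((c1 + c2) * (1 - \<epsilon>) + c3 / 2) / c"
    using gap cpos by (simp add: c_def pos_less_divide_eq)
  \<comment> \<open>A rational threshold, so that comparing the output size with
    \<open>\<theta> * V z\<close> becomes a comparison of natural numbers with constant
    coefficients.\<close>
  then obtain \<theta> where \<theta>: "\<theta> \<in> \<rat>" "(1 + f x y) * (1/2 + \<epsilon>) < \<theta>" "\<theta> < ((c1 + c2) * (1 - \<epsilon>) + c3 / 2) / c"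
    using Rats_dense_in_real by blast
  have "0 \<le> (1 + f x y) * (1/2 + \<epsilon>)" using f_nonneg[OF xy(1,2)] \<epsilon> by simp
  then have \<theta>0: "0 < \<theta>" using \<theta>(2) by linarith
  obtain \<alpha> \<beta> where ab: "\<beta> \<noteq> 0" "\<theta> = real \<alpha> / real \<beta>" using Rats_abs_nat_div_natE[OF \<theta>(1)] \<theta>0 by (metis abs_of_pos)
  obtain s l D \<zeta> \<gamma> where red: "\<forall>n C k. 1 \<le> k \<longrightarrow> wf_unique_game k (n, C) \<longrightarrow>
      (1 - \<zeta> \<le> ug_value k (n, C) \<longrightarrow>
        (\<exists>X. covers (base_size C k s l D) (base_adj C k s l D) X \<and> card X \<le> (1/2 + \<epsilon>) * base_size C k s l D)) \<and>
      (ug_value k (n, C) \<le> \<gamma> \<longrightarrow>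
        (\<forall>X. covers (base_size C k s l D) (base_adj C k s l D) X \<longrightarrow> (1 - \<epsilon>) * base_size C k s l D \<le> card X))"
    and par: "2 \<le> s" "1 \<le> l" "1 \<le> D" "0 < \<zeta>" "0 < \<gamma>"
    using unique_games_to_vertex_cover[OF \<epsilon>] by (elim exE conjE) (rule that)
  obtain k where k: "1 \<le> k" and hard: "gap_unique_games_NP_hard k \<zeta> \<gamma>"
    using UGC par(4,5) unfolding unique_games_conjecture_def by blast
  have "L \<in> class_P" if L: "L \<in> class_NP" for L
  proof -
    obtain r where r: "polytime_on UNIV (\<lambda>x. x) (\<lambda>z. enc_unique_game (r z))"
      and "\<forall>z. wf_unique_game k (r z) \<and> (z \<in> L \<longrightarrow> ug_value k (r z) \<ge> 1 - \<zeta>) \<and> (z \<notin> L \<longrightarrow> ug_value k (r z) \<le> \<gamma>)"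
      using hard[unfolded gap_unique_games_NP_hard_def, THEN bspec, OF L] by (elim exE conjE) (rule that)
    then have gapr: "wf_unique_game k (r z) \<and> (z \<in> L \<longrightarrow> ug_value k (r z) \<ge> 1 - \<zeta>) \<and> (z \<notin> L \<longrightarrow> ug_value k (r z) \<le> \<gamma>)" for z
      by blast
    define N where "N z = base_size (snd (r z)) k s l D" for z
    define R where "R z = base_adj (snd (r z)) k s l D" for z
    define V where "V z = copies.nv (N z) c1 c2 c3" for z
    define E where "E z = copies.edges (N z) (R z) c1 c2 c3" for z
    define X where "X z = copies.pred (N z) c1 c2 c3" for z
    have ug: "ug_graph (fst (r z)) (snd (r z)) k s l" for z
      using gapr[of z] k par by unfold_locales auto
    have cp: "copies (N z) (R z) c1 c2 c3" for z
      unfolding N_def R_def by (rule ug_graph.copies_base[OF ug par(3) c0])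
    have simple: "simple_graph {..<V z} (E z)" "X z \<subseteq> {..<V z}" for z
      unfolding V_def E_def X_def using copies.simple[OF cp] copies.pred_sub[OF cp] by auto
    define Y where "Y z = A (V z) (E z) (X z)" for z
    have Y: "vertex_cover {..<V z} (E z) (Y z)" for z unfolding Y_def by (rule A_cover[OF simple])
    have decide: "z \<in> L \<longleftrightarrow> \<beta> * card (Y z) \<le> \<alpha> * V z" for z
    proof -
      have Vz: "real (V z) = N z * c" unfolding V_def copies.nv_def[OF cp] by (simp add: c_def)
      have Npos: "0 < real (N z)" using copies.N[OF cp[of z]] by simp
      have Vpos: "0 < real (V z)" unfolding Vz using Npos cpos by simp
      have red_z: "(1 - \<zeta> \<le> ug_value k (r z) \<longrightarrow> (\<exists>X. covers (N z) (R z) X \<and> card X \<le> (1/2 + \<epsilon>) * N z)) \<and>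
          (ug_value k (r z) \<le> \<gamma> \<longrightarrow> (\<forall>X. covers (N z) (R z) X \<longrightarrow> (1 - \<epsilon>) * N z \<le> card X))"
        using red[THEN spec, of "fst (r z)", THEN spec, of "snd (r z)", THEN spec, of k, THEN mp, OF k] gapr[of z] unfolding N_def R_def by simp
      have iff: "\<beta> * card (Y z) \<le> \<alpha> * V z \<longleftrightarrow> real (card (Y z)) \<le> \<theta> * V z"
      proof -
        have "\<beta> * card (Y z) \<le> \<alpha> * V z \<longleftrightarrow> real \<beta> * real (card (Y z)) \<le> real \<alpha> * real (V z)"
          by (simp flip: of_nat_mult)
        also have "\<dots> \<longleftrightarrow> real (card (Y z)) \<le> \<theta> * V z" unfolding ab(2) using ab(1) by (simp add: field_simps)
        finally show ?thesis .
      qed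
      show ?thesis
      proof (cases "z \<in> L")
        case True
        then obtain X0 where X0: "covers (N z) (R z) X0" "card X0 \<le> (1/2 + \<epsilon>) * N z" using red_z gapr[of z] by blast
        have bound: "real (card (Y z)) \<le> (1 + f (real (card (X z - Xopt)) / real (opt_vc {..<V z} (E z)))
               (real (card (Xopt - X z)) / real (opt_vc {..<V z} (E z)))) * real (opt_vc {..<V z} (E z))"
          if "min_vertex_cover {..<V z} (E z) Xopt" for Xopt
          unfolding Y_def by (rule A_bound[OF simple that])
        have "real (card (Y z)) \<le> (1 + f x y) * (1/2 + \<epsilon>) * V z"
          unfolding V_def
          by (rule copies.algorithm_yes[where f = f, OF cp f_nonneg f_mono1 f_mono2 bound[unfolded V_def E_def X_def] X0 less_imp_le[OF \<epsilon>] c1 c2])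
        also have "\<dots> \<le> \<theta> * V z" using \<theta>(2) by (intro mult_right_mono) auto
        finally show ?thesis using True iff by simp
      next
        case False
        then have no: "(1 - \<epsilon>) * N z \<le> card X'" if "covers (N z) (R z) X'" for X' using red_z gapr[of z] that by blast
        have "((c1 + c2) * (1 - \<epsilon>) + c3 / 2) * N z \<le> card (Y z)"
          by (rule copies.algorithm_no[OF cp Y[unfolded V_def E_def] no])
        moreover have "\<theta> * V z < ((c1 + c2) * (1 - \<epsilon>) + c3 / 2) / c * V z" using \<theta>(3) Vpos by (rule mult_strict_right_mono)
        moreover have "((c1 + c2) * (1 - \<epsilon>) + c3 / 2) / c * V z = ((c1 + c2) * (1 - \<epsilon>) + c3 / 2) * N z"
          unfolding Vz using cpos by simp
        ultimately have "\<not> real (card (Y z)) \<le> \<theta> * V z" by linarith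
        then show ?thesis using False iff by simp
      qed
    qed
    \<comment> \<open>The decision procedure chains the reduction to unique games, the expression
      that writes out graph and prediction, the assumed algorithm, and the test of the size of its
      output.\<close>
    let ?F = "\<lambda>w. map (\<lambda>i. eval w [i] (bitE k s l D c1 c2 c3) \<noteq> 0) [0..<eval w [] (lenE k s l D (c1 + c2 + c3))]"
    have 1: "polytime_on UNIV (\<lambda>x. x) (\<lambda>z. ?F (enc_unique_game (r z)))"
      by (rule polytime_compose[OF r polytime_exp]) auto
    have F: "?F (enc_unique_game (r z)) = enc_graph (V z) (E z) @ enc_vertex_set (V z) (X z)" for z
      unfolding V_def E_def X_def N_def R_def by (rule ug_graph.eval_instance[OF ug par(3) c0]) simp
    let ?\<phi> = "\<lambda>z. (V z, E z, X z)"
    have 2: "polytime_on UNIV (\<lambda>x. x) (\<lambda>z. (\<lambda>(n, E, X). enc_vertex_set n (A n E X)) (?\<phi> z))"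
    proof (rule polytime_compose[OF 1 A_polytime[unfolded polytime_vc_algorithm_def]])
      show "?\<phi> z \<in> vc_inputs \<and> ?F (enc_unique_game (r z)) = (\<lambda>(n, E, X). enc_graph n E @ enc_vertex_set n X) (?\<phi> z)" for z
        using simple[of z] F[of z] by (simp add: vc_inputs_def)
    qed
    then have 2: "polytime_on UNIV (\<lambda>x. x) (\<lambda>z. enc_vertex_set (V z) (Y z))" by (simp add: Y_def)
    let ?G = "\<lambda>w. map (\<lambda>i. eval w [i] (thresholdE \<alpha> \<beta>) \<noteq> 0) [0..<eval w [] (Const 1)]"
    have "polytime_on UNIV (\<lambda>x. x) (\<lambda>z. ?G (enc_vertex_set (V z) (Y z)))"
      by (rule polytime_compose[OF 2 polytime_exp]) auto
    moreover have "?G (enc_vertex_set (V z) (Y z)) = [z \<in> L]" for z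
    proof -
      have "Y z \<subseteq> {..<V z}" using Y[of z] by (simp add: vertex_cover_def)
      then show ?thesis using eval_thresholdE[of "Y z" "V z" 0 \<alpha> \<beta>] decide[of z] by simp
    qed
    ultimately show "L \<in> class_P" by (simp add: class_P_def)
  qed
  then show False using P_neq_NP class_P_subset_class_NP by blast
qed

end
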